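(* Let $\Omega_1(x)=y_1+y_2+y_3-y_4-y_5-x$ and $\Omega_2(x)=y_1^2+y_2^2+y_3^2-y_4^2-y_5^2-x^2$. Then there hold the representations $$\mathcal{E}_6(f_1,\dots,f_6)=\frac{1}{\pi^2}\int_{\mathbb{R}^6}f_1(y_1)f_2(y_2)f_3(y_3)\overline{f_4(y_4)f_5(y_5)f_6(y_6)}\,\delta_{\Omega_1(y_6)}\,\delta_{\Omega_2(y_6)}\,dy_1\cdots dy_6,$$ $$\mathcal{T}_6(f_1,\dots,f_5)(x)=\frac{6}{\pi^2}\int_{\mathbb{R}^5}f_1(y_1)f_2(y_2)f_3(y_3)\overline{f_4(y_4)f_5(y_5)}\,\delta_{\Omega_1(x)}\,\delta_{\Omega_2(x)}\,dy_1\cdots dy_5.$$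
   Context: $H=-\Delta+x^2$ on $L^2(\mathbb{R})$, and $e^{itH}$ is the unitary propagator of $iu_t+Hu=0$ (so $e^{itH}\phi_n=e^{it(2n+1)}\phi_n$ for the Hermite functions $\phi_n$, $H\phi_n=(2n+1)\phi_n$). For functions $f_k:\mathbb{R}\to\mathbb{C}$, $$\mathcal{E}_6(f_1,\dots,f_6)=\frac{2}{\pi}\int_{-\pi/4}^{\pi/4}\int_{\mathbb{R}}(e^{itH}f_1)(e^{itH}f_2)(e^{itH}f_3)\overline{(e^{itH}f_4)(e^{itH}f_5)(e^{itH}f_6)}\,dx\,dt,$$ and $\mathcal{T}_6:(L^2)^5\to L^2$ is defined by duality: $\langle\mathcal{T}_6(f_1,\dots,f_5),g\rangle_{L^2}=6\,\mathcal{E}_6(f_1,\dots,f_5,g)$, where $\langle f,g\rangle_{L^2}=\int f\overline{g}\,dx$. Here $\delta_{\Omega}$ denotes the Dirac delta on $\mathbb{R}$ evaluated at the quantity $\Omega$, normalized so that $\int_{\mathbb{R}}e^{is\Omega}\,ds=2\pi\,\delta_{\Omega}$ in the sense of distributions; the formulas are understood in this distributional sense (for instance for Schwartz functions $f_k$, then by density). *)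

theory Defs
  imports "HOL-Analysis.Analysis"
begin

section \<open>The space \<open>L\<^sup>2(\<real>)\<close> and Schwartz functions\<close>

definition L2 :: "(real \<Rightarrow> complex) \<Rightarrow> bool" where
  "L2 f \<longleftrightarrow> f \<in> borel_measurable lborel \<and> integrable lborel (\<lambda>x. (norm (f x))\<^sup>2)"

definition inner_L2 :: "(real \<Rightarrow> complex) \<Rightarrow> (real \<Rightarrow> complex) \<Rightarrow> complex" where
  "inner_L2 f g = (LINT x|lborel. f x * cnj (g x))"

text \<open>Membership in \<open>L\<^sup>2\<close> is part of convergence, because the Bochner integral of a
  non-integrable function is \<open>0\<close>.\<close>

definition tendsto_L2 :: "(nat \<Rightarrow> real \<Rightarrow> complex) \<Rightarrow> (real \<Rightarrow> complex) \<Rightarrow> bool" where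
  "tendsto_L2 g f \<longleftrightarrow> (\<forall>n. L2 (g n)) \<and> L2 f \<and>
     (\<lambda>n. LINT x|lborel. (norm (g n x - f x))\<^sup>2) \<longlonglongrightarrow> 0"

definition D :: "(real \<Rightarrow> 'a::real_normed_vector) \<Rightarrow> real \<Rightarrow> 'a" where
  "D f x = vector_derivative f (at x)"

definition schwartz :: "(real \<Rightarrow> 'a::real_normed_vector) \<Rightarrow> bool" where
  "schwartz f \<longleftrightarrow>
     (\<forall>k x. (D ^^ k) f differentiable (at x)) \<and>
     (\<forall>j k. bounded (range (\<lambda>x. x ^ j *\<^sub>R (D ^^ k) f x)))"

section \<open>The propagator of the harmonic oscillator\<close>

definition H :: "(real \<Rightarrow> complex) \<Rightarrow> real \<Rightarrow> complex" where
  "H \<psi> x = - D (D \<psi>) x + of_real (x\<^sup>2) * \<psi> x"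

text \<open>\<open>u\<close> is the \<open>L\<^sup>2\<close>-valued solution of \<open>i u\<^sub>t + H u = 0\<close>, that is \<open>u\<^sub>t = i H u\<close>, with initial
  datum \<open>f\<close>. The equation is tested against Schwartz functions \<open>\<psi>\<close>, the operator \<open>H\<close> being
  moved to \<open>\<psi>\<close> by symmetry. Testing against the Hermite functions, for which
  \<open>H \<phi>\<^sub>n = (2 n + 1) \<phi>\<^sub>n\<close>, forces
  \<open>\<langle>u(t), \<phi>\<^sub>n\<rangle> = e\<^sup>i\<^sup>t\<^sup>(\<^sup>2\<^sup>n\<^sup>+\<^sup>1\<^sup>) \<langle>f, \<phi>\<^sub>n\<rangle>\<close>; so for every \<open>t\<close> the function \<open>u t\<close> is determined
  up to a null set, and it is the value at \<open>f\<close> of the unitary group generated by \<open>i H\<close>.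
  Joint measurability selects a representative that can be integrated over space-time.\<close>

definition oscillator_solution ::
    "(real \<Rightarrow> complex) \<Rightarrow> (real \<Rightarrow> real \<Rightarrow> complex) \<Rightarrow> bool" where
  "oscillator_solution f u \<longleftrightarrow>
     (\<lambda>(t, x). u t x) \<in> borel_measurable (lborel \<Otimes>\<^sub>M lborel) \<and>
     (\<forall>t. L2 (u t)) \<and>
     (AE x in lborel. u 0 x = f x) \<and>
     (\<forall>\<psi>. schwartz \<psi> \<longrightarrow>
       (\<forall>t. ((\<lambda>s. inner_L2 (u s) \<psi>) has_vector_derivative
               \<i> * inner_L2 (u t) (H \<psi>)) (at t)))"

text \<open>\<open>propagator t f\<close> is \<open>e\<^sup>i\<^sup>t\<^sup>H f\<close>.\<close>

definition propagator :: "real \<Rightarrow> (real \<Rightarrow> complex) \<Rightarrow> real \<Rightarrow> complex" where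
  "propagator t f = (SOME u. oscillator_solution f u) t"

section \<open>The functionals \<open>\<E>\<^sub>6\<close> and \<open>\<T>\<^sub>6\<close>\<close>

definition E6 :: "(real \<Rightarrow> complex) \<Rightarrow> (real \<Rightarrow> complex) \<Rightarrow> (real \<Rightarrow> complex) \<Rightarrow>
    (real \<Rightarrow> complex) \<Rightarrow> (real \<Rightarrow> complex) \<Rightarrow> (real \<Rightarrow> complex) \<Rightarrow> complex" where
  "E6 f1 f2 f3 f4 f5 f6 = of_real (2 / pi) *
     (LINT t:{- (pi / 4)..pi / 4}|lborel. LINT x|lborel.
        propagator t f1 x * propagator t f2 x * propagator t f3 x *
        cnj (propagator t f4 x * propagator t f5 x * propagator t f6 x))"

text \<open>An element of \<open>L\<^sup>2\<close> is determined by duality only up to a null set; \<open>T6\<close> is a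
  representative.\<close>

definition T6 :: "(real \<Rightarrow> complex) \<Rightarrow> (real \<Rightarrow> complex) \<Rightarrow> (real \<Rightarrow> complex) \<Rightarrow>
    (real \<Rightarrow> complex) \<Rightarrow> (real \<Rightarrow> complex) \<Rightarrow> real \<Rightarrow> complex" where
  "T6 f1 f2 f3 f4 f5 =
     (SOME h. L2 h \<and> (\<forall>g. L2 g \<longrightarrow> inner_L2 h g = 6 * E6 f1 f2 f3 f4 f5 g))"

section \<open>Integration against \<open>\<delta>\<^sub>\<Omega>\<^sub>1 \<delta>\<^sub>\<Omega>\<^sub>2\<close>\<close>

text \<open>The Dirac delta evaluated at \<open>\<Omega>\<close> is the limit of \<open>\<epsilon>\<^sup>-\<^sup>1 \<rho>(\<Omega> / \<epsilon>)\<close> as \<open>\<epsilon> \<rightarrow> 0\<close>, for every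
  Schwartz function \<open>\<rho>\<close> of integral one. Such a \<open>\<rho>\<close> is \<open>(2 \<pi>)\<^sup>-\<^sup>1\<close> times the Fourier transform
  of a Schwartz function \<open>\<chi>\<close> with \<open>\<chi>(0) = 1\<close>, whence
  \<open>\<epsilon>\<^sup>-\<^sup>1 \<rho>(\<Omega> / \<epsilon>) = (2 \<pi>)\<^sup>-\<^sup>1 \<integral> e\<^sup>i\<^sup>s\<^sup>\<Omega> \<chi>(\<epsilon> s) ds\<close>. This is the normalization
  \<open>\<integral> e\<^sup>i\<^sup>s\<^sup>\<Omega> ds = 2 \<pi> \<delta>\<^sub>\<Omega>\<close>. The two factors are regularized independently.\<close>

definition has_delta_integral ::
    "('a::euclidean_space \<Rightarrow> complex) \<Rightarrow> ('a \<Rightarrow> real) \<Rightarrow> ('a \<Rightarrow> real) \<Rightarrow> complex \<Rightarrow> bool" where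
  "has_delta_integral F \<Omega>\<^sub>1 \<Omega>\<^sub>2 I \<longleftrightarrow>
     (\<forall>\<rho>\<^sub>1 \<rho>\<^sub>2 :: real \<Rightarrow> real.
        schwartz \<rho>\<^sub>1 \<and> (LINT s|lborel. \<rho>\<^sub>1 s) = 1 \<and>
        schwartz \<rho>\<^sub>2 \<and> (LINT s|lborel. \<rho>\<^sub>2 s) = 1 \<longrightarrow>
        ((\<lambda>(\<epsilon>\<^sub>1, \<epsilon>\<^sub>2). LINT y|lborel.
            F y * of_real (\<rho>\<^sub>1 (\<Omega>\<^sub>1 y / \<epsilon>\<^sub>1) / \<epsilon>\<^sub>1) * of_real (\<rho>\<^sub>2 (\<Omega>\<^sub>2 y / \<epsilon>\<^sub>2) / \<epsilon>\<^sub>2))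
         \<longlongrightarrow> I) (at_right 0 \<times>\<^sub>F at_right 0))"

definition delta_integrable ::
    "('a::euclidean_space \<Rightarrow> complex) \<Rightarrow> ('a \<Rightarrow> real) \<Rightarrow> ('a \<Rightarrow> real) \<Rightarrow> bool" where
  "delta_integrable F \<Omega>\<^sub>1 \<Omega>\<^sub>2 \<longleftrightarrow> integrable lborel F \<and> (\<exists>I. has_delta_integral F \<Omega>\<^sub>1 \<Omega>\<^sub>2 I)"

definition delta_integral ::
    "('a::euclidean_space \<Rightarrow> complex) \<Rightarrow> ('a \<Rightarrow> real) \<Rightarrow> ('a \<Rightarrow> real) \<Rightarrow> complex" where
  "delta_integral F \<Omega>\<^sub>1 \<Omega>\<^sub>2 = (THE I. has_delta_integral F \<Omega>\<^sub>1 \<Omega>\<^sub>2 I)"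

section \<open>The integrands and the phases\<close>

definition F5 :: "(real \<Rightarrow> complex) \<Rightarrow> (real \<Rightarrow> complex) \<Rightarrow> (real \<Rightarrow> complex) \<Rightarrow>
    (real \<Rightarrow> complex) \<Rightarrow> (real \<Rightarrow> complex) \<Rightarrow>
    real \<times> real \<times> real \<times> real \<times> real \<Rightarrow> complex" where
  "F5 f1 f2 f3 f4 f5 =
     (\<lambda>(y1, y2, y3, y4, y5). f1 y1 * f2 y2 * f3 y3 * cnj (f4 y4 * f5 y5))"

definition F6 :: "(real \<Rightarrow> complex) \<Rightarrow> (real \<Rightarrow> complex) \<Rightarrow> (real \<Rightarrow> complex) \<Rightarrow>
    (real \<Rightarrow> complex) \<Rightarrow> (real \<Rightarrow> complex) \<Rightarrow> (real \<Rightarrow> complex) \<Rightarrow>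
    real \<times> real \<times> real \<times> real \<times> real \<times> real \<Rightarrow> complex" where
  "F6 f1 f2 f3 f4 f5 f6 =
     (\<lambda>(y1, y2, y3, y4, y5, y6). f1 y1 * f2 y2 * f3 y3 * cnj (f4 y4 * f5 y5 * f6 y6))"

definition Omega1 :: "real \<Rightarrow> real \<times> real \<times> real \<times> real \<times> real \<Rightarrow> real" where
  "Omega1 x = (\<lambda>(y1, y2, y3, y4, y5). y1 + y2 + y3 - y4 - y5 - x)"

definition Omega2 :: "real \<Rightarrow> real \<times> real \<times> real \<times> real \<times> real \<Rightarrow> real" where
  "Omega2 x = (\<lambda>(y1, y2, y3, y4, y5). y1\<^sup>2 + y2\<^sup>2 + y3\<^sup>2 - y4\<^sup>2 - y5\<^sup>2 - x\<^sup>2)"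

end

theory Submission
  imports Defs "HOL-Probability.Probability"
begin

text \<open>The obstacle is continuity: without Strichartz the six-fold product need not even be
  integrable for L^2 data, and the definition of the delta integral offers no bound in terms of L^2
  norms. The averaged pairing has such a bound by Cauchy-Schwarz alone, so it is the form through
  which both sides are compared. Its constant: pushing Lebesgue measure forward to height a and
  squared radius s gives the density 6 sqrt 3 pi on s >= 0, hence 3 sqrt 3 against an angular
  integral of weight 2 pi; as sums and sums of squares are 3 a and 3 a^2 + 6 s, the two deltas
  contribute 1/3 and 1/6, and 3 sqrt 3 / 18 = sqrt 3 / 6. On coherent states, up to a common factor,
  the spatial integral leaves the exponential of A e^(4it) + B e^(-4it), the rotation that of A'
  e^(i theta) + B' e^(-i theta). Over a full period such integrals depend only on the product of the
  two coefficients, so the computation comes down to A B = A' B', a polynomial identity. The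
  propagator is a Hilbert choice among solutions, so uniqueness has to be proved before anything can
  be computed with it.\<close>

text \<open>The condition \<open>\<Omega>\<^sub>1 = \<Omega>\<^sub>2 = 0\<close> says that \<open>(y\<^sub>1, y\<^sub>2, y\<^sub>3)\<close> lies on the circle through
  \<open>(y\<^sub>4, y\<^sub>5, y\<^sub>6)\<close> about the axis \<open>(1, 1, 1)\<close>. In cylindrical coordinates about this axis the two
  deltas become an average over that circle, so the delta integral equals \<open>\<surd>3/6\<close> times
  \<open>\<integral>\<^sub>-\<^sub>\<pi>\<^sup>\<pi> \<langle>(f\<^sub>1 \<otimes> f\<^sub>2 \<otimes> f\<^sub>3) \<circ> R\<^sub>\<theta>, f\<^sub>4 \<otimes> f\<^sub>5 \<otimes> f\<^sub>6\<rangle> d\<theta>\<close> with \<open>R\<^sub>\<theta>\<close> the rotation by \<open>\<theta>\<close>;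
  the degenerate circles occur only for a null set of parameters. Rotations preserve Lebesgue measure, so
  this pairing is a bounded six-linear form on \<open>L\<^sup>2\<close>.

  On coherent states \<open>exp (- x\<^sup>2/2 + z x - z\<^sup>2/4)\<close> the propagator acts by rotating \<open>z\<close>, and an explicit
  Gaussian computation identifies \<open>\<E>\<^sub>6\<close> with \<open>1/\<pi>\<^sup>2 \<cdot> \<surd>3/6\<close> times the pairing. By linearity the identity
  holds for finite superpositions of coherent states, where it also yields the Strichartz inequality
  \<open>L\<^sup>2 \<rightarrow> L\<^sup>6\<^sub>t\<^sub>,\<^sub>x\<close>; since such superpositions are dense, the identity extends to all of \<open>L\<^sup>2\<close>. Freezing
  \<open>y\<^sub>6 = x\<close> gives the statement for \<open>\<T>\<^sub>6\<close> by duality.\<close>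

section \<open>Square integrable functions\<close>

lemma integrable_mult_of_squares:
  fixes f g :: "'a \<Rightarrow> complex"
  assumes [measurable]: "f \<in> borel_measurable M" "g \<in> borel_measurable M"
    and "integrable M (\<lambda>x. (norm (f x))\<^sup>2)" "integrable M (\<lambda>x. (norm (g x))\<^sup>2)"
  shows "integrable M (\<lambda>x. f x * g x)"
proof (rule Bochner_Integration.integrable_bound)
  show "integrable M (\<lambda>x. (norm (f x))\<^sup>2 + (norm (g x))\<^sup>2)" using assms by simp
  have "norm (f x) * norm (g x) \<le> (norm (f x))\<^sup>2 + (norm (g x))\<^sup>2" for x
    using sum_squares_bound[of "norm (f x)" "norm (g x)"]
      mult_nonneg_nonneg[OF norm_ge_zero[of "f x"] norm_ge_zero[of "g x"]] by linarith
  thus "AE x in M. norm (f x * g x) \<le> norm ((norm (f x))\<^sup>2 + (norm (g x))\<^sup>2)"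
    by (auto simp: norm_mult intro!: AE_I2)
qed simp

lemma Cauchy_Schwarz_integral:
  fixes f g :: "'a \<Rightarrow> complex"
  assumes [measurable]: "f \<in> borel_measurable M" "g \<in> borel_measurable M"
    and f: "integrable M (\<lambda>x. (norm (f x))\<^sup>2)" and g: "integrable M (\<lambda>x. (norm (g x))\<^sup>2)"
  shows "(\<integral>x. norm (f x) * norm (g x) \<partial>M)
    \<le> sqrt (\<integral>x. (norm (f x))\<^sup>2 \<partial>M) * sqrt (\<integral>x. (norm (g x))\<^sup>2 \<partial>M)"
proof -
  have fg: "integrable M (\<lambda>x. norm (f x) * norm (g x))"
    using integrable_norm[OF integrable_mult_of_squares[OF assms]] by (simp add: norm_mult)
  have "(\<integral>\<^sup>+x. ennreal (norm (f x)) * ennreal (norm (g x)) \<partial>M)\<^sup>2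
    \<le> (\<integral>\<^sup>+x. ennreal (norm (f x)) ^ 2 \<partial>M) * (\<integral>\<^sup>+x. ennreal (norm (g x)) ^ 2 \<partial>M)"
    by (rule Cauchy_Schwarz_nn_integral) auto
  hence "(ennreal (\<integral>x. norm (f x) * norm (g x) \<partial>M))\<^sup>2
     \<le> ennreal (\<integral>x. (norm (f x))\<^sup>2 \<partial>M) * ennreal (\<integral>x. (norm (g x))\<^sup>2 \<partial>M)"
    using f g fg
    by (simp add: ennreal_mult'[symmetric] ennreal_power nn_integral_eq_integral)
  hence "(\<integral>x. norm (f x) * norm (g x) \<partial>M)\<^sup>2 \<le> (\<integral>x. (norm (f x))\<^sup>2 \<partial>M) * (\<integral>x. (norm (g x))\<^sup>2 \<partial>M)"
    by (simp add: ennreal_power ennreal_mult'[symmetric])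
  hence "sqrt ((\<integral>x. norm (f x) * norm (g x) \<partial>M)\<^sup>2) \<le> sqrt ((\<integral>x. (norm (f x))\<^sup>2 \<partial>M) * (\<integral>x. (norm (g x))\<^sup>2 \<partial>M))"
    by (rule real_sqrt_le_mono)
  thus ?thesis by (simp add: real_sqrt_mult)
qed

definition l2n :: "(real \<Rightarrow> complex) \<Rightarrow> real" where
  "l2n f = sqrt (LINT x|lborel. (norm (f x))\<^sup>2)"

lemma l2n_nonneg [simp]: "0 \<le> l2n f" by (simp add: l2n_def)

lemma l2n_sq: "(l2n f)\<^sup>2 = (LINT x|lborel. (norm (f x))\<^sup>2)" by (simp add: l2n_def)

lemma L2_measurable: "L2 f \<Longrightarrow> f \<in> borel_measurable borel" by (simp add: L2_def)

lemma L2_mult_integrable: "L2 f \<Longrightarrow> L2 g \<Longrightarrow> integrable lborel (\<lambda>x. f x * g x)"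
  unfolding L2_def by (intro integrable_mult_of_squares) auto

lemma borel_measurable_cnj' [measurable (raw)]:
  "f \<in> borel_measurable M \<Longrightarrow> (\<lambda>x. cnj (f x)) \<in> borel_measurable M"
  by (rule measurable_compose[OF _ borel_measurable_continuous_onI]) (auto intro: continuous_intros)

lemma L2_cnj: "L2 f \<Longrightarrow> L2 (\<lambda>x. cnj (f x))"
  unfolding L2_def by auto

lemma L2_inner_integrable: "L2 f \<Longrightarrow> L2 g \<Longrightarrow> integrable lborel (\<lambda>x. f x * cnj (g x))"
  by (intro L2_mult_integrable L2_cnj)

lemma L2_scale: "L2 f \<Longrightarrow> L2 (\<lambda>x. c * f x)"
  unfolding L2_def by (auto simp: norm_mult power_mult_distrib)

lemma L2_add: assumes "L2 f" "L2 g" shows "L2 (\<lambda>x. f x + g x)"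
proof -
  have [measurable]: "f \<in> borel_measurable borel" "g \<in> borel_measurable borel"
    using assms by (auto simp: L2_def)
  have "integrable lborel (\<lambda>x. (norm (f x + g x))\<^sup>2)"
  proof (rule Bochner_Integration.integrable_bound)
    show "integrable lborel (\<lambda>x. 2 * (norm (f x))\<^sup>2 + 2 * (norm (g x))\<^sup>2)"
      using assms by (auto simp: L2_def)
    have "(norm (f x + g x))\<^sup>2 \<le> 2 * (norm (f x))\<^sup>2 + 2 * (norm (g x))\<^sup>2" for x
    proof -
      have "(norm (f x + g x))\<^sup>2 \<le> (norm (f x) + norm (g x))\<^sup>2"
        by (intro power_mono norm_triangle_ineq) auto
      also have "\<dots> \<le> 2 * (norm (f x))\<^sup>2 + 2 * (norm (g x))\<^sup>2"
        using sum_squares_bound[of "norm (f x)" "norm (g x)"] by (simp add: power2_sum)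
      finally show ?thesis .
    qed
    thus "AE x in lborel. norm ((norm (f x + g x))\<^sup>2) \<le> norm (2 * (norm (f x))\<^sup>2 + 2 * (norm (g x))\<^sup>2)"
      by (auto intro!: AE_I2)
  qed auto
  thus ?thesis by (simp add: L2_def)
qed

lemma L2_diff: assumes "L2 f" "L2 g" shows "L2 (\<lambda>x. f x - g x)"
  using L2_add[OF assms(1) L2_scale[OF assms(2), of "-1"]] by simp

lemma L2_zero [simp]: "L2 (\<lambda>x. 0)" by (simp add: L2_def)

lemma l2n_cong_AE:
  assumes [measurable]: "f \<in> borel_measurable borel" "g \<in> borel_measurable borel"
    and "AE x in lborel. f x = g x"
  shows "l2n f = l2n g"
  unfolding l2n_def by (intro arg_cong[where f=sqrt] integral_cong_AE) (use assms in auto)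

lemma norm_inner_L2_le:
  assumes "L2 f" "L2 g" shows "norm (inner_L2 f g) \<le> l2n f * l2n g"
proof -
  have "norm (inner_L2 f g) \<le> (LINT x|lborel. norm (f x * cnj (g x)))"
    unfolding inner_L2_def by (rule integral_norm_bound)
  also have "\<dots> = (LINT x|lborel. norm (f x) * norm (g x))" by (simp add: norm_mult)
  also have "\<dots> \<le> l2n f * l2n g" unfolding l2n_def
    using assms by (intro Cauchy_Schwarz_integral) (auto simp: L2_def)
  finally show ?thesis .
qed

lemma l2n_triangle:
  assumes "L2 f" "L2 g" shows "l2n (\<lambda>x. f x + g x) \<le> l2n f + l2n g"
proof (rule power2_le_imp_le)
  have i: "integrable lborel (\<lambda>x. norm (f x) * norm (g x))"
    using integrable_norm[OF L2_mult_integrable[OF assms]] by (simp add: norm_mult)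
  have "(l2n (\<lambda>x. f x + g x))\<^sup>2 = (LINT x|lborel. (norm (f x + g x))\<^sup>2)" by (rule l2n_sq)
  also have "\<dots> \<le> (LINT x|lborel. (norm (f x))\<^sup>2 + (norm (g x))\<^sup>2 + 2 * (norm (f x) * norm (g x)))"
  proof (rule integral_mono)
    show "integrable lborel (\<lambda>x. (norm (f x + g x))\<^sup>2)" using L2_add[OF assms] by (simp add: L2_def)
    show "integrable lborel (\<lambda>x. (norm (f x))\<^sup>2 + (norm (g x))\<^sup>2 + 2 * (norm (f x) * norm (g x)))"
      using i assms by (auto simp: L2_def)
    fix x
    have "(norm (f x + g x))\<^sup>2 \<le> (norm (f x) + norm (g x))\<^sup>2"
      by (intro power_mono norm_triangle_ineq) auto
    thus "(norm (f x + g x))\<^sup>2 \<le> (norm (f x))\<^sup>2 + (norm (g x))\<^sup>2 + 2 * (norm (f x) * norm (g x))"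
      by (simp add: power2_sum)
  qed
  also have "\<dots> = (l2n f)\<^sup>2 + (l2n g)\<^sup>2 + 2 * (LINT x|lborel. norm (f x) * norm (g x))"
    using i assms by (simp add: l2n_sq L2_def)
  also have "\<dots> \<le> (l2n f)\<^sup>2 + (l2n g)\<^sup>2 + 2 * (l2n f * l2n g)"
    using Cauchy_Schwarz_integral[of f lborel g] assms unfolding l2n_def L2_def by auto
  finally show "(l2n (\<lambda>x. f x + g x))\<^sup>2 \<le> (l2n f + l2n g)\<^sup>2" by (simp add: power2_sum)
qed auto

lemma l2n_scale: "l2n (\<lambda>x. c * f x) = norm c * l2n f"
  by (simp add: l2n_def norm_mult power_mult_distrib real_sqrt_mult)

lemma l2n_diff_commute: "l2n (\<lambda>x. f x - g x) = l2n (\<lambda>x. g x - f x)"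
  by (simp add: l2n_def norm_minus_commute)

lemma l2n_diff_triangle:
  assumes "L2 f" "L2 g" "L2 h"
  shows "l2n (\<lambda>x. f x - h x) \<le> l2n (\<lambda>x. f x - g x) + l2n (\<lambda>x. g x - h x)"
  using l2n_triangle[OF L2_diff[OF assms(1,2)] L2_diff[OF assms(2,3)]] by simp

lemma l2n_diff_abs: assumes "L2 f" "L2 g" shows "\<bar>l2n f - l2n g\<bar> \<le> l2n (\<lambda>x. f x - g x)"
  using l2n_triangle[OF L2_diff[OF assms] assms(2)] l2n_triangle[OF L2_diff[OF assms(2,1)] assms(1)]
    l2n_diff_commute[of f g] by simp

lemma l2n_eq_0_iff: assumes "L2 f" shows "l2n f = 0 \<longleftrightarrow> (AE x in lborel. f x = 0)"
  unfolding l2n_def using assms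
  by (simp add: L2_def integral_nonneg_eq_0_iff_AE)

lemma inner_L2_add_left: "L2 f \<Longrightarrow> L2 g \<Longrightarrow> L2 h \<Longrightarrow> inner_L2 (\<lambda>x. f x + g x) h = inner_L2 f h + inner_L2 g h"
  unfolding inner_L2_def using L2_inner_integrable[of f h] L2_inner_integrable[of g h]
  by (simp add: distrib_right)

lemma inner_L2_diff_left: "L2 f \<Longrightarrow> L2 g \<Longrightarrow> L2 h \<Longrightarrow> inner_L2 (\<lambda>x. f x - g x) h = inner_L2 f h - inner_L2 g h"
  unfolding inner_L2_def using L2_inner_integrable[of f h] L2_inner_integrable[of g h]
  by (simp add: left_diff_distrib)

lemma inner_L2_add_right: "L2 f \<Longrightarrow> L2 g \<Longrightarrow> L2 h \<Longrightarrow> inner_L2 h (\<lambda>x. f x + g x) = inner_L2 h f + inner_L2 h g"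
  unfolding inner_L2_def using L2_inner_integrable[of h f] L2_inner_integrable[of h g]
  by (simp add: distrib_left)

lemma inner_L2_diff_right: "L2 f \<Longrightarrow> L2 g \<Longrightarrow> L2 h \<Longrightarrow> inner_L2 h (\<lambda>x. f x - g x) = inner_L2 h f - inner_L2 h g"
  unfolding inner_L2_def using L2_inner_integrable[of h f] L2_inner_integrable[of h g]
  by (simp add: right_diff_distrib)

lemma inner_L2_scale_left: "inner_L2 (\<lambda>x. c * f x) h = c * inner_L2 f h"
  unfolding inner_L2_def by (simp add: mult.assoc)

lemma inner_L2_scale_right: "inner_L2 h (\<lambda>x. c * f x) = cnj c * inner_L2 h f"
  unfolding inner_L2_def by (simp add: mult.left_commute)

lemma inner_L2_self: "inner_L2 f f = of_real ((l2n f)\<^sup>2)"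
proof -
  have "inner_L2 f f = (LINT x|lborel. complex_of_real ((norm (f x))\<^sup>2))"
    unfolding inner_L2_def by (intro Bochner_Integration.integral_cong refl) (metis complex_norm_square)
  thus ?thesis by (simp only: integral_complex_of_real l2n_sq)
qed

lemma inner_L2_commute: "inner_L2 g f = cnj (inner_L2 f g)"
proof -
  have "inner_L2 g f = (LINT x|lborel. cnj (f x * cnj (g x)))"
    unfolding inner_L2_def by (simp add: mult.commute)
  also have "\<dots> = cnj (inner_L2 f g)" unfolding inner_L2_def by (rule Bochner_Integration.integral_cnj)
  finally show ?thesis .
qed

lemma inner_L2_cong_AE:
  assumes [measurable]: "f \<in> borel_measurable borel" "f' \<in> borel_measurable borel" "g \<in> borel_measurable borel"
    and "AE x in lborel. f x = f' x"
  shows "inner_L2 f g = inner_L2 f' g"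
  unfolding inner_L2_def by (intro integral_cong_AE) (use assms in auto)

text \<open>Serves \<open>waves_dense\<close> twice: as source of the parallelogram law, and to
  expand the distance from \<open>f\<close> to a perturbed approximant.\<close>

lemma l2n_add_sq:
  assumes "L2 f" "L2 g"
  shows "(l2n (\<lambda>x. f x + g x))\<^sup>2 = (l2n f)\<^sup>2 + (l2n g)\<^sup>2 + 2 * Re (inner_L2 f g)"
proof -
  have "complex_of_real ((l2n (\<lambda>x. f x + g x))\<^sup>2) = inner_L2 f f + inner_L2 g g + (inner_L2 f g + inner_L2 g f)"
    unfolding inner_L2_self[symmetric] using assms
    by (simp add: inner_L2_add_left inner_L2_add_right L2_add)
  also have "\<dots> = complex_of_real ((l2n f)\<^sup>2 + (l2n g)\<^sup>2 + 2 * Re (inner_L2 f g))"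
    by (simp add: inner_L2_self inner_L2_commute[of g f] complex_add_cnj)
  finally show ?thesis using of_real_eq_iff by blast
qed

lemma tendsto_L2_iff:
  "tendsto_L2 g f \<longleftrightarrow> (\<forall>n. L2 (g n)) \<and> L2 f \<and> (\<lambda>n. l2n (\<lambda>x. g n x - f x)) \<longlonglongrightarrow> 0"
proof -
  have "(\<lambda>n. LINT x|lborel. (norm (g n x - f x))\<^sup>2) \<longlonglongrightarrow> 0 \<longleftrightarrow> (\<lambda>n. l2n (\<lambda>x. g n x - f x)) \<longlonglongrightarrow> 0"
    (is "?a \<longleftrightarrow> ?b")
  proof
    assume ?a from tendsto_real_sqrt[OF this] show ?b by (simp add: l2n_def)
  next
    assume ?b from tendsto_power[OF this, of 2] show ?a by (simp add: l2n_sq)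
  qed
  thus ?thesis by (simp add: tendsto_L2_def)
qed

lemma tendsto_L2_unique:
  assumes "tendsto_L2 v f" "tendsto_L2 v g" shows "AE x in lborel. f x = g x"
proof -
  have L: "L2 f" "L2 g" "\<And>n. L2 (v n)" using assms by (auto simp: tendsto_L2_iff)
  have "(\<lambda>n. l2n (\<lambda>x. v n x - f x) + l2n (\<lambda>x. v n x - g x)) \<longlonglongrightarrow> 0 + 0"
    using assms by (intro tendsto_add) (auto simp: tendsto_L2_iff)
  moreover have "l2n (\<lambda>x. f x - g x) \<le> l2n (\<lambda>x. v n x - f x) + l2n (\<lambda>x. v n x - g x)" for n
    using l2n_diff_triangle[OF L(1) L(3) L(2), of n] l2n_diff_commute[of f "v n"] by simp
  ultimately have "l2n (\<lambda>x. f x - g x) \<le> 0"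
    by (intro LIMSEQ_le_const[of _ 0]) auto
  hence "l2n (\<lambda>x. f x - g x) = 0" using l2n_nonneg[of "\<lambda>x. f x - g x"] by linarith
  thus ?thesis using l2n_eq_0_iff[OF L2_diff[OF L(1,2)]] by simp
qed

lemma tendsto_L2_inner:
  assumes "tendsto_L2 v f" "L2 g" shows "(\<lambda>n. inner_L2 (v n) g) \<longlonglongrightarrow> inner_L2 f g"
proof -
  have L: "L2 f" "\<And>n. L2 (v n)" using assms by (auto simp: tendsto_L2_iff)
  have lim: "(\<lambda>n. l2n (\<lambda>x. v n x - f x) * l2n g) \<longlonglongrightarrow> 0"
    using assms by (intro tendsto_mult_left_zero) (auto simp: tendsto_L2_iff)
  have "norm (inner_L2 (v n) g - inner_L2 f g) \<le> l2n (\<lambda>x. v n x - f x) * l2n g" for n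
    using norm_inner_L2_le[OF L2_diff[OF L(2) L(1)] assms(2)] inner_L2_diff_left[OF L(2) L(1) assms(2)] by simp
  hence "(\<lambda>n. inner_L2 (v n) g - inner_L2 f g) \<longlonglongrightarrow> 0"
    by (intro tendsto_norm_zero_cancel[OF tendsto_sandwich[OF _ _ tendsto_const lim]] always_eventually) auto
  thus ?thesis by (simp add: LIM_zero_iff)
qed

text \<open>Riesz--Fischer with a parameter: a sequence converging in \<open>L\<^sup>2\<close> uniformly in \<open>t\<close> has a
  jointly measurable limit, namely the pointwise limit of a subsequence chosen independently of \<open>t\<close>.\<close>

lemma uniformly_Cauchy_L2_limit:
  fixes V :: "nat \<Rightarrow> real \<Rightarrow> real \<Rightarrow> complex"
  assumes meas[measurable]: "\<And>n. (\<lambda>(t, x). V n t x) \<in> borel_measurable (lborel \<Otimes>\<^sub>M lborel)"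
    and L: "\<And>n t. L2 (V n t)"
    and cauchy: "\<And>e. e > 0 \<Longrightarrow> \<exists>N. \<forall>m\<ge>N. \<forall>n\<ge>N. \<forall>t. l2n (\<lambda>x. V m t x - V n t x) \<le> e"
  obtains u where "(\<lambda>(t, x). u t x) \<in> borel_measurable (lborel \<Otimes>\<^sub>M lborel)"
    and "\<And>t. L2 (u t)"
    and "\<And>e. e > 0 \<Longrightarrow> \<exists>N. \<forall>n\<ge>N. \<forall>t. l2n (\<lambda>x. V n t x - u t x) \<le> e"
proof -
  have "\<forall>k. \<exists>N. \<forall>m\<ge>N. \<forall>n\<ge>N. \<forall>t. l2n (\<lambda>x. V m t x - V n t x) \<le> (1/2)^k" using cauchy by simp
  then obtain N where N: "\<And>k m n t. m \<ge> N k \<Longrightarrow> n \<ge> N k \<Longrightarrow> l2n (\<lambda>x. V m t x - V n t x) \<le> (1/2)^k"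
    by metis
  \<comment> \<open>The partial sums make \<open>r m\<close> exceed every \<open>N k\<close> with k
    \<le> m, and the summand \<open>k\<close> forces \<open>r\<close> to infinity. Nothing here
    depends on \<open>t\<close>.\<close>
  define r where "r k = (\<Sum>j\<le>k. N j) + k" for k
  have rN: "r m \<ge> N k" if "m \<ge> k" for m k
  proof -
    have "N k \<le> (\<Sum>j\<le>m. N j)" using that by (intro member_le_sum) auto
    thus ?thesis by (simp add: r_def)
  qed
  have rk: "r k \<ge> k" for k by (simp add: r_def)
  \<comment> \<open>Where the subsequence diverges, \<open>lim\<close> is an unspecified value;
    joint measurability survives all the same.\<close>
  define u where "u t x = lim (\<lambda>k. V (r k) t x)" for t x
  have mV[measurable]: "V n t \<in> borel_measurable borel" for n t using L by (simp add: L2_def)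
  have meas_u: "(\<lambda>(t, x). u t x) \<in> borel_measurable (lborel \<Otimes>\<^sub>M lborel)"
  proof -
    have "(\<lambda>z. lim (\<lambda>k. (\<lambda>(t, x). V (r k) t x) z)) \<in> borel_measurable (lborel \<Otimes>\<^sub>M lborel)"
      by (intro borel_measurable_lim_metric meas)
    thus ?thesis by (simp add: u_def case_prod_beta)
  qed
  have mu[measurable]: "u t \<in> borel_measurable borel" for t
    unfolding u_def by measurable
  have conv: "AE x in lborel. (\<lambda>k. V (r k) t x) \<longlonglongrightarrow> u t x" for t
  proof -
    define d where "d k x = V (r (Suc k)) t x - V (r k) t x" for k x
    have [measurable]: "d k \<in> borel_measurable borel" for k unfolding d_def by measurable
    have Ld: "L2 (d k)" for k unfolding d_def by (intro L2_diff L)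
    have "(LINT x|lborel. (norm (d k x))\<^sup>2) \<le> ((1/2)^k)\<^sup>2" for k
      unfolding l2n_sq[symmetric] d_def by (intro power_mono N rN) auto
    \<comment> \<open>The squared increments are at most (1/4)^k, so the weight 2^k still leaves the
      summable bound (1/2)^k. Almost everywhere the weighted squares are then summable, hence
      bounded, and the increments decay geometrically.\<close>
    hence b: "(LINT x|lborel. 2^k * (norm (d k x))\<^sup>2) \<le> (1/2)^k" for k
      using mult_left_mono[of "LINT x|lborel. (norm (d k x))\<^sup>2" "((1/2)^k)\<^sup>2" "2^k"]
      by (simp add: power2_eq_square power_divide)
    have "(\<integral>\<^sup>+x. (\<Sum>k. ennreal (2^k * (norm (d k x))\<^sup>2)) \<partial>lborel) = (\<Sum>k. \<integral>\<^sup>+x. ennreal (2^k * (norm (d k x))\<^sup>2) \<partial>lborel)"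
      by (rule nn_integral_suminf) auto
    also have "\<dots> = (\<Sum>k. ennreal (LINT x|lborel. 2^k * (norm (d k x))\<^sup>2))"
      using Ld by (intro suminf_cong nn_integral_eq_integral) (auto simp: L2_def)
    also have "\<dots> \<le> (\<Sum>k. ennreal ((1/2)^k))"
      by (intro suminf_le ennreal_leI b) auto
    also have "\<dots> = ennreal (\<Sum>k. (1/2)^k)" by (rule suminf_ennreal2) auto
    also have "\<dots> < \<infinity>" by simp
    finally have "AE x in lborel. (\<Sum>k. ennreal (2^k * (norm (d k x))\<^sup>2)) \<noteq> \<infinity>"
      by (intro nn_integral_PInf_AE) auto
    thus ?thesis
    proof eventually_elim
      case (elim x)
      have "summable (\<lambda>k. 2^k * (norm (d k x))\<^sup>2)"
        using elim by (intro summable_suminf_not_top) auto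
      hence "bounded (range (\<lambda>k. 2^k * (norm (d k x))\<^sup>2))"
        using summable_imp_bounded by blast
      then obtain C where C: "\<And>k. norm (2^k * (norm (d k x))\<^sup>2) \<le> C" by (auto simp: bounded_iff)
      have "norm (d k x) \<le> sqrt C * (sqrt (1/2)) ^ k" for k
      proof (rule power2_le_imp_le)
        have "(norm (d k x))\<^sup>2 \<le> C * (1/2)^k" using C[of k] by (simp add: power_divide field_simps)
        also have "\<dots> = (sqrt C * (sqrt (1/2)) ^ k)\<^sup>2"
          using order_trans[OF norm_ge_zero C[of 0]]
          by (simp add: power_mult_distrib power_mult[symmetric] mult.commute[of k 2])
             (simp add: power_mult)
        finally show "(norm (d k x))\<^sup>2 \<le> (sqrt C * (sqrt (1/2)) ^ k)\<^sup>2" .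
        show "0 \<le> sqrt C * (sqrt (1/2)) ^ k" using order_trans[OF norm_ge_zero C[of 0]] by simp
      qed
      note dle = this
      have "sqrt (1/2) < sqrt (1::real)" by (subst real_sqrt_less_iff) simp
      hence "summable (\<lambda>k. sqrt C * (sqrt (1/2)) ^ k)"
        by (intro summable_mult summable_geometric) simp
      hence "summable (\<lambda>k. d k x)"
        by (rule summable_comparison_test'[where N=0]) (rule dle)
      hence "(\<lambda>n. (\<Sum>k<n. d k x)) \<longlonglongrightarrow> (\<Sum>k. d k x)" by (rule summable_LIMSEQ)
      moreover have "(\<Sum>k<n. d k x) = V (r n) t x - V (r 0) t x" for n
        unfolding d_def by (rule sum_lessThan_telescope)
      ultimately have "(\<lambda>n. V (r n) t x - V (r 0) t x + V (r 0) t x) \<longlonglongrightarrow> (\<Sum>k. d k x) + V (r 0) t x"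
        by (intro tendsto_add tendsto_const) simp
      hence "convergent (\<lambda>n. V (r n) t x)" by (auto simp: convergent_def)
      thus ?case unfolding u_def by (simp add: convergent_LIMSEQ_iff)
    qed
  qed
  \<comment> \<open>Fatou along the subsequence carries a Cauchy bound \<open>e\<close> over to the
    distance from \<open>V n t\<close> to the limit, for the original sequence and with the same
    \<open>e\<close>.\<close>
  have fatou: "(\<integral>\<^sup>+x. ennreal ((norm (V n t x - u t x))\<^sup>2) \<partial>lborel) \<le> ennreal (e\<^sup>2)"
    if e: "e > 0" "\<forall>m\<ge>M. l2n (\<lambda>x. V n t x - V m t x) \<le> e" for n t e M
  proof -
    have "(\<integral>\<^sup>+x. ennreal ((norm (V n t x - u t x))\<^sup>2) \<partial>lborel)
       = (\<integral>\<^sup>+x. liminf (\<lambda>k. ennreal ((norm (V n t x - V (r k) t x))\<^sup>2)) \<partial>lborel)"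
    proof (rule nn_integral_cong_AE)
      show "AE x in lborel. ennreal ((norm (V n t x - u t x))\<^sup>2) = liminf (\<lambda>k. ennreal ((norm (V n t x - V (r k) t x))\<^sup>2))"
        using conv[of t]
      proof eventually_elim
        case (elim x)
        have "(\<lambda>k. ennreal ((norm (V n t x - V (r k) t x))\<^sup>2)) \<longlonglongrightarrow> ennreal ((norm (V n t x - u t x))\<^sup>2)"
          by (intro tendsto_intros elim)
        thus ?case by (intro lim_imp_Liminf[symmetric]) simp_all
      qed
    qed
    also have "\<dots> \<le> liminf (\<lambda>k. \<integral>\<^sup>+x. ennreal ((norm (V n t x - V (r k) t x))\<^sup>2) \<partial>lborel)"
      by (rule nn_integral_liminf) auto
    also have "\<dots> \<le> liminf (\<lambda>k. ennreal (e\<^sup>2))"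
    proof (rule Liminf_mono, rule eventually_sequentiallyI[of M])
      fix k assume "k \<ge> M"
      hence "(LINT x|lborel. (norm (V n t x - V (r k) t x))\<^sup>2) \<le> e\<^sup>2"
        unfolding l2n_sq[symmetric] using e rk[of k] by (intro power_mono) auto
      moreover have "integrable lborel (\<lambda>x. (norm (V n t x - V (r k) t x))\<^sup>2)"
        using L2_diff[OF L L] by (auto simp: L2_def)
      ultimately show "(\<integral>\<^sup>+x. ennreal ((norm (V n t x - V (r k) t x))\<^sup>2) \<partial>lborel) \<le> ennreal (e\<^sup>2)"
        by (simp add: nn_integral_eq_integral ennreal_leI)
    qed
    also have "\<dots> = ennreal (e\<^sup>2)" by (simp add: Liminf_const)
    finally show ?thesis .
  qed
  have diffL: "L2 (\<lambda>x. V n t x - u t x)" if e: "e > 0" "\<forall>m\<ge>M. l2n (\<lambda>x. V n t x - V m t x) \<le> e" for n t e M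
    unfolding L2_def
  proof (intro conjI integrableI_bounded)
    have "(\<integral>\<^sup>+x. ennreal (norm ((norm (V n t x - u t x))\<^sup>2)) \<partial>lborel) \<le> ennreal (e\<^sup>2)"
      using fatou[OF e] by simp
    thus "(\<integral>\<^sup>+x. ennreal (norm ((norm (V n t x - u t x))\<^sup>2)) \<partial>lborel) < \<infinity>"
      by (rule le_less_trans) simp
  qed auto
  have le: "l2n (\<lambda>x. V n t x - u t x) \<le> e" if e: "e > 0" "\<forall>m\<ge>M. l2n (\<lambda>x. V n t x - V m t x) \<le> e" for n t e M
  proof (rule power2_le_imp_le)
    have "ennreal (LINT x|lborel. (norm (V n t x - u t x))\<^sup>2) \<le> ennreal (e\<^sup>2)"
      using fatou[OF e] diffL[OF e] by (subst nn_integral_eq_integral[symmetric]) (auto simp: L2_def)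
    thus "(l2n (\<lambda>x. V n t x - u t x))\<^sup>2 \<le> e\<^sup>2" by (simp add: l2n_sq)
  qed (use e in auto)
  show ?thesis
  proof (rule that)
    show "(\<lambda>(t, x). u t x) \<in> borel_measurable (lborel \<Otimes>\<^sub>M lborel)" by (rule meas_u)
    show "L2 (u t)" for t
    proof -
      have "L2 (\<lambda>x. V (N 0) t x - u t x)" by (rule diffL[of 1 "N 0"]) (use N[of 0] in auto)
      from L2_diff[OF L this, of "N 0" t] show ?thesis by simp
    qed
    fix e :: real assume "e > 0"
    then obtain M where "\<forall>m\<ge>M. \<forall>n\<ge>M. \<forall>t. l2n (\<lambda>x. V m t x - V n t x) \<le> e" using cauchy by blast
    with le[OF \<open>e > 0\<close>] show "\<exists>N. \<forall>n\<ge>N. \<forall>t. l2n (\<lambda>x. V n t x - u t x) \<le> e" by blast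
  qed
qed

section \<open>Schwartz functions\<close>

lemma schwartz_D: "schwartz f \<Longrightarrow> schwartz (D f)"
proof -
  assume f: "schwartz f"
  have "(D ^^ k) (D f) = (D ^^ Suc k) f" for k by (simp add: funpow_swap1)
  with f show ?thesis unfolding schwartz_def by metis
qed

lemma schwartz_has_vector_derivative:
  assumes "schwartz f" shows "(f has_vector_derivative D f x) (at x)"
proof -
  have "(D ^^ 0) f differentiable (at x)" using assms unfolding schwartz_def by blast
  thus ?thesis unfolding D_def by (simp add: vector_derivative_works)
qed

lemma schwartz_continuous_on: "schwartz f \<Longrightarrow> continuous_on A f"
  using schwartz_has_vector_derivative has_vector_derivative_continuous continuous_at_imp_continuous_on
  by metis

lemma schwartz_isCont: "schwartz f \<Longrightarrow> isCont f x"
  using schwartz_has_vector_derivative has_vector_derivative_continuous by metis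

lemma schwartz_measurable: "schwartz f \<Longrightarrow> f \<in> borel_measurable borel"
  by (intro borel_measurable_continuous_onI schwartz_continuous_on)

lemma schwartz_bounded_power:
  assumes "schwartz f" obtains C where "\<And>x. norm (x ^ j *\<^sub>R f x) \<le> C"
proof -
  have "bounded (range (\<lambda>x. x ^ j *\<^sub>R (D ^^ 0) f x))" using assms unfolding schwartz_def by blast
  thus ?thesis using that by (auto simp: bounded_iff)
qed

lemma schwartz_bounded: assumes "schwartz f" obtains C where "C > 0" "\<And>x. norm (f x) \<le> C"
proof -
  obtain C where "\<And>x. norm (x ^ 0 *\<^sub>R f x) \<le> C" using schwartz_bounded_power[OF assms] by blast
  hence C: "norm (f x) \<le> C" for x by simp
  show ?thesis
  proof (rule that[of "max C 1"])
    show "norm (f x) \<le> max C 1" for x using C[of x] by simp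
  qed simp
qed

text \<open>The bounds for the powers j and j + 2 are added; their sum controls the product with 1 +
  x^2.\<close>

lemma schwartz_decay:
  assumes "schwartz f" obtains C where "C > 0" "\<And>x. norm (x ^ j *\<^sub>R f x) \<le> C * inverse (1 + x\<^sup>2)"
proof -
  obtain C1 where C1: "\<And>x. norm (x ^ j *\<^sub>R f x) \<le> C1" using schwartz_bounded_power[OF assms] by blast
  obtain C2 where C2: "\<And>x. norm (x ^ (j + 2) *\<^sub>R f x) \<le> C2" using schwartz_bounded_power[OF assms] by blast
  show ?thesis
  proof (rule that[of "\<bar>C1\<bar> + \<bar>C2\<bar> + 1"])
    fix x :: real
    have "norm (x ^ j *\<^sub>R f x) * (1 + x\<^sup>2) = norm (x ^ j *\<^sub>R f x) + norm (x ^ (j + 2) *\<^sub>R f x)"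
      by (simp add: power_add distrib_left abs_mult power2_eq_square)
    also have "\<dots> \<le> \<bar>C1\<bar> + \<bar>C2\<bar> + 1" using C1[of x] C2[of x] by linarith
    finally show "norm (x ^ j *\<^sub>R f x) \<le> (\<bar>C1\<bar> + \<bar>C2\<bar> + 1) * inverse (1 + x\<^sup>2)"
      by (simp add: field_simps add_pos_nonneg)
  qed simp
qed

lemma integrable_inverse_1_plus_square_lborel: "integrable lborel (\<lambda>x::real. inverse (1 + x\<^sup>2))"
  using integrable_inverse_1_plus_square unfolding set_integrable_def by (simp add: einterval_eq)

lemma schwartz_integrable_power:
  fixes f :: "real \<Rightarrow> 'a::{banach, second_countable_topology}"
  assumes "schwartz f" shows "integrable lborel (\<lambda>x. x ^ j *\<^sub>R f x)"
proof -
  obtain C where C: "C > 0" "\<And>x. norm (x ^ j *\<^sub>R f x) \<le> C * inverse (1 + x\<^sup>2)"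
    using schwartz_decay[OF assms] by blast
  have [measurable]: "f \<in> borel_measurable borel" by (rule schwartz_measurable[OF assms])
  show ?thesis
  proof (rule Bochner_Integration.integrable_bound)
    show "integrable lborel (\<lambda>x. C * inverse (1 + x\<^sup>2))"
      by (intro integrable_mult_right integrable_inverse_1_plus_square_lborel)
    show "AE x in lborel. norm (x ^ j *\<^sub>R f x) \<le> norm (C * inverse (1 + x\<^sup>2))"
      using C order_trans[OF C(2) abs_ge_self] by (intro AE_I2) auto
  qed simp
qed

lemma schwartz_integrable:
  fixes f :: "real \<Rightarrow> 'a::{banach, second_countable_topology}"
  shows "schwartz f \<Longrightarrow> integrable lborel f"
  using schwartz_integrable_power[of f 0] by simp

lemma schwartz_L2_power:
  assumes "schwartz f" shows "L2 (\<lambda>x. of_real (x ^ j) * f x)"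
proof -
  obtain C where C: "C > 0" "\<And>x. norm (x ^ j *\<^sub>R f x) \<le> C * inverse (1 + x\<^sup>2)"
    using schwartz_decay[OF assms] by blast
  have [measurable]: "f \<in> borel_measurable borel" by (rule schwartz_measurable[OF assms])
  have "integrable lborel (\<lambda>x. (norm (of_real (x ^ j) * f x))\<^sup>2)"
  proof (rule Bochner_Integration.integrable_bound)
    show "integrable lborel (\<lambda>x. C\<^sup>2 * inverse (1 + x\<^sup>2))"
      by (intro integrable_mult_right integrable_inverse_1_plus_square_lborel)
    show "AE x in lborel. norm ((norm (of_real (x ^ j) * f x))\<^sup>2) \<le> norm (C\<^sup>2 * inverse (1 + x\<^sup>2))"
    proof (rule AE_I2)
      fix x :: real
      have i: "inverse (1 + x\<^sup>2) \<le> 1" by (intro inverse_le_1_iff[THEN iffD2]) auto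
      have "(norm (of_real (x ^ j) * f x))\<^sup>2 \<le> (C * inverse (1 + x\<^sup>2))\<^sup>2" 
        using C(2)[of x] by (intro power_mono) (auto simp: norm_mult norm_power power_abs)
      also have "\<dots> = C\<^sup>2 * (inverse (1 + x\<^sup>2) * inverse (1 + x\<^sup>2))"
        by (simp add: power2_eq_square algebra_simps)
      also have "\<dots> \<le> C\<^sup>2 * (inverse (1 + x\<^sup>2) * 1)"
        using i by (intro mult_left_mono) (auto simp: add_nonneg_nonneg)
      finally show "norm ((norm (of_real (x ^ j) * f x))\<^sup>2) \<le> norm (C\<^sup>2 * inverse (1 + x\<^sup>2))" by simp
    qed
  qed auto
  thus ?thesis by (simp add: L2_def)
qed

lemma schwartz_L2: "schwartz f \<Longrightarrow> L2 f" using schwartz_L2_power[of f 0] by simp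

lemma schwartz_L2_H: assumes "schwartz f" shows "L2 (H f)"
proof -
  have "L2 (\<lambda>x. of_real (x ^ 2) * f x - D (D f) x)"
    by (intro L2_diff schwartz_L2_power schwartz_L2 schwartz_D assms)
  moreover have "H f = (\<lambda>x. of_real (x ^ 2) * f x - D (D f) x)" by (auto simp: H_def fun_eq_iff)
  ultimately show ?thesis by simp
qed

text \<open>Differentiation stays inside this family and acts on the polynomial alone. The vector
  \<open>v\<close> makes one family serve both as complex test functions in the uniqueness proof and
  as the real mollifier of mass one.\<close>

definition poly_gauss :: "real poly \<Rightarrow> 'a::real_normed_vector \<Rightarrow> real \<Rightarrow> 'a" where
  "poly_gauss p v x = (poly p x * exp (- (x\<^sup>2 / 2))) *\<^sub>R v"

lemma poly_gauss_has_vector_derivative: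
  "(poly_gauss p v has_vector_derivative poly_gauss (pderiv p - [:0, 1:] * p) v x) (at x)"
proof -
  have "((\<lambda>x. poly p x * exp (- (x\<^sup>2 / 2))) has_real_derivative
     (poly (pderiv p - [:0, 1:] * p) x * exp (- (x\<^sup>2 / 2)))) (at x)"
    by (auto intro!: derivative_eq_intros poly_DERIV simp: algebra_simps)
  thus ?thesis unfolding poly_gauss_def[abs_def] has_real_derivative_iff_has_vector_derivative
    by (intro has_vector_derivative_scaleR[THEN has_vector_derivative_eq_rhs])
       (auto intro!: derivative_eq_intros simp: has_real_derivative_iff_has_vector_derivative)
qed

lemma D_eqI: "(\<And>x. (f has_vector_derivative f' x) (at x)) \<Longrightarrow> D f = f'"
  by (auto simp: D_def fun_eq_iff intro: vector_derivative_at)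

lemma D_poly_gauss: "D (poly_gauss p v) = poly_gauss (pderiv p - [:0, 1:] * p) v"
  by (intro D_eqI poly_gauss_has_vector_derivative)

text \<open>Monomials are absorbed by |x|^n \<le> n! exp |x|, and |x| - x^2/2 never exceeds
  1/2.\<close>

lemma poly_mult_gauss_bounded: "\<exists>C. \<forall>x::real. \<bar>poly p x * exp (- (x\<^sup>2 / 2))\<bar> \<le> C"
proof -
  have mono: "\<bar>x ^ n * exp (- (x\<^sup>2 / 2))\<bar> \<le> fact n * exp (1/2)" for n and x :: real
  proof -
    have "\<bar>x\<bar> ^ n / fact n \<le> exp \<bar>x\<bar>" 
      using sum_le_suminf[OF summable_exp[of "\<bar>x\<bar>"], of "{n}"]
      by (simp add: exp_def divide_inverse mult.commute)
    hence "\<bar>x\<bar> ^ n \<le> fact n * exp \<bar>x\<bar>" by (simp add: field_simps)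
    hence "\<bar>x ^ n * exp (- (x\<^sup>2 / 2))\<bar> \<le> fact n * exp \<bar>x\<bar> * exp (- (x\<^sup>2 / 2))"
      by (simp add: abs_mult power_abs)
    also have "\<dots> = fact n * exp (\<bar>x\<bar> - x\<^sup>2 / 2)" by (simp add: mult.assoc flip: exp_add)
    also have "\<dots> \<le> fact n * exp (1/2)"
    proof -
      have "0 \<le> (\<bar>x\<bar> - 1)\<^sup>2" by simp
      hence "\<bar>x\<bar> - x\<^sup>2 / 2 \<le> 1/2" by (simp add: power2_diff)
      thus ?thesis by simp
    qed
    finally show ?thesis .
  qed
  have "\<bar>poly p x * exp (- (x\<^sup>2 / 2))\<bar> \<le> (\<Sum>i\<le>degree p. \<bar>coeff p i\<bar> * (fact i * exp (1/2)))" for x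
  proof -
    have "\<bar>poly p x * exp (- (x\<^sup>2 / 2))\<bar> = \<bar>\<Sum>i\<le>degree p. coeff p i * (x ^ i * exp (- (x\<^sup>2 / 2)))\<bar>"
      by (simp add: poly_altdef sum_distrib_right mult.assoc)
    also have "\<dots> \<le> (\<Sum>i\<le>degree p. \<bar>coeff p i * (x ^ i * exp (- (x\<^sup>2 / 2)))\<bar>)" by (rule sum_abs)
    also have "\<dots> \<le> (\<Sum>i\<le>degree p. \<bar>coeff p i\<bar> * (fact i * exp (1/2)))"
      using mono by (intro sum_mono) (simp add: abs_mult mult_left_mono)
    finally show ?thesis .
  qed
  thus ?thesis by blast
qed

lemma schwartz_poly_gauss: "schwartz (poly_gauss p v)"
proof -
  have ex: "\<exists>q. (D ^^ k) (poly_gauss p v) = poly_gauss q v" for k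
  proof (induction k)
    case (Suc k) thus ?case by (auto simp: D_poly_gauss)
  qed auto
  show ?thesis unfolding schwartz_def
  proof (intro conjI allI)
    fix k x
    show "(D ^^ k) (poly_gauss p v) differentiable (at x)"
      using ex[of k] differentiableI_vector[OF poly_gauss_has_vector_derivative] by metis
  next
    fix j k
    obtain q where q: "(D ^^ k) (poly_gauss p v) = poly_gauss q v" using ex by blast
    obtain C where C: "\<And>x. \<bar>poly (monom 1 j * q) x * exp (- (x\<^sup>2 / 2))\<bar> \<le> C"
      using poly_mult_gauss_bounded by blast
    have "norm (x ^ j *\<^sub>R (D ^^ k) (poly_gauss p v) x) \<le> C * norm v" for x
    proof -
      have "norm (x ^ j *\<^sub>R (D ^^ k) (poly_gauss p v) x) = \<bar>poly (monom 1 j * q) x * exp (- (x\<^sup>2 / 2))\<bar> * norm v"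
        by (simp add: q poly_gauss_def poly_monom abs_mult)
      thus ?thesis using C by (simp add: mult_right_mono)
    qed
    thus "bounded (range (\<lambda>x. x ^ j *\<^sub>R (D ^^ k) (poly_gauss p v) x))" by (auto simp: bounded_iff)
  qed
qed

text \<open>Integration by parts in the shape needed to move \<open>H\<close> off a test function:
  \<open>F\<close> collects the boundary terms.\<close>

lemma integral_total_derivative_eq_0:
  fixes F f :: "real \<Rightarrow> complex"
  assumes "\<And>x. (F has_vector_derivative f x) (at x)" "\<And>x. isCont f x" "integrable lborel f"
    and "(F \<longlongrightarrow> 0) at_top" "(F \<longlongrightarrow> 0) at_bot"
  shows "(LINT x|lborel. f x) = 0"
proof -
  have "(LBINT x=-\<infinity>..\<infinity>. f x) = 0 - 0"
    using assms by (intro interval_integral_FTC_integrable[of _ _ F])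
      (auto simp: ereal_tendsto_simps set_integrable_def einterval_eq)
  thus ?thesis by (simp add: interval_lebesgue_integral_def set_lebesgue_integral_def einterval_eq)
qed

section \<open>Gaussians\<close>

text \<open>Read off from the characteristic function of the standard normal distribution.\<close>

lemma gaussian_fourier:
  "has_bochner_integral lborel (\<lambda>x. complex_of_real (exp (- (x\<^sup>2 / 2))) * exp (\<i> * of_real (t * x)))
     (complex_of_real (sqrt (2 * pi) * exp (- (t\<^sup>2 / 2))))"
proof -
  have i: "integrable lborel (\<lambda>x. complex_of_real (exp (- (x\<^sup>2 / 2))) * exp (\<i> * of_real (t * x)))"
  proof (rule Bochner_Integration.integrable_bound)
    show "integrable lborel (poly_gauss 1 (1::real))" by (intro schwartz_integrable schwartz_poly_gauss)
  qed (auto simp: poly_gauss_def norm_mult norm_exp_i_times)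
  have "complex_of_real (exp (- (t^2) / 2)) = char std_normal_distribution t"
    by (simp add: char_std_normal_distribution)
  also have "\<dots> = (LINT x|lborel. std_normal_density x *\<^sub>R exp (\<i> * of_real (t * x)))"
    unfolding char_def by (subst integral_density) auto
  also have "\<dots> = (LINT x|lborel. complex_of_real (1 / sqrt (2 * pi)) * (complex_of_real (exp (- (x\<^sup>2 / 2))) * exp (\<i> * of_real (t * x))))"
    unfolding std_normal_density_def scaleR_conv_of_real of_real_mult mult.assoc minus_divide_left ..
  also have "\<dots> = complex_of_real (1 / sqrt (2 * pi)) * (LINT x|lborel. (complex_of_real (exp (- (x\<^sup>2 / 2))) * exp (\<i> * of_real (t * x))))"
    by (rule integral_mult_right_zero)
  finally have "(LINT x|lborel. (complex_of_real (exp (- (x\<^sup>2 / 2))) * exp (\<i> * of_real (t * x)))) = complex_of_real (sqrt (2 * pi) * exp (- (t\<^sup>2 / 2)))"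
    by (simp add: field_simps)
  thus ?thesis using i by (simp add: has_bochner_integral_iff)
qed

text \<open>The real part of \<beta> is removed by completing the square, which is a real
  translation, and the imaginary part is a frequency for \<open>gaussian_fourier\<close>. The
  substitution thus stays on the real line.\<close>

lemma gaussian_integral:
  fixes a :: real and \<beta> :: complex
  assumes a: "a > 0"
  shows "has_bochner_integral lborel (\<lambda>x. exp (- of_real (a * x\<^sup>2) + \<beta> * of_real x))
    (of_real (sqrt (pi / a)) * exp (\<beta>\<^sup>2 / of_real (4 * a)))"
proof -
  define b t where "b = Re \<beta>" and "t = Im \<beta>"
  have \<beta>: "\<beta> = of_real b + \<i> * of_real t" by (simp add: b_def t_def complex_eq_iff)
  \<comment> \<open>Scale \<open>c\<close> and centre \<open>s\<close> are chosen so that the real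
    part of the exponent at s + c y is b^2/(4a) - y^2/2.\<close>
  define c where "c = 1 / sqrt (2 * a)"
  have c: "c > 0" "c\<^sup>2 = 1 / (2 * a)" using a by (auto simp: c_def power_divide)
  define s where "s = b / (2 * a)"
  define K where "K = exp (complex_of_real (b\<^sup>2 / (4 * a)) + \<i> * of_real (t * s))"
  let ?f = "\<lambda>x. exp (- complex_of_real (a * x\<^sup>2) + \<beta> * of_real x)"
  have e: "?f (s + c * y) = K * (complex_of_real (exp (- (y\<^sup>2 / 2))) * exp (\<i> * of_real (t * c * y)))" for y
  proof -
    have "- (a * (s + c * y)\<^sup>2) + b * (s + c * y) = b\<^sup>2 / (4 * a) - y\<^sup>2 / 2"
    proof -
      have "- (a * (s + c * y)\<^sup>2) + b * (s + c * y) = - a * s\<^sup>2 + b * s + (b - 2 * a * s) * c * y - a * c\<^sup>2 * y\<^sup>2"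
        by (simp add: power2_eq_square algebra_simps)
      also have "\<dots> = b\<^sup>2 / (4 * a) - y\<^sup>2 / 2" unfolding c(2) using a
        by (simp add: s_def power2_eq_square field_simps)
      finally show ?thesis .
    qed
    hence 1: "- complex_of_real (a * (s + c * y)\<^sup>2) + of_real b * of_real (s + c * y) = of_real (b\<^sup>2 / (4 * a) - y\<^sup>2 / 2)"
      by (metis of_real_add of_real_minus of_real_mult)
    have "- complex_of_real (a * (s + c * y)\<^sup>2) + \<beta> * of_real (s + c * y)
      = (- complex_of_real (a * (s + c * y)\<^sup>2) + of_real b * of_real (s + c * y)) + \<i> * of_real (t * (s + c * y))"
      by (simp add: \<beta> algebra_simps)
    also have "\<dots> = (complex_of_real (b\<^sup>2 / (4 * a)) + \<i> * of_real (t * s)) + (complex_of_real (- (y\<^sup>2 / 2)) + \<i> * of_real (t * c * y))"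
      unfolding 1 by (simp add: algebra_simps)
    finally show ?thesis unfolding K_def by (simp only: exp_add exp_of_real)
  qed
  have "has_bochner_integral lborel (\<lambda>y. K * (complex_of_real (exp (- (y\<^sup>2 / 2))) * exp (\<i> * of_real (t * c * y))))
     (K * (complex_of_real (sqrt (2 * pi) * exp (- ((t * c)\<^sup>2 / 2)))))"
    by (intro has_bochner_integral_mult_right gaussian_fourier)
  hence h: "has_bochner_integral lborel (\<lambda>y. ?f (s + c * y)) (K * (complex_of_real (sqrt (2 * pi) * exp (- ((t * c)\<^sup>2 / 2)))))"
    by (simp only: e)
  have v: "K * (complex_of_real (sqrt (2 * pi) * exp (- ((t * c)\<^sup>2 / 2))))
     = (of_real (sqrt (pi / a)) * exp (\<beta>\<^sup>2 / of_real (4 * a))) /\<^sub>R \<bar>c\<bar>"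
  proof -
    have scale: "complex_of_real (A / c) * X = (of_real A * X) /\<^sub>R \<bar>c\<bar>" for A X
      using c(1) by (simp add: scaleR_conv_of_real field_simps)
    define E where "E = exp (- ((t * c)\<^sup>2 / 2))"
    have f1: "sqrt (2 * pi) = sqrt (pi / a) / c"
      using a by (simp add: c_def real_sqrt_mult real_sqrt_divide field_simps)
    have "(t * c)\<^sup>2 / 2 = t\<^sup>2 / (4 * a)" by (simp add: power_mult_distrib c(2))
    hence "(complex_of_real (b\<^sup>2 / (4 * a)) + \<i> * of_real (t * s)) + of_real (- ((t * c)\<^sup>2 / 2)) = \<beta>\<^sup>2 / of_real (4 * a)"
      by (simp only:) (use a in \<open>simp add: \<beta> s_def power2_eq_square field_simps\<close>)
    hence f2: "K * of_real E = exp (\<beta>\<^sup>2 / of_real (4 * a))"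
      unfolding K_def E_def by (metis exp_add exp_of_real)
    have "K * of_real (sqrt (2 * pi) * E) = of_real (sqrt (2 * pi)) * (K * of_real E)"
      unfolding of_real_mult by (rule mult.left_commute)
    also have "\<dots> = of_real (sqrt (pi / a) / c) * exp (\<beta>\<^sup>2 / of_real (4 * a))"
      unfolding f1 f2 ..
    also have "\<dots> = (of_real (sqrt (pi / a)) * exp (\<beta>\<^sup>2 / of_real (4 * a))) /\<^sub>R \<bar>c\<bar>"
      by (rule scale)
    finally show ?thesis unfolding E_def .
  qed
  show ?thesis
    by (rule iffD2[OF lborel_has_bochner_integral_real_affine_iff[of c _ _ s, OF less_imp_neq[OF c(1), symmetric]]])
       (rule h[unfolded v])
qed

text \<open>The Gaussian \<open>coh z\<close> is the coherent state \<open>\<Sum>\<^sub>n z\<^sup>n / (2\<^sup>n n!) \<phi>\<^sub>n\<close> with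
  \<open>\<phi>\<^sub>n\<close> the unnormalized Hermite functions, so that \<open>e\<^sup>i\<^sup>t\<^sup>H\<close> maps it to \<open>e\<^sup>i\<^sup>t coh (e\<^sup>2\<^sup>i\<^sup>t z)\<close>.\<close>

definition coh :: "complex \<Rightarrow> real \<Rightarrow> complex" where
  "coh z x = exp (- of_real (x\<^sup>2 / 2) + z * of_real x - z\<^sup>2 / 4)"

definition coh_flow :: "complex \<Rightarrow> real \<Rightarrow> real \<Rightarrow> complex" where
  "coh_flow z t x = cis t * coh (cis (2 * t) * z) x"

text \<open>Half of the Gaussian decay is given up for a bound that sees only |z|. The flow rotates
  z, so the same bound holds at all times.\<close>

lemma norm_coh_le: "norm (coh z x) \<le> exp (2 * (norm z)\<^sup>2) * exp (- (x\<^sup>2 / 4))"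
proof -
  have "norm (coh z x) = exp (- (x\<^sup>2 / 2) + Re z * x - Re (z\<^sup>2) / 4)"
    by (simp add: coh_def norm_exp_eq_Re)
  moreover have "- (x\<^sup>2 / 2) + Re z * x - Re (z\<^sup>2) / 4 \<le> 2 * (norm z)\<^sup>2 + - (x\<^sup>2 / 4)"
  proof -
    have "0 \<le> (x / 2 - Re z)\<^sup>2" by simp
    hence "Re z * x \<le> x\<^sup>2 / 4 + (Re z)\<^sup>2" by (simp add: power2_diff power_divide mult.commute)
    moreover have "(norm z)\<^sup>2 = (Re z)\<^sup>2 + (Im z)\<^sup>2" by (simp add: cmod_power2)
    moreover have "- (X / 2) + A - (R - I) / 4 \<le> 2 * (R + I) + - (X / 4)"
      if "A \<le> X / 4 + R" "0 \<le> R" "0 \<le> I" for A R I X :: real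
    proof -
      have "2 * (R + I) + - (X / 4) - (- (X / 2) + A - (R - I) / 4) = (X / 4 + R - A) + (5/4 * R + 7/4 * I)"
        by (simp add: field_simps)
      also have "\<dots> \<ge> 0" using that by (intro add_nonneg_nonneg) auto
      finally show ?thesis by simp
    qed
    ultimately show ?thesis unfolding Re_power2 by simp
  qed
  ultimately show ?thesis by (simp flip: exp_add)
qed

lemma norm_coh_flow_le: "norm (coh_flow z t x) \<le> exp (2 * (norm z)\<^sup>2) * exp (- (x\<^sup>2 / 4))"
  using norm_coh_le[of "cis (2 * t) * z" x] by (simp add: coh_flow_def norm_mult)

lemma coh_flow_0 [simp]: "coh_flow z 0 = coh z" by (simp add: coh_flow_def fun_eq_iff)

lemma continuous_coh_flow: "continuous_on UNIV (\<lambda>(t, x). coh_flow z t x)"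
  unfolding coh_flow_def coh_def case_prod_beta by (intro continuous_intros) simp_all

text \<open>The value involves z and w only through z times the conjugate of w, which is unchanged
  when both are rotated by the same angle. This is the unitarity of the flow on coherent
  states.\<close>

lemma inner_coh_has: "has_bochner_integral lborel (\<lambda>x. coh z x * cnj (coh w x)) (of_real (sqrt pi) * exp (z * cnj w / 2))"
proof -
  have "coh z x * cnj (coh w x) = exp (- (z\<^sup>2 + (cnj w)\<^sup>2) / 4) * exp (- of_real (1 * x\<^sup>2) + (z + cnj w) * of_real x)" for x
    unfolding coh_def exp_cnj exp_add[symmetric]
    by (rule arg_cong[where f=exp]) (simp add: field_simps)
  moreover have "has_bochner_integral lborel (\<lambda>x. exp (- (z\<^sup>2 + (cnj w)\<^sup>2) / 4) * exp (- of_real (1 * x\<^sup>2) + (z + cnj w) * of_real x))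
    (exp (- (z\<^sup>2 + (cnj w)\<^sup>2) / 4) * (of_real (sqrt (pi / 1)) * exp ((z + cnj w)\<^sup>2 / of_real (4 * 1))))"
    by (intro has_bochner_integral_mult_right gaussian_integral) simp
  moreover have "exp (- (z\<^sup>2 + (cnj w)\<^sup>2) / 4) * (of_real (sqrt (pi / 1)) * exp ((z + cnj w)\<^sup>2 / of_real (4 * 1)))
    = of_real (sqrt pi) * exp (z * cnj w / 2)"
    unfolding mult.left_commute[of "exp _"] exp_add[symmetric]
    by (simp add: power2_sum) (simp add: field_simps)
  ultimately show ?thesis by (simp only:)
qed

lemma coh_measurable [measurable]: "coh z \<in> borel_measurable borel"
  unfolding coh_def[abs_def] by (intro borel_measurable_continuous_onI continuous_intros) simp_all

lemma L2_coh: "L2 (coh z)"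
proof -
  have "integrable lborel (\<lambda>x. norm (coh z x * cnj (coh z x)))"
    using inner_coh_has[of z z] by (intro integrable_norm) (auto simp: has_bochner_integral_iff)
  thus ?thesis by (simp add: L2_def norm_mult power2_eq_square)
qed

lemma inner_coh: "inner_L2 (coh z) (coh w) = of_real (sqrt pi) * exp (z * cnj w / 2)"
  unfolding inner_L2_def using inner_coh_has by (simp add: has_bochner_integral_iff)

lemma L2_coh_flow: "L2 (coh_flow z t)"
  unfolding coh_flow_def[abs_def] by (intro L2_scale L2_coh)

lemma inner_coh_flow: "inner_L2 (coh_flow z t) (coh_flow w t) = inner_L2 (coh z) (coh w)"
proof -
  have u: "cis s * cnj (cis s) = 1" for s by (simp add: cis_cnj cis_mult)
  have "cis (2 * t) * z * cnj (cis (2 * t) * w) = (cis (2 * t) * cnj (cis (2 * t))) * (z * cnj w)"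
    by simp
  hence v: "cis (2 * t) * z * cnj (cis (2 * t) * w) = z * cnj w" unfolding u by simp
  have "inner_L2 (coh_flow z t) (coh_flow w t)
    = (cis t * cnj (cis t)) * inner_L2 (coh (cis (2 * t) * z)) (coh (cis (2 * t) * w))"
    unfolding coh_flow_def[abs_def] inner_L2_scale_left inner_L2_scale_right by (rule mult.assoc[symmetric])
  thus ?thesis unfolding u inner_coh v by simp
qed

section \<open>Completeness of Gaussian moments and of coherent states\<close>

lemma Fourier_integrable:
  fixes f :: "real \<Rightarrow> complex"
  assumes "integrable lborel f" shows "integrable lborel (\<lambda>x. f x * exp (\<i> * of_real (t * x)))"
proof (rule Bochner_Integration.integrable_bound[OF assms])
  show "(\<lambda>x. f x * exp (\<i> * of_real (t * x))) \<in> borel_measurable lborel"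
    using assms by measurable
qed (simp add: norm_mult norm_exp_i_times)

text \<open>Positive and negative part have the same transform, in particular the same mass (take t
  = 0). Divided by this mass they are probability densities with equal characteristic functions, so
  Levy's uniqueness theorem identifies them.\<close>

lemma Fourier_unique_real:
  fixes g :: "real \<Rightarrow> real"
  assumes g: "integrable lborel g"
    and 0: "\<And>t. (LINT x|lborel. complex_of_real (g x) * exp (\<i> * of_real (t * x))) = 0"
  shows "AE x in lborel. g x = 0"
proof -
  define p q where "p x = max 0 (g x)" and "q x = max 0 (- g x)" for x
  have [measurable]: "g \<in> borel_measurable borel" using g by simp
  have [measurable]: "p \<in> borel_measurable borel" "q \<in> borel_measurable borel"
    unfolding p_def q_def by measurable
  have ip: "integrable lborel p" and iq: "integrable lborel q"
    using g unfolding p_def q_def by auto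
  have pos: "p x \<ge> 0" "q x \<ge> 0" for x by (auto simp: p_def q_def)
  have gpq: "g x = p x - q x" for x by (auto simp: p_def q_def)
  have ipc: "integrable lborel (\<lambda>x. complex_of_real (p x) * exp (\<i> * of_real (t * x)))"
    "integrable lborel (\<lambda>x. complex_of_real (q x) * exp (\<i> * of_real (t * x)))" for t
    by (rule Fourier_integrable[OF integrable_of_real[OF ip]], rule Fourier_integrable[OF integrable_of_real[OF iq]])
  have eq: "(LINT x|lborel. complex_of_real (p x) * exp (\<i> * of_real (t * x)))
    = (LINT x|lborel. complex_of_real (q x) * exp (\<i> * of_real (t * x)))" for t
    using 0[of t] ipc[of t] by (simp add: gpq left_diff_distrib)
  define m where "m = (LINT x|lborel. p x)"
  have m': "m = (LINT x|lborel. q x)" using eq[of 0] by (simp add: m_def)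
  show ?thesis
  proof (cases "m = 0")
    case True
    hence "AE x in lborel. p x = 0" "AE x in lborel. q x = 0"
      using integral_nonneg_eq_0_iff_AE[OF ip] integral_nonneg_eq_0_iff_AE[OF iq] pos m' m_def by auto
    thus ?thesis by eventually_elim (simp add: gpq)
  next
    case False
    moreover have "m \<ge> 0" unfolding m_def by (rule Bochner_Integration.integral_nonneg) (rule pos)
    ultimately have m: "m > 0" by simp
    have dist: "real_distribution (density lborel (\<lambda>x. ennreal (h x / m)))"
      if h: "integrable lborel h" "\<And>x. h x \<ge> 0" "(LINT x|lborel. h x) = m" for h
    proof -
      have [measurable]: "h \<in> borel_measurable borel" using h by simp
      have "prob_space (density lborel (\<lambda>x. ennreal (h x / m)))"
      proof
        have "emeasure (density lborel (\<lambda>x. ennreal (h x / m))) (space (density lborel (\<lambda>x. ennreal (h x / m))))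
          = (\<integral>\<^sup>+x. ennreal (h x / m) \<partial>lborel)"
          by (simp add: emeasure_density)
        also have "\<dots> = ennreal (LINT x|lborel. h x / m)"
          using h m by (intro nn_integral_eq_integral) auto
        also have "\<dots> = 1" using h m by simp
        finally show "emeasure (density lborel (\<lambda>x. ennreal (h x / m))) (space (density lborel (\<lambda>x. ennreal (h x / m)))) = 1" .
      qed
      thus ?thesis by (simp add: real_distribution_def real_distribution_axioms_def)
    qed
    have ch: "char (density lborel (\<lambda>x. ennreal (h x / m))) t
       = (LINT x|lborel. complex_of_real (h x) * exp (\<i> * of_real (t * x))) / m"
      if h[measurable]: "h \<in> borel_measurable borel" "\<And>x. h x \<ge> 0" for h :: "real \<Rightarrow> real" and t
    proof -
      have "char (density lborel (\<lambda>x. ennreal (h x / m))) t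
         = (LINT x|lborel. (h x / m) *\<^sub>R exp (\<i> * of_real (t * x)))"
        unfolding char_def using h m by (subst integral_density) auto
      also have "\<dots> = (LINT x|lborel. (complex_of_real (h x) * exp (\<i> * of_real (t * x))) / of_real m)"
        by (simp add: scaleR_conv_of_real)
      also have "\<dots> = (LINT x|lborel. complex_of_real (h x) * exp (\<i> * of_real (t * x))) / m"
        by (rule integral_divide_zero)
      finally show ?thesis .
    qed
    have "density lborel (\<lambda>x. ennreal (p x / m)) = density lborel (\<lambda>x. ennreal (q x / m))"
    proof (rule Levy_uniqueness)
      show "real_distribution (density lborel (\<lambda>x. ennreal (p x / m)))"
        by (rule dist[OF ip pos(1)]) (simp add: m_def)
      show "real_distribution (density lborel (\<lambda>x. ennreal (q x / m)))"
        by (rule dist[OF iq pos(2)]) (simp add: m')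
      show "char (density lborel (\<lambda>x. ennreal (p x / m))) = char (density lborel (\<lambda>x. ennreal (q x / m)))"
        using pos eq by (simp add: fun_eq_iff ch)
    qed
    hence "AE x in lborel. ennreal (p x / m) = ennreal (q x / m)"
      by (intro sigma_finite_measure.density_unique[OF sigma_finite_lborel]) auto
    thus ?thesis
    proof eventually_elim
      case (elim x)
      hence "p x / m = q x / m" using pos m by (subst (asm) ennreal_inj) auto
      thus ?case using m by (simp add: gpq)
    qed
  qed
qed

text \<open>Conjugation turns the frequency t into -t, so the conjugate of f has vanishing transform
  too, and with it the real and the imaginary part.\<close>

lemma Fourier_unique:
  fixes f :: "real \<Rightarrow> complex"
  assumes f: "integrable lborel f"
    and 0: "\<And>t. (LINT x|lborel. f x * exp (\<i> * of_real (t * x))) = 0"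
  shows "AE x in lborel. f x = 0"
proof -
  have c0: "(LINT x|lborel. cnj (f x) * exp (\<i> * of_real (t * x))) = 0" for t
  proof -
    have "(LINT x|lborel. cnj (f x) * exp (\<i> * of_real (t * x))) = (LINT x|lborel. cnj (f x * exp (\<i> * of_real (- t * x))))"
      by (simp add: exp_cnj)
    also have "\<dots> = cnj (LINT x|lborel. f x * exp (\<i> * of_real (- t * x)))" by (rule Bochner_Integration.integral_cnj)
    finally show ?thesis unfolding 0 by simp
  qed
  have i: "integrable lborel (\<lambda>x. f x * exp (\<i> * of_real (t * x)))" "integrable lborel (\<lambda>x. cnj (f x) * exp (\<i> * of_real (t * x)))" for t
    by (rule Fourier_integrable[OF f], rule Fourier_integrable) (use f in simp)
  have "AE x in lborel. Re (f x) = 0"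
  proof (rule Fourier_unique_real)
    fix t
    have "(LINT x|lborel. complex_of_real (Re (f x)) * exp (\<i> * of_real (t * x)))
      = (LINT x|lborel. (f x * exp (\<i> * of_real (t * x)) + cnj (f x) * exp (\<i> * of_real (t * x))) / 2)"
      by (intro Bochner_Integration.integral_cong) (auto simp: complex_eq_iff algebra_simps)
    also have "\<dots> = 0" using i[of t] 0 c0 by simp
    finally show "(LINT x|lborel. complex_of_real (Re (f x)) * exp (\<i> * of_real (t * x))) = 0" .
  qed (use f in auto)
  moreover have "AE x in lborel. Im (f x) = 0"
  proof (rule Fourier_unique_real)
    fix t
    have h: "(w * e - cnj w * e) * (- \<i> / 2) = of_real (Im w) * e" for w e :: complex
    proof -
      have "(w * e - cnj w * e) * (- \<i> / 2) = ((w - cnj w) * (- \<i> / 2)) * e"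
        unfolding left_diff_distrib[symmetric] by (simp only: ac_simps)
      also have "(w - cnj w) * (- \<i> / 2) = of_real (Im w)" by (simp add: complex_eq_iff)
      finally show ?thesis .
    qed
    have "(LINT x|lborel. complex_of_real (Im (f x)) * exp (\<i> * of_real (t * x)))
      = (LINT x|lborel. (f x * exp (\<i> * of_real (t * x)) - cnj (f x) * exp (\<i> * of_real (t * x))) * (- \<i> / 2))"
      unfolding h ..
    also have "\<dots> = 0" using i[of t] 0 c0 by simp
    finally show "(LINT x|lborel. complex_of_real (Im (f x)) * exp (\<i> * of_real (t * x))) = 0" .
  qed (use f in auto)
  ultimately show ?thesis by eventually_elim (simp add: complex_eq_iff)
qed

lemma L2_exp_quarter: "L2 (\<lambda>x. of_real (exp (- (x\<^sup>2 / 4))))"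
proof -
  have "integrable lborel (poly_gauss 1 (1::real))" by (intro schwartz_integrable schwartz_poly_gauss)
  hence "integrable lborel (\<lambda>x::real. exp (- (x\<^sup>2 / 2)))" by (simp add: poly_gauss_def[abs_def])
  moreover have "(norm (complex_of_real (exp (- (x\<^sup>2 / 4)))))\<^sup>2 = exp (- (x\<^sup>2 / 2))" for x :: real
    by (simp flip: exp_double)
  ultimately show ?thesis unfolding L2_def by simp
qed

text \<open>Provides the dominating function in \<open>moments_complete\<close>: exp (|t| |x|)
  bounds all partial sums of the series of exp (i t x).\<close>

lemma gauss_mult_integrable:
  assumes "L2 f" shows "integrable lborel (\<lambda>x. f x * of_real (exp (\<bar>t\<bar> * \<bar>x\<bar> - x\<^sup>2 / 2)))"
proof (rule Bochner_Integration.integrable_bound)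
  have [measurable]: "f \<in> borel_measurable borel" by (rule L2_measurable[OF assms])
  show "integrable lborel (\<lambda>x. of_real (exp (t\<^sup>2)) * (f x * of_real (exp (- (x\<^sup>2 / 4)))))"
    by (intro integrable_mult_right L2_mult_integrable assms L2_exp_quarter)
  show "(\<lambda>x. f x * of_real (exp (\<bar>t\<bar> * \<bar>x\<bar> - x\<^sup>2 / 2))) \<in> borel_measurable lborel" by measurable
  have "exp (\<bar>t\<bar> * \<bar>x\<bar> - x\<^sup>2 / 2) \<le> exp (t\<^sup>2) * exp (- (x\<^sup>2 / 4))" for x
  proof -
    have "0 \<le> (\<bar>x\<bar> / 2 - \<bar>t\<bar>)\<^sup>2" by simp
    hence "\<bar>t\<bar> * \<bar>x\<bar> \<le> x\<^sup>2 / 4 + t\<^sup>2" by (simp add: power2_diff power_divide mult.commute)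
    thus ?thesis by (simp flip: exp_add)
  qed
  thus "AE x in lborel. norm (f x * of_real (exp (\<bar>t\<bar> * \<bar>x\<bar> - x\<^sup>2 / 2)))
      \<le> norm (of_real (exp (t\<^sup>2)) * (f x * of_real (exp (- (x\<^sup>2 / 4)))))"
    by (intro AE_I2) (simp add: norm_mult mult_left_mono mult.left_commute)
qed

text \<open>An L^2 function need not be integrable; multiplied by a Gaussian it is, and the Gaussian
  has no zeros, so Fourier uniqueness can be applied to the product.\<close>

lemma gauss_mult_eq_0:
  assumes f: "L2 f" and 0: "\<And>t. (LINT x|lborel. (f x * of_real (exp (- (x\<^sup>2 / 2)))) * exp (\<i> * of_real (t * x))) = 0"
  shows "AE x in lborel. f x = 0"
proof -
  have "AE x in lborel. f x * of_real (exp (- (x\<^sup>2 / 2))) = 0"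
    using gauss_mult_integrable[OF f, of 0] by (intro Fourier_unique 0) simp
  thus ?thesis by eventually_elim simp
qed

text \<open>Expanding exp (i t x) in powers of x gives partial sums whose integrals vanish by
  hypothesis; dominated convergence then kills the Fourier transform of f times the
  Gaussian.\<close>

lemma moments_complete:
  assumes f: "L2 f" and 0: "\<And>n. (LINT x|lborel. f x * of_real (x ^ n * exp (- (x\<^sup>2 / 2)))) = 0"
  shows "AE x in lborel. f x = 0"
proof (rule gauss_mult_eq_0[OF f])
  fix t :: real
  have [measurable]: "f \<in> borel_measurable borel" by (rule L2_measurable[OF f])
  let ?g = "\<lambda>x. f x * of_real (exp (- (x\<^sup>2 / 2)))"
  let ?s = "\<lambda>N x. ?g x * (\<Sum>k<N. (\<i> * of_real (t * x)) ^ k / fact k)"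
  have ii: "integrable lborel (\<lambda>x. f x * of_real (x ^ n * exp (- (x\<^sup>2 / 2))))" for n
  proof -
    have "L2 (poly_gauss (monom 1 n) 1)" by (intro schwartz_L2 schwartz_poly_gauss)
    from L2_mult_integrable[OF f this] show ?thesis by (simp add: poly_gauss_def poly_monom scaleR_conv_of_real)
  qed
  have ev: "integral\<^sup>L lborel (?s N) = 0" for N
  proof -
    have "?s N = (\<lambda>x. \<Sum>k<N. ((\<i> * of_real t) ^ k / fact k) * (f x * of_real (x ^ k * exp (- (x\<^sup>2 / 2)))))"
      by (auto simp: fun_eq_iff sum_distrib_left power_mult_distrib field_simps intro!: sum.cong)
    hence "integral\<^sup>L lborel (?s N) = (\<Sum>k<N. (LINT x|lborel. ((\<i> * of_real t) ^ k / fact k) * (f x * of_real (x ^ k * exp (- (x\<^sup>2 / 2))))))"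
      using ii by (simp only:) (intro Bochner_Integration.integral_sum integrable_mult_right, simp)
    also have "\<dots> = 0" using 0 by (simp only: integral_mult_right_zero mult_zero_right sum.neutral_const)
    finally show ?thesis .
  qed
  have "(\<lambda>N. integral\<^sup>L lborel (?s N)) \<longlonglongrightarrow> (LINT x|lborel. ?g x * exp (\<i> * of_real (t * x)))"
  proof (rule integral_dominated_convergence[where w="\<lambda>x. norm (f x * of_real (exp (\<bar>t\<bar> * \<bar>x\<bar> - x\<^sup>2 / 2)))"])
    show "integrable lborel (\<lambda>x. norm (f x * of_real (exp (\<bar>t\<bar> * \<bar>x\<bar> - x\<^sup>2 / 2))))"
      by (intro integrable_norm gauss_mult_integrable f)
    show "AE x in lborel. (\<lambda>N. ?s N x) \<longlonglongrightarrow> ?g x * exp (\<i> * of_real (t * x))"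
    proof (intro AE_I2 tendsto_mult tendsto_const)
      fix x
      have "(\<lambda>k. (\<i> * complex_of_real (t * x)) ^ k /\<^sub>R fact k) sums exp (\<i> * of_real (t * x))" by (rule exp_converges)
      thus "(\<lambda>N. \<Sum>k<N. (\<i> * complex_of_real (t * x)) ^ k / fact k) \<longlonglongrightarrow> exp (\<i> * of_real (t * x))"
        by (simp add: sums_def scaleR_conv_of_real field_simps)
    qed
    fix N
    have le: "norm (\<Sum>k<N. (\<i> * complex_of_real (t * x)) ^ k / fact k) \<le> exp (\<bar>t\<bar> * \<bar>x\<bar>)" for x
    proof -
      have "norm (\<Sum>k<N. (\<i> * complex_of_real (t * x)) ^ k / fact k) \<le> (\<Sum>k<N. inverse (fact k) * (\<bar>t\<bar> * \<bar>x\<bar>) ^ k)"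
        by (intro order_trans[OF norm_sum] sum_mono)
           (simp add: norm_divide norm_power norm_mult norm_inverse abs_mult divide_inverse mult.commute)
      also have "\<dots> \<le> (\<Sum>k. inverse (fact k) * (\<bar>t\<bar> * \<bar>x\<bar>) ^ k)"
        by (intro sum_le_suminf summable_exp) auto
      also have "\<dots> = exp (\<bar>t\<bar> * \<bar>x\<bar>)" by (simp add: exp_def)
      finally show ?thesis .
    qed
    have "norm (?s N x) \<le> norm (f x * of_real (exp (\<bar>t\<bar> * \<bar>x\<bar> - x\<^sup>2 / 2)))" for x
    proof -
      have "norm (?s N x) \<le> norm (?g x) * exp (\<bar>t\<bar> * \<bar>x\<bar>)"
        unfolding norm_mult[of "?g x"] by (intro mult_left_mono le) auto
      also have "\<dots> = norm (f x) * exp (\<bar>t\<bar> * \<bar>x\<bar> + - (x\<^sup>2 / 2))"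
        unfolding exp_add by (simp add: norm_mult)
      finally show ?thesis by (simp add: norm_mult)
    qed
    thus "AE x in lborel. norm (?s N x) \<le> norm (f x * of_real (exp (\<bar>t\<bar> * \<bar>x\<bar> - x\<^sup>2 / 2)))" by simp
  qed simp_all
  thus "(LINT x|lborel. ?g x * exp (\<i> * of_real (t * x))) = 0"
    unfolding ev by (simp add: LIMSEQ_const_iff)
qed

text \<open>Imaginary parameters suffice: up to a constant, the conjugate of coh (-i t) is the
  Gaussian times exp (i t x), so the inner products are Fourier coefficients.\<close>

lemma coh_complete:
  assumes f: "L2 f" and 0: "\<And>z. inner_L2 f (coh z) = 0"
  shows "AE x in lborel. f x = 0"
proof (rule gauss_mult_eq_0[OF f])
  fix t :: real
  have "cnj (coh (- \<i> * of_real t) x) = of_real (exp (t\<^sup>2 / 4)) * (of_real (exp (- (x\<^sup>2 / 2))) * exp (\<i> * of_real (t * x)))" for x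
    unfolding coh_def exp_cnj of_real_exp exp_add[symmetric]
    by (rule arg_cong[where f=exp]) (simp add: power_mult_distrib)
  hence "inner_L2 f (coh (- \<i> * of_real t))
    = (LINT x|lborel. of_real (exp (t\<^sup>2 / 4)) * ((f x * of_real (exp (- (x\<^sup>2 / 2)))) * exp (\<i> * of_real (t * x))))"
    unfolding inner_L2_def by (simp only: mult.assoc mult.left_commute[of "of_real (exp (t\<^sup>2 / 4))"])
  also have "\<dots> = of_real (exp (t\<^sup>2 / 4)) * (LINT x|lborel. (f x * of_real (exp (- (x\<^sup>2 / 2)))) * exp (\<i> * of_real (t * x)))"
    by (rule integral_mult_right_zero)
  finally show "(LINT x|lborel. (f x * of_real (exp (- (x\<^sup>2 / 2)))) * exp (\<i> * of_real (t * x))) = 0"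
    using 0 by simp
qed

section \<open>Finite superpositions of coherent states\<close>

text \<open>A relation between a datum and its explicit evolution, so that a function may be a
  superposition in several ways and no representation has to be chosen. Rule induction then gives
  all facts for datum and flow together.\<close>

inductive wave :: "(real \<Rightarrow> complex) \<Rightarrow> (real \<Rightarrow> real \<Rightarrow> complex) \<Rightarrow> bool" where
  wave_coh: "wave (\<lambda>x. c * coh z x) (\<lambda>t x. c * coh_flow z t x)"
| wave_add: "wave f U \<Longrightarrow> wave g W \<Longrightarrow> wave (\<lambda>x. f x + g x) (\<lambda>t x. U t x + W t x)"

lemma wave_L2: "wave f U \<Longrightarrow> L2 f"
  by (induction rule: wave.induct) (auto intro: L2_scale L2_add L2_coh)

lemma wave_L2_flow: "wave f U \<Longrightarrow> L2 (U t)"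
  by (induction rule: wave.induct) (auto intro: L2_scale L2_add L2_coh_flow)

lemma wave_0: "wave f U \<Longrightarrow> U 0 = f"
  by (induction rule: wave.induct) auto

lemma wave_scale: "wave f U \<Longrightarrow> wave (\<lambda>x. c * f x) (\<lambda>t x. c * U t x)"
proof (induction rule: wave.induct)
  case (wave_coh d z) thus ?case using wave.wave_coh[of "c * d" z] by (simp add: mult.assoc)
next
  case (wave_add f U g W)
  from wave.wave_add[OF wave_add.IH] show ?case by (simp add: distrib_left)
qed

lemma wave_diff: "wave f U \<Longrightarrow> wave g W \<Longrightarrow> wave (\<lambda>x. f x - g x) (\<lambda>t x. U t x - W t x)"
  using wave_add[of f U, OF _ wave_scale[of g W "-1"]] by simp

lemma wave_inner_coh: "wave f U \<Longrightarrow> inner_L2 (U t) (coh_flow z t) = inner_L2 f (coh z)"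
  by (induction rule: wave.induct)
     (simp_all add: inner_L2_scale_left inner_coh_flow inner_L2_add_left wave_L2 wave_L2_flow L2_coh L2_coh_flow)

lemma wave_inner:
  assumes "wave f U" "wave g W" shows "inner_L2 (U t) (W t) = inner_L2 f g"
  using assms(2)
proof (induction rule: wave.induct)
  case (wave_coh c z) thus ?case using wave_inner_coh[OF assms(1)] by (simp add: inner_L2_scale_right)
next
  case (wave_add g1 W1 g2 W2)
  thus ?case using assms(1) by (simp add: inner_L2_add_right wave_L2 wave_L2_flow)
qed

lemma wave_norm: assumes "wave f U" shows "l2n (U t) = l2n f"
proof -
  have "complex_of_real ((l2n (U t))\<^sup>2) = of_real ((l2n f)\<^sup>2)"
    unfolding inner_L2_self[symmetric] by (rule wave_inner[OF assms assms])
  thus ?thesis by (simp only: of_real_eq_iff power2_eq_iff_nonneg l2n_nonneg)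
qed

lemma wave_bound: "wave f U \<Longrightarrow> \<exists>C. \<forall>t x. norm (U t x) \<le> C * exp (- (x\<^sup>2 / 4))"
proof (induction rule: wave.induct)
  case (wave_coh c z)
  have "norm (c * coh_flow z t x) \<le> (norm c * exp (2 * (norm z)\<^sup>2)) * exp (- (x\<^sup>2 / 4))" for t x
    using mult_left_mono[OF norm_coh_flow_le[of z t x], of "norm c"] by (simp add: norm_mult mult.assoc)
  thus ?case by blast
next
  case (wave_add f U g W)
  then obtain C1 C2 where C: "\<And>t x. norm (U t x) \<le> C1 * exp (- (x\<^sup>2 / 4))" "\<And>t x. norm (W t x) \<le> C2 * exp (- (x\<^sup>2 / 4))"
    by blast
  have "norm (U t x + W t x) \<le> (C1 + C2) * exp (- (x\<^sup>2 / 4))" for t x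
    using norm_triangle_ineq[of "U t x" "W t x"] C[of t x] by (simp add: distrib_right)
  thus ?case by blast
qed

lemma wave_continuous: "wave f U \<Longrightarrow> continuous_on UNIV (\<lambda>(t, x). U t x)"
proof (induction rule: wave.induct)
  case (wave_coh c z)
  from continuous_on_mult[OF continuous_on_const continuous_coh_flow, of c z] show ?case by (simp add: case_prod_beta)
next
  case (wave_add f U g W)
  from continuous_on_add[OF wave_add.IH] show ?case by (simp add: case_prod_beta)
qed

text \<open>Orthogonal projection onto the closed span. A minimizing sequence converges, the
  residual of its limit is orthogonal to all coherent states, and \<open>coh_complete\<close> makes
  it vanish.\<close>

lemma waves_dense:
  assumes f: "L2 f" obtains v U where "\<And>n. wave (v n) (U n)" "tendsto_L2 v f"
proof -
  define S where "S = {(l2n (\<lambda>x. f x - w x))\<^sup>2 | w. \<exists>U. wave w U}"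
  define d where "d = Inf S"
  have bdd: "bdd_below S" unfolding S_def by (rule bdd_belowI[of _ 0]) auto
  have ne: "S \<noteq> {}" unfolding S_def using wave_coh by blast
  have dle: "d \<le> (l2n (\<lambda>x. f x - w x))\<^sup>2" if "wave w U" for w U
    unfolding d_def using that by (intro cInf_lower[OF _ bdd]) (auto simp: S_def)
  have "\<exists>w U. wave w U \<and> (l2n (\<lambda>x. f x - w x))\<^sup>2 < d + inverse (real (Suc n))" for n
  proof -
    have "Inf S < d + inverse (real (Suc n))" unfolding d_def by simp
    from cInf_lessD[OF ne this] show ?thesis unfolding S_def by blast
  qed
  then obtain v U where v: "\<And>n. wave (v n) (U n)" "\<And>n. (l2n (\<lambda>x. f x - v n x))\<^sup>2 < d + inverse (real (Suc n))"
    by metis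
  have Lv: "L2 (v n)" for n using wave_L2[OF v(1)] .
  have Ld: "L2 (\<lambda>x. f x - v n x)" for n by (intro L2_diff f Lv)
  \<comment> \<open>Parallelogram law for two residuals: the midpoint of two approximants is again a
    wave, so its residual has squared norm at least \<open>d\<close>, which leaves little room for
    their difference.\<close>
  have close: "(l2n (\<lambda>x. v m x - v n x))\<^sup>2 \<le> 2 * inverse (real (Suc m)) + 2 * inverse (real (Suc n))" for m n
  proof -
    let ?a = "\<lambda>x. f x - v n x" and ?b = "\<lambda>x. f x - v m x"
    have 1: "(l2n (\<lambda>x. ?a x + ?b x))\<^sup>2 = (l2n ?a)\<^sup>2 + (l2n ?b)\<^sup>2 + 2 * Re (inner_L2 ?a ?b)"
      by (rule l2n_add_sq[OF Ld Ld])
    have 2: "(l2n (\<lambda>x. ?a x + (-1) * ?b x))\<^sup>2 = (l2n ?a)\<^sup>2 + (l2n ?b)\<^sup>2 - 2 * Re (inner_L2 ?a ?b)"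
      using l2n_add_sq[OF Ld[of n] L2_scale[OF Ld, of "-1" m]] l2n_scale[of "-1" ?b]
        inner_L2_scale_right[of ?a "-1" ?b] by simp
    have "wave (\<lambda>x. (1/2) * (v n x + v m x)) (\<lambda>t x. (1/2) * (U n t x + U m t x))"
      by (intro wave_scale wave_add v)
    from dle[OF this] have "d \<le> (l2n (\<lambda>x. (1/2) * (?a x + ?b x)))\<^sup>2"
      by (simp add: field_simps)
    hence "4 * d \<le> (l2n (\<lambda>x. ?a x + ?b x))\<^sup>2"
      unfolding l2n_scale by (simp add: power_mult_distrib power_divide)
    hence "(l2n (\<lambda>x. ?a x + (-1) * ?b x))\<^sup>2 \<le> 2 * (l2n ?a)\<^sup>2 + 2 * (l2n ?b)\<^sup>2 - 4 * d" using 1 2 by linarith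
    also have "\<dots> \<le> 2 * inverse (real (Suc m)) + 2 * inverse (real (Suc n))" using v(2)[of n] v(2)[of m] by linarith
    finally show ?thesis by simp
  qed
  \<comment> \<open>The dummy time \<open>t\<close> turns \<open>uniformly_Cauchy_L2_limit\<close>
    into plain completeness of L^2; the limit is \<open>u 0\<close>.\<close>
  have "\<exists>N. \<forall>m\<ge>N. \<forall>n\<ge>N. \<forall>t::real. l2n (\<lambda>x. v m x - v n x) \<le> e" if "e > 0" for e
  proof -
    have "0 < e\<^sup>2 / 4" using that by simp
    then obtain N where N: "inverse (real (Suc N)) < e\<^sup>2 / 4" using reals_Archimedean by blast
    have "l2n (\<lambda>x. v m x - v n x) \<le> e" if "m \<ge> N" "n \<ge> N" for m n
    proof (rule power2_le_imp_le)
      have "inverse (real (Suc k)) \<le> inverse (real (Suc N))" if "k \<ge> N" for k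
        using that by (intro le_imp_inverse_le) auto
      from close[of m n] this[OF \<open>m \<ge> N\<close>] this[OF \<open>n \<ge> N\<close>] N
      show "(l2n (\<lambda>x. v m x - v n x))\<^sup>2 \<le> e\<^sup>2" by linarith
    qed (use \<open>e > 0\<close> in simp)
    thus ?thesis by blast
  qed
  then obtain u where u: "\<And>t. L2 (u t)" "\<And>e. e > 0 \<Longrightarrow> \<exists>N. \<forall>n\<ge>N. \<forall>t::real. l2n (\<lambda>x. v n x - u t x) \<le> e"
  proof (rule uniformly_Cauchy_L2_limit[of "\<lambda>n t. v n", rotated 2])
    show "(\<lambda>(t, x). v n x) \<in> borel_measurable (lborel \<Otimes>\<^sub>M lborel)" for n
      using L2_measurable[OF Lv, of n] by measurable
  qed (use Lv in blast)+
  have lim: "tendsto_L2 v (u 0)"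
    unfolding tendsto_L2_iff
  proof (intro conjI allI Lv u LIMSEQ_I)
    fix r :: real assume "r > 0"
    then obtain N where N: "\<forall>n\<ge>N. \<forall>t::real. l2n (\<lambda>x. v n x - u t x) \<le> r / 2" using u(2)[of "r / 2"] by auto
    show "\<exists>no. \<forall>n\<ge>no. norm (l2n (\<lambda>x. v n x - u 0 x) - 0) < r"
    proof (intro exI[of _ N] allI impI)
      fix n assume "n \<ge> N"
      hence "l2n (\<lambda>x. v n x - u 0 x) \<le> r / 2" using N by blast
      thus "norm (l2n (\<lambda>x. v n x - u 0 x) - 0) < r" using \<open>r > 0\<close> by simp
    qed
  qed
  have orth: "inner_L2 (\<lambda>x. f x - u 0 x) w = 0" if w: "wave w W" for w W
  proof -
    have Lw: "L2 w" using wave_L2[OF w] .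
    define \<alpha> where "\<alpha> n = inner_L2 (\<lambda>x. f x - v n x) w" for n
    define \<beta> where "\<beta> = inner_L2 (\<lambda>x. f x - u 0 x) w"
    have "(\<lambda>n. inner_L2 f w - inner_L2 (v n) w) \<longlonglongrightarrow> inner_L2 f w - inner_L2 (u 0) w"
      by (intro tendsto_intros tendsto_L2_inner[OF lim Lw])
    hence al: "\<alpha> \<longlonglongrightarrow> \<beta>" unfolding \<alpha>_def \<beta>_def by (simp add: inner_L2_diff_left f Lv Lw u)
    \<comment> \<open>Moving \<open>v n\<close> by \<open>s\<close> times \<open>\<alpha> n\<close>
      along \<open>w\<close> changes the squared distance by a linear gain and a quadratic loss.
      This \<open>s\<close> keeps the loss below half of the gain, and it is defined even if
      \<open>w\<close> vanishes.\<close>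
    define s where "s = inverse (1 + (l2n w)\<^sup>2)"
    have s: "s > 0" "s * (l2n w)\<^sup>2 \<le> 1" by (auto simp: s_def field_simps add_pos_nonneg)
    have "2 * s * (norm (\<alpha> n))\<^sup>2 \<le> inverse (real (Suc n)) + s * (norm (\<alpha> n))\<^sup>2" for n
    proof -
      let ?l = "- (of_real s * \<alpha> n)"
      have "wave (\<lambda>x. v n x + (- ?l) * w x) (\<lambda>t x. U n t x + (- ?l) * W t x)"
        by (intro wave_add wave_scale v w)
      from dle[OF this] have "d \<le> (l2n (\<lambda>x. (f x - v n x) + ?l * w x))\<^sup>2" by (simp add: algebra_simps)
      also have "\<dots> = (l2n (\<lambda>x. f x - v n x))\<^sup>2 + (l2n (\<lambda>x. ?l * w x))\<^sup>2
         + 2 * Re (inner_L2 (\<lambda>x. f x - v n x) (\<lambda>x. ?l * w x))"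
        by (rule l2n_add_sq[OF Ld L2_scale[OF Lw]])
      also have "(l2n (\<lambda>x. ?l * w x))\<^sup>2 = s * (norm (\<alpha> n))\<^sup>2 * (s * (l2n w)\<^sup>2)"
        unfolding l2n_scale using s(1) by (simp add: norm_mult power_mult_distrib power2_eq_square)
      also have "inner_L2 (\<lambda>x. f x - v n x) (\<lambda>x. ?l * w x) = - of_real (s * (norm (\<alpha> n))\<^sup>2)"
        unfolding inner_L2_scale_right \<alpha>_def[symmetric] of_real_mult complex_norm_square by (simp add: mult.commute)
      finally have "d \<le> (l2n (\<lambda>x. f x - v n x))\<^sup>2 + s * (norm (\<alpha> n))\<^sup>2 * (s * (l2n w)\<^sup>2) - 2 * s * (norm (\<alpha> n))\<^sup>2"
        by simp
      moreover have "s * (norm (\<alpha> n))\<^sup>2 * (s * (l2n w)\<^sup>2) \<le> s * (norm (\<alpha> n))\<^sup>2 * 1"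
        using s by (intro mult_left_mono) auto
      ultimately show ?thesis using v(2)[of n] by linarith
    qed
    hence le: "s * (norm (\<alpha> n))\<^sup>2 \<le> inverse (real (Suc n))" for n by (simp add: mult.assoc)
    have "(\<lambda>n. s * (norm (\<alpha> n))\<^sup>2) \<longlonglongrightarrow> s * (norm \<beta>)\<^sup>2" by (intro tendsto_intros al)
    moreover have "(\<lambda>n. inverse (real (Suc n))) \<longlonglongrightarrow> 0" by (rule LIMSEQ_inverse_real_of_nat)
    ultimately have "s * (norm \<beta>)\<^sup>2 \<le> 0" using le by (intro LIMSEQ_le) auto
    hence "norm \<beta> = 0" using s(1) by (simp add: mult_le_0_iff)
    thus ?thesis unfolding \<beta>_def by simp
  qed
  have "AE x in lborel. f x - u 0 x = 0"
  proof (rule coh_complete)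
    show "L2 (\<lambda>x. f x - u 0 x)" by (intro L2_diff f u)
    show "inner_L2 (\<lambda>x. f x - u 0 x) (coh z) = 0" for z
      using orth[OF wave_coh[of 1 z]] by simp
  qed
  hence AE: "AE x in lborel. f x = u 0 x" by eventually_elim simp
  have "l2n (\<lambda>x. v n x - f x) = l2n (\<lambda>x. v n x - u 0 x)" for n
    using AE L2_measurable[OF Lv, of n] L2_measurable[OF f] L2_measurable[OF u(1)]
    by (intro l2n_cong_AE) auto
  hence "tendsto_L2 v f" using lim f Lv by (simp add: tendsto_L2_iff)
  thus ?thesis using that v(1) by blast
qed

section \<open>The propagator\<close>

lemma exp_eighth_le: "exp (- (x\<^sup>2 / 8)) \<le> 8 * (inverse x)\<^sup>2" if "x \<noteq> 0" for x :: real
proof -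
  have "x\<^sup>2 / 8 \<le> exp (x\<^sup>2 / 8)" using exp_ge_add_one_self[of "x\<^sup>2 / 8"] by linarith
  hence le: "inverse (exp (x\<^sup>2 / 8)) \<le> inverse (x\<^sup>2 / 8)"
    by (rule le_imp_inverse_le) (use that in simp)
  have "exp (- (x\<^sup>2 / 8)) = inverse (exp (x\<^sup>2 / 8))" by (rule exp_minus)
  also note le
  also have "inverse (x\<^sup>2 / 8) = 8 * (inverse x)\<^sup>2" using that by (simp add: power2_eq_square field_simps)
  finally show ?thesis .
qed

lemma tendsto_exp_eighth: "((\<lambda>x::real. exp (- (x\<^sup>2 / 8))) \<longlongrightarrow> 0) at_infinity"
proof (rule tendsto_sandwich[where f="\<lambda>_. 0" and h="\<lambda>x. 8 * (inverse x)\<^sup>2"])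
  show "((\<lambda>x::real. 8 * (inverse x)\<^sup>2) \<longlongrightarrow> 0) at_infinity"
    using tendsto_mult[OF tendsto_const[of 8] tendsto_power[OF tendsto_inverse_0, of 2]] by simp
  show "\<forall>\<^sub>F x::real in at_infinity. exp (- (x\<^sup>2 / 8)) \<le> 8 * (inverse x)\<^sup>2"
    unfolding eventually_at_infinity by (rule exI[of _ 1]) (auto intro!: exp_eighth_le)
qed (auto intro: always_eventually)

lemma integrable_exp_eighth: "integrable lborel (\<lambda>x::real. exp (- (x\<^sup>2 / 8)))"
proof -
  have "integrable lborel (\<lambda>x. norm (exp (- complex_of_real (1/8 * x\<^sup>2) + 0 * of_real x)))"
    using gaussian_integral[of "1/8" 0] by (intro integrable_norm) (simp add: has_bochner_integral_iff)
  thus ?thesis by (simp add: norm_exp_eq_Re)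
qed

text \<open>Half of the remaining Gaussian decay absorbs the linear factor that each derivative of a
  coherent state brings.\<close>

lemma linear_exp_quarter_le:
  fixes x :: real
  assumes "a \<ge> 0" "b \<ge> 0"
  shows "(a + b * \<bar>x\<bar>) * exp (- (x\<^sup>2 / 4)) \<le> (a + 2 * b) * exp (- (x\<^sup>2 / 8))"
proof -
  have 1: "1 + x\<^sup>2 / 8 \<le> exp (x\<^sup>2 / 8)" by (rule exp_ge_add_one_self)
  have "0 \<le> (\<bar>x\<bar> - 2)\<^sup>2" by simp
  hence "\<bar>x\<bar> \<le> 2 * (1 + x\<^sup>2 / 8)" by (simp add: power2_diff)
  also have "\<dots> \<le> 2 * exp (x\<^sup>2 / 8)" using 1 by (rule mult_left_mono) simp
  finally have 2: "\<bar>x\<bar> \<le> 2 * exp (x\<^sup>2 / 8)" .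
  have "1 \<le> exp (x\<^sup>2 / 8)" by simp
  hence "a * 1 + b * \<bar>x\<bar> \<le> a * exp (x\<^sup>2 / 8) + b * (2 * exp (x\<^sup>2 / 8))"
    using assms 2 by (intro add_mono mult_left_mono) auto
  hence "a + b * \<bar>x\<bar> \<le> (a + 2 * b) * exp (x\<^sup>2 / 8)" by (simp add: algebra_simps)
  hence "(a + b * \<bar>x\<bar>) * exp (- (x\<^sup>2 / 4)) \<le> (a + 2 * b) * exp (x\<^sup>2 / 8) * exp (- (x\<^sup>2 / 4))"
    by (intro mult_right_mono) auto
  also have "\<dots> = (a + 2 * b) * exp (- (x\<^sup>2 / 8))" by (simp add: mult.assoc flip: exp_add)
  finally show ?thesis .
qed

text \<open>Difference quotients along sequences are the form in which dominated convergence can be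
  applied.\<close>

lemma has_vector_derivative_iff_quotient:
  fixes f :: "real \<Rightarrow> 'a::real_normed_vector"
  shows "(f has_vector_derivative v) (at t) \<longleftrightarrow> ((\<lambda>y. (f y - f t) /\<^sub>R (y - t)) \<longlongrightarrow> v) (at t)"
proof -
  have "((\<lambda>y. (f y - f t) /\<^sub>R (y - t)) \<longlongrightarrow> v) (at t) \<longleftrightarrow> ((\<lambda>y. norm ((f y - f t) /\<^sub>R (y - t) - v)) \<longlongrightarrow> 0) (at t)"
    unfolding tendsto_norm_zero_iff LIM_zero_iff ..
  also have "\<dots> \<longleftrightarrow> ((\<lambda>y. norm ((f y - f t) - (y - t) *\<^sub>R v) / norm (y - t)) \<longlongrightarrow> 0) (at t)"
  proof (rule filterlim_cong[OF refl refl])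
    have "norm ((f y - f t) /\<^sub>R (y - t) - v) = norm ((f y - f t) - (y - t) *\<^sub>R v) / norm (y - t)" if "y \<noteq> t" for y
    proof -
      have "(f y - f t) /\<^sub>R (y - t) - v = ((f y - f t) - (y - t) *\<^sub>R v) /\<^sub>R (y - t)"
        using that by (simp add: scaleR_diff_right)
      thus ?thesis by (simp only: norm_scaleR) (simp add: divide_inverse mult.commute)
    qed
    thus "\<forall>\<^sub>F y in at t. norm ((f y - f t) /\<^sub>R (y - t) - v) = norm ((f y - f t) - (y - t) *\<^sub>R v) / norm (y - t)"
      by (auto simp: eventually_at_filter)
  qed
  also have "\<dots> \<longleftrightarrow> (f has_vector_derivative v) (at t)"
    unfolding has_vector_derivative_def has_derivative_iff_norm
    by (auto intro: bounded_linear_scaleR_left)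
  finally show ?thesis ..
qed

text \<open>By the mean value inequality \<open>w\<close> dominates the difference quotients as well
  as the derivative, so dominated convergence applies along every sequence tending to
  \<open>t\<close>.\<close>

lemma has_vector_derivative_integral:
  fixes f f' :: "real \<Rightarrow> real \<Rightarrow> complex"
  assumes der: "\<And>s x. ((\<lambda>s. f s x) has_vector_derivative f' s x) (at s)"
    and i: "\<And>s. integrable lborel (f s)"
    and w: "integrable lborel w" "\<And>s x. norm (f' s x) \<le> w x"
    and m: "f' t \<in> borel_measurable lborel"
  shows "((\<lambda>s. LINT x|lborel. f s x) has_vector_derivative (LINT x|lborel. f' t x)) (at t)"
proof -
  have mi: "f s \<in> borel_measurable lborel" for s using i by auto
  have quot: "((\<lambda>y. (f y x - f t x) /\<^sub>R (y - t)) \<longlongrightarrow> f' t x) (at t)" for x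
    using der[of x t] by (simp only: has_vector_derivative_iff_quotient)
  have "((\<lambda>y. ((LINT x|lborel. f y x) - (LINT x|lborel. f t x)) /\<^sub>R (y - t)) \<longlongrightarrow> (LINT x|lborel. f' t x)) (at t)"
    unfolding tendsto_at_iff_sequentially
  proof (intro allI impI)
    fix X assume X: "\<forall>i. X i \<in> UNIV - {t}" "X \<longlonglongrightarrow> t"
    have "(\<lambda>n. LINT x|lborel. (f (X n) x - f t x) /\<^sub>R (X n - t)) \<longlonglongrightarrow> (LINT x|lborel. f' t x)"
    proof (rule integral_dominated_convergence[where w=w])
      show "AE x in lborel. (\<lambda>n. (f (X n) x - f t x) /\<^sub>R (X n - t)) \<longlonglongrightarrow> f' t x"
        using quot X unfolding tendsto_at_iff_sequentially by (auto simp: o_def)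
      fix n
      show "AE x in lborel. norm ((f (X n) x - f t x) /\<^sub>R (X n - t)) \<le> w x"
      proof (rule AE_I2)
        fix x
        have "norm (f (X n) x - f t x) \<le> w x * norm (X n - t)"
        proof (rule differentiable_bound[of UNIV "\<lambda>s. f s x" "\<lambda>s h. h *\<^sub>R f' s x"])
          show "((\<lambda>s. f s x) has_derivative (\<lambda>h. h *\<^sub>R f' s x)) (at s within UNIV)" for s
            using der by (simp add: has_vector_derivative_def)
          show "onorm (\<lambda>h. h *\<^sub>R f' s x) \<le> w x" for s
            using w(2)[of s x] by (simp add: onorm_scaleR_left bounded_linear_ident onorm_id)
        qed auto
        moreover have "X n \<noteq> t" using X by auto
        moreover have "norm ((f (X n) x - f t x) /\<^sub>R (X n - t)) = norm (f (X n) x - f t x) / norm (X n - t)"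
          by (simp only: norm_scaleR real_norm_def abs_inverse divide_inverse mult.commute)
        ultimately show "norm ((f (X n) x - f t x) /\<^sub>R (X n - t)) \<le> w x"
          by (simp add: pos_divide_le_eq)
      qed
    qed (use m mi w in auto)
    thus "((\<lambda>y. ((LINT x|lborel. f y x) - (LINT x|lborel. f t x)) /\<^sub>R (y - t)) \<circ> X) \<longlonglongrightarrow> (LINT x|lborel. f' t x)"
      using i by (simp add: o_def)
  qed
  thus ?thesis by (simp only: has_vector_derivative_iff_quotient)
qed

section \<open>The evolution equation on coherent states\<close>

lemma coh_flow_has_vector_derivative_time:
  "((\<lambda>s. coh_flow z s x) has_vector_derivative
     \<i> * ((1 + 2 * (cis (2 * s) * z) * of_real x - (cis (2 * s) * z)\<^sup>2) * coh_flow z s x)) (at s)"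
proof -
  \<comment> \<open>Time is made complex so that the exponent becomes holomorphic and the complex
    chain rule applies; the result is then restricted to real times.\<close>
  define E where "E w = exp (2 * \<i> * w)" for w
  have e: "(E has_field_derivative 2 * \<i> * E w) (at w)" for w
    unfolding E_def by (auto intro!: derivative_eq_intros)
  have p: "((\<lambda>w. \<i> * w + (- of_real (x\<^sup>2 / 2) + E w * z * of_real x - (E w * z)\<^sup>2 / 4)) has_field_derivative
     \<i> * (1 + 2 * (E w * z) * of_real x - (E w * z)\<^sup>2)) (at w)" for w
    by (auto intro!: derivative_eq_intros e simp: field_simps power2_eq_square)
  have "((\<lambda>r. exp (\<i> * of_real r + (- of_real (x\<^sup>2 / 2) + E (of_real r) * z * of_real x - (E (of_real r) * z)\<^sup>2 / 4)))
     has_vector_derivative exp (\<i> * of_real s + (- of_real (x\<^sup>2 / 2) + E (of_real s) * z * of_real x - (E (of_real s) * z)\<^sup>2 / 4))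
       * (\<i> * (1 + 2 * (E (of_real s) * z) * of_real x - (E (of_real s) * z)\<^sup>2))) (at s)"
    by (rule has_vector_derivative_real_field[OF DERIV_chain2[OF DERIV_exp p]])
  moreover have E: "E (of_real r) = cis (2 * r)" for r by (simp add: E_def cis_conv_exp mult_ac)
  moreover have "exp (\<i> * of_real r + (- of_real (x\<^sup>2 / 2) + cis (2 * r) * z * of_real x - (cis (2 * r) * z)\<^sup>2 / 4)) = coh_flow z r x" for r
    unfolding coh_flow_def coh_def exp_add[symmetric] cis_conv_exp[of r] ..
  ultimately show ?thesis by (simp only: mult.assoc mult.commute[of "coh_flow z s x"])
qed

lemma coh_has_vector_derivative:
  "(coh z has_vector_derivative (z - of_real x) * coh z x) (at x)"
proof -
  have "((\<lambda>w. exp (- (w\<^sup>2 / 2) + z * w - z\<^sup>2 / 4)) has_field_derivative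
     (z - of_real x) * exp (- ((of_real x)\<^sup>2 / 2) + z * of_real x - z\<^sup>2 / 4)) (at (of_real x))"
    by (auto intro!: derivative_eq_intros simp: algebra_simps)
  from has_vector_derivative_real_field[OF this] show ?thesis
    by (simp add: coh_def[abs_def])
qed

lemma coh_flow_has_vector_derivative:
  "(coh_flow z t has_vector_derivative (cis (2 * t) * z - of_real x) * coh_flow z t x) (at x)"
  unfolding coh_flow_def[abs_def]
  using has_vector_derivative_mult_right[OF coh_has_vector_derivative[of "cis (2 * t) * z" x], of "cis t"]
  by (simp add: mult_ac)

lemma coh_flow_measurable [measurable]: "coh_flow z t \<in> borel_measurable borel"
  by (rule L2_measurable[OF L2_coh_flow])

text \<open>A coherent state turns \<open>H\<close> into multiplication by 1 + 2 \<zeta> x -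
  \<zeta>^2. The same factor, times i, comes out of the time derivative in
  \<open>coh_flow_has_vector_derivative_time\<close>, and this agreement is the weak evolution
  equation.\<close>

lemma inner_coh_flow_H:
  fixes z :: complex and t :: real
  assumes \<psi>: "schwartz \<psi>"
  defines "\<zeta> \<equiv> \<lambda>t. cis (2 * t) * z"
  shows "inner_L2 (coh_flow z t) (H \<psi>)
    = (LINT x|lborel. (1 + 2 * \<zeta> t * of_real x - (\<zeta> t)\<^sup>2) * coh_flow z t x * cnj (\<psi> x))" (is "?L = ?R")
    and "integrable lborel (\<lambda>x. (1 + 2 * \<zeta> t * of_real x - (\<zeta> t)\<^sup>2) * coh_flow z t x * cnj (\<psi> x))"
proof -
  let ?U = "coh_flow z t"
  let ?K = "exp (2 * (norm z)\<^sup>2)"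
  obtain C0 where C0: "C0 > 0" "\<And>x. norm (\<psi> x) \<le> C0" using schwartz_bounded[OF \<psi>] by blast
  obtain C1 where C1: "C1 > 0" "\<And>x. norm (D \<psi> x) \<le> C1" using schwartz_bounded[OF schwartz_D[OF \<psi>]] by blast
  note [measurable] = schwartz_measurable[OF \<psi>] schwartz_measurable[OF schwartz_D[OF \<psi>]]
    schwartz_measurable[OF schwartz_D[OF schwartz_D[OF \<psi>]]]
  \<comment> \<open>Green's formula: with U the coherent state, F is U' cnj \<psi> - U cnj \<psi>',
    and its derivative \<open>F'\<close> is U cnj (H \<psi>) - (H U) cnj \<psi>.\<close>
  define F where "F x = (\<zeta> t - of_real x) * ?U x * cnj (\<psi> x) - ?U x * cnj (D \<psi> x)" for x
  define F' where "F' x = ?U x * cnj (H \<psi> x) - (1 + 2 * \<zeta> t * of_real x - (\<zeta> t)\<^sup>2) * ?U x * cnj (\<psi> x)" for x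
  have nz: "norm (\<zeta> t) = norm z" by (simp add: \<zeta>_def norm_mult)
  have b: "norm ((1 + 2 * \<zeta> t * of_real x - (\<zeta> t)\<^sup>2) * ?U x * cnj (\<psi> x))
      \<le> C0 * ?K * ((1 + (norm z)\<^sup>2 + 2 * (2 * norm z)) * exp (- (x\<^sup>2 / 8)))" for x
  proof -
    have "norm (1 + 2 * \<zeta> t * of_real x - (\<zeta> t)\<^sup>2) \<le> norm (1 + 2 * \<zeta> t * of_real x) + norm ((\<zeta> t)\<^sup>2)" by (rule norm_triangle_ineq4)
    also have "\<dots> \<le> norm (1::complex) + norm (2 * \<zeta> t * of_real x) + norm ((\<zeta> t)\<^sup>2)" by (intro add_mono norm_triangle_ineq order_refl)
    also have "\<dots> = (1 + (norm z)\<^sup>2) + 2 * norm z * \<bar>x\<bar>" by (simp add: norm_mult norm_power nz)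
    finally have "norm ((1 + 2 * \<zeta> t * of_real x - (\<zeta> t)\<^sup>2) * ?U x * cnj (\<psi> x))
      \<le> ((1 + (norm z)\<^sup>2) + 2 * norm z * \<bar>x\<bar>) * (?K * exp (- (x\<^sup>2 / 4))) * C0"
      unfolding norm_mult by (intro mult_mono norm_coh_flow_le) (auto simp: C0)
    also have "\<dots> = C0 * ?K * (((1 + (norm z)\<^sup>2) + 2 * norm z * \<bar>x\<bar>) * exp (- (x\<^sup>2 / 4)))" by (simp only: ac_simps)
    also have "\<dots> \<le> C0 * ?K * ((1 + (norm z)\<^sup>2 + 2 * (2 * norm z)) * exp (- (x\<^sup>2 / 8)))"
      using C0 by (intro mult_left_mono linear_exp_quarter_le) auto
    finally show ?thesis .
  qed
  show int: "integrable lborel (\<lambda>x. (1 + 2 * \<zeta> t * of_real x - (\<zeta> t)\<^sup>2) * ?U x * cnj (\<psi> x))"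
  proof (rule Bochner_Integration.integrable_bound)
    show "integrable lborel (\<lambda>x. C0 * ?K * ((1 + (norm z)\<^sup>2 + 2 * (2 * norm z)) * exp (- (x\<^sup>2 / 8))))"
      by (intro integrable_mult_right integrable_exp_eighth)
    show "AE x in lborel. norm ((1 + 2 * \<zeta> t * of_real x - (\<zeta> t)\<^sup>2) * ?U x * cnj (\<psi> x))
      \<le> norm (C0 * ?K * ((1 + (norm z)\<^sup>2 + 2 * (2 * norm z)) * exp (- (x\<^sup>2 / 8))))"
      by (intro AE_I2 order_trans[OF b]) simp
  qed measurable
  have iH: "integrable lborel (\<lambda>x. ?U x * cnj (H \<psi> x))"
    by (intro L2_inner_integrable L2_coh_flow schwartz_L2_H \<psi>)
  have "norm (F x) \<le> ?K * (((C0 * norm z + C1) + 2 * C0) * exp (- (x\<^sup>2 / 8)))" for x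
  proof -
    have "norm (F x) \<le> norm ((\<zeta> t - of_real x) * ?U x * cnj (\<psi> x)) + norm (?U x * cnj (D \<psi> x))"
      unfolding F_def by (rule norm_triangle_ineq4)
    also have "\<dots> \<le> (norm z + \<bar>x\<bar>) * (?K * exp (- (x\<^sup>2 / 4))) * C0 + (?K * exp (- (x\<^sup>2 / 4))) * C1"
    proof -
      have "norm (\<zeta> t - of_real x) \<le> norm z + \<bar>x\<bar>" using norm_triangle_ineq4[of "\<zeta> t" "of_real x"] by (simp add: nz)
      thus ?thesis unfolding norm_mult by (intro add_mono mult_mono norm_coh_flow_le) (auto simp: C0 C1)
    qed
    also have "\<dots> = ?K * (((C0 * norm z + C1) + C0 * \<bar>x\<bar>) * exp (- (x\<^sup>2 / 4)))" by (simp add: algebra_simps)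
    also have "\<dots> \<le> ?K * (((C0 * norm z + C1) + 2 * C0) * exp (- (x\<^sup>2 / 8)))"
      using C0(1) C1(1) by (intro mult_left_mono linear_exp_quarter_le) auto
    finally show ?thesis .
  qed
  note Fle = this
  have T: "((\<lambda>x::real. ?K * (((C0 * norm z + C1) + 2 * C0) * exp (- (x\<^sup>2 / 8)))) \<longlongrightarrow> 0) at_infinity"
    by (intro tendsto_mult_right_zero tendsto_exp_eighth)
  have F0: "(F \<longlongrightarrow> 0) at_infinity"
    by (rule Lim_null_comparison[OF _ T]) (simp only: Fle eventually_True)
  have dU: "((\<lambda>x. ?U x) has_vector_derivative (\<zeta> t - of_real x) * ?U x) (at x)" for x
    unfolding \<zeta>_def by (rule coh_flow_has_vector_derivative)
  have d0: "((\<lambda>x. cnj (\<psi> x)) has_vector_derivative cnj (D \<psi> x)) (at x)" for x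
    by (intro has_vector_derivative_cnj schwartz_has_vector_derivative \<psi>)
  have d1: "((\<lambda>x. cnj (D \<psi> x)) has_vector_derivative cnj (D (D \<psi>) x)) (at x)" for x
    by (intro has_vector_derivative_cnj schwartz_has_vector_derivative schwartz_D \<psi>)
  have dx: "((\<lambda>x. \<zeta> t - complex_of_real x) has_vector_derivative - 1) (at x)" for x
    by (auto intro!: derivative_eq_intros)
  have "(LINT x|lborel. F' x) = 0"
  proof (rule integral_total_derivative_eq_0[where F=F])
    fix x
    show "(F has_vector_derivative F' x) (at x)"
      unfolding F_def F'_def H_def
      by (rule has_vector_derivative_eq_rhs,
          rule has_vector_derivative_diff[OF has_vector_derivative_mult[OF has_vector_derivative_mult[OF dx dU] d0] has_vector_derivative_mult[OF dU d1]])
         (simp add: algebra_simps power2_eq_square)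
    show "isCont F' x" unfolding F'_def H_def
      by (intro continuous_intros schwartz_isCont[OF \<psi>] schwartz_isCont[OF schwartz_D[OF schwartz_D[OF \<psi>]]]
        has_vector_derivative_continuous[OF dU])
  next
    show "integrable lborel F'" unfolding F'_def by (intro Bochner_Integration.integrable_diff iH int)
    show "(F \<longlongrightarrow> 0) at_top" by (rule tendsto_mono[OF at_top_le_at_infinity F0])
    show "(F \<longlongrightarrow> 0) at_bot" by (rule tendsto_mono[OF at_bot_le_at_infinity F0])
  qed
  thus "?L = ?R" unfolding F'_def inner_L2_def using iH int by simp
qed

lemma coh_flow_derivative:
  assumes \<psi>: "schwartz \<psi>"
  shows "((\<lambda>s. inner_L2 (coh_flow z s) \<psi>) has_vector_derivative \<i> * inner_L2 (coh_flow z t) (H \<psi>)) (at t)"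
proof -
  let ?f' = "\<lambda>s x. \<i> * ((1 + 2 * (cis (2 * s) * z) * of_real x - (cis (2 * s) * z)\<^sup>2) * coh_flow z s x) * cnj (\<psi> x)"
  obtain C0 where C0: "C0 > 0" "\<And>x. norm (\<psi> x) \<le> C0" using schwartz_bounded[OF \<psi>] by blast
  have [measurable]: "\<psi> \<in> borel_measurable borel" by (rule schwartz_measurable[OF \<psi>])
  let ?K = "exp (2 * (norm z)\<^sup>2)"
  have "((\<lambda>s. LINT x|lborel. coh_flow z s x * cnj (\<psi> x)) has_vector_derivative (LINT x|lborel. ?f' t x)) (at t)"
  proof (rule has_vector_derivative_integral[where w="\<lambda>x. C0 * ?K * ((1 + (norm z)\<^sup>2 + 2 * (2 * norm z)) * exp (- (x\<^sup>2 / 8)))"])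
    show "((\<lambda>s. coh_flow z s x * cnj (\<psi> x)) has_vector_derivative ?f' s x) (at s)" for s x
      by (rule has_vector_derivative_mult_left[OF coh_flow_has_vector_derivative_time])
    show "integrable lborel (\<lambda>x. coh_flow z s x * cnj (\<psi> x))" for s
      by (intro L2_inner_integrable L2_coh_flow schwartz_L2 \<psi>)
    show "integrable lborel (\<lambda>x. C0 * ?K * ((1 + (norm z)\<^sup>2 + 2 * (2 * norm z)) * exp (- (x\<^sup>2 / 8))))"
      by (intro integrable_mult_right integrable_exp_eighth)
    show "norm (?f' s x) \<le> C0 * ?K * ((1 + (norm z)\<^sup>2 + 2 * (2 * norm z)) * exp (- (x\<^sup>2 / 8)))" for s x
    proof -
      let ?\<zeta> = "cis (2 * s) * z"
      have "norm (1 + 2 * ?\<zeta> * of_real x - ?\<zeta>\<^sup>2) \<le> norm (1 + 2 * ?\<zeta> * of_real x) + norm (?\<zeta>\<^sup>2)" by (rule norm_triangle_ineq4)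
      also have "\<dots> \<le> norm (1::complex) + norm (2 * ?\<zeta> * of_real x) + norm (?\<zeta>\<^sup>2)" by (intro add_mono norm_triangle_ineq order_refl)
      also have "\<dots> = (1 + (norm z)\<^sup>2) + 2 * norm z * \<bar>x\<bar>" by (simp add: norm_mult norm_power)
      finally have "norm (?f' s x) \<le> norm \<i> * (((1 + (norm z)\<^sup>2) + 2 * norm z * \<bar>x\<bar>) * (?K * exp (- (x\<^sup>2 / 4)))) * C0"
        unfolding norm_mult[of "_ * (_ * coh_flow z s x)"] norm_mult[of \<i>] norm_mult[of _ "coh_flow z s x"]
        by (intro mult_mono norm_coh_flow_le order_refl) (auto simp: C0)
      also have "\<dots> = C0 * ?K * (((1 + (norm z)\<^sup>2) + 2 * norm z * \<bar>x\<bar>) * exp (- (x\<^sup>2 / 4)))"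
        unfolding norm_ii mult_1_left by (simp only: ac_simps)
      also have "\<dots> \<le> C0 * ?K * ((1 + (norm z)\<^sup>2 + 2 * (2 * norm z)) * exp (- (x\<^sup>2 / 8)))"
        using C0 by (intro mult_left_mono linear_exp_quarter_le) auto
      finally show ?thesis .
    qed
    show "?f' t \<in> borel_measurable lborel" by measurable
  qed
  moreover have "(LINT x|lborel. ?f' t x) = \<i> * inner_L2 (coh_flow z t) (H \<psi>)"
    unfolding inner_coh_flow_H(1)[OF \<psi>] by (simp add: mult.assoc)
  ultimately show ?thesis unfolding inner_L2_def by simp
qed

lemma wave_derivative:
  assumes "wave f U" "schwartz \<psi>"
  shows "((\<lambda>s. inner_L2 (U s) \<psi>) has_vector_derivative \<i> * inner_L2 (U t) (H \<psi>)) (at t)"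
  using assms(1)
proof (induction rule: wave.induct)
  case (wave_coh c z)
  from has_vector_derivative_mult_right[OF coh_flow_derivative[OF assms(2), of z t], of c]
  show ?case by (simp add: inner_L2_scale_left mult.left_commute)
next
  case (wave_add f U g W)
  have "inner_L2 (\<lambda>x. U s x + W s x) \<psi> = inner_L2 (U s) \<psi> + inner_L2 (W s) \<psi>" for s
    using wave_add.hyps assms(2) by (intro inner_L2_add_left wave_L2_flow schwartz_L2)
  moreover have "inner_L2 (\<lambda>x. U t x + W t x) (H \<psi>) = inner_L2 (U t) (H \<psi>) + inner_L2 (W t) (H \<psi>)"
    using wave_add.hyps assms(2) by (intro inner_L2_add_left wave_L2_flow schwartz_L2_H)
  ultimately show ?case using has_vector_derivative_add[OF wave_add.IH] by (simp add: distrib_left)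
qed

lemma wave_measurable: "wave f U \<Longrightarrow> (\<lambda>(t, x). U t x) \<in> borel_measurable (lborel \<Otimes>\<^sub>M lborel)"
proof -
  assume "wave f U"
  hence "(\<lambda>(t, x). U t x) \<in> borel_measurable borel"
    by (intro borel_measurable_continuous_onI wave_continuous)
  thus ?thesis by (simp add: lborel_prod)
qed

lemma wave_solution: "wave f U \<Longrightarrow> oscillator_solution f U"
  unfolding oscillator_solution_def
  by (auto simp: wave_measurable wave_L2_flow wave_0 intro!: wave_derivative)

text \<open>The flow of waves is isometric, so convergence of the data gives convergence of the
  flows uniformly in time. This produces a jointly measurable limit, and it makes the time
  derivatives of the pairings converge uniformly, so that the weak equation passes to the
  limit.\<close>

lemma oscillator_solution_exists:
  assumes f: "L2 f" obtains u where "oscillator_solution f u" "\<And>t. l2n (u t) = l2n f"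
proof -
  obtain v U where v: "\<And>n. wave (v n) (U n)" "tendsto_L2 v f" using waves_dense[OF f] by blast
  have Lv: "L2 (v n)" for n by (rule wave_L2[OF v(1)])
  have LU: "L2 (U n t)" for n t by (rule wave_L2_flow[OF v(1)])
  have iso: "l2n (\<lambda>x. U m t x - U n t x) = l2n (\<lambda>x. v m x - v n x)" for m n t
    by (rule wave_norm[OF wave_diff[OF v(1) v(1)]])
  have "\<exists>N. \<forall>m\<ge>N. \<forall>n\<ge>N. \<forall>t. l2n (\<lambda>x. U m t x - U n t x) \<le> e" if "e > 0" for e
  proof -
    have "(\<lambda>n. l2n (\<lambda>x. v n x - f x)) \<longlonglongrightarrow> 0" using v(2) by (simp add: tendsto_L2_iff)
    moreover have "e / 2 > 0" using that by simp
    ultimately obtain N where N: "\<And>n. n \<ge> N \<Longrightarrow> norm (l2n (\<lambda>x. v n x - f x) - 0) < e / 2"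
      using LIMSEQ_D[of _ 0 "e / 2"] by blast
    have "l2n (\<lambda>x. v m x - v n x) \<le> e" if "m \<ge> N" "n \<ge> N" for m n
      using l2n_diff_triangle[OF Lv f Lv, of m n] N[OF that(1)] N[OF that(2)] l2n_diff_commute[of f "v n"] by simp
    thus ?thesis unfolding iso by blast
  qed
  then obtain u where u: "(\<lambda>(t, x). u t x) \<in> borel_measurable (lborel \<Otimes>\<^sub>M lborel)" "\<And>t. L2 (u t)"
    "\<And>e. e > 0 \<Longrightarrow> \<exists>N. \<forall>n\<ge>N. \<forall>t. l2n (\<lambda>x. U n t x - u t x) \<le> e"
    using uniformly_Cauchy_L2_limit[of U, OF wave_measurable[OF v(1)] LU] by blast
  have lim: "tendsto_L2 (\<lambda>n. U n t) (u t)" for t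
    unfolding tendsto_L2_iff
  proof (intro conjI allI LU u LIMSEQ_I)
    fix r :: real assume "r > 0"
    then obtain N where N: "\<forall>n\<ge>N. \<forall>t. l2n (\<lambda>x. U n t x - u t x) \<le> r / 2" using u(3)[of "r / 2"] by auto
    show "\<exists>no. \<forall>n\<ge>no. norm (l2n (\<lambda>x. U n t x - u t x) - 0) < r"
    proof (intro exI[of _ N] allI impI)
      fix n assume "n \<ge> N"
      hence "l2n (\<lambda>x. U n t x - u t x) \<le> r / 2" using N by blast
      thus "norm (l2n (\<lambda>x. U n t x - u t x) - 0) < r" using \<open>r > 0\<close> by simp
    qed
  qed
  have l2lim: "(\<lambda>n. l2n (w n)) \<longlonglongrightarrow> l2n h" if "tendsto_L2 w h" for w h
  proof -
    have z: "(\<lambda>n. l2n (\<lambda>x. w n x - h x)) \<longlonglongrightarrow> 0" using that by (simp add: tendsto_L2_iff)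
    have "norm (l2n (w n) - l2n h) \<le> l2n (\<lambda>x. w n x - h x)" for n
      using l2n_diff_abs[of "w n" h] that by (auto simp: tendsto_L2_iff)
    hence "(\<lambda>n. l2n (w n) - l2n h) \<longlonglongrightarrow> 0"
      by (intro Lim_null_comparison[OF always_eventually z] allI)
    thus ?thesis by (simp add: LIM_zero_iff)
  qed
  have norm_u: "l2n (u t) = l2n f" for t
  proof (rule LIMSEQ_unique)
    show "(\<lambda>n. l2n (U n t)) \<longlonglongrightarrow> l2n (u t)" by (rule l2lim[OF lim])
    show "(\<lambda>n. l2n (U n t)) \<longlonglongrightarrow> l2n f" using l2lim[OF v(2)] by (simp add: wave_norm[OF v(1)])
  qed
  have "oscillator_solution f u" unfolding oscillator_solution_def
  proof (intro conjI allI impI u)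
    show "AE x in lborel. u 0 x = f x"
    proof (rule tendsto_L2_unique)
      show "tendsto_L2 v (u 0)" using lim[of 0] by (simp add: wave_0[OF v(1)])
    qed (rule v)
  next
    fix \<psi> :: "real \<Rightarrow> complex" and t assume \<psi>: "schwartz \<psi>"
    have LH: "L2 (H \<psi>)" and L\<psi>: "L2 \<psi>" using \<psi> by (auto intro: schwartz_L2_H schwartz_L2)
    have "\<exists>g. \<forall>s\<in>UNIV. (\<lambda>n. inner_L2 (U n s) \<psi>) \<longlonglongrightarrow> g s \<and> (g has_derivative (\<lambda>h. h *\<^sub>R (\<i> * inner_L2 (u s) (H \<psi>)))) (at s within UNIV)"
    proof (rule has_derivative_sequence[where ?x0.0=0])
      show "((\<lambda>s. inner_L2 (U n s) \<psi>) has_derivative (\<lambda>h. h *\<^sub>R (\<i> * inner_L2 (U n s) (H \<psi>)))) (at s within UNIV)" for n s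
        using wave_derivative[OF v(1) \<psi>, of n s] by (simp add: has_vector_derivative_def)
      show "(\<lambda>n. inner_L2 (U n 0) \<psi>) \<longlonglongrightarrow> inner_L2 (u 0) \<psi>" by (rule tendsto_L2_inner[OF lim L\<psi>])
      fix e :: real assume e: "e > 0"
      define e' where "e' = e / (1 + l2n (H \<psi>))"
      have e': "e' > 0" "e' * l2n (H \<psi>) \<le> e" using e l2n_nonneg[of "H \<psi>"]
        by (auto simp: e'_def field_simps add_pos_nonneg)
      obtain N where N: "\<forall>n\<ge>N. \<forall>t. l2n (\<lambda>x. U n t x - u t x) \<le> e'" using u(3)[OF e'(1)] by blast
      show "\<forall>\<^sub>F n in sequentially. \<forall>s\<in>UNIV. \<forall>h. norm (h *\<^sub>R (\<i> * inner_L2 (U n s) (H \<psi>)) - h *\<^sub>R (\<i> * inner_L2 (u s) (H \<psi>))) \<le> e * norm h"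
      proof (rule eventually_sequentiallyI[of N], intro ballI allI)
        fix n s h assume "n \<ge> N"
        have "norm (inner_L2 (U n s) (H \<psi>) - inner_L2 (u s) (H \<psi>)) \<le> l2n (\<lambda>x. U n s x - u s x) * l2n (H \<psi>)"
          using norm_inner_L2_le[OF L2_diff[OF LU u(2)] LH] inner_L2_diff_left[OF LU u(2) LH] by simp
        also have "\<dots> \<le> e' * l2n (H \<psi>)" using N \<open>n \<ge> N\<close> by (intro mult_right_mono) auto
        also have "\<dots> \<le> e" by (rule e')
        finally have "\<bar>h\<bar> * norm (\<i> * (inner_L2 (U n s) (H \<psi>) - inner_L2 (u s) (H \<psi>))) \<le> \<bar>h\<bar> * e"
          by (intro mult_left_mono) (auto simp: norm_mult)
        thus "norm (h *\<^sub>R (\<i> * inner_L2 (U n s) (H \<psi>)) - h *\<^sub>R (\<i> * inner_L2 (u s) (H \<psi>))) \<le> e * norm h"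
          by (simp add: scaleR_diff_right[symmetric] right_diff_distrib[symmetric] mult.commute)
      qed
    qed auto
    then obtain g where g: "\<And>s. (\<lambda>n. inner_L2 (U n s) \<psi>) \<longlonglongrightarrow> g s"
      "\<And>s. (g has_derivative (\<lambda>h. h *\<^sub>R (\<i> * inner_L2 (u s) (H \<psi>)))) (at s)" by auto
    have "g = (\<lambda>s. inner_L2 (u s) \<psi>)"
      using LIMSEQ_unique[OF g(1) tendsto_L2_inner[OF lim L\<psi>]] by auto
    with g(2)[of t] show "((\<lambda>s. inner_L2 (u s) \<psi>) has_vector_derivative \<i> * inner_L2 (u t) (H \<psi>)) (at t)"
      by (simp add: has_vector_derivative_def)
  qed
  thus ?thesis using that norm_u by blast
qed

text \<open>\<open>H\<close> maps a monomial Gaussian to itself and to one of degree two less, which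
  makes the system of moments triangular. For n < 2 the second coefficient is zero, so the truncated
  difference \<open>n - 2\<close> does no harm.\<close>

lemma H_monom_gauss:
  "H (poly_gauss (monom 1 n) 1) x = of_nat (2 * n + 1) * poly_gauss (monom 1 n) 1 x
     - of_nat (n * (n - 1)) * poly_gauss (monom 1 (n - 2)) 1 x"
proof -
  let ?p = "monom 1 n :: real poly"
  have "H (poly_gauss ?p (1::complex)) x = of_real ((poly ?p x + 2 * (x * poly (pderiv ?p) x) - poly (pderiv (pderiv ?p)) x) * exp (- (x\<^sup>2 / 2)))"
    unfolding H_def D_poly_gauss unfolding poly_gauss_def scaleR_conv_of_real
    by (simp add: pderiv_diff pderiv_mult pderiv_pCons algebra_simps power2_eq_square)
  also have "poly ?p x + 2 * (x * poly (pderiv ?p) x) - poly (pderiv (pderiv ?p)) x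
     = of_nat (2 * n + 1) * x ^ n - of_nat (n * (n - 1)) * x ^ (n - 2)"
  proof -
    have "n = 0 \<or> n = 1 \<or> (\<exists>m. n = Suc (Suc m))" by presburger
    thus ?thesis by (auto simp: pderiv_monom poly_monom algebra_simps)
  qed
  finally have h: "H (poly_gauss ?p 1) x
    = of_real ((of_nat (2 * n + 1) * x ^ n - of_nat (n * (n - 1)) * x ^ (n - 2)) * exp (- (x\<^sup>2 / 2)))" .
  show ?thesis unfolding h by (simp add: poly_gauss_def poly_monom scaleR_conv_of_real algebra_simps)
qed

text \<open>The moments of the difference of two solutions against \<open>x\<^sup>n e\<^sup>-\<^sup>x\<^sup>\<^sup>2\<^sup>/\<^sup>2\<close> solve a triangular
  system of linear differential equations, hence vanish.\<close>

lemma oscillator_solution_unique: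
  assumes u: "oscillator_solution f u" and v: "oscillator_solution f v"
  shows "AE x in lborel. u t x = v t x"
proof -
  let ?b = "\<lambda>n. poly_gauss (monom 1 n) (1::complex)"
  have b: "schwartz (?b n)" for n by (rule schwartz_poly_gauss)
  have Lb: "L2 (?b n)" for n by (rule schwartz_L2[OF b])
  have L: "L2 (u t)" "L2 (v t)" for t using u v by (auto simp: oscillator_solution_def)
  have d: "((\<lambda>s. inner_L2 (u s) (?b n)) has_vector_derivative \<i> * inner_L2 (u t) (H (?b n))) (at t)"
    "((\<lambda>s. inner_L2 (v s) (?b n)) has_vector_derivative \<i> * inner_L2 (v t) (H (?b n))) (at t)" for n t
    using u v b by (auto simp: oscillator_solution_def)
  have Hb: "inner_L2 w (H (?b n)) = of_nat (2 * n + 1) * inner_L2 w (?b n) - of_nat (n * (n - 1)) * inner_L2 w (?b (n - 2))"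
    if "L2 w" for w n
  proof -
    have "H (?b n) = (\<lambda>x. of_nat (2 * n + 1) * ?b n x - of_nat (n * (n - 1)) * ?b (n - 2) x)"
      by (rule ext) (rule H_monom_gauss)
    thus ?thesis using that
      by (simp only: inner_L2_diff_right L2_scale Lb inner_L2_scale_right complex_cnj_of_nat)
  qed
  define m where "m n t = inner_L2 (u t) (?b n) - inner_L2 (v t) (?b n)" for n t
  have dm: "(m n has_vector_derivative \<i> * (of_nat (2 * n + 1) * m n t - of_nat (n * (n - 1)) * m (n - 2) t)) (at t)" for n t
    unfolding m_def
    by (rule has_vector_derivative_eq_rhs[OF has_vector_derivative_diff[OF d(1)[of n t] d(2)[of n t]]])
       (simp add: Hb L right_diff_distrib)
  have "AE x in lborel. u 0 x = f x" "AE x in lborel. v 0 x = f x" using u v by (auto simp: oscillator_solution_def)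
  hence "AE x in lborel. u 0 x = v 0 x" by eventually_elim simp
  hence m0: "m n 0 = 0" for n
    unfolding m_def using inner_L2_cong_AE[of "u 0" "v 0" "?b n"] L L2_measurable L2_measurable[OF Lb] by auto
  have mz: "m n t = 0" for n t
  proof (induction n arbitrary: t rule: less_induct)
    case (less n)
    have z: "complex_of_nat (n * (n - 1)) * m (n - 2) t = 0" for t
      using less.IH[of "n - 2" t] by (cases "n < 2") (auto simp: less_2_cases_iff)
    \<comment> \<open>Integrating factor: once the lower moment is known to vanish, the equation is
      m' = i (2n + 1) m.\<close>
    define g where "g t = cis (- (real (2 * n + 1)) * t) * m n t" for t
    have c: "((\<lambda>t. cis (- (real (2 * n + 1)) * t)) has_vector_derivative - (\<i> * of_nat (2 * n + 1)) * cis (- (real (2 * n + 1)) * t)) (at t)" for t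
    proof -
      have "((\<lambda>w. exp (- (\<i> * of_nat (2 * n + 1)) * w)) has_field_derivative - (\<i> * of_nat (2 * n + 1)) * exp (- (\<i> * of_nat (2 * n + 1)) * of_real t)) (at (of_real t))"
        by (auto intro!: derivative_eq_intros)
      note hv = has_vector_derivative_real_field[OF this]
      have eq: "cis (- (real (2 * n + 1)) * r) = exp (- (\<i> * of_nat (2 * n + 1)) * of_real r)" for r
        unfolding cis_conv_exp by (rule arg_cong[where f=exp]) (simp add: algebra_simps)
      show ?thesis unfolding eq by (rule hv)
    qed
    have "(g has_vector_derivative 0) (at t)" for t
      unfolding g_def
      by (rule has_vector_derivative_eq_rhs[OF has_vector_derivative_mult[OF c dm]])
         (subst z, simp add: algebra_simps)
    then obtain k where "\<And>t. g t = k"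
      using has_vector_derivative_zero_constant[of UNIV g] by auto
    hence "g t = g 0" by simp
    hence "g t = 0" by (simp add: g_def m0)
    thus ?case by (simp add: g_def cis_neq_zero)
  qed
  have "AE x in lborel. u t x - v t x = 0"
  proof (rule moments_complete)
    show "L2 (\<lambda>x. u t x - v t x)" by (intro L2_diff L)
    fix n
    have "inner_L2 (\<lambda>x. u t x - v t x) (?b n) = 0"
      using mz[of n t] by (simp add: m_def inner_L2_diff_left L Lb)
    thus "(LINT x|lborel. (u t x - v t x) * of_real (x ^ n * exp (- (x\<^sup>2 / 2)))) = 0"
      by (simp add: inner_L2_def poly_gauss_def poly_monom scaleR_conv_of_real)
  qed
  thus ?thesis by eventually_elim simp
qed

lemma oscillator_solution_add:
  assumes u: "oscillator_solution f u" and v: "oscillator_solution g v"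
  shows "oscillator_solution (\<lambda>x. f x + g x) (\<lambda>t x. u t x + v t x)"
proof -
  have L: "L2 (u t)" "L2 (v t)" for t using u v by (auto simp: oscillator_solution_def)
  show ?thesis unfolding oscillator_solution_def
  proof (intro conjI allI impI)
    have "(\<lambda>z. (\<lambda>(t, x). u t x) z + (\<lambda>(t, x). v t x) z) \<in> borel_measurable (lborel \<Otimes>\<^sub>M lborel)"
      using u v unfolding oscillator_solution_def by (intro borel_measurable_add) blast+
    thus "(\<lambda>(t, x). u t x + v t x) \<in> borel_measurable (lborel \<Otimes>\<^sub>M lborel)" by (simp add: case_prod_beta)
    show "L2 (\<lambda>x. u t x + v t x)" for t by (intro L2_add L)
    have "AE x in lborel. u 0 x = f x" "AE x in lborel. v 0 x = g x" using u v by (auto simp: oscillator_solution_def)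
    thus "AE x in lborel. u 0 x + v 0 x = f x + g x" by eventually_elim simp
    fix \<psi> :: "real \<Rightarrow> complex" and t assume \<psi>: "schwartz \<psi>"
    have "((\<lambda>s. inner_L2 (u s) \<psi> + inner_L2 (v s) \<psi>) has_vector_derivative \<i> * inner_L2 (u t) (H \<psi>) + \<i> * inner_L2 (v t) (H \<psi>)) (at t)"
      using u v \<psi> unfolding oscillator_solution_def by (intro has_vector_derivative_add) blast+
    thus "((\<lambda>s. inner_L2 (\<lambda>x. u s x + v s x) \<psi>) has_vector_derivative \<i> * inner_L2 (\<lambda>x. u t x + v t x) (H \<psi>)) (at t)"
      by (simp add: inner_L2_add_left L schwartz_L2[OF \<psi>] schwartz_L2_H[OF \<psi>] distrib_left)
  qed
qed

section \<open>Properties of the chosen propagator\<close>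

lemma propagator_solution: assumes "L2 f" shows "oscillator_solution f (\<lambda>t. propagator t f)"
proof -
  obtain u where "oscillator_solution f u" using oscillator_solution_exists[OF assms] by blast
  from someI[of "oscillator_solution f", OF this] show ?thesis by (simp add: propagator_def)
qed

lemma propagator_L2: "L2 f \<Longrightarrow> L2 (propagator t f)"
  using propagator_solution by (auto simp: oscillator_solution_def)

lemma propagator_measurable:
  "L2 f \<Longrightarrow> (\<lambda>z. propagator (fst z) f (snd z)) \<in> borel_measurable (borel :: (real \<times> real) measure)"
  using propagator_solution[of f] unfolding oscillator_solution_def lborel_prod split_def by simp

text \<open>The choice operator may pick any solution; uniqueness identifies it almost everywhere
  with the limit of waves, whose norm is known.\<close>

lemma propagator_norm: assumes "L2 f" shows "l2n (propagator t f) = l2n f"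
proof -
  obtain u where u: "oscillator_solution f u" "\<And>t. l2n (u t) = l2n f" using oscillator_solution_exists[OF assms] by blast
  have "l2n (propagator t f) = l2n (u t)"
  proof (rule l2n_cong_AE)
    show "u t \<in> borel_measurable borel" using u by (auto simp: oscillator_solution_def L2_def)
    show "propagator t f \<in> borel_measurable borel" by (intro L2_measurable propagator_L2 assms)
  qed (rule oscillator_solution_unique[OF propagator_solution[OF assms] u(1)])
  thus ?thesis by (simp add: u)
qed

lemma propagator_add:
  assumes "L2 f" "L2 g"
  shows "AE x in lborel. propagator t (\<lambda>x. f x + g x) x = propagator t f x + propagator t g x"
  by (rule oscillator_solution_unique[OF propagator_solution[OF L2_add[OF assms]]
        oscillator_solution_add[OF propagator_solution[OF assms(1)] propagator_solution[OF assms(2)]]])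

lemma propagator_wave: "wave f U \<Longrightarrow> AE x in lborel. propagator t f x = U t x"
  by (rule oscillator_solution_unique[OF propagator_solution wave_solution]) (auto intro: wave_L2)

section \<open>Rotations about the diagonal of \<open>\<real>\<^sup>3\<close>\<close>

type_synonym r3 = "real \<times> real \<times> real"

section \<open>Tonelli and linear changes of variables\<close>

lemma nn_integral_lborel_fst:
  fixes f :: "'a::euclidean_space \<times> 'b::euclidean_space \<Rightarrow> ennreal"
  assumes [measurable]: "f \<in> borel_measurable borel"
  shows "(\<integral>\<^sup>+z. f z \<partial>lborel) = (\<integral>\<^sup>+x. \<integral>\<^sup>+y. f (x, y) \<partial>lborel \<partial>lborel)"
proof -
  have "f \<in> borel_measurable (lborel \<Otimes>\<^sub>M lborel)" by (simp add: lborel_prod)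
  from lborel.nn_integral_fst[OF this] show ?thesis by (simp add: lborel_prod)
qed

lemma nn_integral_lborel_snd:
  fixes f :: "'a::euclidean_space \<times> 'b::euclidean_space \<Rightarrow> ennreal"
  assumes [measurable]: "f \<in> borel_measurable borel"
  shows "(\<integral>\<^sup>+z. f z \<partial>lborel) = (\<integral>\<^sup>+y. \<integral>\<^sup>+x. f (x, y) \<partial>lborel \<partial>lborel)"
proof -
  have "f \<in> borel_measurable (lborel \<Otimes>\<^sub>M lborel)" by (simp add: lborel_prod)
  from lborel_pair.nn_integral_snd[OF this] show ?thesis by (simp add: lborel_prod)
qed

lemma measurable_Pair_borel [measurable]:
  fixes x :: "'a::euclidean_space" and y :: "'b::euclidean_space"
  shows "(\<lambda>y. (x, y)) \<in> borel_measurable (borel :: 'b measure)"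
    and "(\<lambda>x. (x, y)) \<in> borel_measurable (borel :: 'a measure)"
  by (auto intro!: borel_measurable_continuous_onI continuous_intros)

lemma fst_snd_borel [measurable]:
  "fst \<in> borel_measurable (borel :: ('a::euclidean_space \<times> 'b::euclidean_space) measure)"
  "snd \<in> borel_measurable (borel :: ('a::euclidean_space \<times> 'b::euclidean_space) measure)"
  by (intro borel_measurable_continuous_onI continuous_intros)+

lemma nn_integral_param_measurable:
  fixes f :: "'a::euclidean_space \<times> 'b::euclidean_space \<Rightarrow> ennreal"
  assumes "f \<in> borel_measurable borel"
  shows "(\<lambda>x. \<integral>\<^sup>+y. f (x, y) \<partial>lborel) \<in> borel_measurable borel"
proof -
  have "sets (borel \<Otimes>\<^sub>M lborel) = sets (borel :: ('a \<times> 'b) measure)"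
    by (subst borel_prod[symmetric]) (intro sets_pair_measure_cong, auto)
  hence "f \<in> borel_measurable (borel \<Otimes>\<^sub>M lborel)"
    using assms measurable_cong_sets by blast
  thus ?thesis by (intro lborel.borel_measurable_nn_integral) simp
qed

lemma nn_integral_shear_fst:
  fixes f :: "real \<times> 'b::euclidean_space \<Rightarrow> ennreal"
  assumes f[measurable]: "f \<in> borel_measurable borel" and g[measurable]: "g \<in> borel_measurable borel" and a: "a \<noteq> 0"
  shows "(\<integral>\<^sup>+z. f z \<partial>lborel) = ennreal \<bar>a\<bar> * (\<integral>\<^sup>+z. f (g (snd z) + a * fst z, snd z) \<partial>lborel)"
proof -
  have [measurable]: "(\<lambda>z. f (g (snd z) + a * fst z, snd z)) \<in> borel_measurable borel"
    unfolding borel_prod[symmetric] using f unfolding borel_prod[symmetric] by measurable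
  have [measurable]: "(\<lambda>x. f (x, y)) \<in> borel_measurable borel" for y by measurable
  have "(\<integral>\<^sup>+z. f z \<partial>lborel) = (\<integral>\<^sup>+y. \<integral>\<^sup>+x. f (x, y) \<partial>lborel \<partial>lborel)" by (rule nn_integral_lborel_snd) measurable
  also have "\<dots> = (\<integral>\<^sup>+y. \<bar>a\<bar> * (\<integral>\<^sup>+x. f (g y + a * x, y) \<partial>lborel) \<partial>lborel)"
    by (intro nn_integral_cong nn_integral_real_affine a) measurable
  also have "\<dots> = ennreal \<bar>a\<bar> * (\<integral>\<^sup>+y. (\<integral>\<^sup>+x. f (g y + a * x, y) \<partial>lborel) \<partial>lborel)"
  proof (rule nn_integral_cmult)
    have "(\<lambda>(y, x). f (g y + a * x, y)) \<in> borel_measurable (borel \<Otimes>\<^sub>M lborel)"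
      using f unfolding borel_prod[symmetric] by measurable
    thus "(\<lambda>y. \<integral>\<^sup>+x. f (g y + a * x, y) \<partial>lborel) \<in> borel_measurable lborel"
      using lborel.borel_measurable_nn_integral[of "\<lambda>y x. f (g y + a * x, y)" borel] by simp
  qed
  also have "(\<integral>\<^sup>+y. (\<integral>\<^sup>+x. f (g y + a * x, y) \<partial>lborel) \<partial>lborel) = (\<integral>\<^sup>+z. f (g (snd z) + a * fst z, snd z) \<partial>lborel)"
    by (subst nn_integral_lborel_snd) simp_all
  finally show ?thesis .
qed

lemma nn_integral_shear_snd:
  fixes f :: "'b::euclidean_space \<times> real \<Rightarrow> ennreal"
  assumes f[measurable]: "f \<in> borel_measurable borel" and g[measurable]: "g \<in> borel_measurable borel" and a: "a \<noteq> 0"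
  shows "(\<integral>\<^sup>+z. f z \<partial>lborel) = ennreal \<bar>a\<bar> * (\<integral>\<^sup>+z. f (fst z, g (fst z) + a * snd z) \<partial>lborel)"
proof -
  have [measurable]: "(\<lambda>z. f (fst z, g (fst z) + a * snd z)) \<in> borel_measurable borel"
    unfolding borel_prod[symmetric] using f unfolding borel_prod[symmetric] by measurable
  have [measurable]: "(\<lambda>x. f (y, x)) \<in> borel_measurable borel" for y by measurable
  have "(\<integral>\<^sup>+z. f z \<partial>lborel) = (\<integral>\<^sup>+y. \<integral>\<^sup>+x. f (y, x) \<partial>lborel \<partial>lborel)" by (rule nn_integral_lborel_fst) measurable
  also have "\<dots> = (\<integral>\<^sup>+y. \<bar>a\<bar> * (\<integral>\<^sup>+x. f (y, g y + a * x) \<partial>lborel) \<partial>lborel)"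
    by (intro nn_integral_cong nn_integral_real_affine a) measurable
  also have "\<dots> = ennreal \<bar>a\<bar> * (\<integral>\<^sup>+y. (\<integral>\<^sup>+x. f (y, g y + a * x) \<partial>lborel) \<partial>lborel)"
  proof (rule nn_integral_cmult)
    have "(\<lambda>(y, x). f (y, g y + a * x)) \<in> borel_measurable (borel \<Otimes>\<^sub>M lborel)"
      using f unfolding borel_prod[symmetric] by measurable
    thus "(\<lambda>y. \<integral>\<^sup>+x. f (y, g y + a * x) \<partial>lborel) \<in> borel_measurable lborel"
      using lborel.borel_measurable_nn_integral[of "\<lambda>y x. f (y, g y + a * x)" borel] by simp
  qed
  also have "(\<integral>\<^sup>+y. (\<integral>\<^sup>+x. f (y, g y + a * x) \<partial>lborel) \<partial>lborel) = (\<integral>\<^sup>+z. f (fst z, g (fst z) + a * snd z) \<partial>lborel)"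
    by (subst nn_integral_lborel_fst) simp_all
  finally show ?thesis .
qed

text \<open>Each shear changes a single coordinate and has Jacobian |a|. Three of them composed give
  the rotations about the diagonal as well as the passage to cylindrical coordinates.\<close>

definition shear1 :: "real \<Rightarrow> real \<Rightarrow> real \<Rightarrow> r3 \<Rightarrow> r3" where
  "shear1 a b c = (\<lambda>(x, y, z). (a * x + b * y + c * z, y, z))"
definition shear2 :: "real \<Rightarrow> real \<Rightarrow> real \<Rightarrow> r3 \<Rightarrow> r3" where
  "shear2 a b c = (\<lambda>(x, y, z). (x, a * y + b * x + c * z, z))"
definition shear3 :: "real \<Rightarrow> real \<Rightarrow> real \<Rightarrow> r3 \<Rightarrow> r3" where
  "shear3 a b c = (\<lambda>(x, y, z). (x, y, a * z + b * x + c * y))"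

lemma shear_measurable [measurable]:
  "shear1 a b c \<in> borel_measurable borel" "shear2 a b c \<in> borel_measurable borel" "shear3 a b c \<in> borel_measurable borel"
  unfolding shear1_def shear2_def shear3_def split_def
  by (intro borel_measurable_continuous_onI continuous_intros)+

lemma nn_integral_shear1:
  assumes f[measurable]: "f \<in> borel_measurable borel" and a: "a \<noteq> 0"
  shows "(\<integral>\<^sup>+z. f z \<partial>lborel) = ennreal \<bar>a\<bar> * (\<integral>\<^sup>+z. f (shear1 a b c z) \<partial>lborel)"
proof -
  have "(\<lambda>p::real \<times> real. b * fst p + c * snd p) \<in> borel_measurable borel"
    by (intro borel_measurable_continuous_onI continuous_intros)
  from nn_integral_shear_fst[OF f this a] show ?thesis
    by (simp add: shear1_def split_def ac_simps)
qed

lemma nn_integral_shear2: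
  assumes f[measurable]: "f \<in> borel_measurable borel" and a: "a \<noteq> 0"
  shows "(\<integral>\<^sup>+z. f z \<partial>lborel) = ennreal \<bar>a\<bar> * (\<integral>\<^sup>+z. f (shear2 a b c z) \<partial>lborel)"
proof -
  have m: "(\<lambda>p. f (x, p)) \<in> borel_measurable borel" for x by measurable
  have "(\<integral>\<^sup>+z. f z \<partial>lborel) = (\<integral>\<^sup>+x. \<integral>\<^sup>+p. f (x, p) \<partial>lborel \<partial>lborel)" by (rule nn_integral_lborel_fst) measurable
  also have "\<dots> = (\<integral>\<^sup>+x. \<bar>a\<bar> * (\<integral>\<^sup>+p. f (shear2 a b c (x, p)) \<partial>lborel) \<partial>lborel)"
  proof (rule nn_integral_cong)
    fix x :: real
    have "(\<lambda>z. b * x + c * z) \<in> borel_measurable borel" by measurable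
    from nn_integral_shear_fst[OF m this a, of x]
    show "(\<integral>\<^sup>+p. f (x, p) \<partial>lborel) = ennreal \<bar>a\<bar> * (\<integral>\<^sup>+p. f (shear2 a b c (x, p)) \<partial>lborel)"
      by (simp add: shear2_def split_def ac_simps)
  qed
  also have "\<dots> = ennreal \<bar>a\<bar> * (\<integral>\<^sup>+x. (\<integral>\<^sup>+p. f (shear2 a b c (x, p)) \<partial>lborel) \<partial>lborel)"
  proof (rule nn_integral_cmult)
    show "(\<lambda>x. \<integral>\<^sup>+p. f (shear2 a b c (x, p)) \<partial>lborel) \<in> borel_measurable lborel"
      using nn_integral_param_measurable[of "\<lambda>z. f (shear2 a b c z)"] by simp
  qed
  also have "(\<integral>\<^sup>+x. (\<integral>\<^sup>+p. f (shear2 a b c (x, p)) \<partial>lborel) \<partial>lborel) = (\<integral>\<^sup>+z. f (shear2 a b c z) \<partial>lborel)"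
    by (rule nn_integral_lborel_fst[symmetric]) measurable
  finally show ?thesis .
qed

lemma nn_integral_shear3:
  assumes f[measurable]: "f \<in> borel_measurable borel" and a: "a \<noteq> 0"
  shows "(\<integral>\<^sup>+z. f z \<partial>lborel) = ennreal \<bar>a\<bar> * (\<integral>\<^sup>+z. f (shear3 a b c z) \<partial>lborel)"
proof -
  have m: "(\<lambda>p. f (x, p)) \<in> borel_measurable borel" for x by measurable
  have "(\<integral>\<^sup>+z. f z \<partial>lborel) = (\<integral>\<^sup>+x. \<integral>\<^sup>+p. f (x, p) \<partial>lborel \<partial>lborel)" by (rule nn_integral_lborel_fst) measurable
  also have "\<dots> = (\<integral>\<^sup>+x. \<bar>a\<bar> * (\<integral>\<^sup>+p. f (shear3 a b c (x, p)) \<partial>lborel) \<partial>lborel)"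
  proof (rule nn_integral_cong)
    fix x :: real
    have "(\<lambda>y. b * x + c * y) \<in> borel_measurable borel" by measurable
    from nn_integral_shear_snd[OF m this a, of x]
    show "(\<integral>\<^sup>+p. f (x, p) \<partial>lborel) = ennreal \<bar>a\<bar> * (\<integral>\<^sup>+p. f (shear3 a b c (x, p)) \<partial>lborel)"
      by (simp add: shear3_def split_def ac_simps)
  qed
  also have "\<dots> = ennreal \<bar>a\<bar> * (\<integral>\<^sup>+x. (\<integral>\<^sup>+p. f (shear3 a b c (x, p)) \<partial>lborel) \<partial>lborel)"
  proof (rule nn_integral_cmult)
    show "(\<lambda>x. \<integral>\<^sup>+p. f (shear3 a b c (x, p)) \<partial>lborel) \<in> borel_measurable lborel"
      using nn_integral_param_measurable[of "\<lambda>z. f (shear3 a b c z)"] by simp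
  qed
  also have "(\<integral>\<^sup>+x. (\<integral>\<^sup>+p. f (shear3 a b c (x, p)) \<partial>lborel) \<partial>lborel) = (\<integral>\<^sup>+z. f (shear3 a b c z) \<partial>lborel)"
    by (rule nn_integral_lborel_fst[symmetric]) measurable
  finally show ?thesis .
qed

lemma nn_integral_shears:
  assumes f[measurable]: "f \<in> borel_measurable borel" and a: "a1 \<noteq> 0" "a2 \<noteq> 0" "a3 \<noteq> 0"
  shows "(\<integral>\<^sup>+z. f z \<partial>lborel)
    = ennreal (\<bar>a1\<bar> * \<bar>a2\<bar> * \<bar>a3\<bar>) * (\<integral>\<^sup>+z. f (shear3 a3 b3 c3 (shear2 a2 b2 c2 (shear1 a1 b1 c1 z))) \<partial>lborel)"
proof -
  have "(\<integral>\<^sup>+z. f z \<partial>lborel) = ennreal \<bar>a3\<bar> * (\<integral>\<^sup>+z. f (shear3 a3 b3 c3 z) \<partial>lborel)"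
    by (rule nn_integral_shear3[OF f a(3)])
  also have "(\<integral>\<^sup>+z. f (shear3 a3 b3 c3 z) \<partial>lborel) = ennreal \<bar>a2\<bar> * (\<integral>\<^sup>+z. f (shear3 a3 b3 c3 (shear2 a2 b2 c2 z)) \<partial>lborel)"
    by (rule nn_integral_shear2[OF _ a(2)]) measurable
  also have "(\<integral>\<^sup>+z. f (shear3 a3 b3 c3 (shear2 a2 b2 c2 z)) \<partial>lborel)
     = ennreal \<bar>a1\<bar> * (\<integral>\<^sup>+z. f (shear3 a3 b3 c3 (shear2 a2 b2 c2 (shear1 a1 b1 c1 z))) \<partial>lborel)"
    by (rule nn_integral_shear1[OF _ a(1)]) measurable
  finally show ?thesis by (simp add: ennreal_mult mult.assoc mult.left_commute)
qed

text \<open>\<open>Rot \<theta>\<close> is the rotation by \<open>\<theta>\<close> about the axis \<open>(1, 1, 1)\<close>, a circulant matrix.\<close>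

definition RA :: "real \<Rightarrow> real" where "RA \<theta> = (1 + 2 * cos \<theta>) / 3"
definition RB :: "real \<Rightarrow> real" where "RB \<theta> = (1 - cos \<theta>) / 3 - sin \<theta> / sqrt 3"
definition RC :: "real \<Rightarrow> real" where "RC \<theta> = (1 - cos \<theta>) / 3 + sin \<theta> / sqrt 3"

definition Rot :: "real \<Rightarrow> r3 \<Rightarrow> r3" where
  "Rot \<theta> = (\<lambda>(x, y, z). (RA \<theta> * x + RB \<theta> * y + RC \<theta> * z, RC \<theta> * x + RA \<theta> * y + RB \<theta> * z,
      RB \<theta> * x + RC \<theta> * y + RA \<theta> * z))"

lemma R_sum: "RA \<theta> + RB \<theta> + RC \<theta> = 1"
  by (simp add: RA_def RB_def RC_def add_divide_distrib diff_divide_distrib)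

text \<open>Together with \<open>R_sum\<close> this yields both orthogonality relations in
  \<open>R_squares\<close>.\<close>

lemma RBC: "RB \<theta> * RC \<theta> = (RA \<theta>)\<^sup>2 - RA \<theta>"
proof -
  have "RB \<theta> * RC \<theta> = ((1 - cos \<theta>) / 3)\<^sup>2 - (sin \<theta>)\<^sup>2 / 3"
    by (simp add: RB_def RC_def algebra_simps power2_eq_square)
  also have "\<dots> = ((1 - cos \<theta>) / 3)\<^sup>2 - (1 - (cos \<theta>)\<^sup>2) / 3" by (simp add: sin_squared_eq)
  also have "\<dots> = (RA \<theta>)\<^sup>2 - RA \<theta>"
    by (simp add: RA_def field_simps power2_eq_square)
  finally show ?thesis .
qed

lemma R_squares: "(RA \<theta>)\<^sup>2 + (RB \<theta>)\<^sup>2 + (RC \<theta>)\<^sup>2 = 1"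
  "RA \<theta> * RB \<theta> + RB \<theta> * RC \<theta> + RC \<theta> * RA \<theta> = 0"
proof -
  have b: "RB \<theta> + RC \<theta> = 1 - RA \<theta>" using R_sum[of \<theta>] by simp
  have "RA \<theta> * RB \<theta> + RB \<theta> * RC \<theta> + RC \<theta> * RA \<theta> = RA \<theta> * (RB \<theta> + RC \<theta>) + RB \<theta> * RC \<theta>"
    by (simp add: algebra_simps)
  thus 1: "RA \<theta> * RB \<theta> + RB \<theta> * RC \<theta> + RC \<theta> * RA \<theta> = 0"
    unfolding b RBC by (simp add: algebra_simps power2_eq_square)
  have "(RA \<theta>)\<^sup>2 + (RB \<theta>)\<^sup>2 + (RC \<theta>)\<^sup>2 = (RA \<theta> + RB \<theta> + RC \<theta>)\<^sup>2
     - 2 * (RA \<theta> * RB \<theta> + RB \<theta> * RC \<theta> + RC \<theta> * RA \<theta>)"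
    by (simp add: power2_eq_square algebra_simps)
  thus "(RA \<theta>)\<^sup>2 + (RB \<theta>)\<^sup>2 + (RC \<theta>)\<^sup>2 = 1" unfolding 1 R_sum by simp
qed

text \<open>A triangular factorization with pivots \<open>RA \<theta>\<close>, 1 and
  \<open>1 / RA \<theta>\<close>. Their product is one, whence the invariance of Lebesgue measure;
  division by the first pivot is what excludes \<open>RA \<theta> = 0\<close>.\<close>

lemma Rot_shears:
  assumes A: "RA \<theta> \<noteq> 0"
  shows "Rot \<theta> w = shear3 (1 / RA \<theta>) (- (RC \<theta> / RA \<theta>)) (- (RB \<theta> / RA \<theta>))
     (shear2 1 (RC \<theta> / RA \<theta>) (- (RC \<theta> / RA \<theta>)) (shear1 (RA \<theta>) (RB \<theta>) (RC \<theta>) w))"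
proof -
  define a b c where "a = RA \<theta>" and "b = RB \<theta>" and "c = RC \<theta>"
  have s: "a + b + c = 1" and bc: "b * c = a\<^sup>2 - a" and q: "a\<^sup>2 + b\<^sup>2 + c\<^sup>2 = 1" and o: "a * b + b * c + c * a = 0"
    unfolding a_def b_def c_def by (rule R_sum, rule RBC, rule R_squares(1), rule R_squares(2))
  have a: "a \<noteq> 0" using A by (simp add: a_def)
  have "c * (a + b + c) = c" unfolding s by simp
  hence cc: "c\<^sup>2 = c + a * b" using o by (simp add: power2_eq_square algebra_simps)
  have xy: "a * c + b * c = - (a * b)" "b * c + a * b = - (a * c)" using o by (simp_all add: algebra_simps)
  have zz: "c\<^sup>2 + b\<^sup>2 = 1 - a\<^sup>2" using q by simp
  obtain x y z where w: "w = (x, y, z)" by (cases w) auto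
  define X where "X = a * x + b * y + c * z"
  define Y where "Y = y + (c / a) * X - (c / a) * z"
  have Y: "Y = c * x + a * y + b * z"
  proof -
    have "a * Y = a * y + c * (a * x + b * y + c * z) - c * z"
      unfolding Y_def X_def using a by (simp add: field_simps)
    also have "\<dots> = a * (c * x) + (a + b * c) * y + (c\<^sup>2 - c) * z" by (simp add: algebra_simps power2_eq_square)
    also have "\<dots> = a * (c * x + a * y + b * z)" unfolding bc cc by (simp add: algebra_simps power2_eq_square)
    finally show ?thesis using a by simp
  qed
  have Z: "(1 / a) * z - (c / a) * X - (b / a) * Y = b * x + c * y + a * z"
  proof -
    have "a * ((1 / a) * z - (c / a) * X - (b / a) * Y) = z - c * X - b * Y"
      using a by (simp add: field_simps)
    also have "\<dots> = z - (a * c + b * c) * x - (b * c + a * b) * y - (c\<^sup>2 + b\<^sup>2) * z"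
      unfolding X_def Y by (simp add: algebra_simps power2_eq_square)
    also have "\<dots> = a * (b * x + c * y + a * z)"
      unfolding xy zz by (simp add: algebra_simps power2_eq_square)
    finally show ?thesis using a by simp
  qed
  have "shear1 a b c w = (X, y, z)" by (simp add: shear1_def w X_def)
  moreover have "shear2 1 (c / a) (- (c / a)) (X, y, z) = (X, Y, z)" by (simp add: shear2_def Y_def)
  moreover have "shear3 (1 / a) (- (c / a)) (- (b / a)) (X, Y, z) = (X, Y, b * x + c * y + a * z)"
    by (simp add: shear3_def Z[symmetric])
  ultimately have "shear3 (1 / a) (- (c / a)) (- (b / a)) (shear2 1 (c / a) (- (c / a)) (shear1 a b c w))
    = (a * x + b * y + c * z, c * x + a * y + b * z, b * x + c * y + a * z)"
    by (simp only: X_def Y)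
  thus ?thesis by (simp add: w Rot_def a_def b_def c_def)
qed

lemma nn_integral_Rot:
  assumes f[measurable]: "f \<in> borel_measurable borel" and A: "RA \<theta> \<noteq> 0"
  shows "(\<integral>\<^sup>+w. f (Rot \<theta> w) \<partial>lborel) = (\<integral>\<^sup>+w. f w \<partial>lborel)"
  using nn_integral_shears[OF f A, of 1 "1 / RA \<theta>" "- (RC \<theta> / RA \<theta>)" "- (RB \<theta> / RA \<theta>)" "RC \<theta> / RA \<theta>" "- (RC \<theta> / RA \<theta>)" "RB \<theta>" "RC \<theta>"] A
  unfolding Rot_shears[OF A, symmetric] by (simp add: abs_divide)

lemma continuous_Rot: "continuous_on UNIV (\<lambda>z. Rot (fst z) (snd z))"
  unfolding Rot_def RA_def RB_def RC_def split_def by (intro continuous_intros) auto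

lemma Rot_measurable [measurable]: "Rot \<theta> \<in> borel_measurable borel"
  unfolding Rot_def split_def by (intro borel_measurable_continuous_onI continuous_intros)

lemma Rot_measurable_pair: "(\<lambda>z. Rot (fst z) (snd z)) \<in> borel_measurable borel"
  by (intro borel_measurable_continuous_onI continuous_Rot)

lemma distr_Rot:
  assumes "RA \<theta> \<noteq> 0" shows "distr lborel borel (Rot \<theta>) = lborel"
proof (rule measure_eqI)
  fix A assume A: "A \<in> sets (distr lborel borel (Rot \<theta>))"
  hence [measurable]: "A \<in> sets borel" by simp
  have "emeasure (distr lborel borel (Rot \<theta>)) A = (\<integral>\<^sup>+w. indicator A w \<partial>distr lborel borel (Rot \<theta>))"
    using A by simp
  also have "\<dots> = (\<integral>\<^sup>+w. indicator A (Rot \<theta> w) \<partial>lborel)" by (rule nn_integral_distr) auto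
  also have "\<dots> = (\<integral>\<^sup>+w. indicator A w \<partial>lborel)" by (rule nn_integral_Rot[OF _ assms]) auto
  finally show "emeasure (distr lborel borel (Rot \<theta>)) A = emeasure lborel A" by simp
qed simp

text \<open>The excluded angles are 2 pi/3 and -2 pi/3, at which the rotation permutes the
  coordinates cyclically. Two angles are negligible because every use integrates over
  \<theta>.\<close>

lemma AE_RA_nonzero: "AE \<theta> in lborel. \<theta> \<in> {-pi..pi} \<longrightarrow> RA \<theta> \<noteq> 0"
proof -
  have "\<theta> = 2 * pi / 3 \<or> \<theta> = - (2 * pi / 3)" if "\<theta> \<in> {-pi..pi}" "RA \<theta> = 0" for \<theta>
  proof -
    have c: "cos \<bar>\<theta>\<bar> = - (1 / 2)" using that(2) by (simp add: RA_def)
    have "cos (2 * pi / 3) = - (1/2)"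
      using cos_minus_pi[of "pi / 3"] cos_60 by (simp add: field_simps)
    hence "\<bar>\<theta>\<bar> = 2 * pi / 3"
      using that c by (intro cos_inj_pi[of "\<bar>\<theta>\<bar>" "2 * pi / 3"]) auto
    thus ?thesis by linarith
  qed
  moreover have "AE \<theta> in lborel. \<theta> \<noteq> 2 * pi / 3" "AE \<theta> in lborel. \<theta> \<noteq> - (2 * pi / 3)" by (rule AE_lborel_singleton)+
  ultimately show ?thesis by (auto elim!: eventually_elim2)
qed

text \<open>Cylindrical coordinates about the diagonal: the height is \<open>hgt\<close> and the squared radius \<open>rad\<close>,
  scaled so that the point with coordinates \<open>(a, p, q)\<close> has \<open>rad = p\<^sup>2 + q\<^sup>2\<close>.\<close>

definition cart :: "real \<Rightarrow> real \<Rightarrow> real \<Rightarrow> r3" where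
  "cart a p q = (a + q + sqrt 3 * p, a + q - sqrt 3 * p, a - 2 * q)"
definition hgt :: "r3 \<Rightarrow> real" where "hgt = (\<lambda>(x, y, z). (x + y + z) / 3)"
definition rad :: "r3 \<Rightarrow> real" where "rad = (\<lambda>(x, y, z). (x\<^sup>2 + y\<^sup>2 + z\<^sup>2 - 3 * ((x + y + z) / 3)\<^sup>2) / 6)"

lemma hgt_cart: "hgt (cart a p q) = a" by (simp add: hgt_def cart_def)

lemma rad_cart: "rad (cart a p q) = p\<^sup>2 + q\<^sup>2"
proof -
  have "(a + q + sqrt 3 * p)\<^sup>2 + (a + q - sqrt 3 * p)\<^sup>2 = 2 * (a + q)\<^sup>2 + 2 * (sqrt 3 * p)\<^sup>2"
    by (simp add: power2_eq_square algebra_simps)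
  hence "(a + q + sqrt 3 * p)\<^sup>2 + (a + q - sqrt 3 * p)\<^sup>2 = 2 * (a + q)\<^sup>2 + 6 * p\<^sup>2" by (simp add: power_mult_distrib)
  thus ?thesis by (simp add: rad_def cart_def) (simp add: power2_eq_square algebra_simps)
qed

lemma cart_surj:
  obtains p q where "w = cart (hgt w) p q"
proof -
  obtain x y z where w: "w = (x, y, z)" by (cases w) auto
  have "w = cart (hgt w) ((x - y) / (2 * sqrt 3)) ((x + y - 2 * z) / 6)"
    by (simp add: w cart_def hgt_def field_simps)
  thus ?thesis by (rule that)
qed

lemma Rot_cart: "Rot \<theta> (cart a p q) = cart a (p * cos \<theta> - q * sin \<theta>) (q * cos \<theta> + p * sin \<theta>)"
proof -
  have s3: "sqrt 3 * sqrt 3 = (3::real)" by simp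
  define r where "r = sqrt (3::real)"
  have r: "r * r = 3" "r \<noteq> 0" by (auto simp: r_def)
  have d: "sin \<theta> / r = r * sin \<theta> / 3" using r by (simp add: field_simps)
  show ?thesis
    unfolding Rot_def cart_def RA_def RB_def RC_def r_def[symmetric] d
    using r(1) by (simp add: field_simps)
qed

lemma hgt_Rot: "hgt (Rot \<theta> w) = hgt w"
proof -
  obtain p q where w: "w = cart (hgt w) p q" by (rule cart_surj)
  show ?thesis by (subst (1) w) (simp add: Rot_cart hgt_cart)
qed

lemma rad_Rot: "rad (Rot \<theta> w) = rad w"
proof -
  obtain p q where w: "w = cart (hgt w) p q" by (rule cart_surj)
  have "(p * c - q * s)\<^sup>2 + (q * c + p * s)\<^sup>2 = (p\<^sup>2 + q\<^sup>2) * (c\<^sup>2 + s\<^sup>2)" for c s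
    by (simp add: power2_eq_square algebra_simps)
  from this[of "cos \<theta>" "sin \<theta>"] have "rad (Rot \<theta> (cart (hgt w) p q)) = rad (cart (hgt w) p q)" by (simp add: Rot_cart rad_cart)
  thus ?thesis using w by simp
qed

lemma rad_nonneg: "rad w \<ge> 0"
proof -
  obtain p q where w: "w = cart (hgt w) p q" by (rule cart_surj)
  show ?thesis by (subst w) (simp add: rad_cart)
qed

lemma hgt_rad_measurable [measurable]: "hgt \<in> borel_measurable borel" "rad \<in> borel_measurable borel"
  unfolding hgt_def rad_def split_def by (intro borel_measurable_continuous_onI continuous_intros; simp)+

text \<open>The Jacobian is the product of the pivots 1, 2 sqrt 3 and 3 of a factorization into
  shears.\<close>

lemma nn_integral_cart:
  assumes f[measurable]: "f \<in> borel_measurable borel"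
  shows "(\<integral>\<^sup>+w. f w \<partial>lborel) = ennreal (6 * sqrt 3) * (\<integral>\<^sup>+z. f (cart (fst z) (fst (snd z)) (snd (snd z))) \<partial>lborel)"
proof -
  have "shear3 (-3) (1/2) (1/2) (shear2 (- (2 * sqrt 3)) 1 0 (shear1 1 (sqrt 3) 1 z)) = cart (fst z) (fst (snd z)) (snd (snd z))" for z
    by (simp add: shear1_def shear2_def shear3_def cart_def split_def field_simps)
  thus ?thesis
    using nn_integral_shears[OF f, of 1 "- (2 * sqrt 3)" "-3" "1/2" "1/2" 1 0 "sqrt 3" 1] by (simp add: abs_mult)
qed

text \<open>A disc of squared radius r has area pi r, so the squared norm maps planar Lebesgue
  measure to pi times Lebesgue measure on the half-line.\<close>

lemma nn_integral_radial:
  assumes f[measurable]: "f \<in> borel_measurable borel"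
  shows "(\<integral>\<^sup>+z. f ((fst z)\<^sup>2 + (snd z)\<^sup>2) \<partial>(lborel :: (real \<times> real) measure)) = ennreal pi * (\<integral>\<^sup>+s. f s * indicator {0..} s \<partial>lborel)"
proof -
  \<comment> \<open>With the minus sign the half-lines {x<..} pull back to discs. They then have
    finite measure, as \<open>measure_eqI_lessThan\<close> demands.\<close>
  let ?N1 = "distr (lborel :: (real \<times> real) measure) borel (\<lambda>z. - (norm z)\<^sup>2)"
  let ?N2 = "density lborel (\<lambda>s. ennreal pi * indicator {..0} (s::real))"
  have nsq: "(norm z)\<^sup>2 = (fst z)\<^sup>2 + (snd z)\<^sup>2" for z :: "real \<times> real"
    by (cases z) (simp add: norm_Pair)
  have e1: "emeasure ?N1 {x<..} = ennreal pi * ennreal (max 0 (- x))" for x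
  proof -
    have "emeasure ?N1 {x<..} = emeasure lborel {z :: real \<times> real. (norm z)\<^sup>2 < - x}"
      by (subst emeasure_distr) (auto intro!: arg_cong[where f="emeasure lborel"])
    also have "\<dots> = ennreal pi * ennreal (max 0 (- x))"
    proof (cases "x < 0")
      case True
      have lt: "(norm z)\<^sup>2 < - x \<longleftrightarrow> norm z < sqrt (- x)" for z :: "real \<times> real"
        using real_sqrt_less_iff[of "(norm z)\<^sup>2" "- x"] by simp
      have "{z :: real \<times> real. (norm z)\<^sup>2 < - x} = ball 0 (sqrt (- x))"
        by (simp only: set_eq_iff mem_Collect_eq mem_ball_0 lt) simp
      also have "emeasure lborel (ball (0::real \<times> real) (sqrt (- x))) = ennreal (unit_ball_vol (real 2) * sqrt (- x) ^ 2)"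
        using emeasure_ball[of "sqrt (- x)" "0::real \<times> real"] True by simp
      finally show ?thesis using True ennreal_mult'[of pi "- x"] by (simp add: unit_ball_vol_2)
    next
      case False
      have "- x \<le> (norm z)\<^sup>2" for z :: "real \<times> real" using False zero_le_power2[of "norm z"] by linarith
      hence e: "{z :: real \<times> real. (norm z)\<^sup>2 < - x} = {}" by (simp add: not_less)
      show ?thesis unfolding e using False by simp
    qed
    finally show ?thesis .
  qed
  have e2: "emeasure ?N2 {x<..} = ennreal pi * ennreal (max 0 (- x))" for x
  proof -
    have "emeasure ?N2 {x<..} = (\<integral>\<^sup>+s. ennreal pi * indicator {x<..0} s \<partial>lborel)"
      by (subst emeasure_density) (auto intro!: nn_integral_cong split: split_indicator)
    also have "\<dots> = ennreal pi * emeasure lborel {x<..0}" by (rule nn_integral_cmult_indicator) simp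
    also have "emeasure lborel {x<..0} = ennreal (max 0 (- x))" by (cases "x \<le> 0") auto
    finally show ?thesis .
  qed
  have N: "?N1 = ?N2"
    by (rule measure_eqI_lessThan) (auto simp: e1 e2 ennreal_mult_less_top)
  have "(\<integral>\<^sup>+z. f ((fst z)\<^sup>2 + (snd z)\<^sup>2) \<partial>(lborel :: (real \<times> real) measure)) = (\<integral>\<^sup>+u. f (- u) \<partial>?N1)"
    by (subst nn_integral_distr) (simp_all add: nsq add.commute)
  also have "\<dots> = (\<integral>\<^sup>+u. ennreal pi * indicator {..0} u * f (- u) \<partial>lborel)"
    unfolding N by (subst nn_integral_density) auto
  also have "\<dots> = ennreal \<bar>-1\<bar> * (\<integral>\<^sup>+s. ennreal pi * indicator {..0} (0 + (-1) * s) * f (- (0 + (-1) * s)) \<partial>lborel)"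
    by (rule nn_integral_real_affine) auto
  also have "\<dots> = (\<integral>\<^sup>+s. ennreal pi * (f s * indicator {0..} s) \<partial>lborel)"
    by (simp, intro nn_integral_cong) (auto split: split_indicator simp: mult_ac)
  also have "\<dots> = ennreal pi * (\<integral>\<^sup>+s. f s * indicator {0..} s \<partial>lborel)" by (rule nn_integral_cmult) auto
  finally show ?thesis .
qed

lemma nn_integral_hgt_rad:
  fixes f :: "real \<times> real \<Rightarrow> ennreal"
  assumes f[measurable]: "f \<in> borel_measurable borel"
  shows "(\<integral>\<^sup>+w. f (hgt w, rad w) \<partial>lborel) = (\<integral>\<^sup>+z. ennreal (6 * sqrt 3 * pi) * indicator {0..} (snd z) * f z \<partial>lborel)"
proof -
  have hr: "(\<lambda>w. (hgt w, rad w)) \<in> borel_measurable borel"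
    by (intro borel_measurable_Pair hgt_rad_measurable)
  have m1: "(\<lambda>z::r3. f (fst z, (fst (snd z))\<^sup>2 + (snd (snd z))\<^sup>2)) \<in> borel_measurable borel"
    by (rule measurable_compose[OF _ f], rule borel_measurable_continuous_onI) (intro continuous_intros)
  have m2: "(\<lambda>s. f (a, s)) \<in> borel_measurable borel" for a by measurable
  have m3: "(\<lambda>z::real\<times>real. f z * indicator {0..} (snd z)) \<in> borel_measurable borel"
    using f unfolding borel_prod[symmetric] by measurable
  have "(\<integral>\<^sup>+w. f (hgt w, rad w) \<partial>lborel)
     = ennreal (6 * sqrt 3) * (\<integral>\<^sup>+z. f (fst z, (fst (snd z))\<^sup>2 + (snd (snd z))\<^sup>2) \<partial>(lborel :: r3 measure))"
    using nn_integral_cart[OF measurable_compose[OF hr f]] by (simp add: hgt_cart rad_cart)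
  also have "(\<integral>\<^sup>+z. f (fst z, (fst (snd z))\<^sup>2 + (snd (snd z))\<^sup>2) \<partial>(lborel :: r3 measure))
     = (\<integral>\<^sup>+a. (\<integral>\<^sup>+z. f (a, (fst z)\<^sup>2 + (snd z)\<^sup>2) \<partial>lborel) \<partial>lborel)"
    using nn_integral_lborel_fst[OF m1] by simp
  also have "\<dots> = (\<integral>\<^sup>+a. ennreal pi * (\<integral>\<^sup>+s. f (a, s) * indicator {0..} s \<partial>lborel) \<partial>lborel)"
    by (intro nn_integral_cong nn_integral_radial m2)
  also have "\<dots> = ennreal pi * (\<integral>\<^sup>+a. (\<integral>\<^sup>+s. f (a, s) * indicator {0..} s \<partial>lborel) \<partial>lborel)"
  proof (rule nn_integral_cmult)
    show "(\<lambda>a. \<integral>\<^sup>+s. f (a, s) * indicator {0..} s \<partial>lborel) \<in> borel_measurable lborel"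
      using nn_integral_param_measurable[OF m3] by simp
  qed
  also have "(\<integral>\<^sup>+a. (\<integral>\<^sup>+s. f (a, s) * indicator {0..} s \<partial>lborel) \<partial>lborel) = (\<integral>\<^sup>+z. f z * indicator {0..} (snd z) \<partial>lborel)"
    using nn_integral_lborel_fst[OF m3] by simp
  also have "ennreal (6 * sqrt 3) * (ennreal pi * (\<integral>\<^sup>+z. f z * indicator {0..} (snd z) \<partial>lborel))
     = (\<integral>\<^sup>+z. ennreal (6 * sqrt 3 * pi) * (f z * indicator {0..} (snd z)) \<partial>lborel)"
    using m3 by (subst nn_integral_cmult) (simp_all add: ennreal_mult mult.assoc)
  finally show ?thesis by (simp add: mult_ac)
qed

lemma distr_hgt_rad:
  "distr lborel borel (\<lambda>w. (hgt w, rad w)) = density lborel (\<lambda>z. ennreal (6 * sqrt 3 * pi * indicator {0..} (snd z)))"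
proof (rule measure_eqI)
  have hr[measurable]: "(\<lambda>w. (hgt w, rad w)) \<in> borel_measurable borel"
    by (intro borel_measurable_Pair hgt_rad_measurable)
  have [measurable]: "(\<lambda>z::real\<times>real. ennreal (6 * sqrt 3 * pi * indicator {0..} (snd z))) \<in> borel_measurable borel"
    by measurable
  fix A assume A: "A \<in> sets (distr lborel borel (\<lambda>w. (hgt w, rad w)))"
  hence [measurable]: "A \<in> sets borel" by simp
  have "emeasure (distr lborel borel (\<lambda>w. (hgt w, rad w))) A = (\<integral>\<^sup>+w. indicator A w \<partial>distr lborel borel (\<lambda>w. (hgt w, rad w)))"
    using A by simp
  also have "\<dots> = (\<integral>\<^sup>+w. indicator A (hgt w, rad w) \<partial>lborel)" by (rule nn_integral_distr) auto
  also have "\<dots> = (\<integral>\<^sup>+z. ennreal (6 * sqrt 3 * pi) * indicator {0..} (snd z) * indicator A z \<partial>lborel)"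
    by (rule nn_integral_hgt_rad) auto
  also have "\<dots> = (\<integral>\<^sup>+z. ennreal (6 * sqrt 3 * pi * indicator {0..} (snd z)) * indicator A z \<partial>lborel)"
    by (intro nn_integral_cong) (auto split: split_indicator)
  also have "\<dots> = emeasure (density lborel (\<lambda>z. ennreal (6 * sqrt 3 * pi * indicator {0..} (snd z)))) A"
    by (rule emeasure_density[symmetric]) auto
  finally show "emeasure (distr lborel borel (\<lambda>w. (hgt w, rad w))) A = emeasure (density lborel (\<lambda>z. ennreal (6 * sqrt 3 * pi * indicator {0..} (snd z)))) A" .
qed simp

section \<open>Integration against the two Dirac deltas\<close>

text \<open>An angular integral over the circle through \<open>w\<close> about the diagonal, of
  total weight 2 pi and not normalized.\<close>

definition circ :: "(r3 \<Rightarrow> complex) \<Rightarrow> r3 \<Rightarrow> complex" where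
  "circ \<Phi> w = (LINT \<theta>|lborel. indicator {-pi..pi} \<theta> *\<^sub>R \<Phi> (Rot \<theta> w))"

text \<open>The same angular integral in terms of height and squared radius. For s < 0 the odd
  extension of \<open>sqrt\<close> keeps it continuous on the whole plane; the indicator of {0..}
  discards these values when it is integrated.\<close>

definition circ_prof :: "(r3 \<Rightarrow> complex) \<Rightarrow> real \<Rightarrow> real \<Rightarrow> complex" where
  "circ_prof \<Phi> a s = (LINT \<theta>|lborel. indicator {-pi..pi} \<theta> *\<^sub>R \<Phi> (cart a (sqrt s * cos \<theta>) (sqrt s * sin \<theta>)))"

lemma integrable_indicator_continuous:
  fixes f :: "real \<Rightarrow> complex"
  assumes "continuous_on UNIV f" shows "integrable lborel (\<lambda>x. indicator {a..b} x *\<^sub>R f x)"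
  by (rule borel_integrable_compact) (auto intro: continuous_on_subset[OF assms])

text \<open>The part of the shifted interval beyond pi is moved back by one period and fills the gap
  at the other end.\<close>

lemma periodic_integral_shift:
  fixes f :: "real \<Rightarrow> complex"
  assumes f: "continuous_on UNIV f" and per: "\<And>x. f (x + 2 * pi) = f x" and \<phi>: "0 \<le> \<phi>" "\<phi> < 2 * pi"
  shows "(LINT x|lborel. indicator {-pi..pi} x *\<^sub>R f (\<phi> + x)) = (LINT x|lborel. indicator {-pi..pi} x *\<^sub>R f x)"
proof -
  note int = integrable_indicator_continuous[OF f]
  have [measurable]: "f \<in> borel_measurable borel" by (rule borel_measurable_continuous_onI[OF f])
  have "(LINT x|lborel. indicator {-pi..pi} x *\<^sub>R f (\<phi> + x)) = (LINT x|lborel. indicator {-pi+\<phi>..pi+\<phi>} (\<phi> + 1 * x) *\<^sub>R f (\<phi> + 1 * x))"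
    by (intro Bochner_Integration.integral_cong) (auto split: split_indicator)
  also have "\<dots> = (LINT x|lborel. indicator {-pi+\<phi>..pi+\<phi>} x *\<^sub>R f x)"
    using lborel_integral_real_affine[of 1 "\<lambda>x. indicator {-pi+\<phi>..pi+\<phi>} x *\<^sub>R f x" \<phi>] by simp
  also have "\<dots> = (LINT x|lborel. indicator {-pi+\<phi>..pi} x *\<^sub>R f x + indicator {pi..pi+\<phi>} x *\<^sub>R f x)"
  proof (rule integral_cong_AE)
    show "AE x in lborel. indicator {-pi+\<phi>..pi+\<phi>} x *\<^sub>R f x = indicator {-pi+\<phi>..pi} x *\<^sub>R f x + indicator {pi..pi+\<phi>} x *\<^sub>R f x"
      using AE_lborel_singleton[of pi] by eventually_elim (use \<phi> in \<open>auto split: split_indicator\<close>)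
  qed auto
  also have "\<dots> = (LINT x|lborel. indicator {-pi+\<phi>..pi} x *\<^sub>R f x) + (LINT x|lborel. indicator {pi..pi+\<phi>} x *\<^sub>R f x)"
    by (intro Bochner_Integration.integral_add int)
  also have "(LINT x|lborel. indicator {pi..pi+\<phi>} x *\<^sub>R f x) = (LINT x|lborel. indicator {pi..pi+\<phi>} (2 * pi + 1 * x) *\<^sub>R f (2 * pi + 1 * x))"
    using lborel_integral_real_affine[of 1 "\<lambda>x. indicator {pi..pi+\<phi>} x *\<^sub>R f x" "2 * pi"] by simp
  also have "\<dots> = (LINT x|lborel. indicator {-pi..-pi+\<phi>} x *\<^sub>R f x)"
    by (intro Bochner_Integration.integral_cong) (auto split: split_indicator simp: add.commute[of "2 * pi"] per)
  also have "(LINT x|lborel. indicator {-pi+\<phi>..pi} x *\<^sub>R f x) + \<dots>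
    = (LINT x|lborel. indicator {-pi+\<phi>..pi} x *\<^sub>R f x + indicator {-pi..-pi+\<phi>} x *\<^sub>R f x)"
    by (intro Bochner_Integration.integral_add[symmetric] int)
  also have "\<dots> = (LINT x|lborel. indicator {-pi..pi} x *\<^sub>R f x)"
  proof (rule integral_cong_AE)
    show "AE x in lborel. indicator {-pi+\<phi>..pi} x *\<^sub>R f x + indicator {-pi..-pi+\<phi>} x *\<^sub>R f x = indicator {-pi..pi} x *\<^sub>R f x"
      using AE_lborel_singleton[of "-pi+\<phi>"] by eventually_elim (use \<phi> in \<open>auto split: split_indicator\<close>)
  qed auto
  finally show ?thesis .
qed

lemma continuous_cart: "continuous_on A (\<lambda>x. cart (f x) (g x) (h x))"
  if "continuous_on A f" "continuous_on A g" "continuous_on A h" for f g h :: "'a::topological_space \<Rightarrow> real"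
  unfolding cart_def by (intro continuous_intros that)

text \<open>In polar coordinates around the diagonal \<open>w\<close> has some angle \<phi>,
  arbitrary if \<open>w\<close> lies on the axis, and rotation adds \<theta> to it. Periodicity then
  removes \<phi>.\<close>

lemma circ_eq_prof:
  assumes \<Phi>: "continuous_on UNIV \<Phi>"
  shows "circ \<Phi> w = circ_prof \<Phi> (hgt w) (rad w)"
proof -
  obtain p q where w: "w = cart (hgt w) p q" by (rule cart_surj)
  have s: "rad w = p\<^sup>2 + q\<^sup>2" by (subst w) (rule rad_cart)
  have "\<exists>\<phi>. 0 \<le> \<phi> \<and> \<phi> < 2 * pi \<and> p = sqrt (rad w) * cos \<phi> \<and> q = sqrt (rad w) * sin \<phi>"
  proof (cases "rad w = 0")
    case True
    hence "p = 0 \<and> q = 0" using s sum_power2_eq_zero_iff[of p q] by simp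
    thus ?thesis using True by (intro exI[of _ 0]) simp
  next
    case False
    hence pos: "rad w > 0" using rad_nonneg[of w] by simp
    have "(p / sqrt (rad w))\<^sup>2 + (q / sqrt (rad w))\<^sup>2 = (p\<^sup>2 + q\<^sup>2) / rad w"
      using pos by (simp add: power_divide add_divide_distrib)
    also have "\<dots> = 1" unfolding s[symmetric] using pos by simp
    finally obtain \<phi> where "0 \<le> \<phi>" "\<phi> < 2 * pi" "p / sqrt (rad w) = cos \<phi>" "q / sqrt (rad w) = sin \<phi>"
      by (rule sincos_total_2pi)
    thus ?thesis using pos by (intro exI[of _ \<phi>]) (auto simp: field_simps)
  qed
  then obtain \<phi> where \<phi>: "0 \<le> \<phi>" "\<phi> < 2 * pi" "p = sqrt (rad w) * cos \<phi>" "q = sqrt (rad w) * sin \<phi>" by blast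
  define f where "f \<theta> = \<Phi> (cart (hgt w) (sqrt (rad w) * cos \<theta>) (sqrt (rad w) * sin \<theta>))" for \<theta>
  have "Rot \<theta> w = cart (hgt w) (sqrt (rad w) * cos (\<phi> + \<theta>)) (sqrt (rad w) * sin (\<phi> + \<theta>))" for \<theta>
  proof -
    have "Rot \<theta> w = cart (hgt w) (p * cos \<theta> - q * sin \<theta>) (q * cos \<theta> + p * sin \<theta>)"
      by (subst w) (rule Rot_cart)
    thus ?thesis by (simp add: \<phi>(3,4) cos_add sin_add algebra_simps)
  qed
  hence "circ \<Phi> w = (LINT \<theta>|lborel. indicator {-pi..pi} \<theta> *\<^sub>R f (\<phi> + \<theta>))" by (simp add: circ_def f_def)
  also have "\<dots> = (LINT \<theta>|lborel. indicator {-pi..pi} \<theta> *\<^sub>R f \<theta>)"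
  proof (rule periodic_integral_shift[OF _ _ \<phi>(1,2)])
    show "continuous_on UNIV f" unfolding f_def
      by (intro continuous_on_compose2[OF \<Phi>] continuous_cart continuous_intros) auto
    show "f (x + 2 * pi) = f x" for x by (simp add: f_def)
  qed
  also have "\<dots> = circ_prof \<Phi> (hgt w) (rad w)" by (simp add: circ_prof_def f_def)
  finally show ?thesis .
qed

lemma norm_indicator_integral_le:
  fixes f :: "real \<Rightarrow> complex"
  assumes "\<And>x. norm (f x) \<le> C"
  shows "norm (LINT \<theta>|lborel. indicator {-pi..pi} \<theta> *\<^sub>R f \<theta>) \<le> 2 * pi * C"
proof -
  have C: "C \<ge> 0" using order_trans[OF norm_ge_zero assms] .
  have i: "integrable lborel (\<lambda>\<theta>. C * indicator {-pi..pi} \<theta>)"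
    by (intro integrable_mult_right integrable_real_indicator) (auto simp: emeasure_lborel_Icc_eq)
  have "norm (LINT \<theta>|lborel. indicator {-pi..pi} \<theta> *\<^sub>R f \<theta>) \<le> (LINT \<theta>|lborel. norm (indicator {-pi..pi} \<theta> *\<^sub>R f \<theta>))"
    by (rule integral_norm_bound)
  also have "\<dots> \<le> (LINT \<theta>|lborel. C * indicator {-pi..pi} \<theta>)"
  proof (rule integral_mono')
    show "norm (indicator {-pi..pi} \<theta> *\<^sub>R f \<theta>) \<le> C * indicator {-pi..pi} \<theta>" for \<theta>
      using assms[of \<theta>] C by (auto split: split_indicator)
  qed (use i C in auto)
  also have "\<dots> = 2 * pi * C" by simp
  finally show ?thesis .
qed

lemma circ_prof_bound: "(\<And>w. norm (\<Phi> w) \<le> C) \<Longrightarrow> norm (circ_prof \<Phi> a s) \<le> 2 * pi * C"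
  unfolding circ_prof_def by (rule norm_indicator_integral_le)

lemma circ_prof_tendsto:
  assumes \<Phi>: "continuous_on UNIV \<Phi>" and b: "\<And>w. norm (\<Phi> w) \<le> C" and an: "an \<longlonglongrightarrow> a" and sn: "sn \<longlonglongrightarrow> s"
  shows "(\<lambda>n. circ_prof \<Phi> (an n) (sn n)) \<longlonglongrightarrow> circ_prof \<Phi> a s"
  unfolding circ_prof_def
proof (rule integral_dominated_convergence[where w="\<lambda>\<theta>. C * indicator {-pi..pi} \<theta>"])
  have m: "(\<lambda>\<theta>. \<Phi> (cart a (sqrt s * cos \<theta>) (sqrt s * sin \<theta>))) \<in> borel_measurable borel" for a s
    by (intro borel_measurable_continuous_onI continuous_on_compose2[OF \<Phi>] continuous_cart continuous_intros) auto
  show "(\<lambda>\<theta>. indicator {-pi..pi} \<theta> *\<^sub>R \<Phi> (cart a (sqrt s * cos \<theta>) (sqrt s * sin \<theta>))) \<in> borel_measurable lborel"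
    using m by measurable
  show "(\<lambda>\<theta>. indicator {-pi..pi} \<theta> *\<^sub>R \<Phi> (cart (an n) (sqrt (sn n) * cos \<theta>) (sqrt (sn n) * sin \<theta>))) \<in> borel_measurable lborel" for n
    using m by measurable
  show "integrable lborel (\<lambda>\<theta>. C * indicator {-pi..pi} \<theta>)"
    by (intro integrable_mult_right integrable_real_indicator) (auto simp: emeasure_lborel_Icc_eq)
  show "AE \<theta> in lborel. norm (indicator {-pi..pi} \<theta> *\<^sub>R \<Phi> (cart (an n) (sqrt (sn n) * cos \<theta>) (sqrt (sn n) * sin \<theta>))) \<le> C * indicator {-pi..pi} \<theta>" for n
    using b by (intro AE_I2) (auto split: split_indicator)
  show "AE \<theta> in lborel. (\<lambda>n. indicator {-pi..pi} \<theta> *\<^sub>R \<Phi> (cart (an n) (sqrt (sn n) * cos \<theta>) (sqrt (sn n) * sin \<theta>)))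
     \<longlonglongrightarrow> indicator {-pi..pi} \<theta> *\<^sub>R \<Phi> (cart a (sqrt s * cos \<theta>) (sqrt s * sin \<theta>))"
  proof (intro AE_I2 tendsto_scaleR tendsto_const)
    fix \<theta>
    have "isCont \<Phi> z" for z using \<Phi> continuous_on_eq_continuous_at[OF open_UNIV] by blast
    thus "(\<lambda>n. \<Phi> (cart (an n) (sqrt (sn n) * cos \<theta>) (sqrt (sn n) * sin \<theta>))) \<longlonglongrightarrow> \<Phi> (cart a (sqrt s * cos \<theta>) (sqrt s * sin \<theta>))"
      by (rule isCont_tendsto_compose) (unfold cart_def, intro tendsto_intros an sn)
  qed
qed

lemma circ_prof_measurable:
  assumes \<Phi>: "continuous_on UNIV \<Phi>" and b: "\<And>w. norm (\<Phi> w) \<le> C"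
  shows "(\<lambda>z. circ_prof \<Phi> (fst z) (snd z)) \<in> borel_measurable borel"
proof (rule borel_measurable_continuous_onI)
  have "isCont (\<lambda>z. circ_prof \<Phi> (fst z) (snd z)) z" for z :: "real \<times> real"
    unfolding continuous_at_sequentially o_def
    by (intro allI impI circ_prof_tendsto[OF \<Phi> b] tendsto_fst tendsto_snd)
  thus "continuous_on UNIV (\<lambda>z. circ_prof \<Phi> (fst z) (snd z))" by (simp add: continuous_on_eq_continuous_at)
qed

section \<open>Fubini and integrals over an angle and a point\<close>

lemma lborel_Fubini:
  fixes f :: "'a::euclidean_space \<times> 'b::euclidean_space \<Rightarrow> 'c::{banach, second_countable_topology}"
  assumes "integrable lborel f"
  shows "(LINT z|lborel. f z) = (LINT x|lborel. LINT y|lborel. f (x, y))"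
    and "(LINT z|lborel. f z) = (LINT y|lborel. LINT x|lborel. f (x, y))"
    and "integrable lborel (\<lambda>x. LINT y|lborel. f (x, y))"
    and "integrable lborel (\<lambda>y. LINT x|lborel. f (x, y))"
    and "AE x in lborel. integrable lborel (\<lambda>y. f (x, y))"
    and "AE y in lborel. integrable lborel (\<lambda>x. f (x, y))"
proof -
  have i: "integrable (lborel \<Otimes>\<^sub>M lborel) f" using assms by (simp add: lborel_prod)
  hence i': "integrable (lborel \<Otimes>\<^sub>M lborel) (case_prod (\<lambda>x y. f (x, y)))" by simp
  show "(LINT z|lborel. f z) = (LINT x|lborel. LINT y|lborel. f (x, y))"
    using lborel_pair.integral_fst'[OF i] by (simp add: lborel_prod)
  show "(LINT z|lborel. f z) = (LINT y|lborel. LINT x|lborel. f (x, y))"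
    using lborel_pair.integral_snd[OF i'] by (simp add: lborel_prod)
  show "integrable lborel (\<lambda>x. LINT y|lborel. f (x, y))" by (rule lborel_pair.integrable_fst'[OF i])
  show "integrable lborel (\<lambda>y. LINT x|lborel. f (x, y))" by (rule lborel_pair.integrable_snd[OF i'])
  show "AE x in lborel. integrable lborel (\<lambda>y. f (x, y))" by (rule lborel_pair.AE_integrable_fst'[OF i])
  show "AE y in lborel. integrable lborel (\<lambda>x. f (x, y))" by (rule lborel_pair.AE_integrable_snd[OF i'])
qed

lemma integrable_prod_mult:
  fixes f :: "'a::euclidean_space \<Rightarrow> complex" and g :: "'b::euclidean_space \<Rightarrow> complex"
  assumes f: "integrable lborel f" and g: "integrable lborel g"
  shows "integrable lborel (\<lambda>z. f (fst z) * g (snd z))"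
proof (rule integrableI_bounded)
  have [measurable]: "f \<in> borel_measurable borel" "g \<in> borel_measurable borel" using f g by auto
  show m: "(\<lambda>z. f (fst z) * g (snd z)) \<in> borel_measurable lborel" by measurable
  have "(\<integral>\<^sup>+z. ennreal (norm (f (fst z) * g (snd z))) \<partial>lborel) = (\<integral>\<^sup>+x. \<integral>\<^sup>+y. ennreal (norm (f x)) * ennreal (norm (g y)) \<partial>lborel \<partial>lborel)"
    using nn_integral_lborel_fst[of "\<lambda>z. ennreal (norm (f (fst z) * g (snd z)))"] by (simp add: norm_mult ennreal_mult)
  also have "\<dots> = (\<integral>\<^sup>+x. ennreal (norm (f x)) \<partial>lborel) * (\<integral>\<^sup>+y. ennreal (norm (g y)) \<partial>lborel)"
    by (simp add: nn_integral_cmult nn_integral_multc)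
  also have "\<dots> < \<infinity>" using f g by (simp add: integrable_iff_bounded ennreal_mult_less_top)
  finally show "(\<integral>\<^sup>+z. ennreal (norm (f (fst z) * g (snd z))) \<partial>lborel) < \<infinity>" .
qed

lemma integral_prod_mult:
  fixes f :: "'a::euclidean_space \<Rightarrow> complex" and g :: "'b::euclidean_space \<Rightarrow> complex"
  assumes f: "integrable lborel f" and g: "integrable lborel g"
  shows "(LINT z|lborel. f (fst z) * g (snd z)) = (LINT x|lborel. f x) * (LINT y|lborel. g y)"
  using lborel_Fubini(1)[OF integrable_prod_mult[OF f g]] by simp

lemma nn_integral_Rot_pair:
  assumes [measurable]: "h \<in> borel_measurable borel"
  shows "(\<integral>\<^sup>+z. indicator {-pi..pi} (fst z) * h (Rot (fst z) (snd z)) \<partial>lborel) = ennreal (2 * pi) * (\<integral>\<^sup>+v. h v \<partial>lborel)"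
proof -
  have [measurable]: "(\<lambda>z. h (Rot (fst z) (snd z))) \<in> borel_measurable borel"
    by (rule measurable_compose[OF Rot_measurable_pair]) simp
  have "(\<integral>\<^sup>+z. indicator {-pi..pi} (fst z) * h (Rot (fst z) (snd z)) \<partial>lborel)
     = (\<integral>\<^sup>+\<theta>. \<integral>\<^sup>+v. indicator {-pi..pi} \<theta> * h (Rot \<theta> v) \<partial>lborel \<partial>lborel)"
    by (subst nn_integral_lborel_fst) simp_all
  also have "\<dots> = (\<integral>\<^sup>+\<theta>. indicator {-pi..pi} \<theta> * (\<integral>\<^sup>+v. h v \<partial>lborel) \<partial>lborel)"
  proof (rule nn_integral_cong_AE)
    show "AE \<theta> in lborel. (\<integral>\<^sup>+v. indicator {-pi..pi} \<theta> * h (Rot \<theta> v) \<partial>lborel) = indicator {-pi..pi} \<theta> * (\<integral>\<^sup>+v. h v \<partial>lborel)"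
      using AE_RA_nonzero
    proof eventually_elim
      case (elim \<theta>)
      have "(\<integral>\<^sup>+v. indicator {-pi..pi} \<theta> * h (Rot \<theta> v) \<partial>lborel) = indicator {-pi..pi} \<theta> * (\<integral>\<^sup>+v. h (Rot \<theta> v) \<partial>lborel)"
        by (rule nn_integral_cmult) simp
      thus ?case using elim nn_integral_Rot[of h \<theta>] by (auto split: split_indicator)
    qed
  qed
  also have "\<dots> = emeasure lborel {-pi..pi} * (\<integral>\<^sup>+v. h v \<partial>lborel)"
    by (subst nn_integral_multc) auto
  finally show ?thesis by (simp add: emeasure_lborel_Icc_eq)
qed

lemma integrable_Rot_pair:
  fixes h :: "r3 \<Rightarrow> complex"
  assumes h: "integrable lborel h"
  shows "integrable lborel (\<lambda>z. indicator {-pi..pi} (fst z) *\<^sub>R h (Rot (fst z) (snd z)))"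
proof (rule integrableI_bounded)
  have [measurable]: "h \<in> borel_measurable borel" using h by simp
  have [measurable]: "(\<lambda>z. h (Rot (fst z) (snd z))) \<in> borel_measurable borel"
    by (rule measurable_compose[OF Rot_measurable_pair]) simp
  show "(\<lambda>z. indicator {-pi..pi} (fst z) *\<^sub>R h (Rot (fst z) (snd z))) \<in> borel_measurable lborel" by measurable
  have "(\<integral>\<^sup>+z. ennreal (norm (indicator {-pi..pi} (fst z) *\<^sub>R h (Rot (fst z) (snd z)))) \<partial>lborel)
     = (\<integral>\<^sup>+z. indicator {-pi..pi} (fst z) * ennreal (norm (h (Rot (fst z) (snd z)))) \<partial>lborel)"
    by (intro nn_integral_cong) (auto split: split_indicator)
  also have "\<dots> = ennreal (2 * pi) * (\<integral>\<^sup>+v. ennreal (norm (h v)) \<partial>lborel)" by (rule nn_integral_Rot_pair) simp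
  also have "\<dots> < \<infinity>" using h by (simp add: integrable_iff_bounded ennreal_mult_less_top)
  finally show "(\<integral>\<^sup>+z. ennreal (norm (indicator {-pi..pi} (fst z) *\<^sub>R h (Rot (fst z) (snd z)))) \<partial>lborel) < \<infinity>" .
qed

lemma integral_Rot:
  fixes h :: "r3 \<Rightarrow> complex"
  assumes [measurable]: "h \<in> borel_measurable borel" and "RA \<theta> \<noteq> 0"
  shows "(LINT v|lborel. h (Rot \<theta> v)) = (LINT v|lborel. h v)"
proof -
  have "(LINT v|lborel. h v) = (LINT v|distr lborel borel (Rot \<theta>). h v)" by (simp add: distr_Rot assms)
  also have "\<dots> = (LINT v|lborel. h (Rot \<theta> v))" by (rule integral_distr) auto
  finally show ?thesis ..
qed

text \<open>Averaging over the rotations, which leave \<open>\<kappa>\<close> alone, turns \<open>\<Phi>\<close> into its circular mean.\<close>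

lemma integral_cylindrical:
  fixes \<kappa> :: "real \<times> real \<Rightarrow> complex"
  assumes \<Phi>: "continuous_on UNIV \<Phi>" and b: "\<And>w. norm (\<Phi> w) \<le> C" and int: "integrable lborel \<Phi>"
    and \<kappa>[measurable]: "\<kappa> \<in> borel_measurable borel" and B: "\<And>z. norm (\<kappa> z) \<le> B"
  defines "g \<equiv> \<lambda>z. circ_prof \<Phi> (fst z) (snd z) * \<kappa> z"
  shows "(LINT v|lborel. \<Phi> v * \<kappa> (hgt v, rad v)) = of_real (3 * sqrt 3) * (LINT z|lborel. indicator {0..} (snd z) *\<^sub>R g z)" (is "?L = ?R")
    and "integrable lborel (\<lambda>z. indicator {0..} (snd z) *\<^sub>R g z)"
proof -
  have [measurable]: "\<Phi> \<in> borel_measurable borel" using int by simp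
  have hr[measurable]: "(\<lambda>w. (hgt w, rad w)) \<in> borel_measurable borel"
    by (intro borel_measurable_Pair hgt_rad_measurable)
  have gm[measurable]: "g \<in> borel_measurable borel"
    unfolding g_def using circ_prof_measurable[OF \<Phi> b] by measurable
  define h where "h v = \<Phi> v * \<kappa> (hgt v, rad v)" for v
  have [measurable]: "h \<in> borel_measurable borel" unfolding h_def by measurable
  have ih: "integrable lborel h"
  proof (rule Bochner_Integration.integrable_bound)
    show "integrable lborel (\<lambda>v. of_real B * \<Phi> v)" using int by simp
    have "norm (h v) \<le> norm (of_real B * \<Phi> v)" for v
    proof -
      have "norm (h v) \<le> norm (\<Phi> v) * B" unfolding h_def norm_mult by (intro mult_left_mono B) auto
      also have "\<dots> \<le> norm (of_real B * \<Phi> v)" unfolding norm_mult norm_of_real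
        using mult_right_mono[OF abs_ge_self norm_ge_zero, of B "\<Phi> v"] by (simp add: mult.commute)
      finally show ?thesis .
    qed
    thus "AE v in lborel. norm (h v) \<le> norm (of_real B * \<Phi> v)" by simp
  qed simp
  have hR: "h (Rot \<theta> v) = \<Phi> (Rot \<theta> v) * \<kappa> (hgt v, rad v)" for \<theta> v by (simp add: h_def hgt_Rot rad_Rot)
  \<comment> \<open>\<open>?F\<close> is integrated in both orders. Points first gives
    \<open>2 * pi\<close> times the left side, by rotation invariance; angles first gives a function
    of height and squared radius, whose integral \<open>distr_hgt_rad\<close> evaluates with density
    6 sqrt 3 pi. The quotient is 3 sqrt 3.\<close>
  let ?F = "\<lambda>z. indicator {-pi..pi} (fst z) *\<^sub>R h (Rot (fst z) (snd z))"
  have iF: "integrable lborel ?F" by (rule integrable_Rot_pair[OF ih])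
  have inner: "(LINT \<theta>|lborel. ?F (\<theta>, v)) = g (hgt v, rad v)" for v
    by (simp add: hR g_def circ_eq_prof[OF \<Phi>, symmetric] circ_def flip: mult_scaleR_left)
  have "(LINT z|lborel. ?F z) = (LINT \<theta>|lborel. LINT v|lborel. indicator {-pi..pi} \<theta> *\<^sub>R h (Rot \<theta> v))"
    using lborel_Fubini(1)[OF iF] by simp
  also have "\<dots> = (LINT \<theta>|lborel. indicator {-pi..pi} \<theta> *\<^sub>R (LINT v|lborel. h v))"
  proof (rule integral_cong_AE)
    show "AE \<theta> in lborel. (LINT v|lborel. indicator {-pi..pi} \<theta> *\<^sub>R h (Rot \<theta> v)) = indicator {-pi..pi} \<theta> *\<^sub>R (LINT v|lborel. h v)"
      using AE_RA_nonzero by eventually_elim (auto simp: integral_Rot split: split_indicator)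
    show "(\<lambda>\<theta>. LINT v|lborel. indicator {-pi..pi} \<theta> *\<^sub>R h (Rot \<theta> v)) \<in> borel_measurable lborel"
      using borel_measurable_integrable[OF lborel_Fubini(3)[OF iF]] by simp
  qed simp
  also have "\<dots> = of_real (2 * pi) * (LINT v|lborel. h v)"
    by (simp add: scaleR_conv_of_real flip: of_real_mult)
  finally have 1: "(LINT z|lborel. ?F z) = of_real (2 * pi) * ?L" unfolding h_def .
  have ig: "integrable lborel (\<lambda>v. g (hgt v, rad v))"
    using lborel_Fubini(4)[OF iF] unfolding inner .
  have dm[measurable]: "(\<lambda>z::real\<times>real. 6 * sqrt 3 * pi * indicator {0..} (snd z)) \<in> borel_measurable borel"
    by measurable
  have "(LINT z|lborel. ?F z) = (LINT v|lborel. g (hgt v, rad v))"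
    using lborel_Fubini(2)[OF iF] unfolding inner .
  also have "\<dots> = (LINT z|distr lborel borel (\<lambda>w. (hgt w, rad w)). g z)"
    by (rule integral_distr[symmetric]) auto
  also have "\<dots> = (LINT z|lborel. (6 * sqrt 3 * pi * indicator {0..} (snd z)) *\<^sub>R g z)"
    unfolding distr_hgt_rad by (rule integral_density) auto
  also have "\<dots> = (LINT z|lborel. of_real (6 * sqrt 3 * pi) * (indicator {0..} (snd z) *\<^sub>R g z))"
    by (intro Bochner_Integration.integral_cong) (auto split: split_indicator simp: scaleR_conv_of_real)
  also have "\<dots> = of_real (6 * sqrt 3 * pi) * (LINT z|lborel. indicator {0..} (snd z) *\<^sub>R g z)"
    by (rule integral_mult_right_zero)
  finally have "of_real (2 * pi) * ?L = of_real (2 * pi) * ?R" using 1 by (simp add: mult_ac)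
  thus "?L = ?R" by simp
  have "integrable (distr lborel borel (\<lambda>w. (hgt w, rad w))) g"
    using ig by (subst integrable_distr_eq) auto
  hence "integrable lborel (\<lambda>z. (6 * sqrt 3 * pi * indicator {0..} (snd z)) *\<^sub>R g z)"
    unfolding distr_hgt_rad by (subst (asm) integrable_density) auto
  hence "integrable lborel (\<lambda>z. (1 / (6 * sqrt 3 * pi)) *\<^sub>R ((6 * sqrt 3 * pi * indicator {0..} (snd z)) *\<^sub>R g z))"
    by (rule integrable_scaleR_right)
  thus "integrable lborel (\<lambda>z. indicator {0..} (snd z) *\<^sub>R g z)" by simp
qed

text \<open>The two mollifiers in cylindrical coordinates: \<open>z\<close> holds height and squared
  radius of the integration point, and a triple has sum 3 \<open>hgt\<close> and sum of squares 3
  \<open>hgt\<close>^2 + 6 \<open>rad\<close>.\<close>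

definition delta_kernel :: "(real \<Rightarrow> real) \<Rightarrow> (real \<Rightarrow> real) \<Rightarrow> real \<Rightarrow> real \<Rightarrow> r3 \<Rightarrow> real \<times> real \<Rightarrow> complex" where
  "delta_kernel \<rho>1 \<rho>2 e1 e2 w z =
     of_real (\<rho>1 (3 * (fst z - hgt w) / e1) / e1) *
     of_real (\<rho>2 ((3 * (fst z)\<^sup>2 + 6 * snd z - (3 * (hgt w)\<^sup>2 + 6 * rad w)) / e2) / e2)"

lemma delta_kernel_bound:
  assumes "\<And>x. \<bar>\<rho>1 x\<bar> \<le> B1" "\<And>x. \<bar>\<rho>2 x\<bar> \<le> B2" "e1 > 0" "e2 > 0"
  shows "norm (delta_kernel \<rho>1 \<rho>2 e1 e2 w z) \<le> (B1 / e1) * (B2 / e2)"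
  unfolding delta_kernel_def norm_mult
  using assms order_trans[OF abs_ge_zero assms(1)]
  by (intro mult_mono) (auto simp: norm_divide divide_right_mono)

lemma delta_kernel_measurable:
  assumes [measurable]: "\<rho>1 \<in> borel_measurable borel" "\<rho>2 \<in> borel_measurable borel"
  shows "delta_kernel \<rho>1 \<rho>2 e1 e2 w \<in> borel_measurable borel"
  unfolding delta_kernel_def[abs_def] by measurable

locale delta_setup =
  fixes \<Phi> :: "r3 \<Rightarrow> complex" and C :: real and \<rho>1 \<rho>2 :: "real \<Rightarrow> real"
  assumes \<Phi>: "continuous_on UNIV \<Phi>" and bound: "\<And>w. norm (\<Phi> w) \<le> C" and int: "integrable lborel \<Phi>"
    and \<rho>1: "schwartz \<rho>1" and \<rho>2: "schwartz \<rho>2"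
begin

text \<open>The regularized integral over the first three variables, the other three being frozen at
  \<open>w\<close>.\<close>

definition "smear e1 e2 w = (LINT v|lborel. \<Phi> v * delta_kernel \<rho>1 \<rho>2 e1 e2 w (hgt v, rad v))"

text \<open>The squared radius obtained by solving \<Omega>1 = e1 \<alpha> and \<Omega>2 = e2
  \<beta>: the first equation gives the height \<open>hgt w + e1 / 3 * \<alpha>\<close>, the second
  is then linear in the squared radius.\<close>

definition "level e1 e2 w \<alpha> \<beta> = rad w + e2 / 6 * \<beta> - ((hgt w + e1 / 3 * \<alpha>)\<^sup>2 - (hgt w)\<^sup>2) / 2"

definition "inner_smear e1 e2 w \<alpha> = (LINT \<beta>|lborel. of_real (\<rho>2 \<beta>) * (indicator {0..} (level e1 e2 w \<alpha> \<beta>) *\<^sub>R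
     circ_prof \<Phi> (hgt w + e1 / 3 * \<alpha>) (level e1 e2 w \<alpha> \<beta>)))"

lemma C_nonneg: "C \<ge> 0" using order_trans[OF norm_ge_zero bound] .

lemma \<rho>_measurable [measurable]: "\<rho>1 \<in> borel_measurable borel" "\<rho>2 \<in> borel_measurable borel"
  using \<rho>1 \<rho>2 schwartz_measurable by auto

text \<open>Height and squared radius are replaced by the arguments of the mollifiers. The phases
  have slopes 3 and 6 in them, so the factor 3 sqrt 3 of \<open>integral_cylindrical\<close> is
  divided by 18.\<close>

lemma smear_eq:
  assumes e: "e1 > 0" "e2 > 0"
  shows "smear e1 e2 w = of_real (sqrt 3 / 6) * (LINT \<alpha>|lborel. of_real (\<rho>1 \<alpha>) * inner_smear e1 e2 w \<alpha>)"
proof -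
  obtain B1 where B1: "\<And>x. norm (\<rho>1 x) \<le> B1" using schwartz_bounded[OF \<rho>1] by blast
  obtain B2 where B2: "\<And>x. norm (\<rho>2 x) \<le> B2" using schwartz_bounded[OF \<rho>2] by blast
  let ?\<kappa> = "delta_kernel \<rho>1 \<rho>2 e1 e2 w"
  have \<kappa>: "norm (?\<kappa> z) \<le> (B1 / e1) * (B2 / e2)" for z
    using B1 B2 e by (intro delta_kernel_bound) auto
  note cyl = integral_cylindrical[OF \<Phi> bound int delta_kernel_measurable[OF \<rho>_measurable] \<kappa>]
  let ?G = "\<lambda>z. indicator {0..} (snd z) *\<^sub>R (circ_prof \<Phi> (fst z) (snd z) * ?\<kappa> z)"
  have "(LINT z|lborel. ?G z) = (LINT a|lborel. LINT s|lborel. ?G (a, s))"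
    by (rule lborel_Fubini(1)[OF cyl(2)])
  also have "\<dots> = \<bar>e1 / 3\<bar> *\<^sub>R (LINT \<alpha>|lborel. LINT s|lborel. ?G (hgt w + e1 / 3 * \<alpha>, s))"
    by (rule lborel_integral_real_affine) (use e in simp)
  also have "(\<lambda>\<alpha>. LINT s|lborel. ?G (hgt w + e1 / 3 * \<alpha>, s))
    = (\<lambda>\<alpha>. of_real (1 / (6 * e1)) * (of_real (\<rho>1 \<alpha>) * inner_smear e1 e2 w \<alpha>))"
  proof
    fix \<alpha>
    let ?t = "rad w - ((hgt w + e1 / 3 * \<alpha>)\<^sup>2 - (hgt w)\<^sup>2) / 2"
    have lv: "?t + e2 / 6 * \<beta> = level e1 e2 w \<alpha> \<beta>" for \<beta> by (simp add: level_def)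
    have "(LINT s|lborel. ?G (hgt w + e1 / 3 * \<alpha>, s)) = \<bar>e2 / 6\<bar> *\<^sub>R (LINT \<beta>|lborel. ?G (hgt w + e1 / 3 * \<alpha>, ?t + e2 / 6 * \<beta>))"
      by (rule lborel_integral_real_affine) (use e in simp)
    also have "(\<lambda>\<beta>. ?G (hgt w + e1 / 3 * \<alpha>, ?t + e2 / 6 * \<beta>))
      = (\<lambda>\<beta>. of_real (\<rho>1 \<alpha> / e1 / e2) * (of_real (\<rho>2 \<beta>) * (indicator {0..} (level e1 e2 w \<alpha> \<beta>) *\<^sub>R
     circ_prof \<Phi> (hgt w + e1 / 3 * \<alpha>) (level e1 e2 w \<alpha> \<beta>))))"
    proof
      fix \<beta>
      have 1: "3 * (hgt w + e1 / 3 * \<alpha> - hgt w) / e1 = \<alpha>" using e by simp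
      have "3 * (hgt w + e1 / 3 * \<alpha>)\<^sup>2 + 6 * level e1 e2 w \<alpha> \<beta> - (3 * (hgt w)\<^sup>2 + 6 * rad w) = e2 * \<beta>"
        by (simp add: level_def field_simps)
      hence 2: "(3 * (hgt w + e1 / 3 * \<alpha>)\<^sup>2 + 6 * level e1 e2 w \<alpha> \<beta> - (3 * (hgt w)\<^sup>2 + 6 * rad w)) / e2 = \<beta>"
        using e by simp
      show "?G (hgt w + e1 / 3 * \<alpha>, ?t + e2 / 6 * \<beta>) = of_real (\<rho>1 \<alpha> / e1 / e2) * (of_real (\<rho>2 \<beta>) * (indicator {0..} (level e1 e2 w \<alpha> \<beta>) *\<^sub>R
     circ_prof \<Phi> (hgt w + e1 / 3 * \<alpha>) (level e1 e2 w \<alpha> \<beta>)))"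
        unfolding lv delta_kernel_def fst_conv snd_conv 1 2
        by (simp add: scaleR_conv_of_real mult_ac)
    qed
    also have "\<bar>e2 / 6\<bar> *\<^sub>R (LINT \<beta>|lborel. of_real (\<rho>1 \<alpha> / e1 / e2) * (of_real (\<rho>2 \<beta>) * (indicator {0..} (level e1 e2 w \<alpha> \<beta>) *\<^sub>R
     circ_prof \<Phi> (hgt w + e1 / 3 * \<alpha>) (level e1 e2 w \<alpha> \<beta>)))) = of_real (1 / (6 * e1)) * (of_real (\<rho>1 \<alpha>) * inner_smear e1 e2 w \<alpha>)"
      unfolding integral_mult_right_zero inner_smear_def[symmetric] unfolding scaleR_conv_of_real
      using e by (simp add: mult.assoc[symmetric])
    finally show "(LINT s|lborel. ?G (hgt w + e1 / 3 * \<alpha>, s)) = of_real (1 / (6 * e1)) * (of_real (\<rho>1 \<alpha>) * inner_smear e1 e2 w \<alpha>)" .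
  qed
  finally have "(LINT z|lborel. ?G z) = of_real (1 / 18) * (LINT \<alpha>|lborel. of_real (\<rho>1 \<alpha>) * inner_smear e1 e2 w \<alpha>)"
    unfolding integral_mult_right_zero scaleR_conv_of_real using e by (simp add: mult.assoc[symmetric])
  note G = this
  show ?thesis unfolding smear_def cyl(1) G by (simp add: mult.assoc[symmetric])
qed

lemma smear_integrand_bound:
  "norm (of_real (\<rho>2 \<beta>) * (indicator {0..} (level e1 e2 w \<alpha> \<beta>) *\<^sub>R circ_prof \<Phi> a (level e1 e2 w \<alpha> \<beta>))) \<le> \<bar>\<rho>2 \<beta>\<bar> * (2 * pi * C)"
proof -
  have "norm (indicator {0..} (level e1 e2 w \<alpha> \<beta>) *\<^sub>R circ_prof \<Phi> a (level e1 e2 w \<alpha> \<beta>)) \<le> 2 * pi * C"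
    using circ_prof_bound[of \<Phi> C a, OF bound] C_nonneg by (auto split: split_indicator)
  thus ?thesis unfolding norm_mult by (auto intro!: mult_left_mono)
qed

lemma inner_smear_bound: "norm (inner_smear e1 e2 w \<alpha>) \<le> (LINT \<beta>|lborel. \<bar>\<rho>2 \<beta>\<bar>) * (2 * pi * C)"
proof -
  have "norm (inner_smear e1 e2 w \<alpha>) \<le> (LINT \<beta>|lborel. \<bar>\<rho>2 \<beta>\<bar> * (2 * pi * C))"
    unfolding inner_smear_def
    by (intro order_trans[OF integral_norm_bound] integral_mono' smear_integrand_bound)
       (use C_nonneg schwartz_integrable[OF \<rho>2] in auto)
  thus ?thesis by simp
qed

definition "smear_const = sqrt 3 / 6 * ((LINT \<alpha>|lborel. \<bar>\<rho>1 \<alpha>\<bar>) * ((LINT \<beta>|lborel. \<bar>\<rho>2 \<beta>\<bar>) * (2 * pi * C)))"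

lemma smear_bound:
  assumes e: "e1 > 0" "e2 > 0" shows "norm (smear e1 e2 w) \<le> smear_const"
proof -
  have "norm (LINT \<alpha>|lborel. of_real (\<rho>1 \<alpha>) * inner_smear e1 e2 w \<alpha>) \<le> (LINT \<alpha>|lborel. \<bar>\<rho>1 \<alpha>\<bar> * ((LINT \<beta>|lborel. \<bar>\<rho>2 \<beta>\<bar>) * (2 * pi * C)))"
    using inner_smear_bound[of e1 e2 w]
    by (intro order_trans[OF integral_norm_bound] integral_mono')
       (use C_nonneg schwartz_integrable[OF \<rho>1] in \<open>auto simp: norm_mult intro!: mult_left_mono\<close>)
  also have "\<dots> = (LINT \<alpha>|lborel. \<bar>\<rho>1 \<alpha>\<bar>) * ((LINT \<beta>|lborel. \<bar>\<rho>2 \<beta>\<bar>) * (2 * pi * C))"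
    by (rule integral_mult_left_zero)
  finally show ?thesis unfolding smear_eq[OF e] smear_const_def norm_mult norm_of_real
    by (rule mult_mono[rotated]) (use C_nonneg in auto)
qed

text \<open>Strict positivity of \<open>rad w\<close> matters: the level tends to it, so the cut-off
  at zero is eventually inactive. On the axis the cut-off would remain visible in the limit.\<close>

lemma smear_tendsto:
  assumes r: "rad w > 0" and e: "\<And>n. e1 n > 0" "\<And>n. e2 n > 0" "e1 \<longlonglongrightarrow> 0" "e2 \<longlonglongrightarrow> 0"
    and one: "(LINT s|lborel. \<rho>1 s) = 1" "(LINT s|lborel. \<rho>2 s) = 1"
  shows "(\<lambda>n. smear (e1 n) (e2 n) w) \<longlonglongrightarrow> of_real (sqrt 3 / 6) * circ \<Phi> w"
proof -
  let ?P = "circ_prof \<Phi> (hgt w) (rad w)"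
  have cm[measurable]: "(\<lambda>z. circ_prof \<Phi> (fst z) (snd z)) \<in> borel_measurable borel"
    by (rule circ_prof_measurable[OF \<Phi> bound])
  have cm2: "(\<lambda>x. circ_prof \<Phi> (f x) (g x)) \<in> borel_measurable borel"
    if [measurable]: "f \<in> borel_measurable borel" "g \<in> borel_measurable borel" for f g :: "'z::euclidean_space \<Rightarrow> real"
    using measurable_compose[OF borel_measurable_Pair[OF that] cm] by simp
  have lvm[measurable]: "level e1 e2 w \<alpha> \<in> borel_measurable borel" for e1 e2 \<alpha> unfolding level_def[abs_def] by measurable
  have inner: "(\<lambda>n. inner_smear (e1 n) (e2 n) w \<alpha>) \<longlonglongrightarrow> ?P" for \<alpha>
  proof -
    have a: "(\<lambda>n. hgt w + e1 n / 3 * \<alpha>) \<longlonglongrightarrow> hgt w"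
      by (auto intro!: tendsto_eq_intros e)
    have l: "(\<lambda>n. level (e1 n) (e2 n) w \<alpha> \<beta>) \<longlonglongrightarrow> rad w" for \<beta>
      unfolding level_def by (auto intro!: tendsto_eq_intros e)
    have "(\<lambda>n. inner_smear (e1 n) (e2 n) w \<alpha>) \<longlonglongrightarrow> (LINT \<beta>|lborel. complex_of_real (\<rho>2 \<beta>) * (1 *\<^sub>R ?P))"
      unfolding inner_smear_def
    proof (rule integral_dominated_convergence[where w="\<lambda>\<beta>. \<bar>\<rho>2 \<beta>\<bar> * (2 * pi * C)"])
      show "integrable lborel (\<lambda>\<beta>. \<bar>\<rho>2 \<beta>\<bar> * (2 * pi * C))" using schwartz_integrable[OF \<rho>2] by auto
      show "AE \<beta> in lborel. norm (complex_of_real (\<rho>2 \<beta>) * (indicator {0..} (level (e1 n) (e2 n) w \<alpha> \<beta>) *\<^sub>R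
          circ_prof \<Phi> (hgt w + e1 n / 3 * \<alpha>) (level (e1 n) (e2 n) w \<alpha> \<beta>))) \<le> \<bar>\<rho>2 \<beta>\<bar> * (2 * pi * C)" for n
        by (intro AE_I2 smear_integrand_bound)
      show "(\<lambda>\<beta>. complex_of_real (\<rho>2 \<beta>) * (indicator {0..} (level (e1 n) (e2 n) w \<alpha> \<beta>) *\<^sub>R
          circ_prof \<Phi> (hgt w + e1 n / 3 * \<alpha>) (level (e1 n) (e2 n) w \<alpha> \<beta>))) \<in> borel_measurable lborel" for n
        using cm2[of "\<lambda>_. hgt w + e1 n / 3 * \<alpha>" "level (e1 n) (e2 n) w \<alpha>"] by measurable
      show "AE \<beta> in lborel. (\<lambda>n. complex_of_real (\<rho>2 \<beta>) * (indicator {0..} (level (e1 n) (e2 n) w \<alpha> \<beta>) *\<^sub>R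
          circ_prof \<Phi> (hgt w + e1 n / 3 * \<alpha>) (level (e1 n) (e2 n) w \<alpha> \<beta>))) \<longlonglongrightarrow> complex_of_real (\<rho>2 \<beta>) * (1 *\<^sub>R ?P)"
      proof (intro AE_I2 tendsto_mult tendsto_const tendsto_scaleR circ_prof_tendsto[OF \<Phi> bound] a l)
        fix \<beta>
        have "\<forall>\<^sub>F n in sequentially. level (e1 n) (e2 n) w \<alpha> \<beta> > 0" using order_tendstoD(1)[OF l r] .
        thus "(\<lambda>n. indicat_real {0..} (level (e1 n) (e2 n) w \<alpha> \<beta>)) \<longlonglongrightarrow> 1"
          by (intro tendsto_eventually) (auto elim: eventually_mono)
      qed
    qed simp
    thus ?thesis using one by simp
  qed
  have "(\<lambda>n. LINT \<alpha>|lborel. of_real (\<rho>1 \<alpha>) * inner_smear (e1 n) (e2 n) w \<alpha>) \<longlonglongrightarrow> (LINT \<alpha>|lborel. complex_of_real (\<rho>1 \<alpha>) * ?P)"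
  proof (rule integral_dominated_convergence[where w="\<lambda>\<alpha>. \<bar>\<rho>1 \<alpha>\<bar> * ((LINT \<beta>|lborel. \<bar>\<rho>2 \<beta>\<bar>) * (2 * pi * C))"])
    show "integrable lborel (\<lambda>\<alpha>. \<bar>\<rho>1 \<alpha>\<bar> * ((LINT \<beta>|lborel. \<bar>\<rho>2 \<beta>\<bar>) * (2 * pi * C)))" using schwartz_integrable[OF \<rho>1] by auto
    show "AE \<alpha> in lborel. norm (of_real (\<rho>1 \<alpha>) * inner_smear (e1 n) (e2 n) w \<alpha>) \<le> \<bar>\<rho>1 \<alpha>\<bar> * ((LINT \<beta>|lborel. \<bar>\<rho>2 \<beta>\<bar>) * (2 * pi * C))" for n
      using inner_smear_bound[of "e1 n" "e2 n" w] by (intro AE_I2) (auto simp: norm_mult intro!: mult_left_mono)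
    show "AE \<alpha> in lborel. (\<lambda>n. of_real (\<rho>1 \<alpha>) * inner_smear (e1 n) (e2 n) w \<alpha>) \<longlonglongrightarrow> complex_of_real (\<rho>1 \<alpha>) * ?P"
      by (intro AE_I2 tendsto_mult tendsto_const inner)
    show "(\<lambda>\<alpha>. of_real (\<rho>1 \<alpha>) * inner_smear (e1 n) (e2 n) w \<alpha>) \<in> borel_measurable lborel" for n
    proof -
      have lm: "(\<lambda>z. level (e1 n) (e2 n) w (fst z) (snd z)) \<in> borel_measurable borel" unfolding level_def by measurable
      have "(\<lambda>z. of_real (\<rho>2 (snd z)) * (indicator {0..} (level (e1 n) (e2 n) w (fst z) (snd z)) *\<^sub>R
          circ_prof \<Phi> (hgt w + e1 n / 3 * fst z) (level (e1 n) (e2 n) w (fst z) (snd z)))) \<in> borel_measurable (borel :: (real \<times> real) measure)"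
        using cm2[of "\<lambda>z::real\<times>real. hgt w + e1 n / 3 * fst z" "\<lambda>z. level (e1 n) (e2 n) w (fst z) (snd z)"] lm by measurable
      hence "(\<lambda>(\<alpha>, \<beta>). of_real (\<rho>2 \<beta>) * (indicator {0..} (level (e1 n) (e2 n) w \<alpha> \<beta>) *\<^sub>R
          circ_prof \<Phi> (hgt w + e1 n / 3 * \<alpha>) (level (e1 n) (e2 n) w \<alpha> \<beta>))) \<in> borel_measurable (lborel \<Otimes>\<^sub>M lborel)"
        by (simp add: lborel_prod split_def)
      from lborel.borel_measurable_lebesgue_integral[OF this]
      have "inner_smear (e1 n) (e2 n) w \<in> borel_measurable lborel" unfolding inner_smear_def[abs_def] by simp
      thus ?thesis by measurable
    qed
  qed simp
  hence "(\<lambda>n. LINT \<alpha>|lborel. of_real (\<rho>1 \<alpha>) * inner_smear (e1 n) (e2 n) w \<alpha>) \<longlonglongrightarrow> ?P" using one by simp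
  thus ?thesis unfolding smear_eq[OF e(1,2)] circ_eq_prof[OF \<Phi>] by (intro tendsto_mult tendsto_const)
qed

end

section \<open>Limits in two independent parameters\<close>

lemma at_right_prod_le:
  "(at_right 0 \<times>\<^sub>F at_right 0 :: (real \<times> real) filter) \<le> at (0, 0) within ({0<..} \<times> {0<..})"
proof -
  let ?F = "at_right 0 \<times>\<^sub>F at_right (0::real) :: (real \<times> real) filter"
  have f: "filterlim fst (at_right 0) ?F" and g: "filterlim snd (at_right 0) ?F"
    by (rule filterlim_fst filterlim_snd)+
  have "((\<lambda>z. (fst z, snd z)) \<longlongrightarrow> (0, 0)) ?F"
    using f g by (intro tendsto_Pair) (auto simp: filterlim_at)
  moreover have "\<forall>\<^sub>F z in ?F. z \<in> {0<..} \<times> {0<..} \<and> z \<noteq> (0, 0)"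
  proof -
    have "\<forall>\<^sub>F z in ?F. fst z \<in> {0<..}" "\<forall>\<^sub>F z in ?F. snd z \<in> {0<..}"
      using f g by (auto simp: filterlim_at elim: eventually_mono)
    thus ?thesis by eventually_elim (auto simp: mem_Times_iff)
  qed
  ultimately have "filterlim (\<lambda>z. z) (at (0, 0) within ({0<..} \<times> {0<..})) ?F"
    by (auto simp: filterlim_at)
  thus ?thesis by (simp add: filterlim_def filtermap_ident)
qed

text \<open>Dominated convergence handles sequences; testing with arbitrary pairs of null sequences
  keeps the two regularizations independent.\<close>

lemma tendsto_at_right_prodI:
  fixes J :: "real \<Rightarrow> real \<Rightarrow> complex"
  assumes "\<And>e1 e2. (\<And>n. e1 n > 0) \<Longrightarrow> (\<And>n. e2 n > 0) \<Longrightarrow> e1 \<longlonglongrightarrow> 0 \<Longrightarrow> e2 \<longlonglongrightarrow> 0 \<Longrightarrow>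
     (\<lambda>n. J (e1 n) (e2 n)) \<longlonglongrightarrow> I"
  shows "((\<lambda>(e1, e2). J e1 e2) \<longlongrightarrow> I) (at_right 0 \<times>\<^sub>F at_right 0)"
proof (rule tendsto_mono[OF at_right_prod_le], unfold tendsto_at_iff_sequentially, intro allI impI)
  fix X :: "nat \<Rightarrow> real \<times> real"
  assume X: "\<forall>i. X i \<in> {0<..} \<times> {0<..} - {(0, 0)}" "X \<longlonglongrightarrow> (0, 0)"
  have "(\<lambda>n. J (fst (X n)) (snd (X n))) \<longlonglongrightarrow> I"
  proof (rule assms)
    show "fst (X n) > 0" "snd (X n) > 0" for n using X(1) by (auto simp: mem_Times_iff)
    show "(\<lambda>n. fst (X n)) \<longlonglongrightarrow> 0" "(\<lambda>n. snd (X n)) \<longlonglongrightarrow> 0"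
      using tendsto_fst[OF X(2)] tendsto_snd[OF X(2)] by simp_all
  qed
  thus "((\<lambda>(e1, e2). J e1 e2) \<circ> X) \<longlonglongrightarrow> I" by (simp add: o_def split_def)
qed

text \<open>Relates the grouping of the first three variables into one point of space to the
  right-nested tuples of the statement. The type 'u is a pair for the five-fold and a triple for the
  six-fold integral.\<close>

definition flat :: "r3 \<times> 'u \<Rightarrow> real \<times> real \<times> real \<times> 'u" where
  "flat z = (fst (fst z), fst (snd (fst z)), snd (snd (fst z)), snd z)"

lemma flat_measurable [measurable]: "(flat :: r3 \<times> 'u::euclidean_space \<Rightarrow> _) \<in> borel_measurable borel"
  unfolding flat_def[abs_def] by (intro borel_measurable_continuous_onI continuous_intros)

lemma distr_flat:
  "distr lborel borel (flat :: r3 \<times> 'u::euclidean_space \<Rightarrow> _) = lborel"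
proof (rule measure_eqI)
  fix A :: "(real \<times> real \<times> real \<times> 'u) set"
  assume "A \<in> sets (distr lborel borel flat)"
  hence A[measurable]: "A \<in> sets borel" by simp
  have m: "(\<lambda>z. indicator A (flat z) :: ennreal) \<in> borel_measurable borel" by measurable
  have m1: "(indicator A :: _ \<Rightarrow> ennreal) \<in> borel_measurable borel" by measurable
  have m2: "(\<lambda>p. indicator A (x, p) :: ennreal) \<in> borel_measurable borel" for x by measurable
  have m3: "(\<lambda>p. indicator A (x, y, p) :: ennreal) \<in> borel_measurable borel" for x y
    by (rule measurable_compose[OF measurable_Pair_borel(1) m2])
  have m4: "(\<lambda>v. \<integral>\<^sup>+u. indicator A (flat (v, u)) \<partial>lborel) \<in> borel_measurable borel"
    by (rule nn_integral_param_measurable[OF m])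
  have m5: "(\<lambda>p. \<integral>\<^sup>+u. indicator A (flat ((x, p), u)) \<partial>lborel) \<in> borel_measurable borel" for x
    by (rule measurable_compose[OF measurable_Pair_borel(1) m4])
  have "emeasure (distr lborel borel flat) A = (\<integral>\<^sup>+z. indicator A z \<partial>distr lborel borel flat)" by simp
  also have "\<dots> = (\<integral>\<^sup>+z. indicator A (flat z) \<partial>lborel)" by (rule nn_integral_distr) auto
  also have "\<dots> = (\<integral>\<^sup>+v. \<integral>\<^sup>+u. indicator A (flat (v, u)) \<partial>lborel \<partial>lborel)" by (rule nn_integral_lborel_fst[OF m])
  also have "\<dots> = (\<integral>\<^sup>+x. \<integral>\<^sup>+p. \<integral>\<^sup>+u. indicator A (flat ((x, p), u)) \<partial>lborel \<partial>lborel \<partial>lborel)" by (rule nn_integral_lborel_fst[OF m4])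
  also have "\<dots> = (\<integral>\<^sup>+x. \<integral>\<^sup>+y. \<integral>\<^sup>+z. \<integral>\<^sup>+u. indicator A (flat ((x, y, z), u)) \<partial>lborel \<partial>lborel \<partial>lborel \<partial>lborel)"
    by (intro nn_integral_cong nn_integral_lborel_fst[OF m5])
  also have "\<dots> = (\<integral>\<^sup>+x. \<integral>\<^sup>+y. \<integral>\<^sup>+z. \<integral>\<^sup>+u. indicator A (x, y, z, u) \<partial>lborel \<partial>lborel \<partial>lborel \<partial>lborel)"
    by (simp add: flat_def)
  also have "\<dots> = (\<integral>\<^sup>+x. \<integral>\<^sup>+y. \<integral>\<^sup>+p. indicator A (x, y, p) \<partial>lborel \<partial>lborel \<partial>lborel)"
    by (intro nn_integral_cong nn_integral_lborel_fst[OF m3, symmetric])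
  also have "\<dots> = (\<integral>\<^sup>+x. \<integral>\<^sup>+p. indicator A (x, p) \<partial>lborel \<partial>lborel)"
    by (intro nn_integral_cong nn_integral_lborel_fst[OF m2, symmetric])
  also have "\<dots> = (\<integral>\<^sup>+z. indicator A z \<partial>lborel)" by (rule nn_integral_lborel_fst[OF m1, symmetric])
  finally show "emeasure (distr lborel borel flat) A = emeasure lborel A" by simp
qed simp

lemma integral_flat:
  fixes f :: "real \<times> real \<times> real \<times> 'u::euclidean_space \<Rightarrow> complex"
  assumes f: "f \<in> borel_measurable borel"
  shows "integrable lborel f \<longleftrightarrow> integrable lborel (\<lambda>z. f (flat z))"
    and "(LINT y|lborel. f y) = (LINT z|lborel. f (flat z))"
proof -
  have "integrable lborel f \<longleftrightarrow> integrable (distr lborel borel flat) f" by (simp add: distr_flat)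
  thus "integrable lborel f \<longleftrightarrow> integrable lborel (\<lambda>z. f (flat z))"
    using f by (subst (asm) integrable_distr_eq) auto
  have "(LINT y|lborel. f y) = (LINT y|distr lborel borel flat. f y)" by (simp add: distr_flat)
  thus "(LINT y|lborel. f y) = (LINT z|lborel. f (flat z))"
    using f by (subst (asm) integral_distr) auto
qed

definition unflat :: "real \<times> real \<times> real \<times> 'u \<Rightarrow> r3 \<times> 'u" where
  "unflat = (\<lambda>(x, y, z, u). ((x, y, z), u))"

lemma unflat_flat [simp]: "unflat (flat z) = z" by (simp add: flat_def unflat_def)

lemma unflat_measurable [measurable]: "(unflat :: _ \<Rightarrow> r3 \<times> 'u::euclidean_space) \<in> borel_measurable borel"
  unfolding unflat_def split_def by (intro borel_measurable_continuous_onI continuous_intros)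

lemma integral_unflat:
  fixes f :: "r3 \<times> 'u::euclidean_space \<Rightarrow> complex"
  assumes f[measurable]: "f \<in> borel_measurable borel"
  shows "integrable lborel (\<lambda>y. f (unflat y)) \<longleftrightarrow> integrable lborel f"
    and "(LINT y|lborel. f (unflat y)) = (LINT z|lborel. f z)"
  using integral_flat[of "\<lambda>y. f (unflat y)"] by simp_all

definition sq3 :: "r3 \<Rightarrow> real" where "sq3 = (\<lambda>(x, y, z). x\<^sup>2 + y\<^sup>2 + z\<^sup>2)"

lemma sq3_eq: "sq3 w = 3 * (hgt w)\<^sup>2 + 6 * rad w"
  by (simp add: sq3_def hgt_def rad_def split_def field_simps power2_eq_square)

text \<open>Fubini freezes u, and the inner integral is a smeared value at w u, to which
  \<open>smear_tendsto\<close> and \<open>smear_bound\<close> apply. General \<Gamma> and w cover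
  both representations: w u is u itself for the form, and a pair completed by the fixed x for the
  operator.\<close>

theorem has_delta_integral_circ:
  fixes \<Gamma> :: "'u::euclidean_space \<Rightarrow> complex" and w :: "'u \<Rightarrow> r3"
  assumes \<Phi>: "continuous_on UNIV \<Phi>" and bound: "\<And>w. norm (\<Phi> w) \<le> C" and int: "integrable lborel \<Phi>"
    and \<Gamma>: "integrable lborel \<Gamma>" and w[measurable]: "w \<in> borel_measurable borel"
    and pos: "AE u in lborel. rad (w u) > 0"
  shows "has_delta_integral (\<lambda>y. \<Phi> (fst (unflat y)) * \<Gamma> (snd (unflat y)))
     (\<lambda>y. 3 * (hgt (fst (unflat y)) - hgt (w (snd (unflat y)))))
     (\<lambda>y. sq3 (fst (unflat y)) - sq3 (w (snd (unflat y))))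
     (LINT u|lborel. \<Gamma> u * (of_real (sqrt 3 / 6) * circ \<Phi> (w u)))"
  unfolding has_delta_integral_def
proof (intro allI impI, elim conjE)
  fix \<rho>1 \<rho>2 :: "real \<Rightarrow> real"
  assume \<rho>: "schwartz \<rho>1" "schwartz \<rho>2" and one: "(LINT s|lborel. \<rho>1 s) = 1" "(LINT s|lborel. \<rho>2 s) = 1"
  interpret delta_setup \<Phi> C \<rho>1 \<rho>2 by unfold_locales (fact \<Phi> bound int \<rho>)+
  have [measurable]: "\<Phi> \<in> borel_measurable borel" "\<Gamma> \<in> borel_measurable borel" using int \<Gamma> by auto
  obtain B1 where B1: "\<And>x. norm (\<rho>1 x) \<le> B1" using schwartz_bounded[OF \<rho>(1)] by blast
  obtain B2 where B2: "\<And>x. norm (\<rho>2 x) \<le> B2" using schwartz_bounded[OF \<rho>(2)] by blast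
  let ?k = "\<lambda>e1 e2 z. \<Phi> (fst z) * \<Gamma> (snd z) * of_real (\<rho>1 (3 * (hgt (fst z) - hgt (w (snd z))) / e1) / e1)
      * of_real (\<rho>2 ((sq3 (fst z) - sq3 (w (snd z))) / e2) / e2)"
  have k: "?k e1 e2 (v, u) = \<Gamma> u * (\<Phi> v * delta_kernel \<rho>1 \<rho>2 e1 e2 (w u) (hgt v, rad v))" for e1 e2 v u
    by (simp add: delta_kernel_def sq3_eq mult_ac)
  have km: "?k e1 e2 \<in> borel_measurable borel" for e1 e2
    unfolding sq3_eq by measurable
  have ki: "integrable lborel (?k e1 e2)" if e: "e1 > 0" "e2 > 0" for e1 e2
  proof (rule Bochner_Integration.integrable_bound)
    show "integrable lborel (\<lambda>z. of_real ((B1 / e1) * (B2 / e2)) * (\<Phi> (fst z) * \<Gamma> (snd z)))"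
      by (intro integrable_mult_right integrable_prod_mult int \<Gamma>)
    have B: "0 \<le> (B1 / e1) * (B2 / e2)"
      using e order_trans[OF norm_ge_zero B1] order_trans[OF norm_ge_zero B2] by simp
    have "norm (?k e1 e2 z) \<le> norm (of_real ((B1 / e1) * (B2 / e2)) * (\<Phi> (fst z) * \<Gamma> (snd z)))" for z
    proof -
      have d: "norm (delta_kernel \<rho>1 \<rho>2 e1 e2 (w (snd z)) (hgt (fst z), rad (fst z))) \<le> (B1 / e1) * (B2 / e2)"
        using B1 B2 e by (intro delta_kernel_bound) auto
      have "norm (?k e1 e2 z) = norm (\<Gamma> (snd z)) * (norm (\<Phi> (fst z)) * norm (delta_kernel \<rho>1 \<rho>2 e1 e2 (w (snd z)) (hgt (fst z), rad (fst z))))"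
        using k[of "fst z" "snd z" e1 e2] by (simp add: norm_mult)
      also have "\<dots> \<le> norm (\<Gamma> (snd z)) * (norm (\<Phi> (fst z)) * ((B1 / e1) * (B2 / e2)))"
        by (intro mult_left_mono d) auto
      also have "\<dots> = norm (of_real ((B1 / e1) * (B2 / e2)) * (\<Phi> (fst z) * \<Gamma> (snd z)))"
        unfolding norm_mult[of "of_real _"] norm_of_real abs_of_nonneg[OF B] norm_mult by (simp only: mult_ac)
      finally show ?thesis .
    qed
    thus "AE z in lborel. norm (?k e1 e2 z) \<le> norm (of_real ((B1 / e1) * (B2 / e2)) * (\<Phi> (fst z) * \<Gamma> (snd z)))" by simp
  qed (use km in simp)
  let ?smear = "delta_setup.smear \<Phi> \<rho>1 \<rho>2" and ?c = "delta_setup.smear_const C \<rho>1 \<rho>2"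
  have inner: "(LINT v|lborel. ?k e1 e2 (v, u)) = \<Gamma> u * ?smear e1 e2 (w u)" for e1 e2 u
    unfolding k smear_def by (rule integral_mult_right_zero)
  have eq: "(LINT y|lborel. \<Phi> (fst (unflat y)) * \<Gamma> (snd (unflat y)) * of_real (\<rho>1 (3 * (hgt (fst (unflat y)) - hgt (w (snd (unflat y)))) / e1) / e1)
      * of_real (\<rho>2 ((sq3 (fst (unflat y)) - sq3 (w (snd (unflat y)))) / e2) / e2)) = (LINT u|lborel. \<Gamma> u * ?smear e1 e2 (w u))"
    if e: "e1 > 0" "e2 > 0" for e1 e2
    by (rule trans[OF integral_unflat(2)[OF km[of e1 e2]] lborel_Fubini(2)[OF ki[OF e], unfolded inner]])
  show "((\<lambda>(e1, e2). LINT y|lborel. \<Phi> (fst (unflat y)) * \<Gamma> (snd (unflat y)) * of_real (\<rho>1 (3 * (hgt (fst (unflat y)) - hgt (w (snd (unflat y)))) / e1) / e1)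
      * of_real (\<rho>2 ((sq3 (fst (unflat y)) - sq3 (w (snd (unflat y)))) / e2) / e2)) \<longlongrightarrow>
      (LINT u|lborel. \<Gamma> u * (of_real (sqrt 3 / 6) * circ \<Phi> (w u)))) (at_right 0 \<times>\<^sub>F at_right 0)"
  proof (rule tendsto_at_right_prodI)
    fix e1 e2 :: "nat \<Rightarrow> real"
    assume e: "\<And>n. e1 n > 0" "\<And>n. e2 n > 0" "e1 \<longlonglongrightarrow> 0" "e2 \<longlonglongrightarrow> 0"
    have sm: "(\<lambda>u. \<Gamma> u * ?smear (e1 n) (e2 n) (w u)) \<in> borel_measurable lborel" for n
      using borel_measurable_integrable[OF lborel_Fubini(4)[OF ki[OF e(1,2)]]] unfolding inner .
    have lim: "AE u in lborel. (\<lambda>n. \<Gamma> u * ?smear (e1 n) (e2 n) (w u)) \<longlonglongrightarrow> \<Gamma> u * (of_real (sqrt 3 / 6) * circ \<Phi> (w u))"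
      using pos by eventually_elim (intro tendsto_mult tendsto_const smear_tendsto e one)
    have "(\<lambda>n. LINT u|lborel. \<Gamma> u * ?smear (e1 n) (e2 n) (w u)) \<longlonglongrightarrow> (LINT u|lborel. \<Gamma> u * (of_real (sqrt 3 / 6) * circ \<Phi> (w u)))"
    proof (rule integral_dominated_convergence[where w="\<lambda>u. norm (\<Gamma> u) * ?c", OF _ sm _ lim])
      show "(\<lambda>u. \<Gamma> u * (of_real (sqrt 3 / 6) * circ \<Phi> (w u))) \<in> borel_measurable lborel"
      proof -
        have "(\<lambda>u. circ_prof \<Phi> (hgt (w u)) (rad (w u))) \<in> borel_measurable borel"
          using measurable_compose[OF borel_measurable_Pair circ_prof_measurable[OF \<Phi> bound], of "\<lambda>u. hgt (w u)" borel "\<lambda>u. rad (w u)"]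
          by simp
        thus ?thesis unfolding circ_eq_prof[OF \<Phi>] by measurable
      qed
      show "integrable lborel (\<lambda>u. norm (\<Gamma> u) * ?c)" using \<Gamma> by simp
      show "AE u in lborel. norm (\<Gamma> u * ?smear (e1 n) (e2 n) (w u)) \<le> norm (\<Gamma> u) * ?c" for n
        unfolding norm_mult by (intro AE_I2 mult_left_mono[OF smear_bound[OF e(1,2)]]) simp
    qed
    thus "(\<lambda>n. LINT y|lborel. \<Phi> (fst (unflat y)) * \<Gamma> (snd (unflat y)) * of_real (\<rho>1 (3 * (hgt (fst (unflat y)) - hgt (w (snd (unflat y)))) / e1 n) / e1 n)
      * of_real (\<rho>2 ((sq3 (fst (unflat y)) - sq3 (w (snd (unflat y)))) / e2 n) / e2 n)) \<longlonglongrightarrow>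
      (LINT u|lborel. \<Gamma> u * (of_real (sqrt 3 / 6) * circ \<Phi> (w u)))"
      unfolding eq[OF e(1,2)] .
  qed
qed

text \<open>The normal density is an admissible mollifier, so the defining condition is not vacuous,
  and the product filter is nontrivial.\<close>

lemma has_delta_integral_unique:
  assumes "has_delta_integral F O1 O2 I" "has_delta_integral F O1 O2 J" shows "I = J"
proof -
  let ?\<rho> = "poly_gauss 1 (1 / sqrt (2 * pi)) :: real \<Rightarrow> real"
  have "?\<rho> = std_normal_density"
    by (auto simp: fun_eq_iff poly_gauss_def std_normal_density_def)
  hence "(LINT s|lborel. ?\<rho> s) = 1" by (simp only: integral_normal_density zero_less_one)
  hence "\<exists>\<rho> :: real \<Rightarrow> real. schwartz \<rho> \<and> (LINT s|lborel. \<rho> s) = 1" using schwartz_poly_gauss by blast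
  hence "\<exists>T. (T \<longlongrightarrow> I) (at_right (0::real) \<times>\<^sub>F at_right (0::real)) \<and> (T \<longlongrightarrow> J) (at_right 0 \<times>\<^sub>F at_right 0)"
    using assms unfolding has_delta_integral_def by blast
  moreover have "at_right (0::real) \<times>\<^sub>F at_right (0::real) \<noteq> bot"
    by (simp add: prod_filter_eq_bot trivial_limit_at_right_real)
  ultimately show ?thesis using tendsto_unique by blast
qed

lemma delta_integral_eqI: "has_delta_integral F O1 O2 I \<Longrightarrow> delta_integral F O1 O2 = I"
  unfolding delta_integral_def using has_delta_integral_unique by blast

lemma AE_fst_neq:
  fixes g :: "'b::euclidean_space \<Rightarrow> real"
  assumes [measurable]: "g \<in> borel_measurable borel"
  shows "AE z in lborel. fst z \<noteq> g (snd z)"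
proof (rule AE_I[where N="{z. fst z = g (snd z)}"])
  have S[measurable]: "{z. fst z = g (snd z)} \<in> sets borel"
  proof -
    have "{z \<in> space borel. fst z = g (snd z)} \<in> sets borel" by measurable
    thus ?thesis by simp
  qed
  have "emeasure lborel {z. fst z = g (snd z)} = (\<integral>\<^sup>+z. indicator {z. fst z = g (snd z)} z \<partial>lborel)" by simp
  also have "\<dots> = (\<integral>\<^sup>+y. \<integral>\<^sup>+x. indicator {z. fst z = g (snd z)} (x, y) \<partial>lborel \<partial>lborel)"
    by (rule nn_integral_lborel_snd) simp
  also have "\<dots> = (\<integral>\<^sup>+y. \<integral>\<^sup>+x. indicator {g y} x \<partial>lborel \<partial>lborel)"
    by (intro nn_integral_cong) (auto split: split_indicator)
  also have "\<dots> = 0" by simp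
  finally show "emeasure lborel {z. fst z = g (snd z)} = 0" .
qed auto

text \<open>Up to a factor \<open>rad\<close> is the squared distance to the diagonal. Comparing
  just the outer coordinates suffices, as the bad set is then the graph treated in
  \<open>AE_fst_neq\<close>.\<close>

lemma rad_pos: assumes "x \<noteq> z" shows "rad (x, y, z) > 0"
proof -
  have "rad (x, y, z) = ((x - y)\<^sup>2 + (y - z)\<^sup>2 + (x - z)\<^sup>2) / 18"
    by (simp add: rad_def power2_eq_square field_simps)
  moreover have "0 < (x - y)\<^sup>2 + (y - z)\<^sup>2 + (x - z)\<^sup>2" using assms by (intro add_nonneg_pos) auto
  ultimately show ?thesis by (metis divide_pos_pos zero_less_numeral)
qed

section \<open>The averaged pairing\<close>

definition tens :: "(real \<Rightarrow> complex) \<Rightarrow> (real \<Rightarrow> complex) \<Rightarrow> (real \<Rightarrow> complex) \<Rightarrow> r3 \<Rightarrow> complex" where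
  "tens f g h w = f (fst w) * (g (fst (snd w)) * h (snd (snd w)))"

lemma tens_measurable [measurable]:
  assumes [measurable]: "f \<in> borel_measurable borel" "g \<in> borel_measurable borel" "h \<in> borel_measurable borel"
  shows "tens f g h \<in> borel_measurable borel"
proof -
  have [measurable]: "(\<lambda>w::r3. fst (snd w)) \<in> borel_measurable borel" "(\<lambda>w::r3. snd (snd w)) \<in> borel_measurable borel"
    by (intro borel_measurable_continuous_onI continuous_intros)+
  show ?thesis unfolding tens_def[abs_def] by measurable
qed

lemma tens_integrable:
  "integrable lborel f \<Longrightarrow> integrable lborel g \<Longrightarrow> integrable lborel h \<Longrightarrow> integrable lborel (tens f g h)"
  unfolding tens_def[abs_def] using integrable_prod_mult[of f "\<lambda>p. g (fst p) * h (snd p)"] integrable_prod_mult[of g h]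
  by simp

lemma nn_integral_prod_mult:
  fixes f :: "'a::euclidean_space \<Rightarrow> ennreal" and g :: "'b::euclidean_space \<Rightarrow> ennreal"
  assumes [measurable]: "f \<in> borel_measurable borel" "g \<in> borel_measurable borel"
  shows "(\<integral>\<^sup>+z. f (fst z) * g (snd z) \<partial>lborel) = (\<integral>\<^sup>+x. f x \<partial>lborel) * (\<integral>\<^sup>+x. g x \<partial>lborel)"
  using nn_integral_lborel_fst[of "\<lambda>z. f (fst z) * g (snd z)"] by (simp add: nn_integral_cmult nn_integral_multc)

lemma L2_nn_integral: "L2 f \<Longrightarrow> (\<integral>\<^sup>+x. ennreal ((norm (f x))\<^sup>2) \<partial>lborel) = ennreal ((l2n f)\<^sup>2)"
  unfolding l2n_sq by (intro nn_integral_eq_integral) (auto simp: L2_def)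

lemma tens_nn_integral:
  assumes L: "L2 f" "L2 g" "L2 h"
  shows "(\<integral>\<^sup>+w. ennreal ((norm (tens f g h w))\<^sup>2) \<partial>lborel) = ennreal ((l2n f * l2n g * l2n h)\<^sup>2)"
proof -
  have [measurable]: "f \<in> borel_measurable borel" "g \<in> borel_measurable borel" "h \<in> borel_measurable borel"
    using L by (auto simp: L2_def)
  have "(\<integral>\<^sup>+w. ennreal ((norm (tens f g h w))\<^sup>2) \<partial>lborel)
     = (\<integral>\<^sup>+w. ennreal ((norm (f (fst w)))\<^sup>2) * (\<lambda>p. ennreal ((norm (g (fst p)))\<^sup>2) * ennreal ((norm (h (snd p)))\<^sup>2)) (snd w) \<partial>lborel)"
    by (simp add: tens_def norm_mult power_mult_distrib ennreal_mult)
  also have "\<dots> = ennreal ((l2n f)\<^sup>2) * (ennreal ((l2n g)\<^sup>2) * ennreal ((l2n h)\<^sup>2))"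
    by (subst nn_integral_prod_mult, measurable, subst nn_integral_prod_mult) (simp_all add: L2_nn_integral L)
  finally show ?thesis by (simp add: power_mult_distrib ennreal_mult mult.assoc)
qed

text \<open>The cut-off in the angle is written into both factors, so that each of them is square
  integrable on the product space and Cauchy-Schwarz applies to the pair.\<close>

definition rq_integrand :: "(nat \<Rightarrow> real \<Rightarrow> complex) \<Rightarrow> real \<times> r3 \<Rightarrow> complex" where
  "rq_integrand F z = (indicator {-pi..pi} (fst z) *\<^sub>R tens (F 0) (F 1) (F 2) (Rot (fst z) (snd z))) *
     cnj (indicator {-pi..pi} (fst z) *\<^sub>R tens (F 3) (F 4) (F 5) (snd z))"

definition RQ :: "(nat \<Rightarrow> real \<Rightarrow> complex) \<Rightarrow> complex" where
  "RQ F = (LINT z|lborel. rq_integrand F z)"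

text \<open>Cauchy-Schwarz over angle and point. The squared norm of each factor is 2 pi times that
  of a tensor product: for the rotated one by invariance of Lebesgue measure, for the other by
  Tonelli.\<close>

lemma RQ_bounds:
  assumes L: "\<And>i. i < 6 \<Longrightarrow> L2 (F i)"
  shows "integrable lborel (rq_integrand F)" and "norm (RQ F) \<le> 2 * pi * (\<Prod>i<6. l2n (F i))"
proof -
  have [measurable]: "F 0 \<in> borel_measurable borel" "F 1 \<in> borel_measurable borel" "F 2 \<in> borel_measurable borel"
    "F 3 \<in> borel_measurable borel" "F 4 \<in> borel_measurable borel" "F 5 \<in> borel_measurable borel"
    by (auto intro!: L2_measurable L)
  let ?\<Phi> = "tens (F 0) (F 1) (F 2)" and ?\<Psi> = "tens (F 3) (F 4) (F 5)"
  let ?a = "l2n (F 0) * l2n (F 1) * l2n (F 2)" and ?b = "l2n (F 3) * l2n (F 4) * l2n (F 5)"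
  let ?X = "\<lambda>z. indicator {-pi..pi} (fst z) *\<^sub>R ?\<Phi> (Rot (fst z) (snd z))"
  let ?Y = "\<lambda>z::real\<times>r3. cnj (indicator {-pi..pi} (fst z) *\<^sub>R ?\<Psi> (snd z))"
  have [measurable]: "(\<lambda>z. ?\<Phi> (Rot (fst z) (snd z))) \<in> borel_measurable borel"
    by (rule measurable_compose[OF Rot_measurable_pair]) measurable
  have mX[measurable]: "?X \<in> borel_measurable borel" and mY[measurable]: "?Y \<in> borel_measurable borel"
    by measurable
  have nX: "(\<integral>\<^sup>+z. ennreal ((norm (?X z))\<^sup>2) \<partial>lborel) = ennreal (2 * pi * ?a\<^sup>2)"
  proof -
    have "(\<integral>\<^sup>+z. ennreal ((norm (?X z))\<^sup>2) \<partial>lborel) = (\<integral>\<^sup>+z. indicator {-pi..pi} (fst z) * ennreal ((norm (?\<Phi> (Rot (fst z) (snd z))))\<^sup>2) \<partial>lborel)"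
      by (intro nn_integral_cong) (auto split: split_indicator)
    also have "\<dots> = ennreal (2 * pi) * (\<integral>\<^sup>+w. ennreal ((norm (?\<Phi> w))\<^sup>2) \<partial>lborel)"
      by (rule nn_integral_Rot_pair) measurable
    also have "\<dots> = ennreal (2 * pi * ?a\<^sup>2)" by (subst tens_nn_integral) (auto intro: L simp: ennreal_mult)
    finally show ?thesis .
  qed
  have nY: "(\<integral>\<^sup>+z. ennreal ((norm (?Y z))\<^sup>2) \<partial>lborel) = ennreal (2 * pi * ?b\<^sup>2)"
  proof -
    have "(\<integral>\<^sup>+z. ennreal ((norm (?Y z))\<^sup>2) \<partial>lborel) = (\<integral>\<^sup>+z. indicator {-pi..pi} (fst z) * ennreal ((norm (?\<Psi> (snd z)))\<^sup>2) \<partial>(lborel :: (real \<times> r3) measure))"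
      by (intro nn_integral_cong) (auto split: split_indicator)
    also have "\<dots> = (\<integral>\<^sup>+\<theta>. indicator {-pi..pi} \<theta> \<partial>lborel) * (\<integral>\<^sup>+w. ennreal ((norm (?\<Psi> w))\<^sup>2) \<partial>lborel)"
      by (rule nn_integral_prod_mult) measurable
    also have "\<dots> = ennreal (2 * pi * ?b\<^sup>2)"
      by (subst tens_nn_integral) (auto intro: L simp: ennreal_mult emeasure_lborel_Icc_eq)
    finally show ?thesis .
  qed
  have iX: "integrable lborel (\<lambda>z. (norm (?X z))\<^sup>2)"
  proof (rule integrableI_bounded)
    show "(\<lambda>z. (norm (?X z))\<^sup>2) \<in> borel_measurable lborel" using mX by measurable
  qed (use nX in simp)
  have iY: "integrable lborel (\<lambda>z. (norm (?Y z))\<^sup>2)"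
  proof (rule integrableI_bounded)
    show "(\<lambda>z. (norm (?Y z))\<^sup>2) \<in> borel_measurable lborel" using mY by measurable
  qed (use nY in simp)
  have "ennreal (LINT z|lborel. (norm (?X z))\<^sup>2) = ennreal (2 * pi * ?a\<^sup>2)"
    using nn_integral_eq_integral[OF iX] nX by simp
  hence vX: "(LINT z|lborel. (norm (?X z))\<^sup>2) = 2 * pi * ?a\<^sup>2" by (subst (asm) ennreal_inj) auto
  have "ennreal (LINT z|lborel. (norm (?Y z))\<^sup>2) = ennreal (2 * pi * ?b\<^sup>2)"
    using nn_integral_eq_integral[OF iY] nY by simp
  hence vY: "(LINT z|lborel. (norm (?Y z))\<^sup>2) = 2 * pi * ?b\<^sup>2" by (subst (asm) ennreal_inj) auto
  have eq: "rq_integrand F = (\<lambda>z. ?X z * ?Y z)" by (simp add: rq_integrand_def fun_eq_iff)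
  show i: "integrable lborel (rq_integrand F)"
    unfolding eq using mX mY by (intro integrable_mult_of_squares iX iY) simp_all
  have "norm (RQ F) \<le> (LINT z|lborel. norm (?X z) * norm (?Y z))"
    unfolding RQ_def eq by (rule order_trans[OF integral_norm_bound]) (simp only: norm_mult order_refl)
  also have "\<dots> \<le> sqrt (LINT z|lborel. (norm (?X z))\<^sup>2) * sqrt (LINT z|lborel. (norm (?Y z))\<^sup>2)"
    using mX mY by (intro Cauchy_Schwarz_integral iX iY) simp_all
  also have "\<dots> = (sqrt (2 * pi) * ?a) * (sqrt (2 * pi) * ?b)"
    unfolding vX vY by (simp add: real_sqrt_mult)
  also have "\<dots> = (sqrt (2 * pi) * sqrt (2 * pi)) * (?a * ?b)" by (simp only: mult_ac)
  also have "\<dots> = 2 * pi * (\<Prod>i<6. l2n (F i))"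
    by (simp add: eval_nat_numeral lessThan_Suc mult_ac)
  finally show "norm (RQ F) \<le> 2 * pi * (\<Prod>i<6. l2n (F i))" .
qed

lemma RQ_eq_circ:
  assumes L: "\<And>i. i < 6 \<Longrightarrow> L2 (F i)"
  shows "RQ F = (LINT w|lborel. circ (tens (F 0) (F 1) (F 2)) w * cnj (tens (F 3) (F 4) (F 5) w))"
    and "integrable lborel (\<lambda>w. circ (tens (F 0) (F 1) (F 2)) w * cnj (tens (F 3) (F 4) (F 5) w))"
proof -
  note i = RQ_bounds(1)[of F, OF L]
  have "(LINT \<theta>|lborel. rq_integrand F (\<theta>, w)) = circ (tens (F 0) (F 1) (F 2)) w * cnj (tens (F 3) (F 4) (F 5) w)" for w
  proof -
    have "rq_integrand F (\<theta>, w) = (indicator {-pi..pi} \<theta> *\<^sub>R tens (F 0) (F 1) (F 2) (Rot \<theta> w)) * cnj (tens (F 3) (F 4) (F 5) w)" for \<theta>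
      by (auto simp: rq_integrand_def split: split_indicator)
    thus ?thesis unfolding circ_def by (simp only: integral_mult_left_zero)
  qed
  with lborel_Fubini(2,4)[OF i] show "RQ F = (LINT w|lborel. circ (tens (F 0) (F 1) (F 2)) w * cnj (tens (F 3) (F 4) (F 5) w))"
    "integrable lborel (\<lambda>w. circ (tens (F 0) (F 1) (F 2)) w * cnj (tens (F 3) (F 4) (F 5) w))"
    unfolding RQ_def by simp_all
qed

section \<open>The identity for coherent states\<close>

lemma integral_cis:
  "(LINT \<tau>|lborel. indicator {-pi..pi} \<tau> *\<^sub>R cis (of_int m * \<tau>)) = (if m = 0 then 2 * pi else 0)"
proof (cases "m = 0")
  case True thus ?thesis by (simp add: scaleR_conv_of_real)
next
  case False
  define F where "F \<tau> = cis (of_int m * \<tau>) / (\<i> * of_int m)" for \<tau>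
  have "(F has_vector_derivative cis (of_int m * \<tau>)) (at \<tau> within {-pi..pi})" for \<tau>
  proof -
    have "((\<lambda>w. exp (\<i> * of_int m * w) / (\<i> * of_int m)) has_field_derivative exp (\<i> * of_int m * of_real \<tau>)) (at (of_real \<tau>))"
      using False by (auto intro!: derivative_eq_intros)
    from has_vector_derivative_real_field[OF this]
    have "((\<lambda>\<tau>. exp (\<i> * of_int m * of_real \<tau>) / (\<i> * of_int m)) has_vector_derivative exp (\<i> * of_int m * of_real \<tau>)) (at \<tau> within {-pi..pi})"
      by (rule has_vector_derivative_at_within)
    moreover have "exp (\<i> * of_int m * of_real \<tau>) = cis (of_int m * \<tau>)" for \<tau> by (simp add: cis_conv_exp mult_ac)
    ultimately show ?thesis unfolding F_def by simp
  qed
  hence "(LINT \<tau>|lborel. indicator {-pi..pi} \<tau> *\<^sub>R cis (of_int m * \<tau>)) = F pi - F (- pi)"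
    by (intro integral_FTC_Icc) (auto intro!: continuous_intros)
  also have "\<dots> = 0"
    using sin_int_times_real[of m] by (simp add: F_def complex_eq_iff diff_divide_distrib[symmetric] sin_npi_int mult.commute[of _ pi] cis.code) 
  finally show ?thesis using False by simp
qed

text \<open>This is 2 pi I_0(2 sqrt(a b)) with I_0 the modified Bessel function.\<close>

definition J :: "complex \<Rightarrow> complex \<Rightarrow> complex" where
  "J a b = (LINT \<tau>|lborel. indicator {-pi..pi} \<tau> *\<^sub>R exp (a * cis \<tau> + b * cis (- \<tau>)))"

text \<open>In the binomial expansion only the central term does not oscillate, and it exists for
  even n alone.\<close>

lemma integral_cis_power:
  fixes a b :: complex
  shows "(LINT \<tau>|lborel. indicator {-pi..pi} \<tau> *\<^sub>R (a * cis \<tau> + b * cis (- \<tau>)) ^ n)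
    = (if even n then 2 * pi * of_nat (n choose (n div 2)) * (a * b) ^ (n div 2) else 0)"
proof -
  have "(a * cis \<tau> + b * cis (- \<tau>)) ^ n = (\<Sum>j\<le>n. (of_nat (n choose j) * a ^ j * b ^ (n - j)) * cis (of_int (2 * int j - int n) * \<tau>))" for \<tau>
  proof -
    have "(a * cis \<tau> + b * cis (- \<tau>)) ^ n = (\<Sum>j\<le>n. of_nat (n choose j) * (a * cis \<tau>) ^ j * (b * cis (- \<tau>)) ^ (n - j))"
      by (rule binomial_ring)
    also have "\<dots> = (\<Sum>j\<le>n. (of_nat (n choose j) * a ^ j * b ^ (n - j)) * cis (of_int (2 * int j - int n) * \<tau>))"
    proof (rule sum.cong[OF refl])
      fix j assume "j \<in> {..n}"
      hence "cis \<tau> ^ j * cis (- \<tau>) ^ (n - j) = cis (of_int (2 * int j - int n) * \<tau>)"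
        by (simp add: Complex.DeMoivre cis_mult of_nat_diff algebra_simps)
      moreover have "of_nat (n choose j) * (a * cis \<tau>) ^ j * (b * cis (- \<tau>)) ^ (n - j)
         = (of_nat (n choose j) * a ^ j * b ^ (n - j)) * (cis \<tau> ^ j * cis (- \<tau>) ^ (n - j))"
        by (simp add: power_mult_distrib mult_ac)
      ultimately show "of_nat (n choose j) * (a * cis \<tau>) ^ j * (b * cis (- \<tau>)) ^ (n - j)
         = (of_nat (n choose j) * a ^ j * b ^ (n - j)) * cis (of_int (2 * int j - int n) * \<tau>)" by simp
    qed
    finally show ?thesis .
  qed
  hence "(LINT \<tau>|lborel. indicator {-pi..pi} \<tau> *\<^sub>R (a * cis \<tau> + b * cis (- \<tau>)) ^ n)
    = (LINT \<tau>|lborel. (\<Sum>j\<le>n. (of_nat (n choose j) * a ^ j * b ^ (n - j)) * (indicator {-pi..pi} \<tau> *\<^sub>R cis (of_int (2 * int j - int n) * \<tau>))))"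
    by (simp add: scaleR_sum_right)
  also have "\<dots> = (\<Sum>j\<le>n. (LINT \<tau>|lborel. (of_nat (n choose j) * a ^ j * b ^ (n - j)) * (indicator {-pi..pi} \<tau> *\<^sub>R cis (of_int (2 * int j - int n) * \<tau>))))"
    by (intro Bochner_Integration.integral_sum integrable_mult_right integrable_indicator_continuous continuous_intros)
  also have "\<dots> = (\<Sum>j\<le>n. (of_nat (n choose j) * a ^ j * b ^ (n - j)) * (if 2 * int j - int n = 0 then 2 * pi else 0))"
    unfolding integral_mult_right_zero integral_cis ..
  also have "\<dots> = (if even n then 2 * pi * of_nat (n choose (n div 2)) * (a * b) ^ (n div 2) else 0)"
  proof (cases "even n")
    case True
    then obtain k where k: "n = 2 * k" by (auto elim: evenE)
    have "(\<Sum>j\<le>n. (of_nat (n choose j) * a ^ j * b ^ (n - j)) * (if 2 * int j - int n = 0 then 2 * pi else 0))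
       = (\<Sum>j\<in>{k}. (of_nat (n choose j) * a ^ j * b ^ (n - j)) * complex_of_real (2 * pi))"
      by (rule sum.mono_neutral_cong_right) (auto simp: k)
    thus ?thesis using True by (simp add: k power_mult_distrib mult_ac)
  next
    case False
    hence "2 * int j - int n \<noteq> 0" for j by presburger
    thus ?thesis using False by simp
  qed
  finally show ?thesis .
qed

lemma J_tendsto:
  "(\<lambda>N. \<Sum>n<N. (LINT \<tau>|lborel. indicator {-pi..pi} \<tau> *\<^sub>R (a * cis \<tau> + b * cis (- \<tau>)) ^ n) / fact n) \<longlonglongrightarrow> J a b"
proof -
  let ?u = "\<lambda>\<tau>. a * cis \<tau> + b * cis (- \<tau>)"
  have m: "(\<lambda>\<tau>. indicator {-pi..pi} \<tau> *\<^sub>R (\<Sum>n<N. ?u \<tau> ^ n / fact n)) \<in> borel_measurable lborel" for N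
    by (intro borel_measurable_integrable integrable_indicator_continuous continuous_intros) auto
  have "(\<lambda>N. LINT \<tau>|lborel. indicator {-pi..pi} \<tau> *\<^sub>R (\<Sum>n<N. ?u \<tau> ^ n / fact n)) \<longlonglongrightarrow> J a b"
    unfolding J_def
  proof (rule integral_dominated_convergence[where w="\<lambda>\<tau>. exp (norm a + norm b) * indicator {-pi..pi} \<tau>"])
    show "(\<lambda>\<tau>. indicator {-pi..pi} \<tau> *\<^sub>R exp (?u \<tau>)) \<in> borel_measurable lborel"
      by (intro borel_measurable_integrable integrable_indicator_continuous continuous_intros)
    show "(\<lambda>\<tau>. indicator {-pi..pi} \<tau> *\<^sub>R (\<Sum>n<N. ?u \<tau> ^ n / fact n)) \<in> borel_measurable lborel" for N by (rule m)
    show "integrable lborel (\<lambda>\<tau>. exp (norm a + norm b) * indicator {-pi..pi} \<tau>)"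
      by (intro integrable_mult_right integrable_real_indicator) (auto simp: emeasure_lborel_Icc_eq)
    show "AE \<tau> in lborel. (\<lambda>N. indicator {-pi..pi} \<tau> *\<^sub>R (\<Sum>n<N. ?u \<tau> ^ n / fact n)) \<longlonglongrightarrow> indicator {-pi..pi} \<tau> *\<^sub>R exp (?u \<tau>)"
    proof (intro AE_I2 tendsto_scaleR tendsto_const)
      fix \<tau>
      have "(\<lambda>n. ?u \<tau> ^ n /\<^sub>R fact n) sums exp (?u \<tau>)" by (rule exp_converges)
      thus "(\<lambda>N. \<Sum>n<N. ?u \<tau> ^ n / fact n) \<longlonglongrightarrow> exp (?u \<tau>)"
        by (simp add: sums_def scaleR_conv_of_real divide_inverse mult.commute)
    qed
    fix N
    have "norm (\<Sum>n<N. ?u \<tau> ^ n / fact n) \<le> exp (norm a + norm b)" for \<tau>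
    proof -
      have u: "norm (?u \<tau>) \<le> norm a + norm b" using norm_triangle_ineq[of "a * cis \<tau>" "b * cis (- \<tau>)"] by (simp add: norm_mult)
      have "norm (\<Sum>n<N. ?u \<tau> ^ n / fact n) \<le> (\<Sum>n<N. inverse (fact n) * (norm a + norm b) ^ n)"
        using power_mono[OF u norm_ge_zero]
        by (intro order_trans[OF norm_sum] sum_mono) (simp add: norm_divide norm_power norm_mult norm_inverse divide_inverse mult.commute)
      also have "\<dots> \<le> (\<Sum>n. inverse (fact n) * (norm a + norm b) ^ n)"
        by (intro sum_le_suminf summable_exp) auto
      also have "\<dots> = exp (norm a + norm b)" by (simp add: exp_def)
      finally show ?thesis .
    qed
    thus "AE \<tau> in lborel. norm (indicator {-pi..pi} \<tau> *\<^sub>R (\<Sum>n<N. ?u \<tau> ^ n / fact n)) \<le> exp (norm a + norm b) * indicator {-pi..pi} \<tau>"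
      by (intro AE_I2) (auto split: split_indicator)
  qed
  moreover have "(LINT \<tau>|lborel. indicator {-pi..pi} \<tau> *\<^sub>R (\<Sum>n<N. ?u \<tau> ^ n / fact n))
    = (\<Sum>n<N. (LINT \<tau>|lborel. indicator {-pi..pi} \<tau> *\<^sub>R ?u \<tau> ^ n) / fact n)" for N
  proof -
    have "(LINT \<tau>|lborel. indicator {-pi..pi} \<tau> *\<^sub>R (\<Sum>n<N. ?u \<tau> ^ n / fact n))
      = (LINT \<tau>|lborel. (\<Sum>n<N. (indicator {-pi..pi} \<tau> *\<^sub>R ?u \<tau> ^ n) / fact n))"
      by (simp only: sum_distrib_left scaleR_conv_of_real times_divide_eq_right)
    also have "\<dots> = (\<Sum>n<N. (LINT \<tau>|lborel. (indicator {-pi..pi} \<tau> *\<^sub>R ?u \<tau> ^ n) / fact n))"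
      by (intro Bochner_Integration.integral_sum integrable_divide integrable_indicator_continuous continuous_intros)
    finally show ?thesis by (simp only: integral_divide_zero)
  qed
  ultimately show ?thesis by simp
qed

text \<open>All terms of the series depend on a and b through a b. This is what allows the rotation
  angle and the time variable to be compared without matching their coefficients one by one.\<close>

lemma J_cong: assumes "a * b = a' * b'" shows "J a b = J a' b'"
  using LIMSEQ_unique[OF J_tendsto[of a b, unfolded integral_cis_power assms] J_tendsto[of a' b', unfolded integral_cis_power]] .

definition gau :: "complex \<Rightarrow> real \<Rightarrow> complex" where
  "gau \<beta> x = exp (- of_real (1 * x\<^sup>2) + \<beta> * of_real x)"

lemma gau_integral: "integrable lborel (gau \<beta>)" "(LINT x|lborel. gau \<beta> x) = of_real (sqrt pi) * exp (\<beta>\<^sup>2 / 4)"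
  using gaussian_integral[of 1 \<beta>] unfolding gau_def[abs_def] by (auto simp: has_bochner_integral_iff)

lemma tens_gau_integral:
  "(LINT w|lborel. tens (gau \<beta>0) (gau \<beta>1) (gau \<beta>2) w) = of_real (sqrt pi ^ 3) * exp ((\<beta>0\<^sup>2 + \<beta>1\<^sup>2 + \<beta>2\<^sup>2) / 4)"
proof -
  have "(LINT w|lborel. tens (gau \<beta>0) (gau \<beta>1) (gau \<beta>2) w) =
     (LINT x|lborel. gau \<beta>0 x) * ((LINT x|lborel. gau \<beta>1 x) * (LINT x|lborel. gau \<beta>2 x))"
    unfolding tens_def[abs_def]
    using integral_prod_mult[OF gau_integral(1)[of \<beta>0] integrable_prod_mult[OF gau_integral(1)[of \<beta>1] gau_integral(1)[of \<beta>2]]]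
      integral_prod_mult[OF gau_integral(1)[of \<beta>1] gau_integral(1)[of \<beta>2]] by simp
  also have "\<dots> = of_real (sqrt pi ^ 3) * exp (\<beta>0\<^sup>2 / 4 + \<beta>1\<^sup>2 / 4 + \<beta>2\<^sup>2 / 4)"
    unfolding gau_integral(2) exp_add power3_eq_cube of_real_mult by (simp only: mult_ac)
  finally show ?thesis by (simp add: add_divide_distrib)
qed

text \<open>Cyclic correlations of the first three parameters with the conjugates of the last three,
  as produced by a circulant matrix. The index is i - k modulo 3, with 3 added to keep the
  subtraction from being truncated for k \<le> 2.\<close>

definition cdot :: "(nat \<Rightarrow> complex) \<Rightarrow> nat \<Rightarrow> complex" where
  "cdot z k = z 0 * cnj (z (3 + (3 - k) mod 3)) + z 1 * cnj (z (3 + (4 - k) mod 3)) + z 2 * cnj (z (3 + (5 - k) mod 3))"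

lemma cdot_simps:
  "cdot z 0 = z 0 * cnj (z 3) + z 1 * cnj (z 4) + z 2 * cnj (z 5)"
  "cdot z 1 = z 0 * cnj (z 5) + z 1 * cnj (z 3) + z 2 * cnj (z 4)"
  "cdot z 2 = z 0 * cnj (z 4) + z 1 * cnj (z 5) + z 2 * cnj (z 3)"
  by (simp_all add: cdot_def)

definition csum :: "(nat \<Rightarrow> complex) \<Rightarrow> complex" where "csum z = z 0 + z 1 + z 2"
definition csq :: "(nat \<Rightarrow> complex) \<Rightarrow> complex" where "csq z = (z 0)\<^sup>2 + (z 1)\<^sup>2 + (z 2)\<^sup>2"
text \<open>The conjugated second half, shifted to indices 0 to 2, so that \<open>csum\<close>,
  \<open>csq\<close> and \<open>cP\<close> apply to both halves.\<close>

definition ctail :: "(nat \<Rightarrow> complex) \<Rightarrow> nat \<Rightarrow> complex" where "ctail z i = cnj (z (3 + i))"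

lemma ctail_simps: "ctail z 0 = cnj (z 3)" "ctail z 1 = cnj (z 4)" "ctail z 2 = cnj (z 5)"
  by (simp_all add: ctail_def)

text \<open>Rotation preserves the sum of squares, so the integrand is again a pure Gaussian. By
  orthogonality the squares of the parameters cancel when the square is completed, and only the
  correlations \<open>cdot\<close> remain.\<close>

lemma inner_RQ_coh:
  "(LINT w|lborel. tens (coh (z 0)) (coh (z 1)) (coh (z 2)) (Rot \<theta> w) * cnj (tens (coh (z 3)) (coh (z 4)) (coh (z 5)) w))
    = of_real (sqrt pi ^ 3) * exp ((RA \<theta> * cdot z 0 + RC \<theta> * cdot z 1 + RB \<theta> * cdot z 2) / 2)"
proof -
  define a b c where "a = complex_of_real (RA \<theta>)" and "b = complex_of_real (RB \<theta>)" and "c = complex_of_real (RC \<theta>)"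
  \<comment> \<open>Coefficients of the three coordinates in the linear part of the exponent; the
    first three parameters enter through the transpose of the rotation.\<close>
  define \<beta>0 \<beta>1 \<beta>2 where "\<beta>0 = a * z 0 + c * z 1 + b * z 2 + cnj (z 3)" and "\<beta>1 = b * z 0 + a * z 1 + c * z 2 + cnj (z 4)"
    and "\<beta>2 = c * z 0 + b * z 1 + a * z 2 + cnj (z 5)"
  define q where "q = ((z 0)\<^sup>2 + (z 1)\<^sup>2 + (z 2)\<^sup>2 + (cnj (z 3))\<^sup>2 + (cnj (z 4))\<^sup>2 + (cnj (z 5))\<^sup>2) / 4"
  have sq: "a\<^sup>2 + b\<^sup>2 + c\<^sup>2 = 1" and o: "a * b + b * c + c * a = 0"
  proof -
    have "a\<^sup>2 + b\<^sup>2 + c\<^sup>2 = of_real ((RA \<theta>)\<^sup>2 + (RB \<theta>)\<^sup>2 + (RC \<theta>)\<^sup>2)" by (simp add: a_def b_def c_def)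
    thus "a\<^sup>2 + b\<^sup>2 + c\<^sup>2 = 1" unfolding R_squares(1) by simp
    have "a * b + b * c + c * a = of_real (RA \<theta> * RB \<theta> + RB \<theta> * RC \<theta> + RC \<theta> * RA \<theta>)" by (simp add: a_def b_def c_def)
    thus "a * b + b * c + c * a = 0" unfolding R_squares(2) by simp
  qed
  have e: "tens (coh (z 0)) (coh (z 1)) (coh (z 2)) (Rot \<theta> w) * cnj (tens (coh (z 3)) (coh (z 4)) (coh (z 5)) w)
     = exp (- q) * tens (gau \<beta>0) (gau \<beta>1) (gau \<beta>2) w" for w
  proof -
    obtain x1 x2 x3 where w: "w = (x1, x2, x3)" by (cases w) auto
    obtain r1 r2 r3 where r: "Rot \<theta> w = (r1, r2, r3)" by (cases "Rot \<theta> w") auto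
    have rr: "complex_of_real r1 = a * x1 + b * x2 + c * x3" "complex_of_real r2 = c * x1 + a * x2 + b * x3"
      "complex_of_real r3 = b * x1 + c * x2 + a * x3"
      using r unfolding w Rot_def a_def b_def c_def by (auto simp: of_real_add of_real_mult)
    have "sq3 (Rot \<theta> w) = sq3 w" unfolding sq3_eq hgt_Rot rad_Rot ..
    hence "r1\<^sup>2 + r2\<^sup>2 + r3\<^sup>2 = x1\<^sup>2 + x2\<^sup>2 + x3\<^sup>2" unfolding r unfolding w by (simp add: sq3_def)
    hence "r1\<^sup>2 / 2 + r2\<^sup>2 / 2 + r3\<^sup>2 / 2 = x1\<^sup>2 / 2 + x2\<^sup>2 / 2 + x3\<^sup>2 / 2" by (simp add: field_simps)
    hence n: "complex_of_real (r1\<^sup>2 / 2) + of_real (r2\<^sup>2 / 2) + of_real (r3\<^sup>2 / 2) = of_real (x1\<^sup>2 / 2) + of_real (x2\<^sup>2 / 2) + of_real (x3\<^sup>2 / 2)"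
      unfolding of_real_add[symmetric] by (rule arg_cong)
    have L: "tens (coh (z 0)) (coh (z 1)) (coh (z 2)) (Rot \<theta> w) * cnj (tens (coh (z 3)) (coh (z 4)) (coh (z 5)) w)
      = exp (((- of_real (r1\<^sup>2 / 2) + z 0 * of_real r1 - (z 0)\<^sup>2 / 4) + ((- of_real (r2\<^sup>2 / 2) + z 1 * of_real r2 - (z 1)\<^sup>2 / 4)
         + (- of_real (r3\<^sup>2 / 2) + z 2 * of_real r3 - (z 2)\<^sup>2 / 4)))
       + cnj ((- of_real (x1\<^sup>2 / 2) + z 3 * of_real x1 - (z 3)\<^sup>2 / 4) + ((- of_real (x2\<^sup>2 / 2) + z 4 * of_real x2 - (z 4)\<^sup>2 / 4)
         + (- of_real (x3\<^sup>2 / 2) + z 5 * of_real x3 - (z 5)\<^sup>2 / 4))))"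
      unfolding r unfolding w tens_def coh_def fst_conv snd_conv exp_cnj exp_add[symmetric] ..
    have R: "exp (- q) * tens (gau \<beta>0) (gau \<beta>1) (gau \<beta>2) w = exp (- q + ((- of_real (1 * x1\<^sup>2) + \<beta>0 * of_real x1) + ((- of_real (1 * x2\<^sup>2) + \<beta>1 * of_real x2) + (- of_real (1 * x3\<^sup>2) + \<beta>2 * of_real x3))))"
      unfolding w tens_def gau_def fst_conv snd_conv exp_add[symmetric] ..
    have "((- of_real (r1\<^sup>2 / 2) + z 0 * of_real r1 - (z 0)\<^sup>2 / 4) + ((- of_real (r2\<^sup>2 / 2) + z 1 * of_real r2 - (z 1)\<^sup>2 / 4)
         + (- of_real (r3\<^sup>2 / 2) + z 2 * of_real r3 - (z 2)\<^sup>2 / 4)))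
       + cnj ((- of_real (x1\<^sup>2 / 2) + z 3 * of_real x1 - (z 3)\<^sup>2 / 4) + ((- of_real (x2\<^sup>2 / 2) + z 4 * of_real x2 - (z 4)\<^sup>2 / 4)
         + (- of_real (x3\<^sup>2 / 2) + z 5 * of_real x3 - (z 5)\<^sup>2 / 4)))
      = - (complex_of_real (r1\<^sup>2 / 2) + of_real (r2\<^sup>2 / 2) + of_real (r3\<^sup>2 / 2)) - (of_real (x1\<^sup>2 / 2) + of_real (x2\<^sup>2 / 2) + of_real (x3\<^sup>2 / 2))
        + (z 0 * of_real r1 + z 1 * of_real r2 + z 2 * of_real r3) + (cnj (z 3) * x1 + cnj (z 4) * x2 + cnj (z 5) * x3) - q"
      by (simp add: q_def algebra_simps add_divide_distrib)
    also have "\<dots> = - q + ((- of_real (1 * x1\<^sup>2) + \<beta>0 * of_real x1) + ((- of_real (1 * x2\<^sup>2) + \<beta>1 * of_real x2) + (- of_real (1 * x3\<^sup>2) + \<beta>2 * of_real x3)))"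
      unfolding n rr \<beta>0_def \<beta>1_def \<beta>2_def by (simp add: algebra_simps)
    finally show ?thesis unfolding L R by (rule arg_cong[where f=exp])
  qed
  have "(\<beta>0\<^sup>2 + \<beta>1\<^sup>2 + \<beta>2\<^sup>2) = (a\<^sup>2 + b\<^sup>2 + c\<^sup>2) * ((z 0)\<^sup>2 + (z 1)\<^sup>2 + (z 2)\<^sup>2)
     + 2 * (a * b + b * c + c * a) * (z 0 * z 1 + z 1 * z 2 + z 2 * z 0)
     + ((cnj (z 3))\<^sup>2 + (cnj (z 4))\<^sup>2 + (cnj (z 5))\<^sup>2) + 2 * (a * cdot z 0 + c * cdot z 1 + b * cdot z 2)"
    unfolding \<beta>0_def \<beta>1_def \<beta>2_def cdot_simps by (simp add: power2_eq_square algebra_simps)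
  hence s: "- q + (\<beta>0\<^sup>2 + \<beta>1\<^sup>2 + \<beta>2\<^sup>2) / 4 = (a * cdot z 0 + c * cdot z 1 + b * cdot z 2) / 2"
    unfolding sq o q_def by (simp add: field_simps)
  have "(LINT w|lborel. tens (coh (z 0)) (coh (z 1)) (coh (z 2)) (Rot \<theta> w) * cnj (tens (coh (z 3)) (coh (z 4)) (coh (z 5)) w))
    = exp (- q) * (LINT w|lborel. tens (gau \<beta>0) (gau \<beta>1) (gau \<beta>2) w)"
    unfolding e by (rule integral_mult_right_zero)
  also have "\<dots> = of_real (sqrt pi ^ 3) * exp (- q + (\<beta>0\<^sup>2 + \<beta>1\<^sup>2 + \<beta>2\<^sup>2) / 4)"
    unfolding tens_gau_integral exp_add by (rule mult.left_commute)
  finally show ?thesis unfolding s by (simp add: a_def b_def c_def)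
qed

text \<open>The coefficient of \<open>cis (4 * t)\<close> in the exponent left by the spatial
  integral, see \<open>space_integral_coh_flow\<close>.\<close>

definition cP :: "(nat \<Rightarrow> complex) \<Rightarrow> complex" where "cP z = (csum z)\<^sup>2 / 12 - csq z / 4"

text \<open>The exponent is a trigonometric polynomial of degree one in \<theta>. Its two
  oscillating coefficients differ from \<open>cP z\<close> and \<open>cP (ctail z)\<close>, but
  their product is the same, which is all that \<open>J\<close> sees.\<close>

lemma RQ_coh:
  "RQ (\<lambda>i. coh (z i)) = of_real (sqrt pi ^ 3) * exp (csum z * csum (ctail z) / 6) * J (cP z) (cP (ctail z))"
proof -
  let ?F = "\<lambda>i. coh (z i)"
  \<comment> \<open>Half of the cosine and of the sine coefficient of the exponent in
    \<open>inner_RQ_coh\<close>.\<close>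
  define u v where "u = (2 * cdot z 0 - cdot z 1 - cdot z 2) / 12" and "v = (cdot z 1 - cdot z 2) / (4 * of_real (sqrt 3))"
  have i: "integrable lborel (rq_integrand ?F)" by (rule RQ_bounds(1)) (rule L2_coh)
  have s3: "complex_of_real (sqrt 3) * of_real (sqrt 3) = 3" by (simp flip: of_real_mult)
  have ex: "(RA \<theta> * cdot z 0 + RC \<theta> * cdot z 1 + RB \<theta> * cdot z 2) / 2
     = csum z * csum (ctail z) / 6 + ((u - \<i> * v) * cis \<theta> + (u + \<i> * v) * cis (- \<theta>))" for \<theta>
  proof -
    have cc: "cis \<theta> = of_real (cos \<theta>) + \<i> * of_real (sin \<theta>)" "cis (- \<theta>) = of_real (cos \<theta>) - \<i> * of_real (sin \<theta>)"
      by (simp_all add: complex_eq_iff)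
    have 1: "(u - \<i> * v) * cis \<theta> + (u + \<i> * v) * cis (- \<theta>) = 2 * u * of_real (cos \<theta>) + 2 * v * of_real (sin \<theta>)"
      unfolding cc by (simp add: algebra_simps)
    have 2: "csum z * csum (ctail z) = cdot z 0 + cdot z 1 + cdot z 2"
      unfolding csum_def ctail_simps cdot_simps by (simp add: algebra_simps)
    have 3: "2 * v = (cdot z 1 - cdot z 2) / (2 * of_real (sqrt 3))" unfolding v_def by (simp add: field_simps)
    define r where "r = complex_of_real (sqrt 3)"
    have r: "r \<noteq> 0" by (simp add: r_def)
    show ?thesis unfolding 1 2 3 unfolding u_def RA_def RB_def RC_def of_real_add of_real_diff of_real_divide of_real_mult r_def[symmetric] using r
      by (simp add: field_simps)
  qed
  have "RQ ?F = (LINT \<theta>|lborel. LINT w|lborel. rq_integrand ?F (\<theta>, w))"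
    unfolding RQ_def by (rule lborel_Fubini(1)[OF i])
  also have "\<dots> = (LINT \<theta>|lborel. (of_real (sqrt pi ^ 3) * exp (csum z * csum (ctail z) / 6)) *
      (indicator {-pi..pi} \<theta> *\<^sub>R exp ((u - \<i> * v) * cis \<theta> + (u + \<i> * v) * cis (- \<theta>))))"
  proof (intro Bochner_Integration.integral_cong refl)
    fix \<theta>
    have "(LINT w|lborel. rq_integrand ?F (\<theta>, w)) = (LINT w|lborel. of_real (indicator {-pi..pi} \<theta>) *
       (tens (coh (z 0)) (coh (z 1)) (coh (z 2)) (Rot \<theta> w) * cnj (tens (coh (z 3)) (coh (z 4)) (coh (z 5)) w)))"
      by (intro Bochner_Integration.integral_cong refl) (auto simp: rq_integrand_def split: split_indicator)
    also have "\<dots> = of_real (indicator {-pi..pi} \<theta>) * (of_real (sqrt pi ^ 3) * exp ((RA \<theta> * cdot z 0 + RC \<theta> * cdot z 1 + RB \<theta> * cdot z 2) / 2))"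
      unfolding integral_mult_right_zero inner_RQ_coh ..
    finally show "(LINT w|lborel. rq_integrand ?F (\<theta>, w)) = (of_real (sqrt pi ^ 3) * exp (csum z * csum (ctail z) / 6)) *
      (indicator {-pi..pi} \<theta> *\<^sub>R exp ((u - \<i> * v) * cis \<theta> + (u + \<i> * v) * cis (- \<theta>)))"
      unfolding ex exp_add[of "csum z * csum (ctail z) / 6"] scaleR_conv_of_real by (simp only: mult_ac)
  qed
  also have "\<dots> = of_real (sqrt pi ^ 3) * exp (csum z * csum (ctail z) / 6) * J (u - \<i> * v) (u + \<i> * v)"
    unfolding integral_mult_right_zero J_def ..
  also have "J (u - \<i> * v) (u + \<i> * v) = J (cP z) (cP (ctail z))"
  proof (rule J_cong)
    have "(u - \<i> * v) * (u + \<i> * v) = u\<^sup>2 + v\<^sup>2" by (simp add: algebra_simps power2_eq_square)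
    also have "v\<^sup>2 = (cdot z 1 - cdot z 2)\<^sup>2 / 48"
    proof -
      have "v\<^sup>2 = (cdot z 1 - cdot z 2)\<^sup>2 / (16 * (of_real (sqrt 3) * of_real (sqrt 3)))"
        by (simp add: v_def power_divide power_mult_distrib power2_eq_square)
      thus ?thesis unfolding s3 by simp
    qed
    also have "u\<^sup>2 + (cdot z 1 - cdot z 2)\<^sup>2 / 48 = cP z * cP (ctail z)"
    proof -
      \<comment> \<open>The left side is four times the product of the two nontrivial discrete
        Fourier coefficients of the cyclic correlation. Such coefficients factor over the two
        triples, and the factors recombine into the symmetric expressions on the right.\<close>
      have "(2 * cdot z 0 - cdot z 1 - cdot z 2)\<^sup>2 + 3 * (cdot z 1 - cdot z 2)\<^sup>2 = ((csum z)\<^sup>2 - 3 * csq z) * ((csum (ctail z))\<^sup>2 - 3 * csq (ctail z))"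
        unfolding cdot_simps csum_def csq_def ctail_simps by algebra
      moreover have "u\<^sup>2 + (cdot z 1 - cdot z 2)\<^sup>2 / 48 = ((2 * cdot z 0 - cdot z 1 - cdot z 2)\<^sup>2 + 3 * (cdot z 1 - cdot z 2)\<^sup>2) / 144"
        by (simp add: u_def power_divide add_divide_distrib)
      moreover have "cP z * cP (ctail z) = ((csum z)\<^sup>2 - 3 * csq z) * ((csum (ctail z))\<^sup>2 - 3 * csq (ctail z)) / 144"
        by (simp add: cP_def field_simps)
      ultimately show ?thesis by (simp only:)
    qed
    finally show "(u - \<i> * v) * (u + \<i> * v) = cP z * cP (ctail z)" .
  qed
  finally show ?thesis .
qed

text \<open>Extension by zero outside the time interval, so that space-time integrals run over the
  whole plane.\<close>

definition window :: "(real \<Rightarrow> real \<Rightarrow> complex) \<Rightarrow> real \<times> real \<Rightarrow> complex" where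
  "window U z = indicator {- (pi / 4)..pi / 4} (fst z) *\<^sub>R U (fst z) (snd z)"

definition prod6 :: "(nat \<Rightarrow> 'a \<Rightarrow> complex) \<Rightarrow> 'a \<Rightarrow> complex" where
  "prod6 Z x = Z 0 x * (Z 1 x * Z 2 x) * cnj (Z 3 x * (Z 4 x * Z 5 x))"

text \<open>The phases \<open>cis t\<close> of three plain and three conjugated factors cancel. In
  the exponent the mixed terms of the completed square are free of time, and the pure ones carry
  \<open>cis (4 * t)\<close> or its inverse.\<close>

lemma space_integral_coh_flow:
  "(LINT x|lborel. prod6 (\<lambda>i x. coh_flow (z i) t x) x)
     = of_real (sqrt (pi / 3)) * exp (csum z * csum (ctail z) / 6) * exp (cP z * cis (4 * t) + cP (ctail z) * cis (- (4 * t)))"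
proof -
  define e d where "e = cis (2 * t)" and "d = cis (- (2 * t))"
  have ed: "e * d = 1" "e\<^sup>2 = cis (4 * t)" "d\<^sup>2 = cis (- (4 * t))" "cnj e = d"
    by (simp_all add: e_def d_def cis_mult power2_eq_square cis_cnj)
  have c1: "cis t * (cis t * cis t) * cnj (cis t * (cis t * cis t)) = 1"
    by (simp add: cis_cnj cis_mult)
  define \<beta> where "\<beta> = e * csum z + d * csum (ctail z)"
  define q where "q = (e\<^sup>2 * csq z + d\<^sup>2 * csq (ctail z)) / 4"
  have p: "prod6 (\<lambda>i x. coh_flow (z i) t x) x = exp (- q) * exp (- of_real (3 * x\<^sup>2) + \<beta> * of_real x)" for x
  proof -
    have "prod6 (\<lambda>i x. coh_flow (z i) t x) x = (cis t * (cis t * cis t) * cnj (cis t * (cis t * cis t))) *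
       (coh (e * z 0) x * (coh (e * z 1) x * coh (e * z 2) x) * cnj (coh (e * z 3) x * (coh (e * z 4) x * coh (e * z 5) x)))"
      unfolding prod6_def coh_flow_def e_def complex_cnj_mult by (simp only: mult_ac)
    also have "\<dots> = exp (((- of_real (x\<^sup>2 / 2) + e * z 0 * of_real x - (e * z 0)\<^sup>2 / 4) + ((- of_real (x\<^sup>2 / 2) + e * z 1 * of_real x - (e * z 1)\<^sup>2 / 4) + (- of_real (x\<^sup>2 / 2) + e * z 2 * of_real x - (e * z 2)\<^sup>2 / 4)))
       + cnj ((- of_real (x\<^sup>2 / 2) + e * z 3 * of_real x - (e * z 3)\<^sup>2 / 4) + ((- of_real (x\<^sup>2 / 2) + e * z 4 * of_real x - (e * z 4)\<^sup>2 / 4) + (- of_real (x\<^sup>2 / 2) + e * z 5 * of_real x - (e * z 5)\<^sup>2 / 4))))"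
      unfolding c1 mult_1_left coh_def exp_cnj exp_add[symmetric] ..
    also have "\<dots> = exp (- q + (- of_real (3 * x\<^sup>2) + \<beta> * of_real x))"
      unfolding q_def \<beta>_def csum_def csq_def ctail_simps
      by (rule arg_cong[where f=exp])
         (simp add: ed(4) power_mult_distrib algebra_simps add_divide_distrib)
    finally show ?thesis by (simp only: exp_add)
  qed
  have "(LINT x|lborel. prod6 (\<lambda>i x. coh_flow (z i) t x) x) = exp (- q) * (LINT x|lborel. exp (- of_real (3 * x\<^sup>2) + \<beta> * of_real x))"
    unfolding p by (rule integral_mult_right_zero)
  also have "(LINT x|lborel. exp (- of_real (3 * x\<^sup>2) + \<beta> * of_real x)) = of_real (sqrt (pi / 3)) * exp (\<beta>\<^sup>2 / of_real (4 * 3))"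
    using gaussian_integral[of 3 \<beta>] by (simp add: has_bochner_integral_iff)
  also have "exp (- q) * (of_real (sqrt (pi / 3)) * exp (\<beta>\<^sup>2 / of_real (4 * 3))) = of_real (sqrt (pi / 3)) * exp (- q + \<beta>\<^sup>2 / 12)"
  proof -
    have "complex_of_real (4 * 3) = 12" by simp
    thus ?thesis unfolding exp_add by (simp only: mult.left_commute)
  qed
  also have "- q + \<beta>\<^sup>2 / 12 = csum z * csum (ctail z) / 6 + (cP z * cis (4 * t) + cP (ctail z) * cis (- (4 * t)))"
  proof -
    have "\<beta>\<^sup>2 = e\<^sup>2 * (csum z)\<^sup>2 + d\<^sup>2 * (csum (ctail z))\<^sup>2 + 2 * (e * d) * (csum z * csum (ctail z))"
      unfolding \<beta>_def by (simp add: power2_eq_square algebra_simps)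
    thus ?thesis unfolding ed q_def cP_def by (simp add: field_simps)
  qed
  finally show ?thesis by (simp only: exp_add mult.assoc)
qed

text \<open>The time interval is exactly one period of \<open>cis (4 * t)\<close>.\<close>

lemma time_integral_J:
  "(LINT t|lborel. indicator {- (pi / 4)..pi / 4} t *\<^sub>R exp (a * cis (4 * t) + b * cis (- (4 * t)))) = J a b / 4"
proof -
  let ?f = "\<lambda>t. indicator {- (pi / 4)..pi / 4} t *\<^sub>R exp (a * cis (4 * t) + b * cis (- (4 * t)))"
  have "(LINT t|lborel. ?f t) = \<bar>1 / 4\<bar> *\<^sub>R (LINT \<tau>|lborel. ?f (0 + 1 / 4 * \<tau>))"
    by (rule lborel_integral_real_affine) simp
  also have "(\<lambda>\<tau>. ?f (0 + 1 / 4 * \<tau>)) = (\<lambda>\<tau>. indicator {-pi..pi} \<tau> *\<^sub>R exp (a * cis \<tau> + b * cis (- \<tau>)))"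
    by (auto simp: fun_eq_iff split: split_indicator)
  finally show ?thesis by (simp add: J_def scaleR_conv_of_real)
qed

section \<open>Six-fold products\<close>

lemma prod6_cong: "(\<And>i. i < 6 \<Longrightarrow> Z i x = Y i x) \<Longrightarrow> prod6 Z x = prod6 Y x"
  by (simp add: prod6_def)

lemma norm_prod6: "norm (prod6 Z x) = (\<Prod>i<6. norm (Z i x))"
  by (simp add: prod6_def norm_mult eval_nat_numeral lessThan_Suc mult_ac)

lemma prod6_measurable:
  assumes "\<And>i. i < 6 \<Longrightarrow> Z i \<in> borel_measurable M" shows "prod6 Z \<in> borel_measurable M"
proof -
  have [measurable]: "Z 0 \<in> borel_measurable M" "Z 1 \<in> borel_measurable M" "Z 2 \<in> borel_measurable M"
    "Z 3 \<in> borel_measurable M" "Z 4 \<in> borel_measurable M" "Z 5 \<in> borel_measurable M" by (simp_all add: assms)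
  show ?thesis unfolding prod6_def[abs_def] by measurable
qed

lemma less_6_cases: "i < (6::nat) \<Longrightarrow> i = 0 \<or> i = 1 \<or> i = 2 \<or> i = 3 \<or> i = 4 \<or> i = 5" by linarith

lemma prod6_add:
  "k < 6 \<Longrightarrow> prod6 (Z(k := \<lambda>x. a x + b x)) x = prod6 (Z(k := a)) x + prod6 (Z(k := b)) x"
  by (drule less_6_cases, elim disjE) (simp_all add: prod6_def algebra_simps)

lemma prod6_scale: "prod6 (\<lambda>i x. c i * Z i x) x = prod6 (\<lambda>i _. c i) x * prod6 Z x"
  by (simp add: prod6_def mult_ac)

lemma prod_le_sum_power:
  fixes n :: "nat \<Rightarrow> real" assumes "\<And>i. n i \<ge> 0"
  shows "(\<Prod>i<6. n i) \<le> (\<Sum>i<6. n i ^ 6)"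
proof -
  obtain m where m: "m < 6" "\<And>i. i < 6 \<Longrightarrow> n i \<le> n m"
  proof -
    have "Max (n ` {..<6}) \<in> n ` {..<6}" by (rule Max_in) (auto simp: lessThan_empty_iff bot_nat_def)
    then obtain m where "m < 6" "n m = Max (n ` {..<6})" by auto
    thus ?thesis by (intro that[of m]) auto
  qed
  have "(\<Prod>i<6. n i) \<le> (\<Prod>i<(6::nat). n m)" using assms m by (intro prod_mono) auto
  also have "\<dots> = n m ^ 6" by simp
  also have "\<dots> \<le> (\<Sum>i<6. n i ^ 6)"
    using assms m by (intro member_le_sum[of m "{..<6}" "\<lambda>i. n i ^ 6"]) auto
  finally show ?thesis .
qed

lemma prod6_integrable:
  assumes m: "\<And>i. i < 6 \<Longrightarrow> Z i \<in> borel_measurable M" and i: "\<And>i. i < 6 \<Longrightarrow> integrable M (\<lambda>x. norm (Z i x) ^ 6)"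
  shows "integrable M (prod6 Z)"
proof (rule Bochner_Integration.integrable_bound)
  show "integrable M (\<lambda>x. \<Sum>i<6. norm (Z i x) ^ 6)" using i by (intro Bochner_Integration.integrable_sum) auto
  show "prod6 Z \<in> borel_measurable M" by (rule prod6_measurable[OF m])
  have "norm (prod6 Z x) \<le> norm (\<Sum>i<6. norm (Z i x) ^ 6)" for x
    unfolding norm_prod6 using prod_le_sum_power[of "\<lambda>i. norm (Z i x)"] by (simp add: sum_nonneg)
  thus "AE x in M. norm (prod6 Z x) \<le> norm (\<Sum>i<6. norm (Z i x) ^ 6)" by simp
qed

text \<open>A crude Hoelder inequality: each factor is divided by \<open>n i\<close> and the product
  is bounded by a sum of sixth powers, at the price of the factor 6. If some \<open>n i\<close> is
  zero, that factor vanishes almost everywhere and so does the product.\<close>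

lemma Hoelder6:
  assumes m: "\<And>i. i < 6 \<Longrightarrow> Z i \<in> borel_measurable M"
    and K: "K \<ge> 0" and n: "\<And>i. n i \<ge> 0"
    and le: "\<And>i. i < 6 \<Longrightarrow> (\<integral>\<^sup>+x. ennreal (norm (Z i x) ^ 6) \<partial>M) \<le> ennreal (K * n i ^ 6)"
  shows "integrable M (prod6 Z)" and "norm (LINT x|M. prod6 Z x) \<le> 6 * K * (\<Prod>i<6. n i)"
proof -
  have i6: "integrable M (\<lambda>x. norm (Z i x) ^ 6)" if "i < 6" for i
  proof (rule integrableI_bounded)
    show "(\<lambda>x. norm (Z i x) ^ 6) \<in> borel_measurable M" using m[OF that] by measurable
    show "(\<integral>\<^sup>+x. ennreal (norm (norm (Z i x) ^ 6)) \<partial>M) < \<infinity>"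
      using le_less_trans[OF le[OF that] ennreal_less_top] by simp
  qed
  show int: "integrable M (prod6 Z)" by (rule prod6_integrable[OF m i6])
  have v: "(LINT x|M. norm (Z i x) ^ 6) \<le> K * n i ^ 6" if "i < 6" for i
    using le[OF that] n[of i] K unfolding nn_integral_eq_integral[OF i6[OF that], simplified]
    by (subst (asm) ennreal_le_iff) auto
  show "norm (LINT x|M. prod6 Z x) \<le> 6 * K * (\<Prod>i<6. n i)"
  proof (cases "\<exists>i<6. n i = 0")
    case True
    then obtain j where j: "j < 6" "n j = 0" by blast
    have "(LINT x|M. norm (Z j x) ^ 6) = 0"
      using v[OF j(1)] j(2) Bochner_Integration.integral_nonneg[of M "\<lambda>x. norm (Z j x) ^ 6"] by (simp add: antisym)
    hence "AE x in M. norm (Z j x) ^ 6 = 0"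
      using integral_nonneg_eq_0_iff_AE[OF i6[OF j(1)]] by simp
    hence "AE x in M. prod6 Z x = 0"
    proof eventually_elim
      case (elim x)
      hence "norm (prod6 Z x) = 0" unfolding norm_prod6 using j(1) by (auto intro!: bexI[of _ j])
      thus ?case by simp
    qed
    hence "(LINT x|M. prod6 Z x) = 0" by (rule integral_eq_zero_AE)
    moreover have "(\<Prod>i<6. n i) = 0" using j by (intro prod_zero) auto
    ultimately show ?thesis by (simp only: norm_zero mult_zero_right order_refl)
  next
    case False
    hence pos: "n i > 0" if "i < 6" for i using n[of i] that by (metis less_eq_real_def)
    have pt: "norm (prod6 Z x) \<le> (\<Prod>i<6. n i) * (\<Sum>i<6. norm (Z i x) ^ 6 / n i ^ 6)" for x
    proof -
      have "norm (prod6 Z x) = (\<Prod>i<6. n i * (norm (Z i x) / n i))"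
        unfolding norm_prod6 using pos by (intro prod.cong refl) (force simp: field_simps)
      also have "\<dots> = (\<Prod>i<6. n i) * (\<Prod>i<6. norm (Z i x) / n i)" by (rule prod.distrib)
      also have "\<dots> \<le> (\<Prod>i<6. n i) * (\<Sum>i<6. (norm (Z i x) / n i) ^ 6)"
        using n by (intro mult_left_mono prod_le_sum_power prod_nonneg) auto
      finally show ?thesis by (simp only: power_divide)
    qed
    have "norm (LINT x|M. prod6 Z x) \<le> (LINT x|M. norm (prod6 Z x))" by (rule integral_norm_bound)
    also have "\<dots> \<le> (LINT x|M. (\<Prod>i<6. n i) * (\<Sum>i<6. norm (Z i x) ^ 6 / n i ^ 6))"
      using int i6 pt by (intro integral_mono integrable_norm integrable_mult_right Bochner_Integration.integrable_sum integrable_divide) auto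
    also have "\<dots> = (\<Prod>i<6. n i) * (\<Sum>i<6. (LINT x|M. norm (Z i x) ^ 6) / n i ^ 6)"
      using i6 by (subst integral_mult_right_zero, subst Bochner_Integration.integral_sum) (auto intro: integrable_divide)
    also have "\<dots> \<le> (\<Prod>i<6. n i) * (\<Sum>i<(6::nat). K)"
    proof (intro mult_left_mono sum_mono prod_nonneg ballI n)
      fix i :: nat assume "i \<in> {..<6}"
      hence i: "i < 6" by simp
      have "n i ^ 6 > 0" using pos[OF i] by simp
      thus "(LINT x|M. norm (Z i x) ^ 6) / n i ^ 6 \<le> K" using v[OF i] by (simp add: pos_divide_le_eq)
    qed
    finally show ?thesis by (simp add: mult_ac)
  qed
qed

section \<open>The identity for superpositions of coherent states\<close>

text \<open>Determined by sqrt (pi/3) / 4 = \<open>slot_const\<close> times sqrt pi ^ 3, the ratio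
  of the two Gaussian computations. Multiplied by 2 / pi it becomes sqrt 3 / (6 pi^2).\<close>

definition slot_const :: real where "slot_const = sqrt 3 / (12 * pi)"

lemma window_add: "window (\<lambda>t x. U t x + W t x) = (\<lambda>z. window U z + window W z)"
  by (auto simp: window_def scaleR_add_right)

lemma window_scale: "window (\<lambda>t x. c * U t x) = (\<lambda>z. c * window U z)"
  by (auto simp: window_def)

lemma prod6_window: "prod6 (\<lambda>i. window (U i)) (t, x) = indicator {- (pi / 4)..pi / 4} t *\<^sub>R prod6 (\<lambda>i x. U i t x) x"
  by (auto simp: prod6_def window_def split: split_indicator)

lemma window_measurable:
  assumes "(\<lambda>z. U (fst z) (snd z)) \<in> borel_measurable borel" shows "window U \<in> borel_measurable borel"
  unfolding window_def[abs_def] using assms by measurable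

lemma wave_window:
  assumes "wave f U"
  shows "window U \<in> borel_measurable lborel" and "integrable lborel (\<lambda>z. norm (window U z) ^ 6)"
proof -
  have "(\<lambda>z. U (fst z) (snd z)) \<in> borel_measurable borel"
    using borel_measurable_continuous_onI[OF wave_continuous[OF assms]] by (simp add: split_def)
  from window_measurable[OF this] show m[measurable]: "window U \<in> borel_measurable lborel" by simp
  obtain C where C: "\<And>t x. norm (U t x) \<le> C * exp (- (x\<^sup>2 / 4))" using wave_bound[OF assms] by blast
  have C0: "0 \<le> C" using order_trans[OF norm_ge_zero C[of 0 0]] by simp
  show "integrable lborel (\<lambda>z. norm (window U z) ^ 6)"
  proof (rule Bochner_Integration.integrable_bound)
    show "integrable lborel (\<lambda>z. complex_of_real (C ^ 6) * (complex_of_real (indicator {- (pi / 4)..pi / 4} (fst z)) * complex_of_real (exp (- ((snd z)\<^sup>2 / 8)))))"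
      by (intro integrable_mult_right integrable_prod_mult integrable_of_real integrable_real_indicator integrable_exp_eighth)
         (auto simp: emeasure_lborel_Icc_eq)
    show "(\<lambda>z. norm (window U z) ^ 6) \<in> borel_measurable lborel" by measurable
    have "norm (window U z) ^ 6 \<le> C ^ 6 * (indicator {- (pi / 4)..pi / 4} (fst z) * exp (- ((snd z)\<^sup>2 / 8)))" for z
    proof (cases "fst z \<in> {- (pi / 4)..pi / 4}")
      case True
      have "norm (window U z) ^ 6 \<le> (C * exp (- ((snd z)\<^sup>2 / 4))) ^ 6"
        using True C by (intro power_mono) (auto simp: window_def)
      also have "\<dots> = C ^ 6 * exp (6 * (- ((snd z)\<^sup>2 / 4)))"
        by (simp add: power_mult_distrib exp_of_nat_mult[symmetric])
      also have "\<dots> \<le> C ^ 6 * exp (- ((snd z)\<^sup>2 / 8))"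
        using C0 by (intro mult_left_mono) auto
      finally show ?thesis using True by simp
    qed (simp add: window_def)
    moreover have "norm (complex_of_real (C ^ 6) * (complex_of_real (indicator {- (pi / 4)..pi / 4} (fst z)) * complex_of_real (exp (- ((snd z)\<^sup>2 / 8)))))
       = C ^ 6 * (indicator {- (pi / 4)..pi / 4} (fst z) * exp (- ((snd z)\<^sup>2 / 8)))" for z
      using C0 by (simp add: norm_mult norm_power)
    ultimately show "AE z in lborel. norm (norm (window U z) ^ 6) \<le> norm (complex_of_real (C ^ 6) * (complex_of_real (indicator {- (pi / 4)..pi / 4} (fst z)) * complex_of_real (exp (- ((snd z)\<^sup>2 / 8)))))"
      by simp
  qed
qed

lemma waves_prod6_integrable:
  "(\<And>i. i < 6 \<Longrightarrow> wave (f i) (U i)) \<Longrightarrow> integrable lborel (prod6 (\<lambda>i. window (U i)))"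
  by (intro prod6_integrable wave_window)

lemma wave_coh_1: "wave (coh z) (coh_flow z)"
  using wave_coh[of 1 z] by simp

lemma identity_coh:
  "(LINT p|lborel. prod6 (\<lambda>i. window (coh_flow (z i))) p) = of_real slot_const * RQ (\<lambda>i. coh (z i))"
proof -
  have int: "integrable lborel (prod6 (\<lambda>i. window (coh_flow (z i))))"
    by (rule waves_prod6_integrable[of "\<lambda>i. coh (z i)"]) (rule wave_coh_1)
  let ?c = "of_real (sqrt (pi / 3)) * exp (csum z * csum (ctail z) / 6)"
  have "(LINT p|lborel. prod6 (\<lambda>i. window (coh_flow (z i))) p)
     = (LINT t|lborel. LINT x|lborel. prod6 (\<lambda>i. window (coh_flow (z i))) (t, x))" by (rule lborel_Fubini(1)[OF int])
  also have "\<dots> = (LINT t|lborel. ?c * (indicator {- (pi / 4)..pi / 4} t *\<^sub>R exp (cP z * cis (4 * t) + cP (ctail z) * cis (- (4 * t)))))"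
    unfolding prod6_window integral_scaleR_right space_integral_coh_flow by simp
  also have "\<dots> = ?c * (J (cP z) (cP (ctail z)) / 4)"
    unfolding integral_mult_right_zero time_integral_J ..
  also have "\<dots> = of_real slot_const * RQ (\<lambda>i. coh (z i))"
  proof -
    have "sqrt (pi / 3) / 4 = slot_const * sqrt pi ^ 3"
    proof -
      have "slot_const * sqrt pi ^ 3 = sqrt 3 * sqrt pi / 12" by (simp add: slot_const_def power3_eq_cube)
      also have "\<dots> = (sqrt 3 * sqrt 3) * sqrt pi / (12 * sqrt 3)" by (simp only: mult.assoc) simp
      also have "\<dots> = sqrt pi / sqrt 3 / 4" by simp
      finally show ?thesis by (simp add: real_sqrt_divide)
    qed
    hence k: "complex_of_real (sqrt (pi / 3)) = 4 * of_real slot_const * of_real (sqrt pi ^ 3)"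
      by (metis (no_types, lifting) divide_eq_eq mult.assoc mult.commute of_real_mult of_real_numeral zero_neq_numeral)
    show ?thesis unfolding RQ_coh k by simp
  qed
  finally show ?thesis .
qed

lemma RQ_cong: "(\<And>i. i < 6 \<Longrightarrow> F i = G i) \<Longrightarrow> RQ F = RQ G"
  by (simp add: RQ_def rq_integrand_def)

lemma RQ_add:
  assumes k: "k < 6" and F: "\<And>i. i < 6 \<Longrightarrow> L2 (F i)" and f: "L2 f" and g: "L2 g"
  shows "RQ (F(k := \<lambda>x. f x + g x)) = RQ (F(k := f)) + RQ (F(k := g))"
proof -
  have "rq_integrand (F(k := \<lambda>x. f x + g x)) = (\<lambda>z. rq_integrand (F(k := f)) z + rq_integrand (F(k := g)) z)"
    using less_6_cases[OF k] by (elim disjE) (simp_all add: fun_eq_iff rq_integrand_def tens_def algebra_simps)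
  moreover have "integrable lborel (rq_integrand (F(k := f)))" "integrable lborel (rq_integrand (F(k := g)))"
    using F f g by (auto intro!: RQ_bounds(1))
  ultimately show ?thesis unfolding RQ_def by simp
qed

lemma RQ_scale: "RQ (\<lambda>i x. c i * F i x) = prod6 (\<lambda>i _. c i) () * RQ F"
proof -
  have "rq_integrand (\<lambda>i x. c i * F i x) = (\<lambda>z. prod6 (\<lambda>i _. c i) () * rq_integrand F z)"
    by (auto simp: fun_eq_iff rq_integrand_def tens_def prod6_def mult_ac split: split_indicator)
  thus ?thesis unfolding RQ_def by simp
qed

text \<open>Multilinearity, one slot at a time: slots below k hold arbitrary waves, the others
  multiples of coherent states. The step releases slot k by an inner induction on the wave placed
  there.\<close>

lemma identity_waves_upto:
  assumes "k \<le> 6"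
  shows "(\<And>i. i < k \<Longrightarrow> wave (f i) (U i)) \<Longrightarrow>
    (\<And>i. k \<le> i \<Longrightarrow> i < 6 \<Longrightarrow> \<exists>c z. f i = (\<lambda>x. c * coh z x) \<and> U i = (\<lambda>t x. c * coh_flow z t x)) \<Longrightarrow>
    (LINT p|lborel. prod6 (\<lambda>i. window (U i)) p) = of_real slot_const * RQ f"
  using assms
proof (induction k arbitrary: f U)
  case 0
  then obtain c z where cz: "\<And>i. i < 6 \<Longrightarrow> f i = (\<lambda>x. c i * coh (z i) x) \<and> U i = (\<lambda>t x. c i * coh_flow (z i) t x)"
    by (metis le0)
  have "(LINT p|lborel. prod6 (\<lambda>i. window (U i)) p) = (LINT p|lborel. prod6 (\<lambda>i x. c i * window (coh_flow (z i)) x) p)"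
    by (intro Bochner_Integration.integral_cong refl prod6_cong) (simp add: cz window_scale)
  also have "\<dots> = prod6 (\<lambda>i _. c i) () * (LINT p|lborel. prod6 (\<lambda>i. window (coh_flow (z i))) p)"
    unfolding prod6_scale by (simp add: prod6_def)
  also have "\<dots> = of_real slot_const * (prod6 (\<lambda>i _. c i) () * RQ (\<lambda>i. coh (z i)))"
    unfolding identity_coh by (rule mult.left_commute)
  also have "prod6 (\<lambda>i _. c i) () * RQ (\<lambda>i. coh (z i)) = RQ (\<lambda>i x. c i * coh (z i) x)" by (rule RQ_scale[symmetric])
  also have "\<dots> = RQ f" by (rule RQ_cong) (simp add: cz)
  finally show ?case .
next
  case (Suc k)
  have k: "k < 6" using Suc.prems(3) by simp
  have W: "wave (f i) (U i)" if "i < 6" for i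
  proof (cases "i < Suc k")
    case False
    with Suc.prems(2)[of i] that show ?thesis by (auto intro: wave_coh)
  qed (use Suc.prems(1) in blast)
  have upd: "(\<lambda>i. window ((U(k := V)) i)) = (\<lambda>i. window (U i))(k := window V)" for V by auto
  have "(LINT p|lborel. prod6 ((\<lambda>i. window (U i))(k := window V)) p) = of_real slot_const * RQ (f(k := g))" if "wave g V" for g V
    using that
  proof (induction rule: wave.induct)
    case (wave_coh c z)
    have "(LINT p|lborel. prod6 (\<lambda>i. window ((U(k := (\<lambda>t x. c * coh_flow z t x))) i)) p) = of_real slot_const * RQ (f(k := (\<lambda>x. c * coh z x)))"
    proof (rule Suc.IH)
      show "wave ((f(k := \<lambda>x. c * coh z x)) i) ((U(k := \<lambda>t x. c * coh_flow z t x)) i)" if "i < k" for i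
        using Suc.prems(1)[of i] that by simp
      show "\<exists>c' z'. (f(k := \<lambda>x. c * coh z x)) i = (\<lambda>x. c' * coh z' x) \<and> (U(k := \<lambda>t x. c * coh_flow z t x)) i = (\<lambda>t x. c' * coh_flow z' t x)"
        if "k \<le> i" "i < 6" for i
        using Suc.prems(2)[of i] that by (cases "i = k") auto
    qed (use k in simp)
    thus ?case unfolding upd .
  next
    case (wave_add g1 V1 g2 V2)
    have i: "integrable lborel (prod6 ((\<lambda>i. window (U i))(k := window V)))" if "wave g V" for g V
      using waves_prod6_integrable[of "f(k := g)" "U(k := V)"] W that unfolding upd by simp
    have "(LINT p|lborel. prod6 ((\<lambda>i. window (U i))(k := window (\<lambda>t x. V1 t x + V2 t x))) p)
      = (LINT p|lborel. prod6 ((\<lambda>i. window (U i))(k := window V1)) p + prod6 ((\<lambda>i. window (U i))(k := window V2)) p)"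
      unfolding window_add prod6_add[OF k] ..
    also have "\<dots> = (LINT p|lborel. prod6 ((\<lambda>i. window (U i))(k := window V1)) p) + (LINT p|lborel. prod6 ((\<lambda>i. window (U i))(k := window V2)) p)"
      by (intro Bochner_Integration.integral_add i[OF wave_add.hyps(1)] i[OF wave_add.hyps(2)])
    also have "\<dots> = of_real slot_const * RQ (f(k := \<lambda>x. g1 x + g2 x))"
    proof -
      have "RQ (f(k := \<lambda>x. g1 x + g2 x)) = RQ (f(k := g1)) + RQ (f(k := g2))"
        by (rule RQ_add[OF k]) (use W wave_add.hyps in \<open>auto intro: wave_L2\<close>)
      thus ?thesis by (simp only: wave_add.IH distrib_left)
    qed
    finally show ?case .
  qed
  from this[OF W[OF k]] show ?case by (simp flip: upd)
qed

lemma identity_waves: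
  "(\<And>i. i < 6 \<Longrightarrow> wave (f i) (U i)) \<Longrightarrow> (LINT p|lborel. prod6 (\<lambda>i. window (U i)) p) = of_real slot_const * RQ f"
  by (rule identity_waves_upto[of 6]) auto

section \<open>The Strichartz inequality\<close>

lemma prod6_diag: "prod6 (\<lambda>_. Z) x = of_real (norm (Z x) ^ 6)"
proof -
  have "prod6 (\<lambda>_. Z) x = of_real ((norm (Z x * (Z x * Z x)))\<^sup>2)"
    unfolding prod6_def complex_norm_square ..
  also have "(norm (Z x * (Z x * Z x)))\<^sup>2 = norm (Z x) ^ 6"
    by (simp add: norm_mult eval_nat_numeral mult_ac)
  finally show ?thesis .
qed

definition str_const :: real where "str_const = slot_const * (2 * pi)"

lemma str_const_nonneg: "str_const \<ge> 0" by (simp add: str_const_def slot_const_def)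

text \<open>With six equal entries the left side of \<open>identity_waves\<close> is the sixth power
  of the L^6 norm, and \<open>RQ_bounds\<close> controls the right side.\<close>

lemma Strichartz_wave:
  assumes w: "wave f U"
  shows "(\<integral>\<^sup>+z. ennreal (norm (window U z) ^ 6) \<partial>lborel) \<le> ennreal (str_const * l2n f ^ 6)"
proof -
  have "complex_of_real (LINT z|lborel. norm (window U z) ^ 6) = (LINT p|lborel. prod6 (\<lambda>i. window U) p)"
    unfolding prod6_diag by (rule integral_complex_of_real[symmetric])
  also have "\<dots> = of_real slot_const * RQ (\<lambda>_. f)" by (rule identity_waves) (rule w)
  finally have "norm (complex_of_real (LINT z|lborel. norm (window U z) ^ 6)) = \<bar>slot_const\<bar> * norm (RQ (\<lambda>_. f))"
    by (simp add: norm_mult)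
  also have "\<dots> \<le> \<bar>slot_const\<bar> * (2 * pi * (\<Prod>i<(6::nat). l2n f))"
    by (intro mult_left_mono RQ_bounds(2)) (auto intro: wave_L2[OF w])
  also have "\<dots> = str_const * l2n f ^ 6" by (simp add: str_const_def slot_const_def)
  finally have "(LINT z|lborel. norm (window U z) ^ 6) \<le> str_const * l2n f ^ 6" by simp
  thus ?thesis by (subst nn_integral_eq_integral[OF wave_window(2)[OF w]]) (auto intro: ennreal_leI)
qed

text \<open>Facts about the propagator hold at each time off a null set that may depend on the time;
  measurability in both variables is what lets these null sets be combined on space-time.\<close>

lemma AE_lborel_pairI:
  fixes P :: "'a::euclidean_space \<times> 'b::euclidean_space \<Rightarrow> bool"
  assumes [measurable]: "{z. P z} \<in> sets borel" and P: "\<And>x. AE y in lborel. P (x, y)"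
  shows "AE z in lborel. P z"
proof -
  have s: "sets (lborel \<Otimes>\<^sub>M lborel :: ('a \<times> 'b) measure) = sets borel" unfolding lborel_prod by simp
  have "{z \<in> space (lborel \<Otimes>\<^sub>M lborel). P z} = {z. P z}" by (simp add: space_pair_measure)
  hence "{z \<in> space (lborel \<Otimes>\<^sub>M lborel). P z} \<in> sets (lborel \<Otimes>\<^sub>M lborel)"
    unfolding s using assms(1) by (simp only:)
  from lborel_pair.AE_pair_measure[OF this] P have "AE z in lborel \<Otimes>\<^sub>M lborel. P z" by simp
  thus ?thesis unfolding lborel_prod .
qed

definition slot :: "(real \<Rightarrow> complex) \<Rightarrow> real \<times> real \<Rightarrow> complex" where
  "slot f = window (\<lambda>t. propagator t f)"

lemma slot_measurable: "L2 f \<Longrightarrow> slot f \<in> borel_measurable borel"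
  unfolding slot_def by (intro window_measurable propagator_measurable)

lemma AE_slotI:
  assumes [measurable]: "\<alpha> \<in> borel_measurable borel" "\<beta> \<in> borel_measurable borel"
    and "\<And>t. AE x in lborel. \<alpha> (t, x) = \<beta> (t, x)"
  shows "AE z in lborel. \<alpha> z = (\<beta> :: real \<times> real \<Rightarrow> complex) z"
proof (rule AE_lborel_pairI)
  have "{z \<in> space borel. \<alpha> z = \<beta> z} \<in> sets borel" by measurable
  thus "{z. \<alpha> z = \<beta> z} \<in> sets borel" by simp
qed (rule assms(3))

lemma slot_add:
  assumes f: "L2 f" and g: "L2 g"
  shows "AE z in lborel. slot (\<lambda>x. f x + g x) z = slot f z + slot g z"
proof (rule AE_slotI)
  show "slot (\<lambda>x. f x + g x) \<in> borel_measurable borel" by (intro slot_measurable L2_add f g)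
  show "(\<lambda>z. slot f z + slot g z) \<in> borel_measurable borel" by (intro borel_measurable_add slot_measurable f g)
  show "AE x in lborel. slot (\<lambda>x. f x + g x) (t, x) = slot f (t, x) + slot g (t, x)" for t
    using propagator_add[OF f g, of t] by eventually_elim (simp add: slot_def window_def scaleR_add_right)
qed

lemma slot_wave: assumes "wave f U" shows "AE z in lborel. slot f z = window U z"
proof (rule AE_slotI)
  show "slot f \<in> borel_measurable borel" by (intro slot_measurable wave_L2[OF assms])
  show "window U \<in> borel_measurable borel" using wave_window(1)[OF assms] by simp
  show "AE x in lborel. slot f (t, x) = window U (t, x)" for t
    using propagator_wave[OF assms, of t] by eventually_elim (simp add: slot_def window_def)
qed

text \<open>The norm is conserved, and pi / 2 is the length of the time interval.\<close>

lemma slot_L2: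
  assumes f: "L2 f"
  shows "integrable lborel (\<lambda>z. (norm (slot f z))\<^sup>2)" "(LINT z|lborel. (norm (slot f z))\<^sup>2) = pi / 2 * (l2n f)\<^sup>2"
proof -
  have [measurable]: "slot f \<in> borel_measurable borel" by (rule slot_measurable[OF f])
  have "(\<integral>\<^sup>+z. ennreal ((norm (slot f z))\<^sup>2) \<partial>lborel) = (\<integral>\<^sup>+t. \<integral>\<^sup>+x. ennreal ((norm (slot f (t, x)))\<^sup>2) \<partial>lborel \<partial>lborel)"
    by (rule nn_integral_lborel_fst) measurable
  also have "\<dots> = (\<integral>\<^sup>+t. indicator {- (pi / 4)..pi / 4} t * ennreal ((l2n f)\<^sup>2) \<partial>lborel)"
  proof (rule nn_integral_cong)
    fix t
    show "(\<integral>\<^sup>+x. ennreal ((norm (slot f (t, x)))\<^sup>2) \<partial>lborel) = indicator {- (pi / 4)..pi / 4} t * ennreal ((l2n f)\<^sup>2)"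
      using L2_nn_integral[OF propagator_L2[OF f], of t]
      by (auto simp: slot_def window_def propagator_norm[OF f] split: split_indicator)
  qed
  also have "\<dots> = ennreal (pi / 2 * (l2n f)\<^sup>2)"
    by (subst nn_integral_multc) (auto simp: emeasure_lborel_Icc_eq ennreal_mult'[symmetric])
  finally have n: "(\<integral>\<^sup>+z. ennreal ((norm (slot f z))\<^sup>2) \<partial>lborel) = ennreal (pi / 2 * (l2n f)\<^sup>2)" .
  show i: "integrable lborel (\<lambda>z. (norm (slot f z))\<^sup>2)"
  proof (rule integrableI_bounded)
    show "(\<lambda>z. (norm (slot f z))\<^sup>2) \<in> borel_measurable lborel" by measurable
  qed (use n in simp)
  have "ennreal (LINT z|lborel. (norm (slot f z))\<^sup>2) = ennreal (pi / 2 * (l2n f)\<^sup>2)"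
    using nn_integral_eq_integral[OF i] n by simp
  thus "(LINT z|lborel. (norm (slot f z))\<^sup>2) = pi / 2 * (l2n f)\<^sup>2" by (subst (asm) ennreal_inj) auto
qed

lemma tendsto_L2_norm: "tendsto_L2 w h \<Longrightarrow> (\<lambda>n. l2n (w n)) \<longlonglongrightarrow> l2n h"
proof -
  assume a: "tendsto_L2 w h"
  hence z: "(\<lambda>n. l2n (\<lambda>x. w n x - h x)) \<longlonglongrightarrow> 0" by (simp add: tendsto_L2_iff)
  have "norm (l2n (w n) - l2n h) \<le> l2n (\<lambda>x. w n x - h x)" for n
    using l2n_diff_abs[of "w n" h] a by (auto simp: tendsto_L2_iff)
  hence "(\<lambda>n. l2n (w n) - l2n h) \<longlonglongrightarrow> 0"
    by (intro Lim_null_comparison[OF always_eventually z] allI)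
  thus ?thesis by (simp add: LIM_zero_iff)
qed

text \<open>The evolved approximants converge in L^2 of space-time by \<open>slot_L2\<close>, hence
  almost everywhere along a subsequence. Fatou then transfers the bound for waves.\<close>

lemma Strichartz:
  assumes f: "L2 f"
  shows "(\<integral>\<^sup>+z. ennreal (norm (slot f z) ^ 6) \<partial>lborel) \<le> ennreal (str_const * l2n f ^ 6)"
proof -
  obtain v U where v: "\<And>n. wave (v n) (U n)" "tendsto_L2 v f" using waves_dense[OF f] by blast
  have Lv: "L2 (v n)" for n by (rule wave_L2[OF v(1)])
  have Ld: "L2 (\<lambda>x. v n x - f x)" for n by (intro L2_diff Lv f)
  note [measurable] = slot_measurable[OF f] slot_measurable[OF Lv] slot_measurable[OF Ld]
  have "(\<lambda>n. pi / 2 * (l2n (\<lambda>x. v n x - f x))\<^sup>2) \<longlonglongrightarrow> pi / 2 * 0\<^sup>2"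
    using v(2) by (intro tendsto_mult tendsto_power tendsto_const) (auto simp: tendsto_L2_iff)
  hence "(\<lambda>n. LINT z|lborel. norm ((norm (slot (\<lambda>x. v n x - f x) z))\<^sup>2)) \<longlonglongrightarrow> 0"
    by (simp add: slot_L2(2)[OF Ld])
  from tendsto_L1_AE_subseq[OF slot_L2(1)[OF Ld] this]
  obtain r :: "nat \<Rightarrow> nat" where r: "strict_mono r" "AE z in lborel. (\<lambda>n. (norm (slot (\<lambda>x. v (r n) x - f x) z))\<^sup>2) \<longlonglongrightarrow> 0"
    by blast
  have ae1: "AE z in lborel. \<forall>n. slot (v (r n)) z = slot (\<lambda>x. v (r n) x - f x) z + slot f z"
    using slot_add[OF Ld f] by (subst AE_all_countable) simp
  have ae2: "AE z in lborel. \<forall>n. slot (v (r n)) z = window (U (r n)) z"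
    using slot_wave[OF v(1)] by (subst AE_all_countable) simp
  have [measurable]: "window (U n) \<in> borel_measurable borel" for n using wave_window(1)[OF v(1)] by simp
  have "AE z in lborel. ennreal (norm (slot f z) ^ 6) = liminf (\<lambda>n. ennreal (norm (window (U (r n)) z) ^ 6))"
    using r(2) ae1 ae2
  proof eventually_elim
    case (elim z)
    have "(\<lambda>n. sqrt ((norm (slot (\<lambda>x. v (r n) x - f x) z))\<^sup>2)) \<longlonglongrightarrow> sqrt 0" by (intro tendsto_real_sqrt elim)
    hence "(\<lambda>n. slot (\<lambda>x. v (r n) x - f x) z) \<longlonglongrightarrow> 0" by (simp add: tendsto_norm_zero_iff)
    hence "(\<lambda>n. slot (\<lambda>x. v (r n) x - f x) z + slot f z) \<longlonglongrightarrow> 0 + slot f z" by (intro tendsto_add tendsto_const)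
    moreover have "slot (\<lambda>x. v (r n) x - f x) z + slot f z = window (U (r n)) z" for n using elim(2,3) by metis
    ultimately have "(\<lambda>n. window (U (r n)) z) \<longlonglongrightarrow> slot f z" by simp
    hence "(\<lambda>n. ennreal (norm (window (U (r n)) z) ^ 6)) \<longlonglongrightarrow> ennreal (norm (slot f z) ^ 6)"
      by (intro tendsto_ennrealI tendsto_power tendsto_norm)
    thus ?case by (intro lim_imp_Liminf[symmetric]) simp_all
  qed
  hence "(\<integral>\<^sup>+z. ennreal (norm (slot f z) ^ 6) \<partial>lborel) = (\<integral>\<^sup>+z. liminf (\<lambda>n. ennreal (norm (window (U (r n)) z) ^ 6)) \<partial>lborel)"
    by (rule nn_integral_cong_AE)
  also have "\<dots> \<le> liminf (\<lambda>n. \<integral>\<^sup>+z. ennreal (norm (window (U (r n)) z) ^ 6) \<partial>lborel)"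
    by (rule nn_integral_liminf) measurable
  also have "\<dots> \<le> liminf (\<lambda>n. ennreal (str_const * l2n (v (r n)) ^ 6))"
    by (intro Liminf_mono always_eventually allI Strichartz_wave v)
  also have "\<dots> = ennreal (str_const * l2n f ^ 6)"
  proof (rule lim_imp_Liminf)
    have "(\<lambda>n. l2n (v (r n))) \<longlonglongrightarrow> l2n f"
      using LIMSEQ_subseq_LIMSEQ[OF tendsto_L2_norm[OF v(2)] r(1)] by (simp add: o_def)
    thus "(\<lambda>n. ennreal (str_const * l2n (v (r n)) ^ 6)) \<longlonglongrightarrow> ennreal (str_const * l2n f ^ 6)"
      by (intro tendsto_ennrealI tendsto_mult tendsto_power tendsto_const)
  qed simp
  finally show ?thesis .
qed

section \<open>Bounded six-linear forms\<close>

text \<open>Stated for any number m of slots because it is used with six for the forms and with five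
  for the operator.\<close>

lemma telescoping_bound_tendsto_0:
  fixes m :: nat
  assumes G: "\<And>i. i < m \<Longrightarrow> tendsto_L2 (\<lambda>n. G n i) (F i)"
  shows "(\<lambda>n. \<Sum>k<m. \<Prod>i<m. if i < k then l2n (G n i) else if i = k then l2n (\<lambda>x. G n k x - F k x) else l2n (F i)) \<longlonglongrightarrow> 0"
proof -
  have "(\<lambda>n. \<Sum>k<m. \<Prod>i<m. if i < k then l2n (G n i) else if i = k then l2n (\<lambda>x. G n k x - F k x) else l2n (F i))
     \<longlonglongrightarrow> (\<Sum>k<m. \<Prod>i<m. if i < k then l2n (F i) else if i = k then 0 else l2n (F i))"
  proof (intro tendsto_sum tendsto_prod)
    fix k i :: nat assume "k \<in> {..<m}" "i \<in> {..<m}"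
    thus "(\<lambda>n. if i < k then l2n (G n i) else if i = k then l2n (\<lambda>x. G n k x - F k x) else l2n (F i))
       \<longlonglongrightarrow> (if i < k then l2n (F i) else if i = k then 0 else l2n (F i))"
      using G[of i] G[of k] by (auto simp: tendsto_L2_iff intro: tendsto_L2_norm)
  qed
  moreover have "(\<Sum>k<m. \<Prod>i<m. if i < k then l2n (F i) else if i = k then 0 else l2n (F i)) = 0"
  proof (rule sum.neutral, rule ballI)
    fix k :: nat assume "k \<in> {..<m}"
    thus "(\<Prod>i<m. if i < k then l2n (F i) else if i = k then 0 else l2n (F i)) = 0"
      by (intro prod_zero) (auto intro!: bexI[of _ k])
  qed
  ultimately show ?thesis by simp
qed

text \<open>Additivity in each slot and a product bound already imply sequential continuity. Entries
  are functions on all naturals, so \<open>cong\<close> records that the form reads the first six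
  only.\<close>

locale multi6 =
  fixes Q :: "(nat \<Rightarrow> real \<Rightarrow> complex) \<Rightarrow> complex" and K :: real
  assumes K_nonneg: "K \<ge> 0"
    and add: "\<And>k F f g. k < 6 \<Longrightarrow> (\<And>i. i < 6 \<Longrightarrow> L2 (F i)) \<Longrightarrow> L2 f \<Longrightarrow> L2 g \<Longrightarrow>
      Q (F(k := \<lambda>x. f x + g x)) = Q (F(k := f)) + Q (F(k := g))"
    and bound: "\<And>F. (\<And>i. i < 6 \<Longrightarrow> L2 (F i)) \<Longrightarrow> norm (Q F) \<le> K * (\<Prod>i<6. l2n (F i))"
    and cong: "\<And>F G. (\<And>i. i < 6 \<Longrightarrow> F i = G i) \<Longrightarrow> Q F = Q G"
begin

lemma norm_diff_le:
  assumes F: "\<And>i. i < 6 \<Longrightarrow> L2 (F i)" and G: "\<And>i. i < 6 \<Longrightarrow> L2 (G i)"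
  shows "norm (Q G - Q F) \<le> K * (\<Sum>k<6. \<Prod>i<6. if i < k then l2n (G i) else if i = k then l2n (\<lambda>x. G k x - F k x) else l2n (F i))"
proof -
  \<comment> \<open>Hybrid arguments, passing from \<open>F\<close> to \<open>G\<close> one slot at
    a time.\<close>
  define m where "m k i = (if i < k then G i else F i)" for k i :: nat
  have Lm: "L2 (m k i)" if "i < 6" for k i using F[OF that] G[OF that] by (simp add: m_def)
  have step: "Q (m (Suc k)) - Q (m k) = Q ((m k)(k := \<lambda>x. G k x - F k x))" if k: "k < 6" for k
  proof -
    have "m (Suc k) = (m k)(k := \<lambda>x. (G k x - F k x) + F k x)" by (auto simp: m_def fun_eq_iff)
    hence "Q (m (Suc k)) = Q ((m k)(k := \<lambda>x. G k x - F k x)) + Q ((m k)(k := F k))"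
      using add[OF k Lm[of _ k] L2_diff[OF G[OF k] F[OF k]] F[OF k]] by simp
    moreover have "(m k)(k := F k) = m k" by (auto simp: m_def fun_eq_iff)
    ultimately show ?thesis by simp
  qed
  have "Q G - Q F = Q (m 6) - Q (m 0)"
    using cong[of G "m 6"] cong[of F "m 0"] by (simp add: m_def)
  also have "\<dots> = (\<Sum>k<6. Q (m (Suc k)) - Q (m k))" by (rule sum_lessThan_telescope[symmetric])
  also have "\<dots> = (\<Sum>k<6. Q ((m k)(k := \<lambda>x. G k x - F k x)))" by (intro sum.cong refl step) simp
  finally have "norm (Q G - Q F) \<le> (\<Sum>k<6. norm (Q ((m k)(k := \<lambda>x. G k x - F k x))))"
    by (simp add: norm_sum)
  also have "\<dots> \<le> (\<Sum>k<6. K * (\<Prod>i<6. if i < k then l2n (G i) else if i = k then l2n (\<lambda>x. G k x - F k x) else l2n (F i)))"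
  proof (rule sum_mono)
    fix k :: nat assume "k \<in> {..<6}"
    hence k: "k < 6" by simp
    have "norm (Q ((m k)(k := \<lambda>x. G k x - F k x))) \<le> K * (\<Prod>i<6. l2n (((m k)(k := \<lambda>x. G k x - F k x)) i))"
      using Lm F[OF k] G[OF k] by (intro bound) (auto intro: L2_diff)
    also have "(\<Prod>i<6. l2n (((m k)(k := \<lambda>x. G k x - F k x)) i)) = (\<Prod>i<6. if i < k then l2n (G i) else if i = k then l2n (\<lambda>x. G k x - F k x) else l2n (F i))"
      by (intro prod.cong refl) (auto simp: m_def)
    finally show "norm (Q ((m k)(k := \<lambda>x. G k x - F k x))) \<le> K * (\<Prod>i<6. if i < k then l2n (G i) else if i = k then l2n (\<lambda>x. G k x - F k x) else l2n (F i))" .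
  qed
  finally show ?thesis by (simp only: sum_distrib_left)
qed

lemma tendsto:
  assumes G: "\<And>i. i < 6 \<Longrightarrow> tendsto_L2 (\<lambda>n. G n i) (F i)"
  shows "(\<lambda>n. Q (G n)) \<longlonglongrightarrow> Q F"
proof -
  have L: "L2 (F i)" "L2 (G n i)" if "i < 6" for i n using G[OF that] by (auto simp: tendsto_L2_iff)
  let ?b = "\<lambda>n. K * (\<Sum>k<6. \<Prod>i<6. if i < k then l2n (G n i) else if i = k then l2n (\<lambda>x. G n k x - F k x) else l2n (F i))"
  have z: "?b \<longlonglongrightarrow> 0" by (rule tendsto_mult_right_zero) (rule telescoping_bound_tendsto_0[OF G])
  have "norm (Q (G n) - Q F) \<le> ?b n" for n by (rule norm_diff_le[OF L])
  hence "(\<lambda>n. Q (G n) - Q F) \<longlonglongrightarrow> 0"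
    by (intro Lim_null_comparison[OF always_eventually z] allI)
  thus ?thesis by (simp add: LIM_zero_iff)
qed

end

lemma multi6_RQ: "multi6 RQ (2 * pi)"
  by unfold_locales (auto intro: RQ_add RQ_bounds(2) RQ_cong)

definition SQ :: "(nat \<Rightarrow> real \<Rightarrow> complex) \<Rightarrow> complex" where
  "SQ F = (LINT z|lborel. prod6 (\<lambda>i. slot (F i)) z)"

lemma SQ_bounds:
  assumes "\<And>i. i < 6 \<Longrightarrow> L2 (F i)"
  shows "integrable lborel (prod6 (\<lambda>i. slot (F i)))" "norm (SQ F) \<le> 6 * str_const * (\<Prod>i<6. l2n (F i))"
  unfolding SQ_def
  by (rule Hoelder6[where n="\<lambda>i. l2n (F i)" and K=str_const]; use assms in \<open>simp add: slot_measurable str_const_nonneg Strichartz\<close>)+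

lemma multi6_SQ: "multi6 SQ (6 * str_const)"
proof
  show "6 * str_const \<ge> 0" using str_const_nonneg by simp
  show "norm (SQ F) \<le> 6 * str_const * (\<Prod>i<6. l2n (F i))" if "\<And>i. i < 6 \<Longrightarrow> L2 (F i)" for F
    by (rule SQ_bounds(2)[OF that])
  show "SQ F = SQ G" if "\<And>i. i < 6 \<Longrightarrow> F i = G i" for F G
    unfolding SQ_def by (intro Bochner_Integration.integral_cong refl prod6_cong) (simp add: that)
  fix k :: nat and F :: "nat \<Rightarrow> real \<Rightarrow> complex" and f g :: "real \<Rightarrow> complex"
  assume k: "k < 6" and F: "\<And>i. i < 6 \<Longrightarrow> L2 (F i)" and f: "L2 f" and g: "L2 g"
  have L: "L2 ((F(k := h)) i)" if "L2 h" "i < 6" for h i using F that by simp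
  have upd: "(\<lambda>i. slot ((F(k := h)) i)) = (\<lambda>i. slot (F i))(k := slot h)" for h by auto
  note i = SQ_bounds(1)[of "F(k := h)" for h, OF L, unfolded upd]
  have "SQ (F(k := \<lambda>x. f x + g x)) = (LINT z|lborel. prod6 ((\<lambda>i. slot (F i))(k := slot f)) z + prod6 ((\<lambda>i. slot (F i))(k := slot g)) z)"
    unfolding SQ_def upd
  proof (rule integral_cong_AE)
    show "AE z in lborel. prod6 ((\<lambda>i. slot (F i))(k := slot (\<lambda>x. f x + g x))) z = prod6 ((\<lambda>i. slot (F i))(k := slot f)) z + prod6 ((\<lambda>i. slot (F i))(k := slot g)) z"
      using slot_add[OF f g]
    proof eventually_elim
      case (elim z)
      show ?case unfolding prod6_add[OF k, symmetric] by (rule prod6_cong) (simp add: elim)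
    qed
  qed (use i[OF L2_add[OF f g]] i[OF f] i[OF g] in simp_all)
  also have "\<dots> = SQ (F(k := f)) + SQ (F(k := g))"
    unfolding SQ_def upd by (rule Bochner_Integration.integral_add[OF i[OF f] i[OF g]])
  finally show "SQ (F(k := \<lambda>x. f x + g x)) = SQ (F(k := f)) + SQ (F(k := g))" .
qed

lemma SQ_eq_RQ:
  assumes F: "\<And>i. i < 6 \<Longrightarrow> L2 (F i)"
  shows "SQ F = of_real slot_const * RQ F"
proof -
  interpret R: multi6 RQ "2 * pi" by (rule multi6_RQ)
  interpret S: multi6 SQ "6 * str_const" by (rule multi6_SQ)
  have "\<forall>i. \<exists>v U. i < 6 \<longrightarrow> (\<forall>n. wave (v n) (U n)) \<and> tendsto_L2 v (F i)"
    using waves_dense[OF F] by metis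
  then obtain v U where v: "\<And>i n. i < 6 \<Longrightarrow> wave (v i n) (U i n)" "\<And>i. i < 6 \<Longrightarrow> tendsto_L2 (v i) (F i)"
    by metis
  have eq: "SQ (\<lambda>i. v i n) = of_real slot_const * RQ (\<lambda>i. v i n)" for n
  proof -
    have L: "L2 (v i n)" if "i < 6" for i by (rule wave_L2[OF v(1)[OF that]])
    have "SQ (\<lambda>i. v i n) = (LINT p|lborel. prod6 (\<lambda>i. window (U i n)) p)"
      unfolding SQ_def
    proof (rule integral_cong_AE)
      have "AE z in lborel. \<forall>i\<in>{..<6}. slot (v i n) z = window (U i n) z"
        using slot_wave[OF v(1)] by (subst AE_ball_countable) auto
      thus "AE z in lborel. prod6 (\<lambda>i. slot (v i n)) z = prod6 (\<lambda>i. window (U i n)) z"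
        by eventually_elim (auto intro: prod6_cong)
      show "prod6 (\<lambda>i. slot (v i n)) \<in> borel_measurable lborel"
        using SQ_bounds(1)[of "\<lambda>i. v i n", OF L] by simp
      show "prod6 (\<lambda>i. window (U i n)) \<in> borel_measurable lborel"
        using waves_prod6_integrable[of "\<lambda>i. v i n" "\<lambda>i. U i n", OF v(1)] by simp
    qed
    also have "\<dots> = of_real slot_const * RQ (\<lambda>i. v i n)"
      by (rule identity_waves) (rule v(1))
    finally show ?thesis .
  qed
  have "(\<lambda>n. SQ (\<lambda>i. v i n)) \<longlonglongrightarrow> SQ F" by (rule S.tendsto) (rule v(2))
  moreover have "(\<lambda>n. of_real slot_const * RQ (\<lambda>i. v i n)) \<longlonglongrightarrow> of_real slot_const * RQ F"
    by (intro tendsto_mult tendsto_const R.tendsto) (rule v(2))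
  ultimately show ?thesis unfolding eq by (rule LIMSEQ_unique)
qed

lemma E6_eq_RQ:
  assumes F: "\<And>i. i < 6 \<Longrightarrow> L2 (F i)"
  shows "E6 (F 0) (F 1) (F 2) (F 3) (F 4) (F 5) = of_real (1 / pi\<^sup>2) * (of_real (sqrt 3 / 6) * RQ F)"
proof -
  have "SQ F = (LINT t|lborel. LINT x|lborel. prod6 (\<lambda>i. slot (F i)) (t, x))"
    unfolding SQ_def by (rule lborel_Fubini(1)[OF SQ_bounds(1)[of F, OF F]])
  also have "\<dots> = (LINT t:{- (pi / 4)..pi / 4}|lborel. LINT x|lborel.
        propagator t (F 0) x * propagator t (F 1) x * propagator t (F 2) x *
        cnj (propagator t (F 3) x * propagator t (F 4) x * propagator t (F 5) x))"
    unfolding slot_def prod6_window integral_scaleR_right set_lebesgue_integral_def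
    by (simp add: prod6_def mult.assoc)
  finally have h: "SQ F = \<dots>" .
  have "E6 (F 0) (F 1) (F 2) (F 3) (F 4) (F 5) = of_real (2 / pi) * SQ F"
    unfolding E6_def h ..
  hence "E6 (F 0) (F 1) (F 2) (F 3) (F 4) (F 5) = of_real (2 / pi) * (of_real slot_const * RQ F)"
    using SQ_eq_RQ[of F, OF F] by (simp only:)
  moreover have "2 / pi * slot_const = 1 / pi\<^sup>2 * (sqrt 3 / 6)"
    by (simp add: slot_const_def power2_eq_square)
  ultimately show ?thesis by (metis (no_types, lifting) mult.assoc of_real_mult)
qed

section \<open>Representation by the averaged pairing\<close>

definition six :: "'a \<Rightarrow> 'a \<Rightarrow> 'a \<Rightarrow> 'a \<Rightarrow> 'a \<Rightarrow> 'a \<Rightarrow> nat \<Rightarrow> 'a" where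
  "six a b c d e f i = [a, b, c, d, e, f] ! i"

lemma six_simps [simp]:
  "six a b c d e f 0 = a" "six a b c d e f (Suc 0) = b" "six a b c d e f 1 = b" "six a b c d e f 2 = c" "six a b c d e f 3 = d"
  "six a b c d e f 4 = e" "six a b c d e f 5 = f"
  by (simp_all add: six_def)

lemma six_all: "P a \<Longrightarrow> P b \<Longrightarrow> P c \<Longrightarrow> P d \<Longrightarrow> P e \<Longrightarrow> P f \<Longrightarrow> i < 6 \<Longrightarrow> P (six a b c d e f i)"
  by (drule less_6_cases) auto

text \<open>Splits off the last variable, which becomes the argument of the operator.\<close>

definition reassoc :: "(real \<times> real) \<times> real \<Rightarrow> r3" where
  "reassoc z = (fst (fst z), snd (fst z), snd z)"

lemma reassoc_measurable [measurable]: "reassoc \<in> borel_measurable borel"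
  unfolding reassoc_def[abs_def] by (intro borel_measurable_continuous_onI continuous_intros)

lemma distr_reassoc: "distr lborel borel reassoc = lborel"
proof (rule measure_eqI)
  fix A :: "r3 set"
  assume "A \<in> sets (distr lborel borel reassoc)"
  hence A[measurable]: "A \<in> sets borel" by simp
  have m: "(\<lambda>z. indicator A (reassoc z) :: ennreal) \<in> borel_measurable borel" by measurable
  have m1: "(indicator A :: _ \<Rightarrow> ennreal) \<in> borel_measurable borel" by measurable
  have m2: "(\<lambda>p. indicator A (x, p) :: ennreal) \<in> borel_measurable borel" for x by measurable
  have m4: "(\<lambda>v. \<integral>\<^sup>+u. indicator A (reassoc (v, u)) \<partial>lborel) \<in> borel_measurable borel"
    by (rule nn_integral_param_measurable[OF m])
  have "emeasure (distr lborel borel reassoc) A = (\<integral>\<^sup>+z. indicator A z \<partial>distr lborel borel reassoc)" by simp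
  also have "\<dots> = (\<integral>\<^sup>+z. indicator A (reassoc z) \<partial>lborel)" by (rule nn_integral_distr) auto
  also have "\<dots> = (\<integral>\<^sup>+v. \<integral>\<^sup>+u. indicator A (reassoc (v, u)) \<partial>lborel \<partial>lborel)" by (rule nn_integral_lborel_fst[OF m])
  also have "\<dots> = (\<integral>\<^sup>+x. \<integral>\<^sup>+y. \<integral>\<^sup>+u. indicator A (reassoc ((x, y), u)) \<partial>lborel \<partial>lborel \<partial>lborel)" by (rule nn_integral_lborel_fst[OF m4])
  also have "\<dots> = (\<integral>\<^sup>+x. \<integral>\<^sup>+y. \<integral>\<^sup>+u. indicator A (x, y, u) \<partial>lborel \<partial>lborel \<partial>lborel)"
    by (simp add: reassoc_def)
  also have "\<dots> = (\<integral>\<^sup>+x. \<integral>\<^sup>+p. indicator A (x, p) \<partial>lborel \<partial>lborel)"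
    by (intro nn_integral_cong nn_integral_lborel_fst[OF m2, symmetric])
  also have "\<dots> = (\<integral>\<^sup>+z. indicator A z \<partial>lborel)" by (rule nn_integral_lborel_fst[OF m1, symmetric])
  finally show "emeasure (distr lborel borel reassoc) A = emeasure lborel A" by simp
qed simp

lemma ennreal_norm_integral_le:
  fixes f :: "'a \<Rightarrow> complex"
  shows "ennreal (norm (LINT x|M. f x)) \<le> (\<integral>\<^sup>+x. ennreal (norm (f x)) \<partial>M)"
  by (cases "integrable M f") (auto intro: integral_norm_bound_ennreal simp: not_integrable_integral_eq)

lemma circ_measurable [measurable]:
  assumes [measurable]: "\<Phi> \<in> borel_measurable borel"
  shows "circ \<Phi> \<in> borel_measurable borel"
proof -
  have sw: "(\<lambda>z::r3 \<times> real. (snd z, fst z)) \<in> borel_measurable borel"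
    by (intro borel_measurable_continuous_onI continuous_intros)
  have "(\<lambda>z. \<Phi> (Rot (fst z) (snd z))) \<in> borel_measurable borel"
    by (rule measurable_compose[OF Rot_measurable_pair]) simp
  from measurable_compose[OF sw this]
  have [measurable]: "(\<lambda>z::r3 \<times> real. \<Phi> (Rot (snd z) (fst z))) \<in> borel_measurable borel" by simp
  have "(\<lambda>z::r3 \<times> real. indicator {-pi..pi} (snd z) *\<^sub>R \<Phi> (Rot (snd z) (fst z))) \<in> borel_measurable borel"
    by measurable
  hence "(\<lambda>z::r3 \<times> real. indicator {-pi..pi} (snd z) *\<^sub>R \<Phi> (Rot (snd z) (fst z))) \<in> borel_measurable (borel \<Otimes>\<^sub>M borel)"
    by (simp only: borel_prod)
  hence "(\<lambda>(w, \<theta>). indicator {-pi..pi} \<theta> *\<^sub>R \<Phi> (Rot \<theta> w)) \<in> borel_measurable (borel \<Otimes>\<^sub>M (lborel :: real measure))"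
    by (simp add: split_def cong: measurable_cong_sets)
  thus ?thesis unfolding circ_def[abs_def] by (rule lborel.borel_measurable_lebesgue_integral)
qed

text \<open>One factor 2 pi comes from Cauchy-Schwarz in the angle, the other from averaging over
  rotations that preserve the measure.\<close>

lemma circ_nn_integral_le:
  assumes [measurable]: "\<Phi> \<in> borel_measurable borel"
  shows "(\<integral>\<^sup>+w. ennreal ((norm (circ \<Phi> w))\<^sup>2) \<partial>lborel) \<le> ennreal (2 * pi) * (ennreal (2 * pi) * (\<integral>\<^sup>+w. ennreal ((norm (\<Phi> w))\<^sup>2) \<partial>lborel))"
proof -
  define X where "X = (\<lambda>z. indicator {-pi..pi} (fst z) * ennreal ((norm (\<Phi> (Rot (fst z) (snd z))))\<^sup>2))"
  have "(\<lambda>z. \<Phi> (Rot (fst z) (snd z))) \<in> borel_measurable borel"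
    by (rule measurable_compose[OF Rot_measurable_pair]) simp
  note [measurable] = this
  have mX: "X \<in> borel_measurable borel" unfolding X_def by measurable
  have "ennreal ((norm (circ \<Phi> w))\<^sup>2) \<le> ennreal (2 * pi) * (\<integral>\<^sup>+\<theta>. X (\<theta>, w) \<partial>lborel)" for w
  proof -
    have "(\<lambda>\<theta>. \<Phi> (Rot \<theta> w)) \<in> borel_measurable borel"
      by (rule measurable_compose[OF measurable_compose[OF measurable_Pair_borel(2) Rot_measurable_pair, simplified]]) simp
    note [measurable] = this
    have "ennreal (norm (circ \<Phi> w)) \<le> (\<integral>\<^sup>+\<theta>. indicator {-pi..pi} \<theta> * (indicator {-pi..pi} \<theta> * ennreal (norm (\<Phi> (Rot \<theta> w)))) \<partial>lborel)"
      unfolding circ_def by (rule order_trans[OF ennreal_norm_integral_le]) (auto intro!: nn_integral_mono split: split_indicator)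
    hence "(ennreal (norm (circ \<Phi> w)))\<^sup>2 \<le> (\<integral>\<^sup>+\<theta>. indicator {-pi..pi} \<theta> * (indicator {-pi..pi} \<theta> * ennreal (norm (\<Phi> (Rot \<theta> w)))) \<partial>lborel)\<^sup>2"
      by (intro power_mono) auto
    also have "\<dots> \<le> (\<integral>\<^sup>+\<theta>. (indicator {-pi..pi} \<theta>)\<^sup>2 \<partial>lborel) * (\<integral>\<^sup>+\<theta>. (indicator {-pi..pi} \<theta> * ennreal (norm (\<Phi> (Rot \<theta> w))))\<^sup>2 \<partial>lborel)"
      by (rule Cauchy_Schwarz_nn_integral) measurable
    also have "(\<integral>\<^sup>+\<theta>. (indicator {-pi..pi} \<theta>)\<^sup>2 \<partial>(lborel::real measure)) = (\<integral>\<^sup>+\<theta>. indicator {-pi..pi} \<theta> \<partial>(lborel::real measure))"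
      by (intro nn_integral_cong) (auto split: split_indicator)
    also have "\<dots> = ennreal (2 * pi)" by simp
    also have "(\<integral>\<^sup>+\<theta>. (indicator {-pi..pi} \<theta> * ennreal (norm (\<Phi> (Rot \<theta> w))))\<^sup>2 \<partial>lborel) = (\<integral>\<^sup>+\<theta>. X (\<theta>, w) \<partial>lborel)"
      unfolding X_def by (intro nn_integral_cong) (auto simp: ennreal_power split: split_indicator)
    finally show ?thesis by (simp add: ennreal_power)
  qed
  hence "(\<integral>\<^sup>+w. ennreal ((norm (circ \<Phi> w))\<^sup>2) \<partial>lborel) \<le> (\<integral>\<^sup>+w. ennreal (2 * pi) * (\<integral>\<^sup>+\<theta>. X (\<theta>, w) \<partial>lborel) \<partial>lborel)"
    by (intro nn_integral_mono)
  also have "\<dots> = ennreal (2 * pi) * (\<integral>\<^sup>+w. \<integral>\<^sup>+\<theta>. X (\<theta>, w) \<partial>lborel \<partial>lborel)"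
  proof (rule nn_integral_cmult)
    have sw: "(\<lambda>z::r3 \<times> real. (snd z, fst z)) \<in> borel_measurable borel"
      by (intro borel_measurable_continuous_onI continuous_intros)
    from nn_integral_param_measurable[OF measurable_compose[OF sw mX]]
    show "(\<lambda>w. \<integral>\<^sup>+\<theta>. X (\<theta>, w) \<partial>lborel) \<in> borel_measurable lborel" by simp
  qed
  also have "(\<integral>\<^sup>+w. \<integral>\<^sup>+\<theta>. X (\<theta>, w) \<partial>lborel \<partial>lborel) = (\<integral>\<^sup>+z. X z \<partial>lborel)"
    by (rule nn_integral_lborel_snd[OF mX, symmetric])
  also have "\<dots> = ennreal (2 * pi) * (\<integral>\<^sup>+w. ennreal ((norm (\<Phi> w))\<^sup>2) \<partial>lborel)"
    unfolding X_def by (rule nn_integral_Rot_pair) measurable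
  finally show ?thesis .
qed

text \<open>The function that represents \<open>RQ\<close> as an inner product in its sixth entry,
  see \<open>inner_Tker\<close>.\<close>

definition Tker :: "(real \<Rightarrow> complex) \<Rightarrow> (real \<Rightarrow> complex) \<Rightarrow> (real \<Rightarrow> complex) \<Rightarrow>
    (real \<Rightarrow> complex) \<Rightarrow> (real \<Rightarrow> complex) \<Rightarrow> real \<Rightarrow> complex" where
  "Tker f1 f2 f3 f4 f5 x =
     (LINT u|lborel. cnj (f4 (fst u) * f5 (snd u)) * circ (tens f1 f2 f3) (fst u, snd u, x))"

text \<open>For fixed x, Cauchy-Schwarz in the two remaining variables separates the product of
  \<open>f4\<close> and \<open>f5\<close> from the angular integral. Integrating over x then
  restores the full norm of the latter on three-space.\<close>

lemma L2_Tker: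
  assumes L: "L2 f1" "L2 f2" "L2 f3" "L2 f4" "L2 f5"
  shows "L2 (Tker f1 f2 f3 f4 f5)"
proof -
  note [measurable] = L[THEN L2_measurable]
  let ?c = "circ (tens f1 f2 f3)"
  have sw: "(\<lambda>z::real \<times> real \<times> real. reassoc (snd z, fst z)) \<in> borel_measurable borel"
    unfolding reassoc_def by (intro borel_measurable_continuous_onI continuous_intros)
  have mc: "(\<lambda>z::real \<times> real \<times> real. ?c (reassoc (snd z, fst z))) \<in> borel_measurable borel"
    by (rule measurable_compose[OF sw]) measurable
  note [measurable] = this
  have m1[measurable]: "(\<lambda>z::real \<times> real \<times> real. fst (snd z)) \<in> borel_measurable borel" 
    and m2[measurable]: "(\<lambda>z::real \<times> real \<times> real. snd (snd z)) \<in> borel_measurable borel"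
    by (intro borel_measurable_continuous_onI continuous_intros)+
  have "(\<lambda>z::real \<times> real \<times> real. cnj (f4 (fst (snd z)) * f5 (snd (snd z))) * ?c (reassoc (snd z, fst z))) \<in> borel_measurable borel"
    by measurable
  hence "(\<lambda>z::real \<times> real \<times> real. cnj (f4 (fst (snd z)) * f5 (snd (snd z))) * ?c (reassoc (snd z, fst z))) \<in> borel_measurable (borel \<Otimes>\<^sub>M borel)"
    by (simp only: borel_prod)
  hence "(\<lambda>(x, u). cnj (f4 (fst u) * f5 (snd u)) * ?c (fst u, snd u, x)) \<in> borel_measurable (borel \<Otimes>\<^sub>M (lborel :: (real \<times> real) measure))"
    by (simp add: split_def reassoc_def cong: measurable_cong_sets)
  hence mT: "Tker f1 f2 f3 f4 f5 \<in> borel_measurable borel"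
    unfolding Tker_def[abs_def] by (rule lborel.borel_measurable_lebesgue_integral)
  define G where "G = (\<integral>\<^sup>+u. ennreal ((norm (f4 (fst u) * f5 (snd u)))\<^sup>2) \<partial>(lborel :: (real \<times> real) measure))"
  have G: "G = ennreal ((l2n f4)\<^sup>2) * ennreal ((l2n f5)\<^sup>2)"
  proof -
    have "G = (\<integral>\<^sup>+u. ennreal ((norm (f4 (fst u)))\<^sup>2) * ennreal ((norm (f5 (snd u)))\<^sup>2) \<partial>(lborel :: (real \<times> real) measure))"
      unfolding G_def by (simp add: norm_mult power_mult_distrib ennreal_mult)
    also have "\<dots> = (\<integral>\<^sup>+x. ennreal ((norm (f4 x))\<^sup>2) \<partial>lborel) * (\<integral>\<^sup>+x. ennreal ((norm (f5 x))\<^sup>2) \<partial>lborel)"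
      by (rule nn_integral_prod_mult) measurable
    finally show ?thesis by (simp add: L2_nn_integral L)
  qed
  define N where "N x = (\<integral>\<^sup>+u. ennreal ((norm (?c (reassoc (u, x))))\<^sup>2) \<partial>lborel)" for x
  have pt: "ennreal ((norm (Tker f1 f2 f3 f4 f5 x))\<^sup>2) \<le> G * N x" for x
  proof -
    have [measurable]: "(\<lambda>u. ?c (reassoc (u, x))) \<in> borel_measurable borel" by measurable
    have [measurable]: "(\<lambda>u::real \<times> real. f4 (fst u) * f5 (snd u)) \<in> borel_measurable borel" by measurable
    have "ennreal (norm (Tker f1 f2 f3 f4 f5 x)) \<le> (\<integral>\<^sup>+u. ennreal (norm (f4 (fst u) * f5 (snd u))) * ennreal (norm (?c (reassoc (u, x)))) \<partial>lborel)"
      unfolding Tker_def by (rule order_trans[OF ennreal_norm_integral_le]) (simp add: reassoc_def norm_mult ennreal_mult)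
    hence "(ennreal (norm (Tker f1 f2 f3 f4 f5 x)))\<^sup>2 \<le> (\<integral>\<^sup>+u. ennreal (norm (f4 (fst u) * f5 (snd u))) * ennreal (norm (?c (reassoc (u, x)))) \<partial>lborel)\<^sup>2"
      by (intro power_mono) auto
    also have "\<dots> \<le> (\<integral>\<^sup>+u. (ennreal (norm (f4 (fst u) * f5 (snd u))))\<^sup>2 \<partial>lborel) * (\<integral>\<^sup>+u. (ennreal (norm (?c (reassoc (u, x)))))\<^sup>2 \<partial>lborel)"
      by (rule Cauchy_Schwarz_nn_integral) measurable
    finally show ?thesis by (simp add: ennreal_power G_def N_def)
  qed
  have mr: "(\<lambda>z. ennreal ((norm (?c (reassoc z)))\<^sup>2)) \<in> borel_measurable borel" by measurable
  have "(\<integral>\<^sup>+x. ennreal ((norm (Tker f1 f2 f3 f4 f5 x))\<^sup>2) \<partial>lborel) \<le> (\<integral>\<^sup>+x. G * N x \<partial>lborel)"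
    by (intro nn_integral_mono pt)
  also have "\<dots> = G * (\<integral>\<^sup>+x. N x \<partial>lborel)"
  proof (rule nn_integral_cmult)
    have "(\<lambda>z::real \<times> real \<times> real. ennreal ((norm (?c (reassoc (snd z, fst z))))\<^sup>2)) \<in> borel_measurable borel" by measurable
    from nn_integral_param_measurable[OF this] show "N \<in> borel_measurable lborel" by (simp add: N_def[abs_def])
  qed
  also have "(\<integral>\<^sup>+x. N x \<partial>lborel) = (\<integral>\<^sup>+z. ennreal ((norm (?c (reassoc z)))\<^sup>2) \<partial>lborel)"
    unfolding N_def by (rule nn_integral_lborel_snd[OF mr, symmetric])
  also have "\<dots> = (\<integral>\<^sup>+w. ennreal ((norm (?c w))\<^sup>2) \<partial>distr lborel borel reassoc)"
    by (rule nn_integral_distr[symmetric]) measurable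
  also have "\<dots> = (\<integral>\<^sup>+w. ennreal ((norm (?c w))\<^sup>2) \<partial>lborel)" by (simp only: distr_reassoc)
  also have "G * \<dots> \<le> G * (ennreal (2 * pi) * (ennreal (2 * pi) * (\<integral>\<^sup>+w. ennreal ((norm (tens f1 f2 f3 w))\<^sup>2) \<partial>lborel)))"
    by (intro mult_left_mono circ_nn_integral_le) auto
  also have "\<dots> < \<infinity>"
    unfolding G tens_nn_integral[OF L(1-3)] infinity_ennreal_def
    by (simp only: ennreal_mult_less_top ennreal_less_top simp_thms)
  finally show ?thesis unfolding L2_def using mT
    by (auto intro!: integrableI_bounded)
qed

lemma inner_Tker:
  assumes L: "L2 f1" "L2 f2" "L2 f3" "L2 f4" "L2 f5" "L2 g"
  shows "inner_L2 (Tker f1 f2 f3 f4 f5) g = RQ (six f1 f2 f3 f4 f5 g)"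
proof -
  let ?F = "six f1 f2 f3 f4 f5 g"
  have LF: "L2 (?F i)" if "i < 6" for i using that by (rule six_all[of L2, OF L])
  define h where "h = (\<lambda>w. circ (tens f1 f2 f3) w * cnj (tens f4 f5 g w))"
  have RQ: "RQ ?F = (LINT w|lborel. h w)" and ih: "integrable lborel h"
    using RQ_eq_circ[of ?F, OF LF] by (simp_all add: h_def)
  have [measurable]: "h \<in> borel_measurable borel" using ih by auto
  have "integrable (distr lborel borel reassoc) h" using ih by (simp only: distr_reassoc)
  hence i: "integrable lborel (\<lambda>z. h (reassoc z))" by (subst (asm) integrable_distr_eq) auto
  have "(LINT w|lborel. h w) = (LINT w|distr lborel borel reassoc. h w)" by (simp only: distr_reassoc)
  also have "\<dots> = (LINT z|lborel. h (reassoc z))" by (rule integral_distr) auto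
  also have "\<dots> = (LINT x|lborel. LINT u|lborel. h (reassoc (u, x)))" by (rule lborel_Fubini(2)[OF i])
  also have "\<dots> = (LINT x|lborel. Tker f1 f2 f3 f4 f5 x * cnj (g x))"
  proof (rule Bochner_Integration.integral_cong[OF refl])
    fix x
    have "h (reassoc (u, x)) = cnj (f4 (fst u) * f5 (snd u)) * circ (tens f1 f2 f3) (fst u, snd u, x) * cnj (g x)" for u
      by (simp add: h_def tens_def reassoc_def)
    thus "(LINT u|lborel. h (reassoc (u, x))) = Tker f1 f2 f3 f4 f5 x * cnj (g x)"
      unfolding Tker_def by (simp only: integral_mult_left_zero)
  qed
  finally show ?thesis by (simp add: RQ inner_L2_def)
qed

text \<open>The constant is 6 / pi^2 times sqrt 3 / 6.\<close>

definition Tfun :: "(real \<Rightarrow> complex) \<Rightarrow> (real \<Rightarrow> complex) \<Rightarrow> (real \<Rightarrow> complex) \<Rightarrow>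
    (real \<Rightarrow> complex) \<Rightarrow> (real \<Rightarrow> complex) \<Rightarrow> real \<Rightarrow> complex" where
  "Tfun f1 f2 f3 f4 f5 x = of_real (sqrt 3 / pi\<^sup>2) * Tker f1 f2 f3 f4 f5 x"

lemma L2_Tfun: "L2 f1 \<Longrightarrow> L2 f2 \<Longrightarrow> L2 f3 \<Longrightarrow> L2 f4 \<Longrightarrow> L2 f5 \<Longrightarrow> L2 (Tfun f1 f2 f3 f4 f5)"
  unfolding Tfun_def[abs_def] by (intro L2_scale L2_Tker)

lemma inner_Tfun:
  assumes L: "L2 f1" "L2 f2" "L2 f3" "L2 f4" "L2 f5" "L2 g"
  shows "inner_L2 (Tfun f1 f2 f3 f4 f5) g = of_real (sqrt 3 / pi\<^sup>2) * RQ (six f1 f2 f3 f4 f5 g)"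
  unfolding Tfun_def[abs_def] inner_L2_scale_left inner_Tker[OF L] ..

lemma E6_six:
  assumes L: "L2 f1" "L2 f2" "L2 f3" "L2 f4" "L2 f5" "L2 f6"
  shows "E6 f1 f2 f3 f4 f5 f6 = of_real (1 / pi\<^sup>2) * (of_real (sqrt 3 / 6) * RQ (six f1 f2 f3 f4 f5 f6))"
  using E6_eq_RQ[of "six f1 f2 f3 f4 f5 f6"] six_all[of L2, OF L] by simp

lemma inner_Tfun_E6:
  assumes L: "L2 f1" "L2 f2" "L2 f3" "L2 f4" "L2 f5" "L2 g"
  shows "inner_L2 (Tfun f1 f2 f3 f4 f5) g = 6 * E6 f1 f2 f3 f4 f5 g"
  unfolding inner_Tfun[OF L] E6_six[OF L] by simp

text \<open>\<open>Tfun\<close> shows that the choice in \<open>T6\<close> is from a nonempty set.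
  The difference of the two functions is then tested against itself.\<close>

lemma T6_AE_eq:
  assumes L: "L2 f1" "L2 f2" "L2 f3" "L2 f4" "L2 f5"
  shows "L2 (T6 f1 f2 f3 f4 f5)" and "AE x in lborel. T6 f1 f2 f3 f4 f5 x = Tfun f1 f2 f3 f4 f5 x"
proof -
  let ?P = "\<lambda>h. L2 h \<and> (\<forall>g. L2 g \<longrightarrow> inner_L2 h g = 6 * E6 f1 f2 f3 f4 f5 g)"
  let ?T = "T6 f1 f2 f3 f4 f5" and ?S = "Tfun f1 f2 f3 f4 f5"
  have S: "?P ?S" using L2_Tfun[OF L] inner_Tfun_E6[OF L] by simp
  have T: "?P ?T" unfolding T6_def by (rule someI[where P = ?P, OF S])
  thus LT: "L2 ?T" by simp
  have LS: "L2 ?S" using S by simp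
  note Ld = L2_diff[OF LT LS]
  have "inner_L2 (\<lambda>x. ?T x - ?S x) (\<lambda>x. ?T x - ?S x) = 0"
    using S T Ld by (simp add: inner_L2_diff_left)
  hence "l2n (\<lambda>x. ?T x - ?S x) = 0" unfolding inner_L2_self by simp
  thus "AE x in lborel. ?T x = ?S x" using l2n_eq_0_iff[OF Ld] by simp
qed

section \<open>Delta integrals of Schwartz functions\<close>

text \<open>The integrand and the phases are variables tied by equations, so that the tuple form of
  the statement can be matched with the grouped form of
  \<open>has_delta_integral_circ\<close>.\<close>

lemma delta_circ:
  fixes \<Gamma> :: "'u::euclidean_space \<Rightarrow> complex" and w :: "'u \<Rightarrow> r3"
  assumes f: "schwartz f1" "schwartz f2" "schwartz f3"
    and \<Gamma>: "integrable lborel \<Gamma>" and w: "w \<in> borel_measurable borel" and pos: "AE u in lborel. rad (w u) > 0"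
    and F: "F = (\<lambda>y. tens f1 f2 f3 (fst (unflat y)) * \<Gamma> (snd (unflat y)))"
    and O1: "O1 = (\<lambda>y. 3 * (hgt (fst (unflat y)) - hgt (w (snd (unflat y)))))"
    and O2: "O2 = (\<lambda>y. sq3 (fst (unflat y)) - sq3 (w (snd (unflat y))))"
  shows "delta_integrable F O1 O2"
    and "delta_integral F O1 O2 = of_real (sqrt 3 / 6) * (LINT u|lborel. \<Gamma> u * circ (tens f1 f2 f3) (w u))"
proof -
  let ?\<Phi> = "tens f1 f2 f3"
  obtain C1 C2 C3 where C: "\<And>x. norm (f1 x) \<le> C1" "\<And>x. norm (f2 x) \<le> C2" "\<And>x. norm (f3 x) \<le> C3"
    using f by (meson schwartz_bounded)
  have "C1 \<ge> 0" "C2 \<ge> 0" "C3 \<ge> 0" using C[THEN order_trans[OF norm_ge_zero]] by auto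
  hence b: "norm (?\<Phi> v) \<le> C1 * (C2 * C3)" for v
    unfolding tens_def norm_mult by (intro mult_mono C mult_nonneg_nonneg) auto
  have c: "continuous_on UNIV ?\<Phi>"
    unfolding tens_def[abs_def]
    by (intro continuous_intros continuous_on_compose2[OF schwartz_continuous_on[of f1 UNIV]]
        continuous_on_compose2[OF schwartz_continuous_on[of f2 UNIV]] continuous_on_compose2[OF schwartz_continuous_on[of f3 UNIV]] f) auto
  have i: "integrable lborel ?\<Phi>" by (intro tens_integrable schwartz_integrable f)
  have d: "has_delta_integral F O1 O2 (LINT u|lborel. \<Gamma> u * (of_real (sqrt 3 / 6) * circ ?\<Phi> (w u)))"
    unfolding F O1 O2 by (rule has_delta_integral_circ[OF c b i \<Gamma> w pos])
  have j: "integrable lborel (\<lambda>z. ?\<Phi> (fst z) * \<Gamma> (snd z))" by (rule integrable_prod_mult[OF i \<Gamma>])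
  hence "(\<lambda>z. ?\<Phi> (fst z) * \<Gamma> (snd z)) \<in> borel_measurable borel" by auto
  from integral_unflat(1)[OF this] j have "integrable lborel F" by (simp add: F)
  with d show "delta_integrable F O1 O2" unfolding delta_integrable_def by blast
  have "(\<lambda>u. \<Gamma> u * (of_real (sqrt 3 / 6) * circ ?\<Phi> (w u))) = (\<lambda>u. of_real (sqrt 3 / 6) * (\<Gamma> u * circ ?\<Phi> (w u)))"
    by (simp only: mult.left_commute)
  with delta_integral_eqI[OF d]
  show "delta_integral F O1 O2 = of_real (sqrt 3 / 6) * (LINT u|lborel. \<Gamma> u * circ ?\<Phi> (w u))"
    by (simp only: integral_mult_right_zero)
qed

lemma F6_delta:
  assumes f: "schwartz f1" "schwartz f2" "schwartz f3" "schwartz f4" "schwartz f5" "schwartz f6"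
  shows "delta_integrable (F6 f1 f2 f3 f4 f5 f6)
          (\<lambda>(y1, y2, y3, y4, y5, y6). Omega1 y6 (y1, y2, y3, y4, y5))
          (\<lambda>(y1, y2, y3, y4, y5, y6). Omega2 y6 (y1, y2, y3, y4, y5))" (is ?a)
    and "E6 f1 f2 f3 f4 f5 f6 = of_real (1 / pi\<^sup>2) *
          delta_integral (F6 f1 f2 f3 f4 f5 f6)
            (\<lambda>(y1, y2, y3, y4, y5, y6). Omega1 y6 (y1, y2, y3, y4, y5))
            (\<lambda>(y1, y2, y3, y4, y5, y6). Omega2 y6 (y1, y2, y3, y4, y5))" (is "_ = _ * ?d")
proof -
  note L = f[THEN schwartz_L2]
  have \<Gamma>: "integrable lborel (\<lambda>w. cnj (tens f4 f5 f6 w))"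
    by (intro integrable_cnj tens_integrable schwartz_integrable f)
  \<comment> \<open>Almost every frozen triple has distinct first and last coordinates and so lies
    off the axis.\<close>
  have "(\<lambda>u::real \<times> real. snd u) \<in> borel_measurable borel" by measurable
  from AE_fst_neq[OF this] have pos: "AE u::r3 in lborel. rad u > 0"
    by eventually_elim (auto simp: rad_pos)
  have w: "(\<lambda>u. u) \<in> borel_measurable (borel :: r3 measure)" by simp
  have F: "F6 f1 f2 f3 f4 f5 f6 = (\<lambda>y. tens f1 f2 f3 (fst (unflat y)) * cnj (tens f4 f5 f6 (snd (unflat y))))"
    by (auto simp: fun_eq_iff F6_def unflat_def tens_def)
  have O1: "(\<lambda>(y1, y2, y3, y4, y5, y6). Omega1 y6 (y1, y2, y3, y4, y5))
      = (\<lambda>y. 3 * (hgt (fst (unflat y)) - hgt (snd (unflat y))))"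
    by (auto simp: fun_eq_iff Omega1_def unflat_def hgt_def field_simps)
  have O2: "(\<lambda>(y1, y2, y3, y4, y5, y6). Omega2 y6 (y1, y2, y3, y4, y5))
      = (\<lambda>y. sq3 (fst (unflat y)) - sq3 (snd (unflat y)))"
    by (auto simp: fun_eq_iff Omega2_def unflat_def sq3_def)
  note d = delta_circ[OF f(1-3) \<Gamma> w pos F O1 O2]
  show ?a by (rule d(1))
  have "RQ (six f1 f2 f3 f4 f5 f6) = (LINT u|lborel. cnj (tens f4 f5 f6 u) * circ (tens f1 f2 f3) u)"
    using RQ_eq_circ(1)[of "six f1 f2 f3 f4 f5 f6"] six_all[of L2, OF L] by (simp add: mult.commute)
  hence "?d = of_real (sqrt 3 / 6) * RQ (six f1 f2 f3 f4 f5 f6)" using d(2) by simp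
  thus "E6 f1 f2 f3 f4 f5 f6 = of_real (1 / pi\<^sup>2) * ?d" by (simp only: E6_six[OF L])
qed

lemma F5_delta:
  assumes f: "schwartz f1" "schwartz f2" "schwartz f3" "schwartz f4" "schwartz f5"
  shows "delta_integrable (F5 f1 f2 f3 f4 f5) (Omega1 x) (Omega2 x)"
    and "of_real (6 / pi\<^sup>2) * delta_integral (F5 f1 f2 f3 f4 f5) (Omega1 x) (Omega2 x) = Tfun f1 f2 f3 f4 f5 x"
proof -
  let ?w = "\<lambda>u::real \<times> real. (fst u, snd u, x)"
  have \<Gamma>: "integrable lborel (\<lambda>u. cnj (f4 (fst u) * f5 (snd u)))"
    by (intro integrable_cnj integrable_prod_mult schwartz_integrable f)
  have "(\<lambda>u::real. x) \<in> borel_measurable borel" by measurable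
  from AE_fst_neq[OF this] have pos: "AE u in lborel. rad (?w u) > 0"
    by eventually_elim (auto simp: rad_pos)
  have w: "?w \<in> borel_measurable borel"
    by (intro borel_measurable_continuous_onI continuous_intros)
  have F: "F5 f1 f2 f3 f4 f5 = (\<lambda>y. tens f1 f2 f3 (fst (unflat y)) * cnj (f4 (fst (snd (unflat y))) * f5 (snd (snd (unflat y)))))"
    by (auto simp: fun_eq_iff F5_def unflat_def tens_def)
  have O1: "Omega1 x = (\<lambda>y. 3 * (hgt (fst (unflat y)) - hgt (?w (snd (unflat y)))))"
    by (auto simp: fun_eq_iff Omega1_def unflat_def hgt_def field_simps)
  have O2: "Omega2 x = (\<lambda>y. sq3 (fst (unflat y)) - sq3 (?w (snd (unflat y))))"
    by (auto simp: fun_eq_iff Omega2_def unflat_def sq3_def)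
  note d = delta_circ[OF f(1-3) \<Gamma> w pos F O1 O2]
  show "delta_integrable (F5 f1 f2 f3 f4 f5) (Omega1 x) (Omega2 x)" by (rule d(1))
  show "of_real (6 / pi\<^sup>2) * delta_integral (F5 f1 f2 f3 f4 f5) (Omega1 x) (Omega2 x) = Tfun f1 f2 f3 f4 f5 x"
    unfolding d(2) Tfun_def Tker_def by simp
qed

section \<open>Passage to the limit\<close>

text \<open>The difference d serves as its own test function: its squared norm is a difference of
  two values of \<open>RQ\<close> with d in the last slot, to which the six-linear estimate applies.
  One factor \<open>l2n d\<close> is then cancelled.\<close>

lemma Tker_diff_le:
  fixes F G :: "nat \<Rightarrow> real \<Rightarrow> complex"
  assumes F: "\<And>i. i < 5 \<Longrightarrow> L2 (F i)" and G: "\<And>i. i < 5 \<Longrightarrow> L2 (G i)"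
  defines "d \<equiv> \<lambda>x. Tker (G 0) (G 1) (G 2) (G 3) (G 4) x - Tker (F 0) (F 1) (F 2) (F 3) (F 4) x"
  shows "L2 d" and "l2n d \<le> 2 * pi * (\<Sum>k<5. \<Prod>i<5. if i < k then l2n (G i) else if i = k then l2n (\<lambda>x. G k x - F k x) else l2n (F i))"
    (is "_ \<le> 2 * pi * ?S")
proof -
  interpret R: multi6 RQ "2 * pi" by (rule multi6_RQ)
  have LF: "L2 (F 0)" "L2 (F 1)" "L2 (F 2)" "L2 (F 3)" "L2 (F 4)" and LG: "L2 (G 0)" "L2 (G 1)" "L2 (G 2)" "L2 (G 3)" "L2 (G 4)"
    using F G by simp_all
  show d: "L2 d" unfolding d_def by (intro L2_diff L2_Tker LF LG)
  have L: "L2 ((F(5 := d)) i)" "L2 ((G(5 := d)) i)" if "i < 6" for i using that F[of i] G[of i] d by auto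
  have e: "RQ (six (F 0) (F 1) (F 2) (F 3) (F 4) d) = RQ (F(5 := d))" for F :: "nat \<Rightarrow> real \<Rightarrow> complex"
    by (rule RQ_cong) (auto dest!: less_6_cases)
  have "complex_of_real ((l2n d)\<^sup>2) = inner_L2 d d" by (rule inner_L2_self[symmetric])
  also have "\<dots> = RQ (G(5 := d)) - RQ (F(5 := d))"
    unfolding e[symmetric] inner_Tker[OF LF d, symmetric] inner_Tker[OF LG d, symmetric]
    by (subst (1) d_def) (intro inner_L2_diff_left L2_Tker LF LG d)
  finally have "norm (complex_of_real ((l2n d)\<^sup>2)) = norm (RQ (G(5 := d)) - RQ (F(5 := d)))" by simp
  also have "\<dots> \<le> 2 * pi * (\<Sum>k<6. \<Prod>i<6. if i < k then l2n ((G(5 := d)) i)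
      else if i = k then l2n (\<lambda>x. (G(5 := d)) k x - (F(5 := d)) k x) else l2n ((F(5 := d)) i))"
    by (rule R.norm_diff_le[OF L])
  \<comment> \<open>Both arguments have d in slot 5, so the summand k = 5 contains the norm of d -
    d, and every other summand contributes the factor \<open>l2n d\<close>.\<close>
  also have "(\<Sum>k<6. \<Prod>i<6. if i < k then l2n ((G(5 := d)) i)
      else if i = k then l2n (\<lambda>x. (G(5 := d)) k x - (F(5 := d)) k x) else l2n ((F(5 := d)) i)) = ?S * l2n d"
  proof -
    have s: "{..<6} = insert (5::nat) {..<5}" by auto
    have "l2n (\<lambda>x. 0) = 0" by (simp add: l2n_def)
    thus ?thesis unfolding s sum_distrib_right by (auto intro!: sum.cong prod.cong)
  qed
  finally have "l2n d * l2n d \<le> (2 * pi * ?S) * l2n d" by (simp add: norm_of_real power2_eq_square mult.assoc norm_mult l2n_nonneg)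
  moreover have "0 \<le> ?S" by (intro sum_nonneg prod_nonneg) (auto simp: l2n_nonneg)
  ultimately show "l2n d \<le> 2 * pi * ?S" using l2n_nonneg[of d] by (cases "l2n d = 0") auto
qed

lemma Tfun_tendsto:
  assumes G: "tendsto_L2 g1 f1" "tendsto_L2 g2 f2" "tendsto_L2 g3 f3" "tendsto_L2 g4 f4" "tendsto_L2 g5 f5"
  shows "tendsto_L2 (\<lambda>n. Tfun (g1 n) (g2 n) (g3 n) (g4 n) (g5 n)) (Tfun f1 f2 f3 f4 f5)"
proof -
  have L: "L2 f1" "L2 f2" "L2 f3" "L2 f4" "L2 f5" "\<And>n. L2 (g1 n)" "\<And>n. L2 (g2 n)" "\<And>n. L2 (g3 n)" "\<And>n. L2 (g4 n)" "\<And>n. L2 (g5 n)"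
    using G by (auto simp: tendsto_L2_iff)
  \<comment> \<open>The fifth function is repeated to fill the sixth place of
    \<open>six\<close>.\<close>
  let ?F = "six f1 f2 f3 f4 f5 f5" and ?G = "\<lambda>n. six (g1 n) (g2 n) (g3 n) (g4 n) (g5 n) (g5 n)"
  have T: "tendsto_L2 (\<lambda>n. ?G n i) (?F i)" if "i < 6" for i
    using less_6_cases[OF that] G by auto
  define S where "S n = (\<Sum>k<5. \<Prod>i<5. if i < k then l2n (?G n i) else if i = k then l2n (\<lambda>x. ?G n k x - ?F k x) else l2n (?F i))" for n
  have S: "S \<longlonglongrightarrow> 0" unfolding S_def by (rule telescoping_bound_tendsto_0) (simp add: T)
  have "l2n (\<lambda>x. Tker (g1 n) (g2 n) (g3 n) (g4 n) (g5 n) x - Tker f1 f2 f3 f4 f5 x) \<le> 2 * pi * S n" for n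
    using Tker_diff_le(2)[of ?F "?G n"] six_all[of L2, OF L(1-5) L(5)] six_all[of L2, OF L(6-10)[of n] L(10)[of n]] by (simp add: S_def)
  moreover have "(\<lambda>x. Tfun (g1 n) (g2 n) (g3 n) (g4 n) (g5 n) x - Tfun f1 f2 f3 f4 f5 x)
     = (\<lambda>x. of_real (sqrt 3 / pi\<^sup>2) * (Tker (g1 n) (g2 n) (g3 n) (g4 n) (g5 n) x - Tker f1 f2 f3 f4 f5 x))" for n
    by (simp add: Tfun_def fun_eq_iff right_diff_distrib)
  ultimately have b: "norm (l2n (\<lambda>x. Tfun (g1 n) (g2 n) (g3 n) (g4 n) (g5 n) x - Tfun f1 f2 f3 f4 f5 x))
      \<le> sqrt 3 / pi\<^sup>2 * (2 * pi * S n)" for n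
    by (simp only: l2n_scale norm_of_real real_norm_def abs_mult abs_of_nonneg[OF l2n_nonneg])
      (intro mult_mono; simp add: l2n_nonneg)
  have z: "(\<lambda>n. sqrt 3 / pi\<^sup>2 * (2 * pi * S n)) \<longlonglongrightarrow> 0" by (intro tendsto_mult_right_zero S)
  have "(\<lambda>n. l2n (\<lambda>x. Tfun (g1 n) (g2 n) (g3 n) (g4 n) (g5 n) x - Tfun f1 f2 f3 f4 f5 x)) \<longlonglongrightarrow> 0"
    by (rule Lim_null_comparison[OF always_eventually z]) (rule allI, rule b)
  thus ?thesis unfolding tendsto_L2_iff using L by (simp add: L2_Tfun)
qed

lemma E6_tendsto:
  assumes G: "tendsto_L2 g1 f1" "tendsto_L2 g2 f2" "tendsto_L2 g3 f3" "tendsto_L2 g4 f4" "tendsto_L2 g5 f5" "tendsto_L2 g6 f6"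
  shows "(\<lambda>n. E6 (g1 n) (g2 n) (g3 n) (g4 n) (g5 n) (g6 n)) \<longlonglongrightarrow> E6 f1 f2 f3 f4 f5 f6"
proof -
  interpret R: multi6 RQ "2 * pi" by (rule multi6_RQ)
  have L: "L2 f1" "L2 f2" "L2 f3" "L2 f4" "L2 f5" "L2 f6"
    "\<And>n. L2 (g1 n)" "\<And>n. L2 (g2 n)" "\<And>n. L2 (g3 n)" "\<And>n. L2 (g4 n)" "\<And>n. L2 (g5 n)" "\<And>n. L2 (g6 n)"
    using G by (auto simp: tendsto_L2_iff)
  have "(\<lambda>n. RQ (six (g1 n) (g2 n) (g3 n) (g4 n) (g5 n) (g6 n))) \<longlonglongrightarrow> RQ (six f1 f2 f3 f4 f5 f6)"
    by (rule R.tendsto) (use G in \<open>auto dest!: less_6_cases\<close>)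
  thus ?thesis unfolding E6_six[OF L(1-6)] E6_six[OF L(7-12)] by (intro tendsto_mult tendsto_const)
qed

text \<open>The approximating Schwartz sequences are arbitrary, so the extension by density is
  independent of their choice. For the operator, which is only determined up to null sets, the limit
  is taken in L^2.\<close>

theorem theorem3p4:
  fixes f1 f2 f3 f4 f5 f6 :: "real \<Rightarrow> complex"
    and g1 g2 g3 g4 g5 g6 :: "nat \<Rightarrow> real \<Rightarrow> complex"
  shows
    "(schwartz f1 \<and> schwartz f2 \<and> schwartz f3 \<and> schwartz f4 \<and> schwartz f5 \<and> schwartz f6 \<longrightarrow>
        delta_integrable (F6 f1 f2 f3 f4 f5 f6)
          (\<lambda>(y1, y2, y3, y4, y5, y6). Omega1 y6 (y1, y2, y3, y4, y5))
          (\<lambda>(y1, y2, y3, y4, y5, y6). Omega2 y6 (y1, y2, y3, y4, y5)) \<and>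
        E6 f1 f2 f3 f4 f5 f6 = of_real (1 / pi\<^sup>2) *
          delta_integral (F6 f1 f2 f3 f4 f5 f6)
            (\<lambda>(y1, y2, y3, y4, y5, y6). Omega1 y6 (y1, y2, y3, y4, y5))
            (\<lambda>(y1, y2, y3, y4, y5, y6). Omega2 y6 (y1, y2, y3, y4, y5)))
     \<and>
     (schwartz f1 \<and> schwartz f2 \<and> schwartz f3 \<and> schwartz f4 \<and> schwartz f5 \<longrightarrow>
        (\<forall>x. delta_integrable (F5 f1 f2 f3 f4 f5) (Omega1 x) (Omega2 x)) \<and>
        (AE x in lborel. T6 f1 f2 f3 f4 f5 x = of_real (6 / pi\<^sup>2) *
          delta_integral (F5 f1 f2 f3 f4 f5) (Omega1 x) (Omega2 x)))
     \<and>
     (L2 f1 \<and> L2 f2 \<and> L2 f3 \<and> L2 f4 \<and> L2 f5 \<and> L2 f6 \<and>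
      (\<forall>n. schwartz (g1 n) \<and> schwartz (g2 n) \<and> schwartz (g3 n) \<and>
           schwartz (g4 n) \<and> schwartz (g5 n) \<and> schwartz (g6 n)) \<and>
      tendsto_L2 g1 f1 \<and> tendsto_L2 g2 f2 \<and> tendsto_L2 g3 f3 \<and>
      tendsto_L2 g4 f4 \<and> tendsto_L2 g5 f5 \<and> tendsto_L2 g6 f6 \<longrightarrow>
        (\<lambda>n. of_real (1 / pi\<^sup>2) *
          delta_integral (F6 (g1 n) (g2 n) (g3 n) (g4 n) (g5 n) (g6 n))
            (\<lambda>(y1, y2, y3, y4, y5, y6). Omega1 y6 (y1, y2, y3, y4, y5))
            (\<lambda>(y1, y2, y3, y4, y5, y6). Omega2 y6 (y1, y2, y3, y4, y5)))
        \<longlonglongrightarrow> E6 f1 f2 f3 f4 f5 f6)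
     \<and>
     (L2 f1 \<and> L2 f2 \<and> L2 f3 \<and> L2 f4 \<and> L2 f5 \<and>
      (\<forall>n. schwartz (g1 n) \<and> schwartz (g2 n) \<and> schwartz (g3 n) \<and>
           schwartz (g4 n) \<and> schwartz (g5 n)) \<and>
      tendsto_L2 g1 f1 \<and> tendsto_L2 g2 f2 \<and> tendsto_L2 g3 f3 \<and>
      tendsto_L2 g4 f4 \<and> tendsto_L2 g5 f5 \<longrightarrow>
        tendsto_L2
          (\<lambda>n x. of_real (6 / pi\<^sup>2) *
             delta_integral (F5 (g1 n) (g2 n) (g3 n) (g4 n) (g5 n)) (Omega1 x) (Omega2 x))
          (T6 f1 f2 f3 f4 f5))"
proof (intro conjI impI allI; elim conjE)
  assume f: "schwartz f1" "schwartz f2" "schwartz f3" "schwartz f4" "schwartz f5" "schwartz f6"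
  show "delta_integrable (F6 f1 f2 f3 f4 f5 f6)
          (\<lambda>(y1, y2, y3, y4, y5, y6). Omega1 y6 (y1, y2, y3, y4, y5))
          (\<lambda>(y1, y2, y3, y4, y5, y6). Omega2 y6 (y1, y2, y3, y4, y5))"
    by (rule F6_delta(1)[OF f])
  show "E6 f1 f2 f3 f4 f5 f6 = of_real (1 / pi\<^sup>2) *
          delta_integral (F6 f1 f2 f3 f4 f5 f6)
            (\<lambda>(y1, y2, y3, y4, y5, y6). Omega1 y6 (y1, y2, y3, y4, y5))
            (\<lambda>(y1, y2, y3, y4, y5, y6). Omega2 y6 (y1, y2, y3, y4, y5))"
    by (rule F6_delta(2)[OF f])
next
  assume f: "schwartz f1" "schwartz f2" "schwartz f3" "schwartz f4" "schwartz f5"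
  show "delta_integrable (F5 f1 f2 f3 f4 f5) (Omega1 x) (Omega2 x)" for x by (rule F5_delta(1)[OF f])
  show "AE x in lborel. T6 f1 f2 f3 f4 f5 x = of_real (6 / pi\<^sup>2) *
          delta_integral (F5 f1 f2 f3 f4 f5) (Omega1 x) (Omega2 x)"
    unfolding F5_delta(2)[OF f] by (rule T6_AE_eq(2)[OF f[THEN schwartz_L2]])
next
  assume g: "\<forall>n. schwartz (g1 n) \<and> schwartz (g2 n) \<and> schwartz (g3 n) \<and>
           schwartz (g4 n) \<and> schwartz (g5 n) \<and> schwartz (g6 n)"
    and t: "tendsto_L2 g1 f1" "tendsto_L2 g2 f2" "tendsto_L2 g3 f3" "tendsto_L2 g4 f4" "tendsto_L2 g5 f5" "tendsto_L2 g6 f6"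
  show "(\<lambda>n. of_real (1 / pi\<^sup>2) *
          delta_integral (F6 (g1 n) (g2 n) (g3 n) (g4 n) (g5 n) (g6 n))
            (\<lambda>(y1, y2, y3, y4, y5, y6). Omega1 y6 (y1, y2, y3, y4, y5))
            (\<lambda>(y1, y2, y3, y4, y5, y6). Omega2 y6 (y1, y2, y3, y4, y5)))
        \<longlonglongrightarrow> E6 f1 f2 f3 f4 f5 f6"
    using E6_tendsto[OF t] g by (simp only: F6_delta(2)[symmetric])
next
  assume L: "L2 f1" "L2 f2" "L2 f3" "L2 f4" "L2 f5"
    and g: "\<forall>n. schwartz (g1 n) \<and> schwartz (g2 n) \<and> schwartz (g3 n) \<and>
           schwartz (g4 n) \<and> schwartz (g5 n)"
    and t: "tendsto_L2 g1 f1" "tendsto_L2 g2 f2" "tendsto_L2 g3 f3" "tendsto_L2 g4 f4" "tendsto_L2 g5 f5"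
  \<comment> \<open>\<open>F5_delta\<close> is an identity at every point, so the delta integrals
    can be replaced by \<open>Tfun\<close> as functions and no null sets have to be collected along
    the sequence.\<close>
  have e: "(\<lambda>n x. of_real (6 / pi\<^sup>2) *
             delta_integral (F5 (g1 n) (g2 n) (g3 n) (g4 n) (g5 n)) (Omega1 x) (Omega2 x))
     = (\<lambda>n. Tfun (g1 n) (g2 n) (g3 n) (g4 n) (g5 n))"
    using g by (intro ext F5_delta(2)) auto
  note T = T6_AE_eq[OF L]
  have LT: "L2 (Tfun f1 f2 f3 f4 f5)" by (rule L2_Tfun[OF L])
  have "l2n (\<lambda>x. Tfun (g1 n) (g2 n) (g3 n) (g4 n) (g5 n) x - T6 f1 f2 f3 f4 f5 x)
      = l2n (\<lambda>x. Tfun (g1 n) (g2 n) (g3 n) (g4 n) (g5 n) x - Tfun f1 f2 f3 f4 f5 x)" for n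
  proof (rule l2n_cong_AE)
    have "L2 (Tfun (g1 n) (g2 n) (g3 n) (g4 n) (g5 n))" using g by (intro L2_Tfun schwartz_L2) auto
    thus "(\<lambda>x. Tfun (g1 n) (g2 n) (g3 n) (g4 n) (g5 n) x - T6 f1 f2 f3 f4 f5 x) \<in> borel_measurable borel"
      "(\<lambda>x. Tfun (g1 n) (g2 n) (g3 n) (g4 n) (g5 n) x - Tfun f1 f2 f3 f4 f5 x) \<in> borel_measurable borel"
      by (intro L2_measurable L2_diff T LT; assumption)+
    show "AE x in lborel. Tfun (g1 n) (g2 n) (g3 n) (g4 n) (g5 n) x - T6 f1 f2 f3 f4 f5 x
        = Tfun (g1 n) (g2 n) (g3 n) (g4 n) (g5 n) x - Tfun f1 f2 f3 f4 f5 x"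
      using T(2) by eventually_elim simp
  qed
  thus "tendsto_L2
          (\<lambda>n x. of_real (6 / pi\<^sup>2) *
             delta_integral (F5 (g1 n) (g2 n) (g3 n) (g4 n) (g5 n)) (Omega1 x) (Omega2 x))
          (T6 f1 f2 f3 f4 f5)"
    unfolding e using Tfun_tendsto[OF t] T(1) by (simp add: tendsto_L2_iff)
qed

end
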